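(* Let $m\in\mathbb{N}$. Assume that (i) $X_1,X_2,\ldots,X_n$ are independent and identically distributed with a probability density function $w$ with respect to Lebesgue measure on $(0,1)$; (ii) there are positive constants $w_1,w_2$ with $w_1\le w(t)\le w_2$ for all $t\in[0,1]$; (iii) with $D=Y-f_o(X)$, $\sup_{x\in[0,1]}\mathbb{E}[\,|D|^{\kappa}\mid X=x\,]<\infty$ for some $\kappa>2$. For $t\in[0,1]$ define $\varepsilon^{nh}(t)$ by $$f^{nh}(t)-\mathbb{E}[\,f^{nh}(t)\mid X_1,\ldots,X_n\,]=\frac1n\sum_{i=1}^n D_i\,\mathfrak{R}_{wmh}(X_i,t)+\varepsilon^{nh}(t).$$ Then for every $\gamma>0$, almost surely, $$\limsup_{n\to\infty}\ \sup_{h\in\mathcal{H}_n(\gamma)}\ \frac{\|\varepsilon^{nh}\|_\infty}{h^{-1/2}(nh)^{-1}\{\log(1/h)\vee\log\log n\}}<\infty .$$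
   Context: $(X_1,Y_1),(X_2,Y_2),\ldots$ is a random sample (i.i.d. copies) of the bivariate random variable $(X,Y)$ with $X\in[0,1]$ almost surely; it is assumed that $f_o(x)=\mathbb{E}[Y\mid X=x]$ exists. $D=Y-f_o(X)$ and $D_i=Y_i-f_o(X_i)$. Sobolev spaces: $W^{m,p}(0,1)=\{f\in C^{m-1}[0,1]: f^{(m-1)}\text{ absolutely continuous},\ f^{(m)}\in L^p(0,1)\}$. The smoothing spline estimator $f^{nh}$ is the minimizer over $f\in W^{m,2}(0,1)$ of $\frac1n\sum_{i=1}^n|f(X_i)-Y_i|^2+h^{2m}\|f^{(m)}\|^2$, where $\|\cdot\|$ is the $L^2(0,1)$ norm; for $n\ge m$ it is almost surely unique. $\|\cdot\|_\infty$ is the $L^\infty(0,1)$ norm, and $a\vee b=\max(a,b)$. For $0<h\le1$, $W^{m,2}(0,1)$ is equipped with the inner product $\langle f,g\rangle_{wmh}=\int_0^1 f(t)g(t)w(t)\,dt+h^{2m}\int_0^1 f^{(m)}(t)g^{(m)}(t)\,dt$, under which it is a reproducing kernel Hilbert space; $\mathfrak{R}_{wmh}(t,s)$ is its reproducing kernel, i.e. $\mathfrak{R}_{wmh}(t,\cdot)\in W^{m,2}(0,1)$ and $f(t)=\langle f,\mathfrak{R}_{wmh}(t,\cdot)\rangle_{wmh}$ for all $f\in W^{m,2}(0,1)$, $t\in[0,1]$. For $\gamma>0$, $\mathcal{H}_n(\gamma)=\big[\gamma\,(n^{-1}\log n)^{1-2/\kappa},\ \tfrac12\big]$, with $\kappa$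 the moment exponent in assumption (iii). *)

theory Defs
  imports "HOL-Probability.Probability"
begin

text \<open>Derivatives are taken relative to the closed unit interval, hence one-sided at 0 and 1.
  Where a derivative does not exist the value is an unspecified real number; for the
  highest-order derivative of a Sobolev function this only happens on a null set.\<close>

definition deriv01 :: "nat \<Rightarrow> (real \<Rightarrow> real) \<Rightarrow> real \<Rightarrow> real" where
  "deriv01 k = ((\<lambda>f x. vector_derivative f (at x within {0..1})) ^^ k)"

definition absolutely_continuous_fun_on :: "real set \<Rightarrow> (real \<Rightarrow> real) \<Rightarrow> bool" where
  "absolutely_continuous_fun_on S f \<longleftrightarrow>
     (\<forall>\<epsilon>>0. \<exists>\<delta>>0. \<forall>(N::nat) a b.
        (\<forall>i<N. a i \<le> b i \<and> {a i..b i} \<subseteq> S) \<longrightarrow>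
        (\<forall>i<N. \<forall>j<N. i \<noteq> j \<longrightarrow> {a i<..<b i} \<inter> {a j<..<b j} = {}) \<longrightarrow>
        (\<Sum>i<N. b i - a i) < \<delta> \<longrightarrow>
        (\<Sum>i<N. \<bar>f (b i) - f (a i)\<bar>) < \<epsilon>)"

text \<open>The space $W^{m,2}(0,1)$, for $m \ge 1$.  Membership depends only on the values on
  the closed unit interval.\<close>

definition sobolev2 :: "nat \<Rightarrow> (real \<Rightarrow> real) set" where
  "sobolev2 m = {f.
     (\<forall>k < m - 1. deriv01 k f differentiable_on {0..1}) \<and>
     continuous_on {0..1} (deriv01 (m - 1) f) \<and>
     absolutely_continuous_fun_on {0..1} (deriv01 (m - 1) f) \<and>
     deriv01 m f \<in> borel_measurable (lebesgue_on {0..1}) \<and>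
     integrable (lebesgue_on {0..1}) (\<lambda>x. (deriv01 m f x)\<^sup>2)}"

definition inner_wmh :: "(real \<Rightarrow> real) \<Rightarrow> nat \<Rightarrow> real \<Rightarrow> (real \<Rightarrow> real) \<Rightarrow> (real \<Rightarrow> real) \<Rightarrow> real" where
  "inner_wmh w m h f g =
     (LINT t|lebesgue_on {0..1}. f t * g t * w t) +
     h ^ (2 * m) * (LINT t|lebesgue_on {0..1}. deriv01 m f t * deriv01 m g t)"

definition reproducing_kernel_wmh ::
    "(real \<Rightarrow> real) \<Rightarrow> nat \<Rightarrow> real \<Rightarrow> (real \<Rightarrow> real \<Rightarrow> real) \<Rightarrow> bool" where
  "reproducing_kernel_wmh w m h R \<longleftrightarrow>
     (\<forall>t\<in>{0..1}. R t \<in> sobolev2 m \<and> (\<forall>f\<in>sobolev2 m. f t = inner_wmh w m h f (R t)))"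

definition spline_objective ::
    "nat \<Rightarrow> nat \<Rightarrow> real \<Rightarrow> (nat \<Rightarrow> real) \<Rightarrow> (nat \<Rightarrow> real) \<Rightarrow> (real \<Rightarrow> real) \<Rightarrow> real" where
  "spline_objective m n h x y f =
     (1 / real n) * (\<Sum>i=1..n. \<bar>f (x i) - y i\<bar>\<^sup>2) +
     h ^ (2 * m) * (LINT t|lebesgue_on {0..1}. (deriv01 m f t)\<^sup>2)"

definition is_smoothing_spline ::
    "nat \<Rightarrow> nat \<Rightarrow> real \<Rightarrow> (nat \<Rightarrow> real) \<Rightarrow> (nat \<Rightarrow> real) \<Rightarrow> (real \<Rightarrow> real) \<Rightarrow> bool" where
  "is_smoothing_spline m n h x y f \<longleftrightarrow>
     f \<in> sobolev2 m \<and>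
     (\<forall>g\<in>sobolev2 m. spline_objective m n h x y f \<le> spline_objective m n h x y g)"

text \<open>The estimator as a function of the data.  Functions on the unit interval are represented by
  extensional functions, so that uniqueness refers to the values on the unit interval only.
  For data with several minimizers (fewer than m distinct design points), which for
  n at least m has probability zero in the model considered, the value is set to 0.\<close>

definition smoothing_spline ::
    "nat \<Rightarrow> nat \<Rightarrow> real \<Rightarrow> (nat \<Rightarrow> real) \<Rightarrow> (nat \<Rightarrow> real) \<Rightarrow> real \<Rightarrow> real" where
  "smoothing_spline m n h x y =
     (if \<exists>!f. f \<in> extensional {0..1} \<and> is_smoothing_spline m n h x y f
      then (THE f. f \<in> extensional {0..1} \<and> is_smoothing_spline m n h x y f)
      else (\<lambda>_. 0))"

text \<open>\<open>is_cond_mean M X Z g\<close>: the conditional expectation of Z given X exists (the conditional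
  expectation of the absolute value of Z is almost surely finite), and the Borel function g is a
  version of x \<open>\<mapsto>\<close> E[Z | X = x].\<close>

definition is_cond_mean ::
    "'a measure \<Rightarrow> ('a \<Rightarrow> real) \<Rightarrow> ('a \<Rightarrow> real) \<Rightarrow> (real \<Rightarrow> real) \<Rightarrow> bool" where
  "is_cond_mean M X Z g \<longleftrightarrow>
     g \<in> borel_measurable borel \<and>
     (AE \<omega> in M. nn_cond_exp M (vimage_algebra (space M) X borel) (\<lambda>\<omega>. ennreal \<bar>Z \<omega>\<bar>) \<omega> < \<infinity>) \<and>
     (AE \<omega> in M. real_cond_exp M (vimage_algebra (space M) X borel) Z \<omega> = g (X \<omega>))"

definition design_algebra :: "'a measure \<Rightarrow> (nat \<Rightarrow> 'a \<Rightarrow> real) \<Rightarrow> nat \<Rightarrow> 'a measure" where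
  "design_algebra M X n =
     vimage_algebra (space M) (\<lambda>\<omega>. \<lambda>i\<in>{1..n}. X i \<omega>) (\<Pi>\<^sub>M i\<in>{1..n}. borel)"

definition Linf_norm01 :: "(real \<Rightarrow> real) \<Rightarrow> ereal" where
  "Linf_norm01 f = esssup (lebesgue_on {0..1}) (\<lambda>t. ereal \<bar>f t\<bar>)"

definition bandwidths :: "real \<Rightarrow> real \<Rightarrow> nat \<Rightarrow> real set" where
  "bandwidths \<kappa> \<gamma> n = {\<gamma> * (ln (real n) / real n) powr (1 - 2 / \<kappa>) .. 1 / 2}"

end

theory Submission
 imports Defs "Jordan_Normal_Form.Determinant" "HOL-Real_Asymp.Real_Asymp"
begin

text \<open>Given the design, the conditionally centred smoothing spline is the spline smoother applied to the
noise alone. Testing its normal equations against the reproducing kernel at t and comparing with the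
reproducing property leaves exactly one term: the error at t is minus the centred empirical process
evaluated at the product of that spline and the kernel. Integration by parts on a dyadic mesh of width
about h bounds such products by discrepancies of the (noise weighted) empirical measure on
subintervals of single mesh cells. These are of order sqrt(n h L), where L is the logarithmic factor
in the theorem, uniformly in h: truncate, apply an exponential maximal inequality on blocks of sample
sizes, and chain over dyadic intervals. The kernel has energy of order 1/h and the noise spline has energy
of order L/(nh), which gives the rate.\<close>

text \<open>The rate is quadratic because two factors of one size meet. With eta = sqrt (L / (n h))
  the discrepancies are of order h eta, so the noise spline has energy norm O(eta) and its product
  with the kernel is tested with relative precision eta; the kernel norm h^(-1/2) then gives eta^2 /
  sqrt h. Two obstacles shape the rest. First, the noise has only kappa moments, so in block k,
  where n is about 2^k, it is cut at tau = (2^k / k)^(1/kappa). The discarded part costs k tau =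
  sqrt (2^k h_k k) with h_k = (k / 2^k)^(1 - 2/kappa), which up to constants is the lower end of the
  bandwidth range. Near it log n and log (1/h) are comparable and a union bound over all grid
  intervals is affordable; for wide bandwidths only dyadic intervals are, and summability over the
  blocks, with ln k about log log n, explains the second term of L. Second, the conclusion is
  uniform in (h, t), whereas conditional expectations are determined for each pair only up to a null
  set; Cramer's rule makes the smoother measurable in the design and continuous in (h, t).\<close>

abbreviation "ball2 p \<equiv> ball (fst p) (snd p)"
abbreviation "incr2 f p \<equiv> f (fst p + snd p) - f (fst p - snd p) :: real"
abbreviation "AC01 \<equiv> absolutely_continuous_fun_on {0..1}"
abbreviation "leb01 \<equiv> lebesgue_on {0..1::real}"
abbreviation "int01 (f :: real => real) \<equiv> integral {0..1} f"
abbreviation "dnorm2 k f \<equiv> int01 (%x. (deriv01 k f x)^2)"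

section \<open>Absolutely continuous functions\<close>

text \<open>Below the intervals are indexed by balls or by members of a division, so the initial
  segments of \<open>nat\<close> in the definition are traded for arbitrary finite index
  sets.\<close>

lemma absolutely_continuous_fun_onD_finite:
 assumes "absolutely_continuous_fun_on S f" "e > 0"
 obtains d where "d > 0" "!!I (a :: 'i => real) b. finite I ==> (!!i. i \<in> I ==> a i <= b i & {a i..b i} <= S) ==>
  (!!i j. i \<in> I ==> j \<in> I ==> i ~= j ==> {a i<..<b i} Int {a j<..<b j} = {}) ==>
  (SUM i:I. b i - a i) < d ==> (SUM i:I. \<bar>f (b i) - f (a i)\<bar>) < e"
proof -
 obtain d where d: "d > 0" and D: "!!(N::nat) a b.
    (\<forall>i<N. a i <= b i & {a i..b i} <= S) ==>
    (\<forall>i<N. \<forall>j<N. i ~= j --> {a i<..<b i} Int {a j<..<b j} = {}) ==>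
    (SUM i<N. b i - a i) < d ==>
    (SUM i<N. \<bar>f (b i) - f (a i)\<bar>) < e"
  using assms(1)[unfolded absolutely_continuous_fun_on_def, rule_format, OF assms(2)] by (elim exE conjE) (rule that, assumption, simp)
 show ?thesis
 proof (rule that[OF d])
  fix I :: "'i set" and a b :: "'i => real"
  assume I: "finite I" "!!i. i \<in> I ==> a i <= b i & {a i..b i} <= S"
   "!!i j. i \<in> I ==> j \<in> I ==> i ~= j ==> {a i<..<b i} Int {a j<..<b j} = {}" "(SUM i:I. b i - a i) < d"
  obtain g where g: "bij_betw g {..<card I} I"
   using ex_bij_betw_nat_finite[OF I(1)] by (auto simp: atLeast0LessThan)
  have mem: "g i \<in> I" if "i < card I" for i
   using g that by (auto simp: bij_betw_def)
  have inj: "g i ~= g j" if "i < card I" "j < card I" "i ~= j" for i j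
   using g that by (auto simp: bij_betw_def inj_on_def)
  have "(SUM i<card I. \<bar>f (b (g i)) - f (a (g i))\<bar>) < e"
   by (rule D) (use I mem inj sum.reindex_bij_betw[OF g, of "%i. b i - a i"] in auto)
  then show "(SUM i:I. \<bar>f (b i) - f (a i)\<bar>) < e"
   using sum.reindex_bij_betw[OF g, of "%i. \<bar>f (b i) - f (a i)\<bar>"] by simp
 qed
qed

section \<open>Differentiability almost everywhere by Vitali coverings\<close>

lemma sum_interval_lengths_le_measure:
 fixes a b :: "'i => real"
 assumes "finite I" "!!i. i \<in> I ==> a i <= b i & {a i<..<b i} <= T"
  "!!i j. i \<in> I ==> j \<in> I ==> i ~= j ==> {a i<..<b i} Int {a j<..<b j} = {}" "T \<in> lmeasurable"
 shows "(SUM i:I. b i - a i) <= measure lebesgue T"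
proof -
 have "(SUM i:I. b i - a i) = (SUM i:I. measure lebesgue {a i<..<b i})"
  by (rule sum.cong) (use assms(2) in auto)
 also have "... = measure lebesgue (\<Union>i\<in>I. {a i<..<b i})"
  by (rule measure_UNION'[symmetric]) (use assms in \<open>auto simp: pairwise_def disjnt_def\<close>)
 also have "... <= measure lebesgue T"
  by (rule measure_mono_fmeasurable) (use assms in \<open>auto intro!: sets.finite_UN\<close>)
 finally show ?thesis .
qed

text \<open>Vitali's theorem supplies a countable disjoint family that misses only a null set. What
  the first n balls leave of \<open>S\<close> decreases to a null set, so finitely many balls
  already cover \<open>S\<close> up to measure \<open>e\<close>. Restricting the family beforehand
  to balls inside \<open>G\<close> keeps the cover within a prescribed open set.\<close>

lemma Vitali_finite_cover:
 fixes S :: "real set"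
 assumes S: "S \<in> lmeasurable" and G: "open G" "S <= G" and e: "e > 0"
  and P: "!!x d. x \<in> S ==> d > 0 ==> \<exists>c r. 0 < r & r < d & x \<in> ball c r & P c r"
 obtains F where "finite F" "!!c r. (c, r) \<in> F ==> 0 < r & P c r & cball c r <= G"
  "!!p q. p \<in> F ==> q \<in> F ==> p ~= q ==> ball2 p Int ball2 q = {}"
  "measure lebesgue (S - (\<Union>p\<in>F. ball2 p)) < e"
proof -
 let ?K = "{(c, r). 0 < r & P c r & cball c r <= G}"
 have cov: "\<exists>i. i \<in> ?K & x \<in> ball2 i & snd i < d" if x: "x \<in> S" "0 < d" for x d
 proof -
  obtain k where k: "k > 0" "cball x k <= G"
   using G x by (meson open_contains_cball subsetD)
  obtain c r where cr: "0 < r" "r < min d (k/2)" "x \<in> ball c r" "P c r"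
   using P[OF x(1), of "min d (k/2)"] x k by auto
  have "cball c r <= cball x k"
  proof
   fix y assume "y \<in> cball c r"
   then have "dist c y <= r" "dist x c < r"
    using cr by (auto simp: dist_commute)
   then show "y \<in> cball x k" using cr dist_triangle[of x y c] by auto
  qed
  then show ?thesis using cr k by (intro exI[of _ "(c,r)"]) auto
 qed
 obtain C where C: "countable C" "C <= ?K"
  "pairwise (%i j. disjnt (ball2 i) (ball2 j)) C"
  "negligible (S - (\<Union>i \<in> C. ball2 i))"
  by (rule Vitali_covering_theorem_balls[of S ?K fst snd, OF cov])
 show ?thesis
 \<comment> \<open>The enumeration \<open>from_nat_into C\<close> used below makes sense for a
   nonempty family only.\<close>
 proof (cases "C = {}")
  case True
  then have "measure lebesgue S = 0" using C(4) negligible_imp_measure0 by auto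
  then show ?thesis using e by (intro that[of "{}"]) auto
 next
  case False
  define B where "B p = ball2 p" for p :: "real \<times> real"
  define A where "A n = S - (\<Union>i\<le>n. B (from_nat_into C i))" for n
  have mA: "A n \<in> lmeasurable" for n
   unfolding A_def B_def by (intro fmeasurable.Diff S) (auto intro!: sets.finite_UN)
  have "(%n. measure lebesgue (A n)) \<longlonglongrightarrow> measure lebesgue (\<Inter>n. A n)"
  proof (rule Lim_measure_decseq)
   show "range A <= sets lebesgue" using mA by auto
   show "decseq A" unfolding A_def decseq_def by (auto simp: subset_eq)
   show "!!i. emeasure lebesgue (A i) ~= \<infinity>" using mA by (metis emeasure_eq_measure2 ennreal_neq_top infinity_ennreal_def)
  qed
  moreover have "(\<Inter>n. A n) <= S - (\<Union>i \<in> C. B i)"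
  proof
   fix x assume x: "x \<in> (\<Inter>n. A n)"
   have "x ~: B i" if "i \<in> C" for i
   proof -
    obtain n where "i = from_nat_into C n"
     using \<open>i \<in> C\<close> C(1) by (metis from_nat_into_surj)
    then show ?thesis using x by (auto simp: A_def)
   qed
   then show "x \<in> S - (\<Union>i \<in> C. B i)" using x by (auto simp: A_def)
  qed
  then have "measure lebesgue (\<Inter>n. A n) = 0"
   using C(4) negligible_subset negligible_imp_measure0 unfolding B_def by metis
  ultimately have "eventually (%n. measure lebesgue (A n) < e) sequentially"
   using e by (metis order_tendstoD(2))
  then obtain n where n: "measure lebesgue (A n) < e" by (auto simp: eventually_sequentially)
  let ?F = "from_nat_into C ` {..n}"
  have FC: "?F <= C" using from_nat_into[OF False] by auto
  show ?thesis
  proof (rule that[of ?F])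
   show "measure lebesgue (S - (\<Union>p\<in>?F. ball2 p)) < e"
    using n unfolding A_def B_def by (simp add: image_image)
   show "finite ?F" by simp
   show "!!c r. (c, r) \<in> ?F ==> 0 < r & P c r & cball c r <= G" using FC C(2) by blast
   show "!!p q. p \<in> ?F ==> q \<in> ?F ==> p ~= q ==> ball2 p Int ball2 q = {}"
    using FC C(3) unfolding pairwise_def disjnt_def by blast
  qed
 qed
qed

text \<open>Removing the intervals of \<open>F2\<close> from those of \<open>F1\<close> leaves
  finitely many intervals whose total length is the difference of the two lengths. The difference of
  the sums of increments telescopes to the increments over these leftovers, which absolute
  continuity makes small.\<close>

lemma finite_disjoint_balls_gap:
 fixes f :: "real => real"
 assumes ac: "AC01 f" and e: "e > 0"
 obtains d where "d > 0" "!!F1 F2. finite F1 ==> finite F2 ==>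
  (!!p. p \<in> F1 ==> 0 < snd p & cball (fst p) (snd p) <= {0..1}) ==>
  (!!p q. p \<in> F1 ==> q \<in> F1 ==> p ~= q ==> ball2 p Int ball2 q = {}) ==>
  (!!p. p \<in> F2 ==> 0 < snd p & cball (fst p) (snd p) <= (\<Union>p\<in>F1. ball2 p)) ==>
  (!!p q. p \<in> F2 ==> q \<in> F2 ==> p ~= q ==> ball2 p Int ball2 q = {}) ==>
  (SUM p:F1. 2 * snd p) - (SUM p:F2. 2 * snd p) < d ==>
  \<bar>(SUM p:F1. incr2 f p) - (SUM p:F2. incr2 f p)\<bar> < e"
proof -
 obtain d where d: "d > 0" and D: "!!I (a :: (real\<times>real) \<times> real set => real) b. finite I ==> (!!i. i \<in> I ==> a i <= b i & {a i..b i} <= {0..1}) ==>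
  (!!i j. i \<in> I ==> j \<in> I ==> i ~= j ==> {a i<..<b i} Int {a j<..<b j} = {}) ==>
  (SUM i:I. b i - a i) < d ==> (SUM i:I. \<bar>f (b i) - f (a i)\<bar>) < e"
  by (fact absolutely_continuous_fun_onD_finite[OF ac e, where 'i="(real\<times>real) \<times> real set"])
 show ?thesis
 proof (rule that[OF d])
  fix F1 F2 :: "(real \<times> real) set"
  assume fin: "finite F1" "finite F2"
  and F1: "!!p. p \<in> F1 ==> 0 < snd p & cball (fst p) (snd p) <= {0..1}"
  and F1d: "!!p q. p \<in> F1 ==> q \<in> F1 ==> p ~= q ==> ball2 p Int ball2 q = {}"
  and F2: "!!p. p \<in> F2 ==> 0 < snd p & cball (fst p) (snd p) <= (\<Union>p\<in>F1. ball2 p)"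
  and F2d: "!!p q. p \<in> F2 ==> q \<in> F2 ==> p ~= q ==> ball2 p Int ball2 q = {}"
  and len: "(SUM p:F1. 2 * snd p) - (SUM p:F2. 2 * snd p) < d"
  define cb where "cb p = cball (fst p) (snd p)" for p :: "real \<times> real"
  define F2' where "F2' p = {q\<in>F2. cb q <= ball2 p}" for p
  have cbI: "cb p = {fst p - snd p .. fst p + snd p}" for p
   unfolding cb_def by (simp add: cball_eq_atLeastAtMost)
  have bI: "ball2 p = {fst p - snd p <..< fst p + snd p}" for p :: "real \<times> real"
   by (simp add: ball_eq_greaterThanLessThan)
  have pos1: "0 < snd p" "cb p <= {0..1}" if "p \<in> F1" for p
   using F1[OF that] by (auto simp: cb_def)
  have pos2: "0 < snd p" "cb p <= (\<Union>p\<in>F1. ball2 p)" if "p \<in> F2" for p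
   using F2[OF that] by (auto simp: cb_def)
  \<comment> \<open>A closed interval is connected and the balls of \<open>F1\<close> are open and
    disjoint, so it cannot meet two of them.\<close>
  have ex1: "\<exists>p\<in>F1. cb q <= ball2 p" if q: "q \<in> F2" for q
  proof -
   have "fst q \<in> cb q" using pos2[OF q] by (simp add: cb_def)
   then obtain p where p: "p \<in> F1" "fst q \<in> ball2 p" using pos2(2)[OF q] by auto
   have "connected (cb q)" by (simp add: cb_def)
   moreover have "open (ball2 p)" "open (\<Union>p'\<in>F1-{p}. ball2 p')" by auto
   moreover have "ball2 p Int (\<Union>p'\<in>F1-{p}. ball2 p') Int cb q = {}"
    using F1d p(1) by blast
   moreover have "cb q <= ball2 p Un (\<Union>p'\<in>F1-{p}. ball2 p')"
    using pos2(2)[OF q] by blast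
   ultimately have "ball2 p Int cb q = {} | (\<Union>p'\<in>F1-{p}. ball2 p') Int cb q = {}"
    by (rule connectedD)
   then have "cb q <= ball2 p"
    using pos2(2)[OF q] p \<open>fst q \<in> cb q\<close> by blast
   then show ?thesis using p by blast
  qed
  have un: "F2 = (\<Union>p\<in>F1. F2' p)" using ex1 by (auto simp: F2'_def)
  have dis: "F2' p Int F2' p' = {}" if "p \<in> F1" "p' \<in> F1" "p ~= p'" for p p'
  proof -
   have "False" if "q \<in> F2' p" "q \<in> F2' p'" for q
   proof -
    have "fst q \<in> cb q" using that pos2[of q] by (simp add: cb_def F2'_def)
    then show False using that F1d \<open>p \<in> F1\<close> \<open>p' \<in> F1\<close> \<open>p ~= p'\<close> unfolding F2'_def by blast
   qed
   then show ?thesis by blast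
  qed
  have sumF2: "(SUM q:F2. g q) = (SUM p:F1. SUM q:F2' p. g q)" for g :: "real \<times> real => real"
   unfolding un by (rule sum.UNION_disjoint) (use fin dis in \<open>auto simp: F2'_def\<close>)
  have "\<exists>r. cb ` F2' p <= r & r division_of cb p" if p: "p \<in> F1" for p
  proof -
   have "cb ` F2' p division_of \<Union>(cb ` F2' p)"
   proof (rule division_ofI)
    show "finite (cb ` F2' p)" using fin by (auto simp: F2'_def)
    show "\<exists>a b. K = cbox a b" if "K \<in> cb ` F2' p" for K using that by (auto simp: cbI cbox_interval)
    show "K ~= {}" if KF: "K \<in> cb ` F2' p" for K
    proof -
     obtain q where q: "q \<in> F2" "K = cb q" using KF unfolding F2'_def by blast
     then show ?thesis using pos2(1)[OF q(1)] by (simp add: cbI)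
    qed
    show "interior K1 Int interior K2 = {}" if K: "K1 \<in> cb ` F2' p" "K2 \<in> cb ` F2' p" "K1 ~= K2" for K1 K2
    proof -
     obtain q1 q2 where q: "q1 \<in> F2" "q2 \<in> F2" "K1 = cb q1" "K2 = cb q2" "q1 ~= q2" using K by (auto simp: F2'_def)
     then show ?thesis using F2d unfolding bI cbI by simp
    qed
   qed auto
   moreover have "\<Union>(cb ` F2' p) <= cbox (fst p - snd p) (fst p + snd p)"
    by (auto simp: F2'_def cb_def ball_eq_greaterThanLessThan cball_eq_atLeastAtMost cbox_interval)
   ultimately obtain r where "cb ` F2' p <= r" "r division_of cbox (fst p - snd p) (fst p + snd p)"
    by (rule partial_division_extend_interval)
   then show ?thesis by (auto simp: cbI cbox_interval)
  qed
  then have "\<forall>p\<in>F1. \<exists>r. cb ` F2' p <= r & r division_of cb p" by blast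
  then obtain r where "\<forall>p\<in>F1. cb ` F2' p <= r p & r p division_of cb p" by (rule bchoice[THEN exE])
  then have r: "!!p. p \<in> F1 ==> cb ` F2' p <= r p" "!!p. p \<in> F1 ==> r p division_of cb p" by auto
  have add: "(SUM K:r p. g (Sup K) - g (Inf K)) = g (fst p + snd p) - g (fst p - snd p)" if p: "p \<in> F1" for p and g :: "real => real"
  proof -
   have le: "fst p - snd p <= fst p + snd p" using pos1(1)[OF p] by simp
   have rp: "r p division_of {fst p - snd p .. fst p + snd p}" using r(2)[OF p] by (simp add: cbI)
   have t: "(%K. (Inf K, K)) ` r p tagged_division_of {fst p - snd p .. fst p + snd p}"
   proof (rule tagged_division_ofI)
    show "finite ((%K. (Inf K, K)) ` r p)" using rp by auto
    fix x K assume "(x, K) \<in> (%K. (Inf K, K)) ` r p"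
    then have K: "K \<in> r p" "x = Inf K" by auto
    obtain a b where ab: "K = {a..b}" using division_ofD(4)[OF rp K(1)] by (auto simp: cbox_interval)
    have "K ~= {}" using division_ofD(3)[OF rp K(1)] .
    then show "x \<in> K" using K ab by simp
    show "K <= {fst p - snd p .. fst p + snd p}" using division_ofD(2)[OF rp K(1)] .
    show "\<exists>a b. K = cbox a b" using division_ofD(4)[OF rp K(1)] .
    fix x' K' assume "(x', K') \<in> (%K. (Inf K, K)) ` r p" "(x, K) ~= (x', K')"
    then show "interior K Int interior K' = {}" using division_ofD(5)[OF rp] K by auto
   next
    show "\<Union>{K. \<exists>x. (x, K) \<in> (%K. (Inf K, K)) ` r p} = {fst p - snd p .. fst p + snd p}"
     using division_ofD(6)[OF rp] by (auto simp: image_iff; blast)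
   qed
   have "(SUM K:r p. g (Sup K) - g (Inf K)) = (\<Sum>(x,K)\<in>(%K. (Inf K, K)) ` r p. g (Sup K) - g (Inf K))"
    by (subst sum.reindex) (auto simp: inj_on_def)
   then show ?thesis using additive_tagged_division_1[OF le t, of g] by simp
  qed
  \<comment> \<open>The leftover pieces. Pairing each with its ball of \<open>F1\<close> keeps the
    index sets of different balls disjoint, so that sums split over the balls.\<close>
  let ?I = "Sigma F1 (%p. r p - cb ` F2' p)"
  have finr: "finite (r p)" if "p \<in> F1" for p using r(2)[OF that] by auto
  \<comment> \<open>Stated for a general \<open>g\<close>: the identity gives the lengths,
    \<open>f\<close> the increments.\<close>
  have split: "(SUM p:F1. g (fst p + snd p) - g (fst p - snd p)) - (SUM p:F2. g (fst p + snd p) - g (fst p - snd p)) = (SUM i:?I. g (Sup (snd i)) - g (Inf (snd i)))" for g :: "real => real"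
  proof -
   have "(SUM K:r p - cb ` F2' p. g (Sup K) - g (Inf K)) = (g (fst p + snd p) - g (fst p - snd p)) - (SUM q:F2' p. g (fst q + snd q) - g (fst q - snd q))"
    if p: "p \<in> F1" for p
   proof -
    have inj: "inj_on cb (F2' p)"
    proof (rule inj_onI)
     fix x y assume "x \<in> F2' p" "y \<in> F2' p" "cb x = cb y"
     then have "{fst x - snd x..fst x + snd x} = {fst y - snd y..fst y + snd y}" "0 < snd x"
      using pos2 by (auto simp: cbI F2'_def)
     then show "x = y" by (auto simp: Icc_eq_Icc prod_eq_iff)
    qed
    have "(SUM K:cb ` F2' p. g (Sup K) - g (Inf K)) = (SUM q:F2' p. g (fst q + snd q) - g (fst q - snd q))"
     by (subst sum.reindex[OF inj], rule sum.cong) (auto simp: cbI F2'_def dest!: pos2(1))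
    then show ?thesis
     by (subst sum_diff) (use finr[OF p] r(1)[OF p] add[OF p, of g] in auto)
   qed
   then have "(SUM i:?I. g (Sup (snd i)) - g (Inf (snd i))) = (SUM p:F1. (g (fst p + snd p) - g (fst p - snd p)) - (SUM q:F2' p. g (fst q + snd q) - g (fst q - snd q)))"
    using sum.Sigma[of F1 "%p. r p - cb ` F2' p" "%p K. g (Sup K) - g (Inf K)"] fin(1) finr by (simp add: case_prod_beta)
   then show ?thesis by (simp add: sum_subtractf sumF2 case_prod_beta)
  qed
  have Ifin: "finite ?I" using fin finr by auto
  have K: "Inf K <= Sup K & K = {Inf K..Sup K} & K <= cb p" if pK: "p \<in> F1" "K \<in> r p" for p K
  proof -
   obtain a b where ab: "K = {a..b}" using division_ofD(4)[OF r(2)[OF pK(1)] pK(2)] by (auto simp: cbox_interval)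
   have "K ~= {}" "K <= cb p" using division_ofD(2,3)[OF r(2)[OF pK(1)] pK(2)] by auto
   then show ?thesis using ab by auto
  qed
  have "(SUM i:?I. \<bar>f (Sup (snd i)) - f (Inf (snd i))\<bar>) < e"
  proof (rule D)
  next
    fix i assume "i \<in> ?I"
    then have "fst i \<in> F1" "snd i \<in> r (fst i)" by auto
    from K[OF this] pos1[OF this(1)] show "Inf (snd i) <= Sup (snd i) & {Inf (snd i)..Sup (snd i)} <= {0..1}" by auto
  next
    fix i j assume ij: "i \<in> ?I" "j \<in> ?I" "i ~= j"
    have int: "{Inf (snd i)<..<Sup (snd i)} = interior (snd i)" if "i \<in> ?I" for i
    proof -
     have "snd i = {Inf (snd i)..Sup (snd i)}" using K[of "fst i" "snd i"] that by auto
     then show ?thesis by (metis interior_atLeastAtMost_real)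
    qed
    show "{Inf (snd i)<..<Sup (snd i)} Int {Inf (snd j)<..<Sup (snd j)} = {}"
    proof (cases "fst i = fst j")
     case True
     then have "snd i ~= snd j" using ij by (simp add: prod_eq_iff)
     then show ?thesis unfolding int[OF ij(1)] int[OF ij(2)]
      using division_ofD(5)[OF r(2), of "fst i" "snd i" "snd j"] ij True by auto
    next
     case False
     have "interior (snd i) <= interior (cb (fst i))" "interior (snd j) <= interior (cb (fst j))"
      using K[of "fst i" "snd i"] K[of "fst j" "snd j"] ij by (auto intro!: interior_mono)
     moreover have "interior (cb (fst i)) Int interior (cb (fst j)) = {}"
      proof -
      have "fst i \<in> F1" "fst j \<in> F1" using ij by auto
      then have "ball2 (fst i) Int ball2 (fst j) = {}" using F1d False by blast
      then show ?thesis by (simp only: bI cbI interior_atLeastAtMost_real)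
     qed
     ultimately show ?thesis unfolding int[OF ij(1)] int[OF ij(2)] by blast
    qed
  next
   show "(SUM i:?I. Sup (snd i) - Inf (snd i)) < d"
    using split[of "%x. x"] len by (simp add: algebra_simps case_prod_beta mult_2)
  qed (fact Ifin)
  then show "\<bar>(SUM p:F1. incr2 f p) - (SUM p:F2. incr2 f p)\<bar> < e"
   unfolding split using sum_abs[of "%i. f (Sup (snd i)) - f (Inf (snd i))" ?I] by linarith
 qed
qed

lemma absolutely_continuous_fun_on_imp_continuous_on:
 assumes "absolutely_continuous_fun_on {a..b} f"
 shows "continuous_on {a..b} f"
 unfolding continuous_on_iff
proof (intro ballI allI impI)
 fix x e :: real assume x: "x \<in> {a..b}" and e: "e > 0"
 obtain d where d: "d > 0" and D: "!!(N::nat) a' b'. (\<forall>i<N. a' i <= b' i & {a' i..b' i} <= {a..b}) ==>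
    (\<forall>i<N. \<forall>j<N. i ~= j --> {a' i<..<b' i} Int {a' j<..<b' j} = {}) ==>
    (SUM i<N. b' i - a' i) < d ==> (SUM i<N. \<bar>f (b' i) - f (a' i)\<bar>) < e"
  using assms[unfolded absolutely_continuous_fun_on_def, rule_format, OF e] by (elim exE conjE) (rule that, assumption, simp)
 show "\<exists>d>0. \<forall>x'\<in>{a..b}. dist x' x < d --> dist (f x') (f x) < e"
 proof (intro exI[of _ d] conjI d ballI impI)
  fix y assume y: "y \<in> {a..b}" "dist y x < d"
  have "\<bar>f (max x y) - f (min x y)\<bar> < e"
   using D[of 1 "%_. min x y" "%_. max x y"] x y by (auto simp: dist_real_def)
  then show "dist (f y) (f x) < e"
   by (auto simp: dist_real_def min_def max_def abs_minus_commute split: if_splits)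
 qed
qed

text \<open>Slopes are tested on small intervals that merely contain the point. The point may move
  within such an open interval, so the set is a countable intersection of open sets for every
  \<open>f\<close> and therefore measurable.\<close>

definition upper_slope_set :: "(real => real) => real => real set" where
 "upper_slope_set f q = {x\<in>{0<..<1}. \<forall>d>0. \<exists>c r. 0 < r & r < d & x \<in> ball c r &
  ball c r <= {0<..<1} & q * (2*r) < f (c+r) - f (c-r)}"

lemma upper_slope_set_measurable: "upper_slope_set f q \<in> lmeasurable"
proof -
 define B where "B n = (\<Union>(c,r)\<in>{(c,r). 0 < r & r < 1 / real (Suc n) & ball c r <= {0<..<1} & q * (2*r) < f (c+r) - f (c-r)}. ball c r)" for n
 have "open (B n)" for n unfolding B_def by (auto intro!: open_UN)
 then have "(\<Inter>n. B n) \<in> sets lebesgue" by (auto intro!: sets.countable_INT)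
 moreover have "upper_slope_set f q = (\<Inter>n. B n) Int {0<..<1}"
 proof (intro equalityI subsetI)
  fix x assume "x \<in> upper_slope_set f q"
  then show "x \<in> (\<Inter>n. B n) Int {0<..<1}"
  proof -
   have x: "x \<in> {0<..<1}" "!!d. d > 0 ==> \<exists>c r. 0 < r & r < d & x \<in> ball c r &
    ball c r <= {0<..<1} & q * (2*r) < f (c+r) - f (c-r)"
    using \<open>x \<in> upper_slope_set f q\<close> unfolding upper_slope_set_def by blast+
   have "x \<in> B n" for n
   proof -
    obtain c r where "0 < r" "r < 1 / real (Suc n)" "x \<in> ball c r" "ball c r <= {0<..<1}" "q * (2*r) < f (c+r) - f (c-r)"
     using x(2)[of "1 / real (Suc n)"] by auto
    then show ?thesis unfolding B_def by (intro UN_I[of "(c,r)"]) auto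
   qed
   then show ?thesis using x(1) by blast
  qed
 next
  fix x assume x: "x \<in> (\<Inter>n. B n) Int {0<..<1}"
  have "\<exists>c r. 0 < r & r < d & x \<in> ball c r & ball c r <= {0<..<1} & q * (2*r) < f (c+r) - f (c-r)"
   if "d > 0" for d
  proof -
   obtain n where n: "1 / real (Suc n) < d" using \<open>d > 0\<close> nat_approx_posE by blast
   have "x \<in> B n" using x by auto
   then obtain c r where "0 < r" "r < 1 / real (Suc n)" "x \<in> ball c r" "ball c r <= {0<..<1}" "q * (2*r) < f (c+r) - f (c-r)"
    unfolding B_def by blast
   then show ?thesis using n by (intro exI[of _ c] exI[of _ r]) auto
  qed
  then show "x \<in> upper_slope_set f q" using x unfolding upper_slope_set_def by blast
 qed
 ultimately show ?thesis
  by (auto intro!: bounded_set_imp_lmeasurable bounded_subset[OF bounded_Ioo[of 0 1]] sets.Int)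
qed

text \<open>Lebesgue's argument for monotone functions, with absolute continuity in the place of
  monotonicity. If the set \<open>E\<close> of points with slopes below \<open>p\<close> and slopes
  above \<open>q\<close> had measure s > 0, it could be covered economically by intervals of slope
  below \<open>p\<close>, and inside these again by intervals of slope above \<open>q\<close>. Both
  families have total length close to s and, by \<open>finite_disjoint_balls_gap\<close>, nearly
  equal total increments, although one is at most about p s and the other at least about q
  s.\<close>

lemma negligible_distinct_slopes:
 assumes ac: "AC01 f" and pq: "p < q"
 shows "negligible (upper_slope_set f q Int upper_slope_set (%x. - f x) (- p))"
proof -
 define E where "E = upper_slope_set f q Int upper_slope_set (%x. - f x) (- p)"
 have E: "E \<in> lmeasurable" unfolding E_def using upper_slope_set_measurable by blast
 have E01: "E <= {0<..<1}" by (auto simp: E_def upper_slope_set_def)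
 define s where "s = measure lebesgue E"
 have "s = 0"
 proof (rule ccontr)
  assume "s ~= 0"
  then have s: "s > 0" by (simp add: s_def zero_less_measure_iff)
  define e where "e = (q - p) * s / 4"
  have e: "e > 0" using s pq by (simp add: e_def)
  obtain d0 where d0: "d0 > 0" and D: "!!F1 F2. finite F1 ==> finite F2 ==>
  (!!p. p \<in> F1 ==> 0 < snd p & cball (fst p) (snd p) <= {0..1}) ==>
  (!!p q. p \<in> F1 ==> q \<in> F1 ==> p ~= q ==> ball2 p Int ball2 q = {}) ==>
  (!!p. p \<in> F2 ==> 0 < snd p & cball (fst p) (snd p) <= (\<Union>p\<in>F1. ball2 p)) ==>
  (!!p q. p \<in> F2 ==> q \<in> F2 ==> p ~= q ==> ball2 p Int ball2 q = {}) ==>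
  (SUM p:F1. 2 * snd p) - (SUM p:F2. 2 * snd p) < d0 ==>
  \<bar>(SUM p:F1. incr2 f p) - (SUM p:F2. incr2 f p)\<bar> < e"
   by (fact finite_disjoint_balls_gap[OF ac e])
  \<comment> \<open>The three bounds serve to apply \<open>D\<close>, to keep the inner family at
    least s/2 long, and to make the error |p| d from unequal lengths at most
    \<open>e\<close>.\<close>
  define d where "d = Min {d0, s, e / (\<bar>p\<bar> + 1)}"
  have d: "d > 0" "d <= d0" "d <= s" "d <= e / (\<bar>p\<bar> + 1)" using d0 s e by (auto simp: d_def)
  then have pd: "\<bar>p\<bar> * d <= e"
  proof -
   have "(\<bar>p\<bar> + 1) * d <= e" using d(4) by (simp add: field_simps)
   then show ?thesis using d(1) by (simp add: algebra_simps)
  qed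
  \<comment> \<open>A second name, as \<open>p\<close> also names the balls below.\<close>
  define p1 where "p1 = p"
  obtain G0 where G0: "open G0" "E <= G0" "G0 - E \<in> lmeasurable" "emeasure lebesgue (G0 - E) < ennreal (d/4)"
   proof (rule sets_lebesgue_outer_open[of E "d/4"])
   show "E \<in> sets lebesgue" "0 < d/4" using E d by auto
  qed
  define G where "G = G0 Int {0<..<1}"
  have G: "open G" "E <= G" "G <= {0<..<1}" using G0 E01 by (auto simp: G_def)
  have Gm: "G \<in> lmeasurable" using G by (intro lmeasurable_open bounded_subset[OF bounded_Ioo]) auto
  have "measure lebesgue G <= measure lebesgue (E Un (G0 - E))"
   by (rule measure_mono_fmeasurable) (use G Gm fmeasurable.Un[OF E G0(3)] in \<open>auto simp: G_def\<close>)
  also have "... <= s + measure lebesgue (G0 - E)"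
   unfolding s_def by (rule measure_Un_le) (use E G0 in auto)
  also have "measure lebesgue (G0 - E) < d/4"
   using G0(3,4) by (simp add: emeasure_eq_measure2 ennreal_less_iff)
  finally have mG: "measure lebesgue G < s + d/4" by simp
  obtain F1 where F1: "finite F1" "!!c r. (c, r) \<in> F1 ==> 0 < r & - p * (2*r) < - f (c+r) - - f (c-r) & cball c r <= G"
   "!!p q. p \<in> F1 ==> q \<in> F1 ==> p ~= q ==> ball2 p Int ball2 q = {}"
   "measure lebesgue (E - (\<Union>p\<in>F1. ball2 p)) < d/4"
  proof (rule Vitali_finite_cover[OF E G(1,2), of "d/4" "%c r. - p * (2*r) < - f (c+r) - - f (c-r)"])
   fix x d' :: real assume "x \<in> E" "d' > 0"
   then show "\<exists>c r. 0 < r & r < d' & x \<in> ball c r & - p * (2*r) < - f (c+r) - - f (c-r)"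
    unfolding E_def upper_slope_set_def by blast
  qed (use d in auto)
  define U where "U = (\<Union>p\<in>F1. ball2 p)"
  have U: "open U" "U <= G"
  proof -
   show "open U" unfolding U_def by auto
   have "ball2 p <= G" if "p \<in> F1" for p
    using F1(2)[of "fst p" "snd p"] that ball_subset_cball[of "fst p" "snd p"] by auto
   then show "U <= G" unfolding U_def by blast
  qed
  have Um: "U \<in> lmeasurable" using U G by (intro lmeasurable_open bounded_subset[OF bounded_Ioo]) auto
  obtain F2 where F2: "finite F2" "!!c r. (c, r) \<in> F2 ==> 0 < r & q * (2*r) < f (c+r) - f (c-r) & cball c r <= U"
   "!!p q. p \<in> F2 ==> q \<in> F2 ==> p ~= q ==> ball2 p Int ball2 q = {}"
   "measure lebesgue ((E Int U) - (\<Union>p\<in>F2. ball2 p)) < d/4"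
  proof (rule Vitali_finite_cover[of "E Int U" U "d/4" "%c r. q * (2*r) < f (c+r) - f (c-r)"])
   fix x d' :: real assume "x \<in> E Int U" "d' > 0"
   then show "\<exists>c r. 0 < r & r < d' & x \<in> ball c r & q * (2*r) < f (c+r) - f (c-r)"
    unfolding E_def upper_slope_set_def by blast
  qed (use d U Um E in auto)
  define V where "V = (\<Union>p\<in>F2. ball2 p)"
  have V: "V <= U"
  proof -
   have "ball2 p <= U" if "p \<in> F2" for p
    using F2(2)[of "fst p" "snd p"] that ball_subset_cball[of "fst p" "snd p"] by auto
   then show ?thesis unfolding V_def by blast
  qed
  have Vm: "V \<in> lmeasurable" unfolding V_def using F2(1) by (intro fmeasurable.finite_UN) auto
  have L: "measure lebesgue (\<Union>p\<in>F. ball2 p) = (SUM p:F. 2 * snd p)"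
   if "finite F" "!!p. p \<in> F ==> 0 < snd p" "!!p q. p \<in> F ==> q \<in> F ==> p ~= q ==> ball2 p Int ball2 q = {}"
   for F :: "(real\<times>real) set"
  proof -
   have "measure lebesgue (\<Union>p\<in>F. ball2 p) = (SUM p:F. measure lebesgue (ball2 p))"
    by (rule measure_UNION') (use that in \<open>auto simp: pairwise_def disjnt_def\<close>)
   also have "... = (SUM p:F. 2 * snd p)"
    by (rule sum.cong) (auto simp: ball_eq_greaterThanLessThan dest!: that(2))
   finally show ?thesis .
  qed
  have FF1: "0 < snd p" "incr2 f p < p1 * (2 * snd p)" "cball (fst p) (snd p) <= G"
   if "p \<in> F1" for p
   using F1(2)[of "fst p" "snd p"] that by (auto simp: p1_def)
  have FF2: "0 < snd p" "q * (2 * snd p) < incr2 f p" "cball (fst p) (snd p) <= U"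
   if "p \<in> F2" for p
   using F2(2)[of "fst p" "snd p"] that by auto
  define L1 where "L1 = (SUM p:F1. 2 * snd p)"
  define L2 where "L2 = (SUM p:F2. 2 * snd p)"
  have L1: "L1 = measure lebesgue U" unfolding L1_def U_def using L[of F1] F1(1,3) FF1(1) by auto
  have L2: "L2 = measure lebesgue V" unfolding L2_def V_def using L[of F2] F2(1,3) FF2(1) by auto
  have l1: "L1 < s + d/4" using measure_mono_fmeasurable[OF U(2) _ Gm] Um mG by (auto simp: L1)
  have "s <= measure lebesgue (V Un ((E Int U) - V) Un (E - U))"
   unfolding s_def by (rule measure_mono_fmeasurable) (use E Um Vm in auto)
  also have "... <= measure lebesgue (V Un ((E Int U) - V)) + measure lebesgue (E - U)"
   by (rule measure_Un_le) (use E Um Vm in auto)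
  also have "... <= measure lebesgue V + measure lebesgue ((E Int U) - V) + measure lebesgue (E - U)"
   using measure_Un_le[of V lebesgue "(E Int U) - V"] E Um Vm by auto
  finally have l2: "s - d/2 < L2" using F1(4) F2(4) by (simp add: L2 U_def V_def)
  have l12: "L2 <= L1" unfolding L1 L2 by (rule measure_mono_fmeasurable[OF V]) (use Um Vm in auto)
  have "\<bar>(SUM p:F1. incr2 f p) - (SUM p:F2. incr2 f p)\<bar> < e"
  proof (rule D)
   show "(SUM p:F1. 2 * snd p) - (SUM p:F2. 2 * snd p) < d0"
    using l1 l2 d by (simp add: L1_def L2_def)
   show "0 < snd p & cball (fst p) (snd p) <= {0..1}" if "p \<in> F1" for p
   proof -
    have "G <= {0..1}" using G(3) by auto
    then show ?thesis using FF1[OF that] by blast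
   qed
   show "0 < snd p & cball (fst p) (snd p) <= (\<Union>p\<in>F1. ball2 p)" if "p \<in> F2" for p
    using FF2[OF that] unfolding U_def by simp
  qed (fact F1(1) F2(1) F1(3) F2(3))+
  moreover have "(SUM p:F1. incr2 f p) <= p1 * L1"
   unfolding L1_def sum_distrib_left by (rule sum_mono) (rule less_imp_le[OF FF1(2)])
  moreover have "q * L2 <= (SUM p:F2. incr2 f p)"
   unfolding L2_def sum_distrib_left by (rule sum_mono) (rule less_imp_le[OF FF2(2)])
  ultimately have "q * L2 < p * L1 + e" unfolding p1_def by linarith
  also have "p * L1 = p * L2 + p * (L1 - L2)" by (simp add: algebra_simps)
  also have "p * (L1 - L2) <= \<bar>p\<bar> * d"
  proof -
   have "p * (L1 - L2) <= \<bar>p\<bar> * (L1 - L2)" using l12 by (intro mult_right_mono) auto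
   also have "... <= \<bar>p\<bar> * d" using l1 l2 d(1) by (intro mult_left_mono) auto
   finally show ?thesis .
  qed
  finally have "(q - p) * L2 < 2 * e" using pd by (simp add: algebra_simps)
  moreover have "(q - p) * (s/2) <= (q - p) * L2" using l2 d pq by (intro mult_left_mono) auto
  ultimately show False by (simp add: e_def mult.commute)
 qed
 then show ?thesis using E unfolding s_def E_def[symmetric] by (simp add: negligible_iff_measure)
qed

text \<open>Inside an interval shorter than the \<open>d\<close> of absolute continuity, a part of
  measure s > 0 would allow disjoint intervals of slope above n with a total increment of at least n
  s / 2, which exceeds 1 for large n. Negligibility is local, so short intervals suffice.\<close>

lemma negligible_infinite_slopes:
 assumes ac: "AC01 f"
 shows "negligible (\<Inter>n::nat. upper_slope_set f n)"
proof (rule locally_negligible_alt[THEN iffD2], rule ballI)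
 define E where "E = (\<Inter>n::nat. upper_slope_set f n)"
 fix x assume "x \<in> (\<Inter>n::nat. upper_slope_set f n)"
 then have x: "x \<in> E" by (simp add: E_def)
 have one: "(0::real) < 1" by simp
 obtain d where d: "d > 0" and D: "!!I (a :: real \<times> real => real) b. finite I ==> (!!i. i \<in> I ==> a i <= b i & {a i..b i} <= {0..1}) ==>
  (!!i j. i \<in> I ==> j \<in> I ==> i ~= j ==> {a i<..<b i} Int {a j<..<b j} = {}) ==>
  (SUM i:I. b i - a i) < d ==> (SUM i:I. \<bar>f (b i) - f (a i)\<bar>) < 1"
  by (fact absolutely_continuous_fun_onD_finite[OF ac one, where 'i="real\<times>real"])
 define G where "G = ball x (d/4) Int {0<..<1}"
 have G: "open G" by (auto simp: G_def)
 have Gm: "G \<in> lmeasurable" "measure lebesgue G < d"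
 proof -
  show "G \<in> lmeasurable" unfolding G_def by auto
  have "measure lebesgue G <= measure lebesgue (ball x (d/4))"
   unfolding G_def by (rule measure_mono_fmeasurable) auto
  then show "measure lebesgue G < d" using d by (simp add: ball_eq_greaterThanLessThan)
 qed
 have Em: "E \<in> lmeasurable"
 proof (rule fmeasurableI2[OF upper_slope_set_measurable[of f "real 0"]])
  show "E <= upper_slope_set f (real 0)" unfolding E_def by blast
  show "E \<in> sets lebesgue" unfolding E_def
   by (auto intro!: sets.countable_INT fmeasurableD[OF upper_slope_set_measurable])
 qed
 define s where "s = measure lebesgue (E Int G)"
 have "s = 0"
 proof (rule ccontr)
  assume "s ~= 0"
  then have s: "s > 0" by (simp add: s_def zero_less_measure_iff)
  obtain n :: nat where n: "real n * (s/2) > 1" using reals_Archimedean3[of "s/2"] s by (metis half_gt_zero)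
  obtain F where F: "finite F" "!!c r. (c, r) \<in> F ==> 0 < r & real n * (2*r) < f (c+r) - f (c-r) & cball c r <= G"
   "!!p q. p \<in> F ==> q \<in> F ==> p ~= q ==> ball2 p Int ball2 q = {}"
   "measure lebesgue (E Int G - (\<Union>p\<in>F. ball2 p)) < s/2"
  proof (rule Vitali_finite_cover[of "E Int G" G "s/2" "%c r. real n * (2*r) < f (c+r) - f (c-r)"])
   fix y d :: real assume "y \<in> E Int G" "0 < d"
   then have "y \<in> upper_slope_set f (real n)" by (auto simp: E_def)
   then show "\<exists>c r. 0 < r & r < d & y \<in> ball c r & real n * (2*r) < f (c+r) - f (c-r)"
    using \<open>0 < d\<close> unfolding upper_slope_set_def by blast
  qed (use Em Gm s G in auto)
  define V where "V = (\<Union>p\<in>F. ball2 p)"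
  have Vm: "V \<in> lmeasurable" unfolding V_def using F(1) by (intro fmeasurable.finite_UN) auto
  have LV: "measure lebesgue V <= (SUM p:F. 2 * snd p)"
  proof -
   have "measure lebesgue V <= (SUM p:F. measure lebesgue (ball2 p))"
    unfolding V_def by (rule measure_UNION_le) (use F(1) in auto)
   also have "... = (SUM p:F. 2 * snd p)"
    by (rule sum.cong) (auto simp: ball_eq_greaterThanLessThan dest!: F(2))
   finally show ?thesis .
  qed
  have bI: "ball2 p = {fst p - snd p <..< fst p + snd p}" for p :: "real \<times> real"
   by (simp add: ball_eq_greaterThanLessThan)
  have FF: "0 < snd p" "real n * (2 * snd p) < incr2 f p" "{fst p - snd p..fst p + snd p} <= G" if "p \<in> F" for p
   using F(2)[of "fst p" "snd p"] that by (auto simp: cball_eq_atLeastAtMost)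
  have "(SUM p:F. (fst p + snd p) - (fst p - snd p)) <= measure lebesgue G"
  proof (rule sum_interval_lengths_le_measure[OF F(1)])
   fix i assume "i \<in> F"
   from FF[OF this] have "fst i - snd i <= fst i + snd i" "{fst i - snd i..fst i + snd i} <= G" by auto
   then show "fst i - snd i <= fst i + snd i & {fst i - snd i<..<fst i + snd i} <= G"
    using greaterThanLessThan_subseteq_atLeastAtMost_iff[of "fst i - snd i" "fst i + snd i" "fst i - snd i" "fst i + snd i"] by blast
  next
   fix i j assume "i \<in> F" "j \<in> F" "i ~= j"
   from F(3)[OF this] show "{fst i - snd i<..<fst i + snd i} Int {fst j - snd j<..<fst j + snd j} = {}"
    unfolding bI .
  qed (rule Gm)
  then have LG: "(SUM p:F. (fst p + snd p) - (fst p - snd p)) < d" using Gm by simp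
  have lt1: "(SUM p:F. \<bar>incr2 f p\<bar>) < 1"
  proof (rule D)
  next
   fix i assume "i \<in> F" from FF[OF this] have "fst i - snd i <= fst i + snd i" "{fst i - snd i..fst i + snd i} <= G" by auto
   moreover have "G <= {0..1}" by (auto simp: G_def)
   ultimately show "fst i - snd i <= fst i + snd i & {fst i - snd i..fst i + snd i} <= {0..1}" by blast
  next
   fix i j assume "i \<in> F" "j \<in> F" "i ~= j"
   from F(3)[OF this] show "{fst i - snd i<..<fst i + snd i} Int {fst j - snd j<..<fst j + snd j} = {}"
    unfolding bI .
  qed (use F(1) LG in auto)
  have "s <= measure lebesgue (V Un (E Int G - V))"
   unfolding s_def by (rule measure_mono_fmeasurable) (use Em Gm Vm in auto)
  also have "... <= measure lebesgue V + measure lebesgue (E Int G - V)"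
   by (rule measure_Un_le) (use Em Gm Vm in auto)
  finally have "s/2 <= (SUM p:F. 2 * snd p)" using F(4) LV by (simp add: V_def)
  then have "real n * (s/2) <= real n * (SUM p:F. 2 * snd p)" by (intro mult_left_mono) auto
  also have "... <= (SUM p:F. \<bar>incr2 f p\<bar>)"
   unfolding sum_distrib_left
  proof (rule sum_mono)
   fix p assume "p \<in> F"
   from FF(2)[OF this] show "real n * (2 * snd p) <= \<bar>incr2 f p\<bar>" by linarith
  qed
  finally show False using n lt1 by linarith
 qed
 moreover have "E Int G \<in> lmeasurable" using Em Gm(1) by (rule fmeasurable.Int)
 ultimately have "negligible (E Int G)" unfolding s_def by (intro negligible_iff_measure[THEN iffD2] conjI)
 moreover have "x \<in> {0<..<1}" using x unfolding E_def upper_slope_set_def by blast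
 then have "x \<in> E Int G" using x d by (auto simp: G_def)
 moreover have "openin (top_of_set E) (E Int G)" using G by (rule openin_open_Int)
 ultimately have "\<exists>U. openin (top_of_set E) U & x \<in> U & negligible U"
  by (intro exI[of _ "E Int G"] conjI)
 then show "\<exists>U. openin (top_of_set (\<Inter>n::nat. upper_slope_set f n)) U & x \<in> U & negligible U"
  by (simp only: E_def)
qed

text \<open>\<open>A\<close> collects the slopes exceeded in every neighbourhood of
  \<open>x\<close>. It is closed downwards, bounded because of \<open>up\<close> and nonempty
  because of \<open>dn\<close>, and its supremum is the derivative: slopes above \<open>L\<close>
  are eventually excluded by definition, slopes below \<open>L\<close> by the rational pairs in
  \<open>ne\<close>.\<close>

lemma differentiable_if_slopes_agree:
 assumes cont: "continuous_on {0..1} f" and x: "x \<in> {0<..<1}"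
  and ne: "!!p q. p \<in> \<rat> ==> q \<in> \<rat> ==> p < q ==> x ~: upper_slope_set f q Int upper_slope_set (%x. - f x) (- p)"
  and up: "x ~: upper_slope_set f (real n1)" and dn: "x ~: upper_slope_set (%x. - f x) (real n2)"
 shows "f differentiable (at x)"
proof -
 obtain \<rho> where \<rho>: "\<rho> > 0" "ball x \<rho> <= {0<..<1}"
  using x open_greaterThanLessThan[of 0 "1::real"] open_contains_ball by meson
 define A where "A = {q. x \<in> upper_slope_set f q}"
 have small: "\<exists>c r. 0 < r & r < d & x \<in> ball c r & ball c r <= {0<..<1}" if "d > 0" for d
 proof (intro exI conjI)
  let ?r = "min (d/2) (\<rho>/2)"
  show "0 < ?r" "?r < d" "x \<in> ball x ?r" using that \<rho> by auto
  have "ball x ?r <= ball x \<rho>" using \<rho> by (intro subset_ball) auto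
  then show "ball x ?r <= {0<..<1}" using \<rho> by blast
 qed
 have notin: "\<exists>d>0. \<forall>c r. 0 < r & r < d & x \<in> ball c r & ball c r <= {0<..<1} --> g (c+r) - g (c-r) <= q * (2*r)"
  if "x ~: upper_slope_set g q" for g q
 proof -
  have "\<not> (\<forall>d>0. \<exists>c r. 0 < r & r < d & x \<in> ball c r & ball c r <= {0<..<1} & q * (2*r) < g (c+r) - g (c-r))"
   using that x unfolding upper_slope_set_def by blast
  then show ?thesis by (meson not_less)
 qed
 have dc: "q' \<in> A" if "q \<in> A" "q' <= q" for q q'
 proof -
  have "\<exists>c r. 0 < r & r < d & x \<in> ball c r & ball c r <= {0<..<1} & q' * (2*r) < f (c+r) - f (c-r)" if d: "d > 0" for d
  proof -
   obtain c r where cr: "0 < r" "r < d" "x \<in> ball c r" "ball c r <= {0<..<1}" "q * (2*r) < f (c+r) - f (c-r)"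
    using \<open>q \<in> A\<close> d unfolding A_def upper_slope_set_def by blast
   have "q' * (2*r) <= q * (2*r)" using \<open>q' <= q\<close> cr by (intro mult_right_mono) auto
   then have "q' * (2*r) < f (c+r) - f (c-r)" using cr(5) by linarith
   then show ?thesis using cr(1-4) by blast
  qed
  then show ?thesis using x unfolding A_def upper_slope_set_def by blast
 qed
 have "real n1 ~: A" using up by (simp add: A_def)
 then have bdd: "bdd_above A" using dc by (intro bdd_aboveI[of _ "real n1"]) (meson linear)
 have nonempty: "A ~= {}"
 proof -
  obtain d where d: "d > 0" "!!c r. 0 < r ==> r < d ==> x \<in> ball c r ==> ball c r <= {0<..<1} ==> - f (c+r) - - f (c-r) <= real n2 * (2*r)"
   using notin[OF dn] by blast
  have "\<exists>c r. 0 < r & r < d' & x \<in> ball c r & ball c r <= {0<..<1} & - (real n2 + 1) * (2*r) < f (c+r) - f (c-r)" if "d' > 0" for d'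
  proof -
   obtain c r where cr: "0 < r" "r < min d d'" "x \<in> ball c r" "ball c r <= {0<..<1}"
    using small[of "min d d'"] d \<open>d' > 0\<close> by auto
   then have "- f (c+r) - - f (c-r) <= real n2 * (2*r)" using d(2)[of r c] by auto
   then show ?thesis using cr by - (rule exI[of _ c], rule exI[of _ r], auto simp: algebra_simps)
  qed
  then have "- (real n2 + 1) \<in> A" using x unfolding A_def upper_slope_set_def by blast
  then show ?thesis by blast
 qed
 define L where "L = Sup A"
 have slopes: "\<exists>d>0. \<forall>c r. 0 < r --> r < d --> x \<in> ball c r --> ball c r <= {0<..<1} --> \<bar>f (c+r) - f (c-r) - L * (2*r)\<bar> <= e * (2*r)"
  if e: "e > 0" for e
 proof -
  have "L + e ~: A" using cSup_upper[OF _ bdd, of "L + e"] e by (auto simp: L_def)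
  then obtain d1 where d1: "d1 > 0" "!!c r. 0 < r ==> r < d1 ==> x \<in> ball c r ==> ball c r <= {0<..<1} ==> f (c+r) - f (c-r) <= (L + e) * (2*r)"
   using notin[of f "L+e"] unfolding A_def by blast
  obtain q where q: "q \<in> \<rat>" "L - e/2 < q" "q < L"
   using Rats_dense_in_real[of "L - e/2" L] e by auto
  obtain a where a: "a \<in> A" "q < a" using less_cSupD[OF nonempty] q(3) by (auto simp: L_def)
  obtain p where p: "p \<in> \<rat>" "L - e < p" "p < q"
   using Rats_dense_in_real[of "L - e" q] e q by auto
  have "q \<in> A" using dc[OF a(1)] a(2) by simp
  then have "x ~: upper_slope_set (%x. - f x) (- p)" using ne[OF p(1) q(1) p(3)] by (auto simp: A_def)
  from notin[OF this] obtain d2 where d2: "d2 > 0" "!!c r. 0 < r ==> r < d2 ==> x \<in> ball c r ==> ball c r <= {0<..<1} ==> - f (c+r) - - f (c-r) <= - p * (2*r)"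
   by blast
  show ?thesis
  proof (intro exI[of _ "min d1 d2"] conjI allI impI)
   show "0 < min d1 d2" using d1 d2 by auto
   fix c r :: real assume cr: "0 < r" "r < min d1 d2" "x \<in> ball c r" "ball c r <= {0<..<1}"
   have "f (c+r) - f (c-r) <= (L + e) * (2*r)" using d1(2)[of r c] cr by auto
   moreover have "- f (c+r) - - f (c-r) <= - p * (2*r)" using d2(2)[of r c] cr by auto
   moreover have "(L - e) * (2*r) <= p * (2*r)" using p cr by (intro mult_right_mono) auto
   ultimately show "\<bar>f (c+r) - f (c-r) - L * (2*r)\<bar> <= e * (2*r)"
    by (simp add: algebra_simps abs_le_iff)
  qed
 qed
 have iso: "isCont f y" if "y \<in> {0<..<1}" for y
  using continuous_on_interior[OF cont, of y] that by simp
 \<comment> \<open>So far \<open>x\<close> lies in the interior of the intervals. An interval that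
   ends at \<open>x\<close> is enlarged by \<theta> on both sides, and continuity of
   \<open>f\<close> allows \<theta> to tend to 0.\<close>
 have seg: "\<exists>d>0. \<forall>u v. u < v --> x \<in> {u..v} --> v - u < d --> \<bar>f v - f u - L * (v - u)\<bar> <= e * (v - u)" if e: "e > 0" for e
 proof -
  obtain d where d: "d > 0" and D: "!!c r. 0 < r ==> r < d ==> x \<in> ball c r ==> ball c r <= {0<..<1} ==> \<bar>f (c+r) - f (c-r) - L * (2*r)\<bar> <= e * (2*r)"
   using slopes[OF e] by blast
  show ?thesis
  proof (intro exI[of _ "min d (\<rho>/2)"] conjI allI impI)
   show "0 < min d (\<rho>/2)" using d \<rho> by auto
   fix u v assume uv: "u < v" "x \<in> {u..v}" "v - u < min d (\<rho>/2)"
   have "u \<in> ball x \<rho>" "v \<in> ball x \<rho>" using uv by (auto simp: dist_real_def)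
   then have uv01: "u \<in> {0<..<1}" "v \<in> {0<..<1}" using \<rho>(2) by blast+
   have "((%\<theta>. e * ((v + \<theta>) - (u - \<theta>)) - \<bar>f (v + \<theta>) - f (u - \<theta>) - L * ((v + \<theta>) - (u - \<theta>))\<bar>) \<longlongrightarrow>
     e * (v - u) - \<bar>f v - f u - L * (v - u)\<bar>) (at_right 0)"
   proof -
    have "((%\<theta>. f (v + \<theta>)) \<longlongrightarrow> f v) (at_right 0)"
     by (rule isCont_tendsto_compose[OF iso[OF uv01(2)]]) (auto intro!: tendsto_eq_intros)
    moreover have "((%\<theta>. f (u - \<theta>)) \<longlongrightarrow> f u) (at_right 0)"
     by (rule isCont_tendsto_compose[OF iso[OF uv01(1)]]) (auto intro!: tendsto_eq_intros)
    ultimately show ?thesis by (auto intro!: tendsto_eq_intros)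
   qed
   moreover have "eventually (%\<theta>. 0 <= e * ((v + \<theta>) - (u - \<theta>)) - \<bar>f (v + \<theta>) - f (u - \<theta>) - L * ((v + \<theta>) - (u - \<theta>))\<bar>) (at_right 0)"
   proof -
    have ev: "eventually (%\<theta>. \<theta> \<in> {0<..<min (d/2) (\<rho>/4)}) (at_right 0)"
     using d \<rho> by (intro eventually_at_right_real) auto
    show ?thesis
     using ev
    proof eventually_elim
     case (elim \<theta>)
     let ?c = "(u + v)/2" and ?r = "(v - u)/2 + \<theta>"
     have "ball ?c ?r <= {0<..<1}"
     proof -
      have "y \<in> ball x \<rho>" if "y \<in> ball ?c ?r" for y
      proof -
       have "u - \<theta> < y" "y < v + \<theta>" using that by (auto simp: ball_eq_greaterThanLessThan field_simps)
       then show ?thesis using uv elim by (auto simp: dist_real_def)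
      qed
      then show ?thesis using \<rho> by blast
     qed
     moreover have "x \<in> ball ?c ?r" using uv elim by (auto simp: ball_eq_greaterThanLessThan field_simps)
     moreover have "0 < \<theta>" "\<theta> < d/2" "v - u < d" "u < v" using uv elim by auto
     then have "0 < ?r" and "?r < d" by (simp_all add: field_simps)
     ultimately have "\<bar>f (?c + ?r) - f (?c - ?r) - L * (2 * ?r)\<bar> <= e * (2 * ?r)" by (intro D)
     moreover have e1: "?c + ?r = v + \<theta>" and e2: "?c - ?r = u - \<theta>" and e3: "2 * ?r = (v + \<theta>) - (u - \<theta>)" by (auto simp: field_simps)
     ultimately have "\<bar>f (v + \<theta>) - f (u - \<theta>) - L * ((v + \<theta>) - (u - \<theta>))\<bar> <= e * ((v + \<theta>) - (u - \<theta>))"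
      unfolding e1 e2 e3 by blast
     then show ?case by linarith
    qed
   qed
   ultimately have "0 <= e * (v - u) - \<bar>f v - f u - L * (v - u)\<bar>"
    by (rule tendsto_lowerbound) simp
   then show "\<bar>f v - f u - L * (v - u)\<bar> <= e * (v - u)" by simp
  qed
 qed
 have "(f has_derivative (%t. L * t)) (at x)"
  unfolding has_derivative_at_alt
 proof (intro conjI allI impI)
  show "bounded_linear (%t. L * t)" by (rule bounded_linear_mult_right)
  fix e :: real assume "e > 0"
  from seg[OF this] obtain d where d: "d > 0" and D: "!!u v. u < v ==> x \<in> {u..v} ==> v - u < d ==> \<bar>f v - f u - L * (v - u)\<bar> <= e * (v - u)"
   by blast
  show "\<exists>d>0. \<forall>y. norm (y - x) < d --> norm (f y - f x - L * (y - x)) <= e * norm (y - x)"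
  proof (intro exI[of _ d] conjI d allI impI)
   fix y assume y: "norm (y - x) < d"
   consider "y = x" | "x < y" | "y < x" by linarith
   then show "norm (f y - f x - L * (y - x)) <= e * norm (y - x)"
   proof cases
    case 2 then show ?thesis using D[of x y] y by auto
   next
    case 3 then show ?thesis using D[of y x] y by (auto simp: algebra_simps abs_le_iff)
   qed auto
  qed
 qed
 then show ?thesis by (rule differentiableI)
qed

proposition absolutely_continuous_fun_on_differentiable_ae:
 assumes ac: "AC01 f"
 shows "negligible {x\<in>{0..1}. \<not> f differentiable (at x within {0..1})}"
proof -
 have acm: "AC01 (%x. - f x)"
  using ac unfolding absolutely_continuous_fun_on_def by (simp add: abs_minus_commute)
 let ?N = "{0, 1} Un (\<Union>(p,q)\<in>{(p,q). p \<in> \<rat> & q \<in> \<rat> & p < q}. upper_slope_set f q Int upper_slope_set (%x. - f x) (- p))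
  Un (\<Inter>n::nat. upper_slope_set f n) Un (\<Inter>n::nat. upper_slope_set (%x. - f x) n)"
 have "countable {(p,q). p \<in> (\<rat>::real set) & q \<in> \<rat> & p < q}"
  by (rule countable_subset[OF _ countable_SIGMA[OF countable_rat countable_rat]]) auto
 then have cu: "negligible (\<Union>(p,q)\<in>{(p,q). p \<in> \<rat> & q \<in> \<rat> & p < q}. upper_slope_set f q Int upper_slope_set (%x. - f x) (- p))"
  using negligible_distinct_slopes[OF ac] by (intro negligible_countable_Union countable_image) auto
 have "negligible ?N"
  by (intro negligible_Un cu negligible_infinite_slopes ac acm) simp
 moreover have "{x\<in>{0..1}. \<not> f differentiable (at x within {0..1})} <= ?N"
 proof
  fix x assume "x \<in> {x\<in>{0..1}. \<not> f differentiable (at x within {0..1})}"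
  then have x: "x \<in> {0..1}" and nd: "\<not> f differentiable (at x)"
   using differentiable_at_withinI by auto
  show "x \<in> ?N"
  proof (rule ccontr)
   assume n: "x ~: ?N"
   then have x01: "x \<in> {0<..<1}" using x by auto
   have "x ~: (\<Inter>n::nat. upper_slope_set f n)" "x ~: (\<Inter>n::nat. upper_slope_set (%x. - f x) n)"
    using n by simp_all
   then obtain n1 n2 :: nat where n12: "x ~: upper_slope_set f n1" "x ~: upper_slope_set (%x. - f x) n2"
    by auto
   have "x ~: upper_slope_set f q Int upper_slope_set (%x. - f x) (- p)" if "p \<in> \<rat>" "q \<in> \<rat>" "p < q" for p q
    using n that by auto
   then have "f differentiable (at x)"
    by (rule differentiable_if_slopes_agree[OF absolutely_continuous_fun_on_imp_continuous_on[OF ac] x01 _ n12])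
   then show False using nd by simp
  qed
 qed
 ultimately show ?thesis by (rule negligible_subset)
qed

text \<open>The Henstock--Kurzweil gauge is chosen so that tags in the exceptional null set only occur in
 intervals inside a small open set, where absolute continuity controls the increments.\<close>

theorem absolutely_continuous_fun_on_has_integral:
 assumes ac: "AC01 f" and ab: "0 <= a" "a <= b" "b <= 1"
 shows "((%x. vector_derivative f (at x within {0..1})) has_integral f b - f a) {a..b}"
proof -
 define N where "N = {x\<in>{0..1}. \<not> f differentiable (at x within {0..1})}"
 have N: "negligible N" unfolding N_def by (rule absolutely_continuous_fun_on_differentiable_ae[OF ac])
 \<comment> \<open>With the value 0 on \<open>N\<close>, a tag there contributes only the increment
   of \<open>f\<close> to the Riemann sum.\<close>
 define g where "g x = (if x \<in> N then 0 else vector_derivative f (at x within {0..1}))" for x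
 have gd: "(f has_vector_derivative g x) (at x within {0..1})" if "x \<in> {0..1}" "x ~: N" for x
  using that unfolding g_def N_def by (auto simp: vector_derivative_works[symmetric])
 have "(g has_integral f b - f a) (cbox a b)"
  unfolding has_integral
 proof (intro allI impI)
  fix e :: real assume e: "e > 0"
  define e' where "e' = e / (4 * (b - a + 1))"
  have e': "e' > 0" "e' * (b - a) < e/2"
  proof -
   show "e' > 0" using e ab by (simp add: e'_def)
   have "e * (b - a) <= e * (b - a + 1)" using e by (intro mult_left_mono) auto
   moreover have "e * (b - a + 1) > 0" using e ab by simp
   ultimately show "e' * (b - a) < e/2" using e ab unfolding e'_def by (simp add: field_simps)
  qed
  obtain d where d: "d > 0" and D: "!!I (a :: real \<times> real set => real) b. finite I ==> (!!i. i \<in> I ==> a i <= b i & {a i..b i} <= {0..1}) ==>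
   (!!i j. i \<in> I ==> j \<in> I ==> i ~= j ==> {a i<..<b i} Int {a j<..<b j} = {}) ==>
   (SUM i:I. b i - a i) < d ==> (SUM i:I. \<bar>f (b i) - f (a i)\<bar>) < e/2"
   by (fact absolutely_continuous_fun_onD_finite[OF ac half_gt_zero[OF e], where 'i="real \<times> real set"])
  obtain T where T: "open T" "N <= T" "T - N \<in> lmeasurable" "emeasure lebesgue (T - N) < ennreal d"
   by (rule sets_lebesgue_outer_open[OF negligible_imp_sets[OF N] d])
  have Tm: "T \<in> lmeasurable" "measure lebesgue T < d"
  proof -
   have Nm: "N \<in> lmeasurable" "measure lebesgue N = 0" using N negligible_imp_measurable negligible_imp_measure0 by blast+
   have eq: "T = N Un (T - N)" using T by auto
   show "T \<in> lmeasurable" using fmeasurable.Un[OF Nm(1) T(3)] eq by simp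
   have "measure lebesgue T <= measure lebesgue N + measure lebesgue (T - N)"
    using measure_Un_le[of N lebesgue "T - N"] Nm T(3) eq by auto
   also have "... < d" using Nm T(3,4) by (simp add: emeasure_eq_measure2 ennreal_less_iff)
   finally show "measure lebesgue T < d" .
  qed
  have "\<forall>x\<in>{0..1} - N. \<exists>r. r > 0 & (\<forall>y\<in>{0..1}. \<bar>y - x\<bar> < r --> \<bar>f y - f x - g x * (y - x)\<bar> <= e' * \<bar>y - x\<bar>)"
  proof
   fix x assume "x \<in> {0..1} - N"
   then have "(f has_vector_derivative g x) (at x within {0..1})" using gd by blast
   then show "\<exists>r. r > 0 & (\<forall>y\<in>{0..1}. \<bar>y - x\<bar> < r --> \<bar>f y - f x - g x * (y - x)\<bar> <= e' * \<bar>y - x\<bar>)"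
    using e'(1) unfolding has_vector_derivative_def has_derivative_within_alt real_norm_def
    by (simp add: mult.commute)
  qed
  then obtain \<rho> where "\<forall>x\<in>{0..1} - N. \<rho> x > 0 & (\<forall>y\<in>{0..1}. \<bar>y - x\<bar> < \<rho> x --> \<bar>f y - f x - g x * (y - x)\<bar> <= e' * \<bar>y - x\<bar>)"
   by (rule bchoice[THEN exE])
  then have \<rho>: "!!x. x \<in> {0..1} ==> x ~: N ==> \<rho> x > 0"
   "!!x y. x \<in> {0..1} ==> x ~: N ==> y \<in> {0..1} ==> \<bar>y - x\<bar> < \<rho> x ==> \<bar>f y - f x - g x * (y - x)\<bar> <= e' * \<bar>y - x\<bar>"
   by blast+
  define \<gamma> where "\<gamma> x = (if x \<in> N then T else if x \<in> {0..1} then ball x (\<rho> x) else UNIV)" for x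
  have gauge: "gauge \<gamma>" unfolding gauge_def \<gamma>_def using T \<rho> by auto
  have main: "norm ((\<Sum>(x, k)\<in>D. measure lborel k *\<^sub>R g x) - (f b - f a)) < e"
   if Dt: "D tagged_division_of cbox a b" and fine: "\<gamma> fine D" for D
  proof -
   have fin: "finite D" using Dt by auto
   have K: "snd i = {Inf (snd i)..Sup (snd i)} & (Inf (snd i) <= fst i & fst i <= Sup (snd i) & a <= Inf (snd i) & Sup (snd i) <= b) & measure lborel (snd i) = Sup (snd i) - Inf (snd i)"
    if "i \<in> D" for i
   proof -
    have i: "(fst i, snd i) \<in> D" using that by simp
    obtain u v where uv: "snd i = cbox u v" using tagged_division_ofD(4)[OF Dt i] by blast
    have x: "fst i \<in> snd i" "snd i <= cbox a b" using tagged_division_ofD(2,3)[OF Dt i] by auto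
    then have "u <= v" using uv by auto
    moreover from this have "Inf (snd i) = u" "Sup (snd i) = v" using uv by (auto simp: cbox_interval)
    ultimately show ?thesis using x uv ab that by (auto simp: cbox_interval)
   qed
   note K1 = K[THEN conjunct1] and K2 = K[THEN conjunct2, THEN conjunct1] and K3 = K[THEN conjunct2, THEN conjunct2]
   have tel: "f b - f a = (SUM i:D. f (Sup (snd i)) - f (Inf (snd i)))"
    using additive_tagged_division_1[OF ab(2), of D f] Dt by (simp add: cbox_interval case_prod_beta)
   have "(\<Sum>(x, k)\<in>D. measure lborel k *\<^sub>R g x) - (f b - f a) = (SUM i:D. measure lborel (snd i) * g (fst i) - (f (Sup (snd i)) - f (Inf (snd i))))"
    unfolding tel by (simp add: sum_subtractf case_prod_beta)
   also have "\<bar>...\<bar> <= (SUM i:D. \<bar>measure lborel (snd i) * g (fst i) - (f (Sup (snd i)) - f (Inf (snd i)))\<bar>)" by (rule sum_abs)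
   also have "... = (SUM i:{i\<in>D. fst i \<in> N}. \<bar>measure lborel (snd i) * g (fst i) - (f (Sup (snd i)) - f (Inf (snd i)))\<bar>)
    + (SUM i:{i\<in>D. fst i ~: N}. \<bar>measure lborel (snd i) * g (fst i) - (f (Sup (snd i)) - f (Inf (snd i)))\<bar>)"
    using fin by (subst sum.union_disjoint[symmetric]) (auto intro!: sum.cong)
   also have "(SUM i:{i\<in>D. fst i \<in> N}. \<bar>measure lborel (snd i) * g (fst i) - (f (Sup (snd i)) - f (Inf (snd i)))\<bar>)
    = (SUM i:{i\<in>D. fst i \<in> N}. \<bar>f (Sup (snd i)) - f (Inf (snd i))\<bar>)"
    by (rule sum.cong) (auto simp: g_def abs_minus_commute)
   also have "... < e/2"
   proof (rule D)
    show "finite {i\<in>D. fst i \<in> N}" using fin by auto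
    show "Inf (snd i) <= Sup (snd i) & {Inf (snd i)..Sup (snd i)} <= {0..1}" if "i \<in> {i\<in>D. fst i \<in> N}" for i
     using K2[of i] that ab by auto
    show dis: "{Inf (snd i)<..<Sup (snd i)} Int {Inf (snd j)<..<Sup (snd j)} = {}" if "i \<in> {i\<in>D. fst i \<in> N}" "j \<in> {i\<in>D. fst i \<in> N}" "i ~= j" for i j
    proof -
     have "interior (snd i) Int interior (snd j) = {}"
      using tagged_division_ofD(5)[OF Dt, of "fst i" "snd i" "fst j" "snd j"] that by auto
     moreover have "interior (snd i) = {Inf (snd i)<..<Sup (snd i)}" "interior (snd j) = {Inf (snd j)<..<Sup (snd j)}"
      using arg_cong[OF K1[of i], of interior] arg_cong[OF K1[of j], of interior] that by simp_all
     ultimately show ?thesis by simp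
    qed
    have "(SUM i:{i\<in>D. fst i \<in> N}. Sup (snd i) - Inf (snd i)) <= measure lebesgue T"
    proof (rule sum_interval_lengths_le_measure[OF _ _ dis Tm(1)])
     show "Inf (snd i) <= Sup (snd i) & {Inf (snd i)<..<Sup (snd i)} <= T" if "i \<in> {i\<in>D. fst i \<in> N}" for i
     proof -
      have "(fst i, snd i) \<in> D" using that by simp
      with fine have "snd i <= \<gamma> (fst i)" unfolding fine_def by blast
      then have "snd i <= T" using that by (simp add: \<gamma>_def)
      then have "{Inf (snd i)..Sup (snd i)} <= T" using K1[of i] that by simp
      moreover have "Inf (snd i) <= Sup (snd i)" using K2[of i] that by auto
      moreover have "{Inf (snd i)<..<Sup (snd i)} <= {Inf (snd i)..Sup (snd i)}" by auto
      ultimately show ?thesis by blast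
     qed
    qed (use fin in auto)
    then show "(SUM i:{i\<in>D. fst i \<in> N}. Sup (snd i) - Inf (snd i)) < d" using Tm by linarith
   qed
   also have "(SUM i:{i\<in>D. fst i ~: N}. \<bar>measure lborel (snd i) * g (fst i) - (f (Sup (snd i)) - f (Inf (snd i)))\<bar>) <= e' * (b - a)"
   proof -
    \<comment> \<open>The tag lies between the end points, so the linearization errors at
      \<open>u\<close> and \<open>v\<close> add up to e' times the length of the interval.\<close>
    have "\<bar>measure lborel (snd i) * g (fst i) - (f (Sup (snd i)) - f (Inf (snd i)))\<bar> <= e' * measure lborel (snd i)" if i: "i \<in> D" "fst i ~: N" for i
    proof -
     define u v x where "u = Inf (snd i)" and "v = Sup (snd i)" and "x = fst i"
     have Ki: "u <= x" "x <= v" "a <= u" "v <= b" and c: "measure lborel (snd i) = v - u" and eq: "snd i = {u..v}"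
      using K1[OF i(1)] K2[OF i(1)] K3[OF i(1)] unfolding u_def v_def x_def by blast+
     have x: "x \<in> {0..1}" "x ~: N" using Ki ab i by (auto simp: x_def)
     have "(fst i, snd i) \<in> D" using i by simp
     with fine have "snd i <= \<gamma> x" unfolding fine_def x_def by blast
     then have "{u..v} <= ball x (\<rho> x)" using x by (simp add: \<gamma>_def eq)
     moreover have "u \<in> {u..v}" "v \<in> {u..v}" using Ki by auto
     ultimately have "u \<in> ball x (\<rho> x)" "v \<in> ball x (\<rho> x)" by blast+
     then have "\<bar>u - x\<bar> < \<rho> x" "\<bar>v - x\<bar> < \<rho> x" by (auto simp: dist_real_def abs_minus_commute)
     moreover have "u \<in> {0..1}" "v \<in> {0..1}" using Ki ab by auto
     ultimately have "\<bar>f u - f x - g x * (u - x)\<bar> <= e' * \<bar>u - x\<bar>" "\<bar>f v - f x - g x * (v - x)\<bar> <= e' * \<bar>v - x\<bar>"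
      using \<rho>(2)[OF x] by blast+
     moreover have "measure lborel (snd i) * g x - (f v - f u) = (f u - f x - g x * (u - x)) - (f v - f x - g x * (v - x))"
      unfolding c by (simp add: algebra_simps)
     moreover have "e' * \<bar>u - x\<bar> + e' * \<bar>v - x\<bar> = e' * measure lborel (snd i)" using Ki unfolding c by (simp add: algebra_simps)
     ultimately have "\<bar>measure lborel (snd i) * g x - (f v - f u)\<bar> <= e' * measure lborel (snd i)" by linarith
     then show ?thesis unfolding u_def v_def x_def .
    qed
    then have "(SUM i:{i\<in>D. fst i ~: N}. \<bar>measure lborel (snd i) * g (fst i) - (f (Sup (snd i)) - f (Inf (snd i)))\<bar>) <= (SUM i:{i\<in>D. fst i ~: N}. e' * measure lborel (snd i))"
     by (intro sum_mono) auto
    also have "... <= (SUM i:D. e' * measure lborel (snd i))"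
     by (rule sum_mono2) (use fin e' in auto)
    also have "... = e' * (b - a)"
     using additive_content_tagged_division[OF Dt] ab by (simp add: sum_distrib_left[symmetric] case_prod_beta)
    finally show ?thesis .
   qed
   finally show ?thesis unfolding real_norm_def using e'(2) by linarith
  qed
  show "\<exists>\<gamma>. gauge \<gamma> & (\<forall>D. D tagged_division_of cbox a b & \<gamma> fine D --> norm ((\<Sum>(x, k)\<in>D. measure lborel k *\<^sub>R g x) - (f b - f a)) < e)"
   using gauge main by (intro exI[of _ \<gamma>] conjI allI impI) (assumption, elim conjE)
 qed
 then have "(g has_integral f b - f a) {a..b}" by (simp add: cbox_interval)
 then show ?thesis
  by (rule has_integral_spike[OF N, rotated]) (auto simp: g_def)
qed

section \<open>Interpolation inequalities in Sobolev spaces\<close>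

definition square_integrable01 :: "(real => real) => bool" where
 "square_integrable01 f \<longleftrightarrow> f \<in> borel_measurable leb01 & (%x. (f x)^2) integrable_on {0..1}"

lemma square_integrable01_product:
 assumes "square_integrable01 f" "square_integrable01 g"
 shows "(%x. f x * g x) absolutely_integrable_on {0..1}"
proof (rule measurable_bounded_by_integrable_imp_absolutely_integrable)
 show "(%x. f x * g x) \<in> borel_measurable leb01"
  using assms unfolding square_integrable01_def by (intro borel_measurable_times) blast+
 show "(%x. (f x)^2 + (g x)^2) integrable_on {0..1}"
  using assms unfolding square_integrable01_def by (intro integrable_add) blast+
 show "norm (f x * g x) <= (f x)^2 + (g x)^2" for x
 proof -
  have "2 * (\<bar>f x\<bar> * \<bar>g x\<bar>) <= \<bar>f x\<bar>^2 + \<bar>g x\<bar>^2" using sum_squares_bound[of "\<bar>f x\<bar>" "\<bar>g x\<bar>"] by simp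
  moreover have "0 <= \<bar>f x\<bar> * \<bar>g x\<bar>" by simp
  ultimately have "\<bar>f x\<bar> * \<bar>g x\<bar> <= (f x)^2 + (g x)^2" unfolding power2_abs by linarith
  then show ?thesis by (simp add: abs_mult)
 qed
qed simp

lemma square_integrable01_continuous:
 assumes "continuous_on {0..1} f" shows "square_integrable01 f"
 unfolding square_integrable01_def
 using assms by (intro conjI continuous_imp_measurable_on_sets_lebesgue integrable_continuous_interval continuous_intros) auto

lemma square_integrable01_abs_int:
 assumes "square_integrable01 f" shows "f absolutely_integrable_on {0..1}"
proof -
 have "square_integrable01 (%_. 1)" by (intro square_integrable01_continuous continuous_on_const)
 from square_integrable01_product[OF assms this] show ?thesis unfolding mult_1_right .
qed

lemma square_integrable01_subinterval:
 assumes "square_integrable01 f" "square_integrable01 g" "0 <= a" "b <= (1::real)"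
 shows "(%x. f x * g x) absolutely_integrable_on {a..b}" "(%x. (f x)^2) integrable_on {a..b}" "f absolutely_integrable_on {a..b}"
proof -
 have s: "{a..b} <= {0..1}" using assms by auto
 show "(%x. f x * g x) absolutely_integrable_on {a..b}"
  by (rule absolutely_integrable_on_subinterval[OF square_integrable01_product[OF assms(1,2)] s])
 show "f absolutely_integrable_on {a..b}"
  by (rule absolutely_integrable_on_subinterval[OF square_integrable01_abs_int[OF assms(1)] s])
 show "(%x. (f x)^2) integrable_on {a..b}"
  by (rule integrable_on_subinterval[OF assms(1)[unfolded square_integrable01_def, THEN conjunct2] s])
qed

lemma square_integrable01_Cauchy_Schwarz:
 assumes f: "square_integrable01 f" and g: "square_integrable01 g" and ab: "0 <= a" "b <= (1::real)"
 shows "(integral {a..b} (%x. \<bar>f x * g x\<bar>))^2 <= integral {a..b} (%x. (f x)^2) * integral {a..b} (%x. (g x)^2)"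
proof -
 let ?A = "integral {a..b} (%x. (f x)^2)" and ?B = "integral {a..b} (%x. (g x)^2)" and ?C = "integral {a..b} (%x. \<bar>f x * g x\<bar>)"
 have i: "(%x. (f x)^2) integrable_on {a..b}" "(%x. (g x)^2) integrable_on {a..b}" "(%x. \<bar>f x * g x\<bar>) integrable_on {a..b}"
  using square_integrable01_subinterval[OF f g ab] square_integrable01_subinterval[OF g f ab]
  by (auto simp: absolutely_integrable_on_def)
 have pos: "0 <= ?A * t^2 - 2 * ?C * t + ?B" for t
 proof -
  have "0 <= integral {a..b} (%x. t^2 * (f x)^2 - 2 * t * \<bar>f x * g x\<bar> + (g x)^2)"
  proof (rule integral_nonneg)
   show "(%x. t^2 * (f x)^2 - 2 * t * \<bar>f x * g x\<bar> + (g x)^2) integrable_on {a..b}"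
    using i by (intro integrable_add integrable_diff integrable_on_mult_right)
   fix x
   have "0 <= (t * \<bar>f x\<bar> - \<bar>g x\<bar>)^2" by simp
   also have "... = t^2 * (f x)^2 - 2 * t * \<bar>f x * g x\<bar> + (g x)^2"
    by (simp add: power2_diff power_mult_distrib abs_mult)
   finally show "0 <= t^2 * (f x)^2 - 2 * t * \<bar>f x * g x\<bar> + (g x)^2" .
  qed
  also have "... = t^2 * ?A - 2 * t * ?C + ?B"
   using i by (simp add: integral_add integral_diff integrable_diff integrable_on_mult_right)
  finally show ?thesis by (simp add: mult.commute mult.left_commute)
 qed
 have A: "?A >= 0" and B: "?B >= 0" and C: "?C >= 0" using i by (auto intro!: integral_nonneg)
 show ?thesis
 proof (cases "?A = 0")
  case True
  have "?C = 0"
  proof (rule ccontr)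
   assume "?C ~= 0"
   then show False using pos[of "(?B + 1) / (2 * ?C)"] True by (simp add: field_simps)
  qed
  then show ?thesis using True by simp
 next
  case False
  then have "0 < ?A" using A by linarith
  then show ?thesis using pos[of "?C / ?A"] by (simp add: power2_eq_square field_simps)
 qed
qed

lemma absolutely_continuous_fun_on_Lipschitz:
 assumes "!!x y. x \<in> S ==> y \<in> S ==> \<bar>f x - f y\<bar> <= K * \<bar>x - y\<bar>"
 shows "absolutely_continuous_fun_on S f"
 unfolding absolutely_continuous_fun_on_def
proof (intro allI impI)
 fix e :: real assume e: "e > 0"
 define K' where "K' = \<bar>K\<bar> + 1"
 have K': "K' > 0" "K <= K'" by (auto simp: K'_def)
 show "\<exists>d>0. \<forall>(N::nat) a b. (\<forall>i<N. a i <= b i & {a i..b i} <= S) -->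
    (\<forall>i<N. \<forall>j<N. i ~= j --> {a i<..<b i} Int {a j<..<b j} = {}) -->
    (SUM i<N. b i - a i) < d --> (SUM i<N. \<bar>f (b i) - f (a i)\<bar>) < e"
 proof (intro exI[of _ "e / K'"] conjI allI impI)
  show "0 < e / K'" using e K' by simp
  fix N :: nat and a b :: "nat => real"
  assume ab: "\<forall>i<N. a i <= b i & {a i..b i} <= S" and s: "(SUM i<N. b i - a i) < e / K'"
  have "(SUM i<N. \<bar>f (b i) - f (a i)\<bar>) <= (SUM i<N. K' * (b i - a i))"
  proof (rule sum_mono)
   fix i assume "i \<in> {..<N}"
   then have i: "a i <= b i" "{a i..b i} <= S" using ab by auto
   then have "a i \<in> S" "b i \<in> S" by auto
   then have "\<bar>f (b i) - f (a i)\<bar> <= K * \<bar>b i - a i\<bar>" using assms by blast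
   also have "... <= K' * (b i - a i)" using i K' by (simp add: mult_right_mono)
   finally show "\<bar>f (b i) - f (a i)\<bar> <= K' * (b i - a i)" .
  qed
  also have "... = K' * (SUM i<N. b i - a i)" by (rule sum_distrib_left[symmetric])
  also have "... < e" using s K'(1) by (simp only: pos_less_divide_eq mult.commute)
  finally show "(SUM i<N. \<bar>f (b i) - f (a i)\<bar>) < e" .
 qed
qed

lemma absolutely_continuous_fun_on_mult:
 assumes f: "AC01 f" and g: "AC01 g"
 shows "AC01 (%x. f x * g x)"
proof -
 have cf: "continuous_on {0..1} f" and cg: "continuous_on {0..1} g"
  using f g by (auto intro: absolutely_continuous_fun_on_imp_continuous_on)
 have "bounded (f ` {0..1})" "bounded (g ` {0..1})"
  using cf cg by (auto intro!: compact_imp_bounded compact_continuous_image)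
 then obtain K1 K2 where K: "!!x. x \<in> {0..1} ==> \<bar>f x\<bar> <= K1" "!!x. x \<in> {0..1} ==> \<bar>g x\<bar> <= K2"
  unfolding bounded_iff by (metis imageI real_norm_def)
 define K where "K = \<bar>K1\<bar> + \<bar>K2\<bar> + 1"
 have KK: "K > 0" "!!x. x \<in> {0..1} ==> \<bar>f x\<bar> <= K" "!!x. x \<in> {0..1} ==> \<bar>g x\<bar> <= K"
  using K by (fastforce simp: K_def)+
 show ?thesis
  unfolding absolutely_continuous_fun_on_def
 proof (intro allI impI)
  fix e :: real assume e: "e > 0"
  define e' where "e' = e / (2 * K)"
  have e': "e' > 0" using e KK by (simp add: e'_def)
  obtain d1 where d1: "d1 > 0" "\<forall>(N::nat) a b. (\<forall>i<N. a i <= b i & {a i..b i} <= {0..1}) -->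
    (\<forall>i<N. \<forall>j<N. i ~= j --> {a i<..<b i} Int {a j<..<b j} = {}) -->
    (SUM i<N. b i - a i) < d1 --> (SUM i<N. \<bar>f (b i) - f (a i)\<bar>) < e'"
   using f e' unfolding absolutely_continuous_fun_on_def by blast
  obtain d2 where d2: "d2 > 0" "\<forall>(N::nat) a b. (\<forall>i<N. a i <= b i & {a i..b i} <= {0..1}) -->
    (\<forall>i<N. \<forall>j<N. i ~= j --> {a i<..<b i} Int {a j<..<b j} = {}) -->
    (SUM i<N. b i - a i) < d2 --> (SUM i<N. \<bar>g (b i) - g (a i)\<bar>) < e'"
   using g e' unfolding absolutely_continuous_fun_on_def by blast
  show "\<exists>d>0. \<forall>(N::nat) a b. (\<forall>i<N. a i <= b i & {a i..b i} <= {0..1}) -->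
    (\<forall>i<N. \<forall>j<N. i ~= j --> {a i<..<b i} Int {a j<..<b j} = {}) -->
    (SUM i<N. b i - a i) < d --> (SUM i<N. \<bar>f (b i) * g (b i) - f (a i) * g (a i)\<bar>) < e"
  proof (intro exI[of _ "min d1 d2"] conjI allI impI)
   show "0 < min d1 d2" using d1 d2 by simp
   fix N :: nat and a b :: "nat => real"
   assume ab: "\<forall>i<N. a i <= b i & {a i..b i} <= {0..1}"
    and dis: "\<forall>i<N. \<forall>j<N. i ~= j --> {a i<..<b i} Int {a j<..<b j} = {}"
    and s: "(SUM i<N. b i - a i) < min d1 d2"
   have "(SUM i<N. \<bar>f (b i) * g (b i) - f (a i) * g (a i)\<bar>) <= (SUM i<N. K * \<bar>f (b i) - f (a i)\<bar> + K * \<bar>g (b i) - g (a i)\<bar>)"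
   proof (rule sum_mono)
    fix i assume "i \<in> {..<N}"
    then have i: "a i \<in> {0..1}" "b i \<in> {0..1}" using ab by auto
    have "f (b i) * g (b i) - f (a i) * g (a i) = g (b i) * (f (b i) - f (a i)) + f (a i) * (g (b i) - g (a i))"
     by (simp add: algebra_simps)
    also have "\<bar>...\<bar> <= \<bar>g (b i)\<bar> * \<bar>f (b i) - f (a i)\<bar> + \<bar>f (a i)\<bar> * \<bar>g (b i) - g (a i)\<bar>"
     by (simp add: abs_mult[symmetric] abs_triangle_ineq)
    also have "... <= K * \<bar>f (b i) - f (a i)\<bar> + K * \<bar>g (b i) - g (a i)\<bar>"
     using KK(2)[OF i(1)] KK(3)[OF i(2)] by (intro add_mono mult_right_mono) auto
    finally show "\<bar>f (b i) * g (b i) - f (a i) * g (a i)\<bar> <= K * \<bar>f (b i) - f (a i)\<bar> + K * \<bar>g (b i) - g (a i)\<bar>" .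
   qed
   also have "... = K * (SUM i<N. \<bar>f (b i) - f (a i)\<bar>) + K * (SUM i<N. \<bar>g (b i) - g (a i)\<bar>)"
    by (simp add: sum.distrib sum_distrib_left)
   also have "... < K * e' + K * e'"
   proof -
    have "(SUM i<N. \<bar>f (b i) - f (a i)\<bar>) < e'" using d1(2)[rule_format, of N a b] ab dis s by simp
    moreover have "(SUM i<N. \<bar>g (b i) - g (a i)\<bar>) < e'" using d2(2)[rule_format, of N a b] ab dis s by simp
    ultimately show ?thesis using KK(1) by (intro add_strict_mono mult_strict_left_mono)
   qed
   also have "... = e" using KK(1) by (simp add: e'_def)
   finally show "(SUM i<N. \<bar>f (b i) * g (b i) - f (a i) * g (a i)\<bar>) < e" .
  qed
 qed
qed

section \<open>Sobolev functions and their derivatives\<close>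

lemma deriv01_0 [simp]: "deriv01 0 f = f"
 by (simp add: deriv01_def)

lemma deriv01_Suc: "deriv01 (Suc k) f = (%x. vector_derivative (deriv01 k f) (at x within {0..1}))"
 by (simp add: deriv01_def)

lemma deriv01_Suc_shift: "deriv01 (Suc k) f = deriv01 k (deriv01 1 f)"
 unfolding deriv01_def by (simp add: funpow_Suc_right del: funpow.simps) 

lemma deriv01_deriv: "deriv01 k f differentiable (at x within {0..1}) ==> (deriv01 k f has_vector_derivative deriv01 (Suc k) f x) (at x within {0..1})"
 unfolding deriv01_Suc by (simp add: vector_derivative_works)

lemma sobolev2_deriv:
 assumes "f \<in> sobolev2 m" "Suc k < m" "x \<in> {0..1}"
 shows "(deriv01 k f has_vector_derivative deriv01 (Suc k) f x) (at x within {0..1})"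
 using assms by (intro deriv01_deriv) (auto simp: sobolev2_def differentiable_on_def)

lemma sobolev2_continuous:
 assumes "f \<in> sobolev2 m" "k < m"
 shows "continuous_on {0..1} (deriv01 k f)"
proof (cases "Suc k < m")
 case True
 then show ?thesis using assms by (intro differentiable_imp_continuous_on) (auto simp: sobolev2_def)
next
 case False
 then have "k = m - 1" using assms by auto
 then show ?thesis using assms by (simp add: sobolev2_def)
qed

text \<open>Below the top order the next derivative is continuous, hence bounded, and the mean value
  inequality gives a Lipschitz bound; at the top order the claim is part of the definition.\<close>

lemma sobolev2_absolutely_continuous:
 assumes f: "f \<in> sobolev2 m" "k < m"
 shows "AC01 (deriv01 k f)"
proof (cases "Suc k < m")
 case True
 have "bounded (deriv01 (Suc k) f ` {0..1})"
  using sobolev2_continuous[OF f(1) True] by (auto intro!: compact_imp_bounded compact_continuous_image)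
 then obtain K where K: "!!x. x \<in> {0..1} ==> \<bar>deriv01 (Suc k) f x\<bar> <= K"
  unfolding bounded_iff by (metis imageI real_norm_def)
 show ?thesis
 proof (rule absolutely_continuous_fun_on_Lipschitz)
  fix x y :: real assume xy: "x \<in> {0..1}" "y \<in> {0..1}"
  have "norm (deriv01 k f x - deriv01 k f y) <= K * norm (x - y)"
   by (rule field_differentiable_bound[of "{0..1}" _ "deriv01 (Suc k) f"])
    (use sobolev2_deriv[OF f(1) True] K xy in \<open>auto simp: has_real_derivative_iff_has_vector_derivative\<close>)
  then show "\<bar>deriv01 k f x - deriv01 k f y\<bar> <= K * \<bar>x - y\<bar>" by simp
 qed
next
 case False
 then have "k = m - 1" using assms by auto
 then show ?thesis using assms(1) unfolding \<open>k = m - 1\<close> sobolev2_def by blast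
qed

lemma sobolev2_has_integral:
 assumes "f \<in> sobolev2 m" "k < m" "0 <= a" "a <= b" "b <= 1"
 shows "(deriv01 (Suc k) f has_integral deriv01 k f b - deriv01 k f a) {a..b}"
 unfolding deriv01_Suc
 by (rule absolutely_continuous_fun_on_has_integral[OF sobolev2_absolutely_continuous[OF assms(1,2)] assms(3-5)])

lemma sobolev2_square_integrable:
 assumes "f \<in> sobolev2 m" "k <= m"
 shows "square_integrable01 (deriv01 k f)"
proof (cases "k < m")
 case True
 then show ?thesis using sobolev2_continuous[OF assms(1)] square_integrable01_continuous by blast
next
 case False
 then have "k = m" using assms by simp
 then show ?thesis using assms integrable_on_lebesgue_on[of "{0..1}" "%x. (deriv01 m f x)^2"]
  unfolding square_integrable01_def sobolev2_def by auto
qed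

lemma sobolev2_deriv01:
 assumes "f \<in> sobolev2 (Suc m)" "m >= 1"
 shows "deriv01 1 f \<in> sobolev2 m"
proof -
 have "deriv01 k (deriv01 1 f) differentiable_on {0..1}" if "k < m - 1" for k
  using assms that unfolding deriv01_Suc_shift[symmetric] sobolev2_def by auto
 moreover have "deriv01 (m - 1) (deriv01 1 f) = deriv01 m f"
  using assms deriv01_Suc_shift[of "m-1" f] by simp
 ultimately show ?thesis
  using assms unfolding sobolev2_def by (auto simp: deriv01_Suc_shift[symmetric, unfolded One_nat_def])
qed

lemma sobolev2_increment_sq:
 assumes f: "f \<in> sobolev2 m" "k < m" and ab: "0 <= a" "a <= b" "b <= 1"
 shows "(deriv01 k f b - deriv01 k f a)^2 <= (b - a) * integral {a..b} (%x. (deriv01 (Suc k) f x)^2)"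
proof -
 let ?g = "deriv01 (Suc k) f"
 have g: "square_integrable01 ?g" using sobolev2_square_integrable[OF f(1)] f(2) by simp
 have one: "square_integrable01 (%_. 1)" by (intro square_integrable01_continuous continuous_on_const)
 have eq: "deriv01 k f b - deriv01 k f a = integral {a..b} ?g"
  using sobolev2_has_integral[OF f ab] by (simp add: integral_unique)
 have "\<bar>integral {a..b} ?g\<bar> <= integral {a..b} (%x. \<bar>?g x * 1\<bar>)"
  using integral_norm_bound_integral[of ?g "{a..b}" "%x. \<bar>?g x * 1\<bar>"] square_integrable01_subinterval(3)[OF g g ab(1,3)]
  by (auto simp: absolutely_integrable_on_def)
 then have "(integral {a..b} ?g)^2 <= (integral {a..b} (%x. \<bar>?g x * 1\<bar>))^2"
  by (metis abs_ge_zero power2_abs power_mono)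
 also have "... <= integral {a..b} (%x. (?g x)^2) * integral {a..b} (%x. 1^2)"
  by (rule square_integrable01_Cauchy_Schwarz[OF g one ab(1,3)])
 also have "integral {a..b} (%x. (1::real)^2) = b - a" using ab by simp
 finally show ?thesis unfolding eq by (simp add: mult.commute)
qed

section \<open>Interpolation between a function and its highest derivative\<close>

lemma integral_mono_set01:
 fixes g :: "real => real"
 assumes "g integrable_on {0..1}" "!!x. x \<in> {0..1} ==> 0 <= g x" "0 <= a" "b <= 1"
 shows "integral {a..b} g <= integral {0..1} g"
proof -
 have "{a..b} <= {0..1}" using assms(3,4) by auto
 then show ?thesis using assms(1,2) integrable_on_subinterval[OF assms(1)] by (intro integral_subset_le) auto
qed

text \<open>The integrals of \<open>G\<close> and of its translate differ only on strips of length
  \<open>d\<close> at the two ends; the right one contributes at most \<open>d * G 1\<close>, the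
  left one is nonnegative. With \<open>G\<close> an indefinite integral this bounds an average of
  local energies by \<open>d\<close> times the total energy.\<close>

lemma integral_shifted_increment:
 fixes G :: "real => real"
 assumes G: "continuous_on {0..1} G" and mono: "!!x y. 0 <= x ==> x <= y ==> y <= 1 ==> G x <= G y"
 and d: "0 < d" "d <= 1/2" and G0: "0 <= G 0" and c: "0 <= c" "c + 1/2 + d <= 1"
 shows "(%x. G (x + d) - G x) integrable_on {c..c+1/2}" "integral {c..c+1/2} (%x. G (x + d) - G x) <= d * G 1"
proof -
 have i: "G integrable_on {u..v}" if "0 <= u" "v <= 1" for u v
  using that by (intro integrable_continuous_interval continuous_on_subset[OF G]) auto
 have sh: "((%x. G (x + d)) has_integral integral {c+d..c+1/2+d} G) {c..c+1/2}"
  using has_integral_shift_real_ivl[OF integrable_integral[OF i[of "c+d" "c+1/2+d"]], of d] c d by simp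
 have h: "((%x. G (x + d) - G x) has_integral integral {c+d..c+1/2+d} G - integral {c..c+1/2} G) {c..c+1/2}"
  using sh integrable_integral[OF i[of c "c+1/2"]] c d by (intro has_integral_diff) auto
 then show "(%x. G (x + d) - G x) integrable_on {c..c+1/2}" by blast
 have e1: "integral {c+d..c+1/2} G + integral {c+1/2..c+1/2+d} G = integral {c+d..c+1/2+d} G"
  using c d by (intro Henstock_Kurzweil_Integration.integral_combine i) auto
 have e2: "integral {c..c+d} G + integral {c+d..c+1/2} G = integral {c..c+1/2} G"
  using c d by (intro Henstock_Kurzweil_Integration.integral_combine i) auto
 have "integral {c+1/2..c+1/2+d} G <= integral {c+1/2..c+1/2+d} (%_. G 1)"
  using c d by (intro integral_le i) (auto intro!: mono)
 also have "... = d * G 1" using d by simp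
 finally have u: "integral {c+1/2..c+1/2+d} G <= d * G 1" .
 have "0 <= integral {c..c+d} G"
 proof (rule integral_nonneg)
  show "G integrable_on {c..c+d}" using c d by (intro i) auto
  fix x assume x: "x \<in> {c..c+d}"
  have "G 0 <= G x" using x c d by (intro mono) auto
  then show "0 <= G x" using G0 by simp
 qed
 then show "integral {c..c+1/2} (%x. G (x + d) - G x) <= d * G 1"
  using integral_unique[OF h] e1 e2 u by linarith
qed

text \<open>On each half of the unit interval the derivative is compared with a difference quotient whose
 step points into the interval; both halves are treated by the same argument with steps of sign s.\<close>

lemma sobolev2_interpolation_order2:
 assumes f: "f \<in> sobolev2 m" "2 <= m" and d: "0 < d" "d <= 1/2"
 shows "dnorm2 1 f <=
  16 / d^2 * int01 (%x. (f x)^2) + 4 * d^2 * dnorm2 2 f"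
proof -
 let ?f1 = "deriv01 1 f" and ?f2 = "deriv01 2 f"
 have cf: "continuous_on {0..1} f" using sobolev2_continuous[OF f(1), of 0] f(2) by simp
 have c1: "continuous_on {0..1} ?f1" using sobolev2_continuous[OF f(1), of 1] f(2) by simp
 have s2: "square_integrable01 ?f2" using sobolev2_square_integrable[OF f(1), of 2] f(2) by simp
 define G where "G x = integral {0..x} (%x. (?f2 x)^2)" for x
 have i2: "(%x. (?f2 x)^2) integrable_on {a..b}" if "0 <= a" "b <= 1" for a b
  using square_integrable01_subinterval(2)[OF s2 s2 that] .
 have Gd: "integral {a..b} (%x. (?f2 x)^2) = G b - G a" if "0 <= a" "a <= b" "b <= 1" for a b
  using Henstock_Kurzweil_Integration.integral_combine[OF that(1,2) i2[of 0 b]] that by (simp add: G_def)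
 have Gpos: "0 <= integral {a..b} (%x. (?f2 x)^2)" if "0 <= a" "b <= 1" for a b
  using i2[OF that] by (intro integral_nonneg) auto
 have Gc: "continuous_on {0..1} G" unfolding G_def
  by (rule indefinite_integral_continuous_1[OF i2]) auto
 have Gm: "G x <= G y" if "0 <= x" "x <= y" "y <= 1" for x y
  using Gd[OF that] Gpos[of x y] that by linarith
 have G0: "G 0 = 0" by (simp add: G_def)
 \<comment> \<open>The mean value theorem gives a point of \<open>{a..a+d}\<close> where the
   derivative equals the difference quotient, and the energy of \<open>?f2\<close> on that interval
   controls the change of \<open>?f1\<close> from there to \<open>x\<close>.\<close>
 have loc: "(?f1 x)^2 <= 4 / d^2 * ((f a)^2 + (f (a + d))^2) + 2 * d * (G (a + d) - G a)"
  if a: "0 <= a" "a + d <= 1" "x \<in> {a..a+d}" for a x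
 proof -
  have "\<exists>\<xi>\<in>{a<..<a+d}. f (a + d) - f a = (a + d - a) *\<^sub>R ?f1 \<xi>"
  proof (rule mvt_simple)
   show "a < a + d" using d by simp
   fix y assume y: "a <= y" "y <= a + d"
   have "(f has_vector_derivative ?f1 y) (at y within {0..1})"
    using sobolev2_deriv[OF f(1), of 0 y] f(2) y a by simp
   then have "(f has_vector_derivative ?f1 y) (at y within {a..a+d})"
    by (rule has_vector_derivative_within_subset) (use a in auto)
   then show "(f has_derivative (%h. h *\<^sub>R ?f1 y)) (at y within {a..a+d})"
    by (simp add: has_vector_derivative_def)
  qed
  then obtain \<xi> where \<xi>: "\<xi> \<in> {a<..<a+d}" "f (a + d) - f a = d * ?f1 \<xi>" by auto
  have inc: "(?f1 x - ?f1 \<xi>)^2 <= d * (G (a + d) - G a)"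
  proof -
   let ?u = "min x \<xi>" and ?v = "max x \<xi>"
   have uv: "0 <= ?u" "?u <= ?v" "?v <= 1" "a <= ?u" "?v <= a + d" using a \<xi> by auto
   have "(?f1 x - ?f1 \<xi>)^2 = (?f1 ?v - ?f1 ?u)^2" by (auto simp: min_def max_def power2_commute)
   also have "... <= (?v - ?u) * integral {?u..?v} (%x. (?f2 x)^2)"
    using sobolev2_increment_sq[OF f(1), of 1 ?u ?v] f(2) uv by (simp add: numeral_2_eq_2)
   also have "... <= d * (G (a + d) - G a)"
   proof (rule mult_mono)
    have "G ?v <= G (a + d)" "G a <= G ?u" using uv a by (auto intro!: Gm)
    then show "integral {?u..?v} (%x. (?f2 x)^2) <= G (a + d) - G a" using Gd[OF uv(1-3)] by linarith
   qed (use uv Gpos[OF uv(1,3)] d in auto)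
   finally show ?thesis .
  qed
  have "(?f1 x)^2 <= 2 * (?f1 \<xi>)^2 + 2 * (?f1 x - ?f1 \<xi>)^2"
   using zero_le_power2[of "2 * ?f1 \<xi> - ?f1 x"] by (simp add: power2_eq_square algebra_simps)
  moreover have "(?f1 \<xi>)^2 <= 2 / d^2 * ((f a)^2 + (f (a + d))^2)"
  proof -
   have "(?f1 \<xi>)^2 = (f (a + d) - f a)^2 / d^2" using \<xi>(2) d by (simp add: power_mult_distrib)
   also have "(f (a + d) - f a)^2 <= 2 * ((f a)^2 + (f (a + d))^2)"
    using zero_le_power2[of "f (a + d) + f a"] by (simp add: power2_eq_square algebra_simps)
   finally show ?thesis using d by (simp add: divide_right_mono)
  qed
  ultimately show ?thesis using inc by (simp add: algebra_simps)
 qed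
 let ?F = "int01 (%x. (f x)^2)"
 have if2: "(%x. (f x)^2) integrable_on {u..v}" if "0 <= u" "v <= 1" for u v
  using that by (intro integrable_continuous_interval continuous_intros continuous_on_subset[OF cf]) auto
 have if1: "(%x. (?f1 x)^2) integrable_on {u..v}" if "0 <= u" "v <= 1" for u v
  using that by (intro integrable_continuous_interval continuous_intros continuous_on_subset[OF c1]) auto
 have sub: "integral {u..v} (%x. (f x)^2) <= ?F" if "0 <= u" "v <= 1" for u v
  by (rule integral_mono_set01) (use that if2 in auto)
 have shf: "((%x. (f (x + s))^2) has_integral integral {u+s..v+s} (%x. (f x)^2)) {u..v}"
  if "0 <= u + s" "v + s <= 1" for u v s
  using has_integral_shift_real_ivl[OF integrable_integral[OF if2[OF that]], of s] by simp
 define R where "R = (%x. 4 / d^2 * ((f x)^2 + (f (x + d))^2) + 2 * d * (G (x + d) - G x))"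
 have half: "integral {c..c+1/2} R <= 8 / d^2 * ?F + 2 * d^2 * G 1 & R integrable_on {c..c+1/2}"
  if c: "0 <= c" "c + 1/2 + d <= 1" for c
 proof -
  have h1: "((%x. (f x)^2) has_integral integral {c..c+1/2} (%x. (f x)^2)) {c..c+1/2}"
   using c d by (intro integrable_integral if2) auto
  have h2: "((%x. (f (x + d))^2) has_integral integral {c+d..c+1/2+d} (%x. (f x)^2)) {c..c+1/2}"
   using c d by (intro shf) auto
  note G = integral_shifted_increment[OF Gc Gm d eq_refl[OF G0[symmetric]] c]
  have h: "(R has_integral 4 / d^2 * (integral {c..c+1/2} (%x. (f x)^2) + integral {c+d..c+1/2+d} (%x. (f x)^2))
    + 2 * d * integral {c..c+1/2} (%x. G (x + d) - G x)) {c..c+1/2}"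
   unfolding R_def using h1 h2 integrable_integral[OF G(1)] by (intro has_integral_add has_integral_mult_right)
  have "4 / d^2 * (integral {c..c+1/2} (%x. (f x)^2) + integral {c+d..c+1/2+d} (%x. (f x)^2)) <= 4 / d^2 * (?F + ?F)"
   using c d by (intro mult_left_mono add_mono sub) auto
  moreover have "2 * d * integral {c..c+1/2} (%x. G (x + d) - G x) <= 2 * d * (d * G 1)"
   using G(2) d by (intro mult_left_mono) auto
  ultimately show ?thesis using h integral_unique[OF h] by (auto simp: power2_eq_square)
 qed
 have l: "integral {0..1/2} (%x. (?f1 x)^2) <= 8 / d^2 * ?F + 2 * d^2 * G 1"
 proof -
  have "integral {0..1/2} (%x. (?f1 x)^2) <= integral {0..1/2} R"
   using half[of 0] d by (intro integral_le if1) (use loc d in \<open>auto simp: R_def\<close>)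
  then show ?thesis using half[of 0] d by simp
 qed
 \<comment> \<open>For \<open>x\<close> in the right half the interval is the one that ends at
   \<open>x\<close>, so the majorant \<open>R\<close> is translated by \<open>d\<close>.\<close>
 have r: "integral {1/2..1} (%x. (?f1 x)^2) <= 8 / d^2 * ?F + 2 * d^2 * G 1"
 proof -
  have h: "(R has_integral integral {1/2-d..1-d} R) {1/2-d..1-d}"
   using half[of "1/2-d"] d by (intro integrable_integral) auto
  have h': "((%x. R (x - d)) has_integral integral {1/2-d..1-d} R) {1/2..1}"
   using has_integral_shift_real_ivl[OF h, of "-d"] by simp
  have "integral {1/2..1} (%x. (?f1 x)^2) <= integral {1/2..1} (%x. R (x - d))"
  proof (rule integral_le)
   show "(%x. R (x - d)) integrable_on {1/2..1}" using h' by blast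
   fix x :: real assume "x \<in> {1/2..1}"
   then show "(?f1 x)^2 <= R (x - d)" using d loc[of "x - d" x] by (auto simp: R_def)
  qed (use if1 in auto)
  then show ?thesis using half[of "1/2-d"] d integral_unique[OF h'] by simp
 qed
 have "int01 (%x. (?f1 x)^2) = integral {0..1/2} (%x. (?f1 x)^2) + integral {1/2..1} (%x. (?f1 x)^2)"
  by (rule Henstock_Kurzweil_Integration.integral_combine[symmetric]) (use if1 in auto)
 moreover have "int01 (%x. (?f2 x)^2) = G 1" by (simp add: G_def)
 ultimately show ?thesis using l r by simp
qed

text \<open>Induction on \<open>m\<close>. The hypothesis applied to the derivative bounds the
  second derivative by the first and the highest one, at step \<open>d\<close>. The inequality of
  order 2 at the shorter step \<theta> d then puts the first derivative on the right with a
  coefficient of at most 1/2, where it is absorbed.\<close>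

lemma sobolev2_interpolation:
 assumes "m >= 1"
 shows "\<exists>C>0. \<forall>f\<in>sobolev2 m. \<forall>d. 0 < d --> d <= 1 -->
  dnorm2 1 f <=
   C * (int01 (%x. (f x)^2) / d^2 + d ^ (2 * m) / d^2 * dnorm2 m f)"
 using assms
proof (induction m rule: nat_induct_at_least)
 case base
 show ?case
 proof (intro exI[of _ 1] conjI ballI allI impI)
  fix f :: "real => real" and d :: real assume f: "f \<in> sobolev2 1" and d: "0 < d" "d <= 1"
  have "0 <= int01 (%x. (f x)^2)"
   using sobolev2_square_integrable[OF f, of 0] by (intro integral_nonneg) (auto simp: square_integrable01_def)
  then show "dnorm2 1 f <=
   1 * (int01 (%x. (f x)^2) / d^2 + d ^ (2 * 1) / d^2 * dnorm2 1 f)"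
   using d by simp
 qed simp
next
 case (Suc m)
 then obtain C where C: "C > 0" and IH: "!!f d. f \<in> sobolev2 m ==> 0 < d ==> d <= 1 ==>
  dnorm2 1 f <=
   C * (int01 (%x. (f x)^2) / d^2 + d ^ (2 * m) / d^2 * dnorm2 m f)"
  by blast
 \<comment> \<open>Small enough for \<open>4 * \<theta>^2 * C <= 1/2\<close>, the coefficient to be
   absorbed.\<close>
 define \<theta> where "\<theta> = 1 / (2 * (1 + 2 * C))"
 have \<theta>: "0 < \<theta>" "\<theta> <= 1/2" using C by (auto simp: \<theta>_def field_simps)
 have \<theta>C: "4 * \<theta>^2 * C <= 1/2"
 proof -
  have "2 * C <= (1 + 2 * C)^2" using C by (simp add: power2_eq_square algebra_simps)
  then have "C / (1 + 2 * C)^2 <= 1/2" using C by (simp add: pos_divide_le_eq)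
  moreover have "4 * \<theta>^2 * C = C / (1 + 2 * C)^2"
   unfolding \<theta>_def power_divide power_mult_distrib by simp
  ultimately show ?thesis by simp
 qed
 show ?case
 proof (intro exI[of _ "32 / \<theta>^2 + 1"] conjI ballI allI impI)
  show "0 < 32 / \<theta>^2 + 1" using \<theta> by (simp add: add_pos_pos)
  fix f :: "real => real" and d :: real assume f: "f \<in> sobolev2 (Suc m)" and d: "0 < d" "d <= 1"
  define A where "A = int01 (%x. (f x)^2)"
  define B where "B = dnorm2 1 f"
  define D where "D = dnorm2 2 f"
  define E where "E = int01 (%x. (deriv01 (Suc m) f x)^2)"
  have nn: "0 <= A" "0 <= B" "0 <= E"
   using sobolev2_square_integrable[OF f, of 0] sobolev2_square_integrable[OF f, of 1] sobolev2_square_integrable[OF f, of "Suc m"] Suc(1)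
   unfolding A_def B_def E_def by (auto intro!: integral_nonneg simp: square_integrable01_def)
  have "D <= C * (B / d^2 + d ^ (2 * m) / d^2 * E)"
   using IH[OF sobolev2_deriv01[OF f Suc(1)] d] unfolding deriv01_Suc_shift[symmetric] Suc_1 B_def D_def E_def .
  then have D: "4 * (\<theta> * d)^2 * D <= 4 * (\<theta> * d)^2 * (C * (B / d^2 + d ^ (2 * m) / d^2 * E))"
   by (intro mult_left_mono) auto
  also have "... = 4 * \<theta>^2 * C * (B + d ^ (2 * m) * E)"
   using d by (simp add: power_mult_distrib field_simps)
  also have "... <= 1/2 * (B + d ^ (2 * m) * E)"
   using \<theta>C nn d by (intro mult_right_mono) auto
  finally have D: "4 * (\<theta> * d)^2 * D <= 1/2 * (B + d ^ (2 * m) * E)" .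
  have B1: "B <= 16 / (\<theta> * d)^2 * A + 4 * (\<theta> * d)^2 * D"
   unfolding A_def B_def D_def
  proof (rule sobolev2_interpolation_order2[OF f])
   show "0 < \<theta> * d" using \<theta> d by simp
   have "\<theta> * d <= 1/2 * 1" using \<theta> d by (intro mult_mono) auto
   then show "\<theta> * d <= 1/2" by simp
  qed (use Suc(1) in simp)
  have B2: "32 / \<theta>^2 * (A / d^2) = 2 * (16 / (\<theta> * d)^2 * A)" by (simp add: power_mult_distrib)
  have "B <= 32 / \<theta>^2 * (A / d^2) + d ^ (2 * m) * E"
  proof -
   have "b <= k2 + z" if "b <= k1 + y" "k2 = 2 * k1" "y <= 1/2 * (b + z)" for b k1 k2 y z :: real
    using that by (auto simp: field_simps)
   from this[OF B1 B2 D] show ?thesis .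
  qed
  also have "d ^ (2 * m) * E = d ^ (2 * Suc m) / d^2 * E" using d by (simp add: power2_eq_square)
  also have "32 / \<theta>^2 * (A / d^2) + d ^ (2 * Suc m) / d^2 * E <= (32 / \<theta>^2 + 1) * (A / d^2 + d ^ (2 * Suc m) / d^2 * E)"
  proof -
   have "K * P + Q <= (K + 1) * (P + Q)" if "0 <= K" "0 <= P" "0 <= Q" for K P Q :: real
    using that by (simp add: algebra_simps)
   then show ?thesis by this (use nn d in auto)
  qed
  finally show "dnorm2 1 f <= (32 / \<theta>^2 + 1) *
   (int01 (%x. (f x)^2) / d^2 + d ^ (2 * Suc m) / d^2 * int01 (%x. (deriv01 (Suc m) f x)^2))"
   unfolding A_def B_def E_def .
 qed
qed

text \<open>The squared norm of \<open>inner_wmh\<close> for the weight 1.\<close>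

definition energy01 :: "nat => real => (real => real) => real" where
 "energy01 m h f = int01 (%x. (f x)^2) + h ^ (2 * m) * dnorm2 m f"

lemma sobolev2_integral_sq_nonneg:
 assumes "f \<in> sobolev2 m" "k <= m"
 shows "0 <= dnorm2 k f"
 using sobolev2_square_integrable[OF assms] by (intro integral_nonneg) (auto simp: square_integrable01_def)

lemma energy01_nonneg: "f \<in> sobolev2 m ==> 0 <= h ==> 0 <= energy01 m h f"
 unfolding energy01_def using sobolev2_integral_sq_nonneg[of f m 0] sobolev2_integral_sq_nonneg[of f m m] by simp

lemma integral_sq_le_energy01: "f \<in> sobolev2 m ==> 0 <= h ==> int01 (%x. (f x)^2) <= energy01 m h f"
 unfolding energy01_def using sobolev2_integral_sq_nonneg[of f m m] by simp

lemma deriv_le_energy01: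
 assumes "m >= 1"
 obtains C where "C >= 1" "!!f h. f \<in> sobolev2 m ==> 0 < h ==> h <= 1 ==>
  h^2 * dnorm2 1 f <= C * energy01 m h f"
proof -
 obtain C where C: "C > 0" "!!f d. f \<in> sobolev2 m ==> 0 < d ==> d <= 1 ==>
  dnorm2 1 f <=
   C * (int01 (%x. (f x)^2) / d^2 + d ^ (2 * m) / d^2 * dnorm2 m f)"
  using sobolev2_interpolation[OF assms] by blast
 show ?thesis
 proof (rule that[of "C + 1"])
  fix f and h :: real assume f: "f \<in> sobolev2 m" and h: "0 < h" "h <= 1"
  have "h^2 * dnorm2 1 f <= h^2 * (C * (int01 (%x. (f x)^2) / h^2 + h ^ (2 * m) / h^2 * dnorm2 m f))"
   using C(2)[OF f h] by (intro mult_left_mono) auto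
  also have "... = C * energy01 m h f" using h by (simp add: energy01_def field_simps)
  also have "... <= (C + 1) * energy01 m h f"
   using energy01_nonneg[OF f, of h] h by (intro mult_right_mono) auto
  finally show "h^2 * dnorm2 1 f <= (C + 1) * energy01 m h f" .
 qed (use C in simp)
qed

lemma integral_ge_min:
 fixes g :: "real => real"
 assumes g: "continuous_on {a..b} g" and ab: "a <= b"
 obtains s where "s \<in> {a..b}" "(b - a) * g s <= integral {a..b} g"
proof -
 obtain s where s: "s \<in> {a..b}" "!!y. y \<in> {a..b} ==> g s <= g y"
  using continuous_attains_inf[of "{a..b}" g] g ab by auto
 have "(b - a) * g s = integral {a..b} (%_. g s)" using ab by simp
 also have "... <= integral {a..b} g"
  using s g by (intro integral_le integrable_continuous_interval) auto
 finally show ?thesis using s that by blast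
qed

text \<open>In a window of length \<open>h\<close> containing \<open>t\<close> some value of f^2 is
  at most its average, and the change from there to \<open>t\<close> is controlled by the
  interpolation inequality at step \<open>h\<close>. Applied to the reproducing kernel this will
  yield its energy of order 1/h.\<close>

lemma sobolev2_pointwise_bound:
 assumes "m >= 1"
 obtains C where "C >= 1" "!!f h t. f \<in> sobolev2 m ==> 0 < h ==> h <= 1 ==> t \<in> {0..1} ==>
  (f t)^2 <= C / h * energy01 m h f"
proof -
 obtain C where C: "C >= 1" "!!f h. f \<in> sobolev2 m ==> 0 < h ==> h <= 1 ==>
  h^2 * dnorm2 1 f <= C * energy01 m h f"
  using deriv_le_energy01[OF assms] by blast
 show ?thesis
 proof (rule that[of "2 + 2 * C"])
  fix f and h t :: real assume f: "f \<in> sobolev2 m" and h: "0 < h" "h <= 1" and t: "t \<in> {0..1}"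
  \<comment> \<open>Left end of a window of length \<open>h\<close> that contains \<open>t\<close>
    and does not leave the unit interval at the right.\<close>
  define a where "a = min t (1 - h)"
  have a: "0 <= a" "a + h <= 1" "t \<in> {a..a+h}" using h t by (auto simp: a_def)
  have cf: "continuous_on {0..1} f" using sobolev2_continuous[OF f, of 0] assms by simp
  have "continuous_on {a..a+h} (%x. (f x)^2)" using a by (intro continuous_intros continuous_on_subset[OF cf]) auto
  moreover have "a <= a + h" using h by simp
  ultimately obtain s where s: "s \<in> {a..a+h}" "(a + h - a) * (f s)^2 <= integral {a..a+h} (%x. (f x)^2)"
   by (rule integral_ge_min)
  have sq0: "square_integrable01 f" using sobolev2_square_integrable[OF f, of 0] by simp
  have sq1: "square_integrable01 (deriv01 1 f)" using sobolev2_square_integrable[OF f, of 1] assms by simp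
  have "integral {a..a+h} (%x. (f x)^2) <= int01 (%x. (f x)^2)"
   by (rule integral_mono_set01) (use a sq0 in \<open>auto simp: square_integrable01_def\<close>)
  then have fs: "h * (f s)^2 <= energy01 m h f" using s(2) integral_sq_le_energy01[OF f, of h] h by simp
  let ?u = "min s t" and ?v = "max s t"
  have uv: "0 <= ?u" "?u <= ?v" "?v <= 1" "?v - ?u <= h" using s t a by auto
  have "(f t - f s)^2 = (f ?v - f ?u)^2" by (auto simp: min_def max_def power2_commute)
  also have "... <= (?v - ?u) * integral {?u..?v} (%x. (deriv01 1 f x)^2)"
   using sobolev2_increment_sq[OF f, of 0 ?u ?v] uv assms by simp
  also have "... <= h * dnorm2 1 f"
  proof (rule mult_mono[OF uv(4)])
   show "integral {?u..?v} (%x. (deriv01 1 f x)^2) <= dnorm2 1 f"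
    by (rule integral_mono_set01) (use uv sq1 in \<open>auto simp: square_integrable01_def\<close>)
   show "0 <= integral {?u..?v} (%x. (deriv01 1 f x)^2)"
    using square_integrable01_subinterval(2)[OF sq1 sq1 uv(1,3)] by (intro integral_nonneg) auto
  qed (use h in auto)
  finally have "h * (f t - f s)^2 <= h^2 * dnorm2 1 f"
   using h by (simp add: power2_eq_square mult.assoc mult_left_mono)
  also have "... <= C * energy01 m h f" by (rule C(2)[OF f h])
  finally have d: "h * (f t - f s)^2 <= C * energy01 m h f" .
  have "(f t)^2 <= 2 * (f s)^2 + 2 * (f t - f s)^2"
   using zero_le_power2[of "2 * f s - f t"] by (simp add: power2_eq_square algebra_simps)
  then have "h * (f t)^2 <= h * (2 * (f s)^2 + 2 * (f t - f s)^2)" using h by (intro mult_left_mono) auto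
  also have "... <= (2 + 2 * C) * energy01 m h f" using fs d by (simp add: algebra_simps)
  finally show "(f t)^2 <= (2 + 2 * C) / h * energy01 m h f" using h by (simp add: field_simps)
 qed (use C in simp)
qed

section \<open>Integration by parts and Taylor's formula\<close>

lemma absolutely_continuous_fun_on_product_has_integral:
 assumes f: "AC01 f" and g: "AC01 g"
  and N: "negligible N"
  and f': "!!x. x \<in> {0..1} ==> x ~: N ==> (f has_vector_derivative f' x) (at x within {0..1})"
  and g': "!!x. x \<in> {0..1} ==> x ~: N ==> (g has_vector_derivative g' x) (at x within {0..1})"
  and ab: "0 <= a" "a <= b" "b <= (1::real)"
 shows "((%x. f' x * g x + f x * g' x) has_integral f b * g b - f a * g a) {a..b}"
proof (rule has_integral_spike[OF N _ absolutely_continuous_fun_on_has_integral[OF absolutely_continuous_fun_on_mult[OF f g] ab]])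
 fix x assume "x \<in> {a..b} - N"
 then have x: "x \<in> {0..1}" "x ~: N" using ab by auto
 have "((%x. f x * g x) has_vector_derivative (f x * g' x + f' x * g x)) (at x within {0..1})"
  by (rule has_vector_derivative_mult[OF f'[OF x] g'[OF x]])
 then show "f' x * g x + f x * g' x = vector_derivative (%x. f x * g x) (at x within {0..1})"
  using vector_derivative_within_closed_interval[of 0 1 x "%x. f x * g x"] x(1) by (simp add: add.commute)
qed

lemma sobolev2_deriv_ae:
 assumes f: "f \<in> sobolev2 m" "k < m"
 obtains N where "negligible N" "!!x. x \<in> {0..1} ==> x ~: N ==> (deriv01 k f has_vector_derivative deriv01 (Suc k) f x) (at x within {0..1})"
proof (rule that[OF absolutely_continuous_fun_on_differentiable_ae[OF sobolev2_absolutely_continuous[OF f]]])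
 fix x :: real assume "x \<in> {0..1}" "x ~: {x\<in>{0..1}. \<not> deriv01 k f differentiable (at x within {0..1})}"
 then show "(deriv01 k f has_vector_derivative deriv01 (Suc k) f x) (at x within {0..1})"
  by (intro deriv01_deriv) auto
qed

text \<open>Integration by parts against \<open>u\<close>, which vanishes at \<open>X\<close>, so
  each step contributes exactly the boundary term of the next Taylor coefficient at 0. It is done
  for absolutely continuous factors, hence the remainder may carry the derivative of order m, which
  is a genuine derivative only almost everywhere.\<close>

lemma sobolev2_Taylor:
 assumes f: "f \<in> sobolev2 m" and j: "j < m" and X: "X \<in> {0..1}"
 shows "((%x. (X - x) ^ j / fact j * deriv01 (Suc j) f x) has_integral
     f X - (SUM k<=j. deriv01 k f 0 * X ^ k / fact k)) {0..X}"
 using j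
proof (induction j)
 case 0
 then show ?case using sobolev2_has_integral[OF f, of 0 0 X] X by simp
next
 case (Suc j)
 define u where "u x = (X - x) ^ Suc j / fact (Suc j)" for x :: real
 have u': "(u has_vector_derivative - ((X - x) ^ j / fact j)) (at x within S)" for x S
  unfolding u_def has_real_derivative_iff_has_vector_derivative[symmetric]
  by (rule derivative_eq_intros refl | simp)+
 have uac: "AC01 u"
 proof (rule absolutely_continuous_fun_on_Lipschitz)
  fix x y :: real assume xy: "x \<in> {0..1}" "y \<in> {0..1}"
  have "norm (u x - u y) <= 1 * norm (x - y)"
  proof (rule field_differentiable_bound[of "{0..1}" u "%x. - ((X - x) ^ j / fact j)"])
   fix z :: real assume z: "z \<in> {0..1}"
   show "(u has_field_derivative - ((X - z) ^ j / fact j)) (at z within {0..1})"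
    using u' by (simp add: has_real_derivative_iff_has_vector_derivative)
   have "\<bar>X - z\<bar> ^ j <= 1" using X z by (intro power_le_one) auto
   moreover have "(1::real) <= fact j" by (rule fact_ge_1)
   ultimately have "\<bar>X - z\<bar> ^ j <= fact j" by linarith
   then show "norm (- ((X - z) ^ j / fact j)) <= 1" by (simp add: power_abs)
  qed (use xy in auto)
  then show "\<bar>u x - u y\<bar> <= 1 * \<bar>x - y\<bar>" by simp
 qed
 obtain N where N: "negligible N" "!!x. x \<in> {0..1} ==> x ~: N ==> (deriv01 (Suc j) f has_vector_derivative deriv01 (Suc (Suc j)) f x) (at x within {0..1})"
  using sobolev2_deriv_ae[OF f Suc.prems] by blast
 have "((%x. - ((X - x) ^ j / fact j) * deriv01 (Suc j) f x + u x * deriv01 (Suc (Suc j)) f x) has_integral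
   u X * deriv01 (Suc j) f X - u 0 * deriv01 (Suc j) f 0) {0..X}"
  by (rule absolutely_continuous_fun_on_product_has_integral[OF uac sobolev2_absolutely_continuous[OF f Suc.prems] N(1) u' N(2)]) (use X in auto)
 from has_integral_add[OF this Suc.IH] Suc.prems
 have "((%x. u x * deriv01 (Suc (Suc j)) f x) has_integral
   (u X * deriv01 (Suc j) f X - u 0 * deriv01 (Suc j) f 0) + (f X - (SUM k<=j. deriv01 k f 0 * X ^ k / fact k))) {0..X}"
  by simp
 moreover have "u X = 0" "u 0 = X ^ Suc j / fact (Suc j)" by (auto simp: u_def)
 ultimately show ?case unfolding u_def by (simp add: algebra_simps)
qed

section \<open>Weighted discrepancies\<close>

text \<open>\<open>q\<close> is only bounded and measurable, but its indefinite integral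
  \<open>Q\<close> is Lipschitz. The defect \<open>H\<close> of the formula has increments of order
  (y - x) (P y - P x), where \<open>P\<close> is the continuous variation function of
  \<open>p\<close>. This is o(y - x), so \<open>H\<close> has derivative 0 at every point and is
  constant.\<close>

lemma indefinite_integral_by_parts:
 fixes p p' q :: "real => real"
 assumes p': "p' absolutely_integrable_on {0..1}"
  and p: "!!x y. 0 <= x ==> x <= y ==> y <= 1 ==> (p' has_integral p y - p x) {x..y}"
  and q: "q \<in> borel_measurable leb01" "!!x. x \<in> {0..1} ==> \<bar>q x\<bar> <= K"
  and ab: "0 <= a" "a <= b" "b <= 1"
 shows "((%x. q x * p x) has_integral p b * integral {a..b} q - integral {a..b} (%s. integral {a..s} q * p' s)) {a..b}"
  "(%s. integral {a..s} q * p' s) integrable_on {a..b}"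
proof -
 have K: "0 <= K" using q(2)[of 0] by simp
 have sub: "p' absolutely_integrable_on {x..y}" if "0 <= x" "y <= 1" for x y
  by (rule absolutely_integrable_on_subinterval[OF p']) (use that in auto)
 have pc: "continuous_on {0..1} p"
 proof -
  have "continuous_on {0..1} (%x. integral {0..x} p')"
   using sub[of 0 1] by (intro indefinite_integral_continuous_1) (auto simp: absolutely_integrable_on_def)
  then have "continuous_on {0..1} (%x. p 0 + integral {0..x} p')" by (intro continuous_intros)
  then show ?thesis by (rule continuous_on_eq) (use integral_unique[OF p[of 0]] in auto)
 qed
 have qi: "q absolutely_integrable_on {0..1}"
  by (rule measurable_bounded_by_integrable_imp_absolutely_integrable[of _ _ "%_. K"]) (use q in auto)
 have qs: "q absolutely_integrable_on {x..y}" if "0 <= x" "y <= 1" for x y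
  by (rule absolutely_integrable_on_subinterval[OF qi]) (use that in auto)
 define Q where "Q x = integral {a..x} q" for x
 have Qadd: "Q y - Q x = integral {x..y} q" if "a <= x" "x <= y" "y <= 1" for x y
  using Henstock_Kurzweil_Integration.integral_combine[of a x y q] qs[of a y] that ab
  by (simp add: Q_def absolutely_integrable_on_def)
 have Qb: "\<bar>Q y - Q x\<bar> <= K * (y - x)" if "a <= x" "x <= y" "y <= 1" for x y
 proof -
  have "norm (integral {x..y} q) <= integral {x..y} (%_. K)"
   using qs[of x y] that ab q(2) by (intro integral_norm_bound_integral) (auto simp: absolutely_integrable_on_def)
  then show ?thesis using Qadd[OF that] that by (simp add: mult.commute)
 qed
 have Qc: "continuous_on {a..b} Q" unfolding Q_def
  using qs[of a b] ab by (intro indefinite_integral_continuous_1) (auto simp: absolutely_integrable_on_def)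
 have Qp: "(%s. Q s * p' s) absolutely_integrable_on {a..b}"
 proof (rule absolutely_integrable_bounded_measurable_product_real)
  show "Q \<in> borel_measurable (lebesgue_on {a..b})"
   by (rule continuous_imp_measurable_on_sets_lebesgue[OF Qc]) simp
  show "bounded (Q ` {a..b})" using Qc by (intro compact_imp_bounded compact_continuous_image) auto
 qed (use sub ab in auto)
 then show "(%s. integral {a..s} q * p' s) integrable_on {a..b}" by (simp add: Q_def absolutely_integrable_on_def)
 have pq: "(%x. p x * q x) absolutely_integrable_on {a..b}"
 proof (rule absolutely_integrable_bounded_measurable_product_real)
  have c: "continuous_on {a..b} p" by (rule continuous_on_subset[OF pc]) (use ab in auto)
  show "p \<in> borel_measurable (lebesgue_on {a..b})"
   by (rule continuous_imp_measurable_on_sets_lebesgue[OF c]) simp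
  show "bounded (p ` {a..b})" using c by (intro compact_imp_bounded compact_continuous_image) auto
 qed (use qs ab in auto)
 define g where "g x = p x * q x + Q x * p' x" for x
 have g: "g integrable_on {a..b}" unfolding g_def
  using pq Qp by (intro integrable_add) (auto simp: absolutely_integrable_on_def)
 define H where "H x = integral {a..x} g - Q x * p x" for x
 define P where "P x = integral {a..x} (%s. \<bar>p' s\<bar>)" for x
 have Pi: "(%s. \<bar>p' s\<bar>) integrable_on {x..y}" if "0 <= x" "y <= 1" for x y
  using sub[OF that] by (simp add: absolutely_integrable_on_def)
 have Padd: "P y - P x = integral {x..y} (%s. \<bar>p' s\<bar>)" if "a <= x" "x <= y" "y <= b" for x y
  using Henstock_Kurzweil_Integration.integral_combine[of a x y "%s. \<bar>p' s\<bar>"] Pi[of a y] that ab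
  by (simp add: P_def)
 have Pc: "continuous_on {a..b} P" unfolding P_def
  using Pi[of a b] ab by (intro indefinite_integral_continuous_1) auto
 have Hinc: "\<bar>H y - H x\<bar> <= 2 * K * (y - x) * (P y - P x)" if xy: "a <= x" "x <= y" "y <= b" for x y
 proof -
  have y1: "y <= 1" "0 <= x" using xy ab by auto
  have gi: "g integrable_on {x..y}" by (rule integrable_on_subinterval[OF g]) (use xy in auto)
  have e1: "integral {a..y} g - integral {a..x} g = integral {x..y} g"
   using Henstock_Kurzweil_Integration.integral_combine[of a x y g] integrable_on_subinterval[OF g, of a y] xy by auto
  have e2: "Q y * p y - Q x * p x = p y * (Q y - Q x) + Q x * (p y - p x)" by (simp add: algebra_simps)
  have e3: "integral {x..y} g - (p y * (Q y - Q x) + Q x * (p y - p x)) = H y - H x"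
   unfolding H_def using e1 e2 by linarith
  have h1: "(q has_integral Q y - Q x) {x..y}"
   using Qadd[OF xy(1,2) y1(1)] qs[OF y1(2,1)] by (simp add: absolutely_integrable_on_def integrable_integral)
  have h2: "(p' has_integral p y - p x) {x..y}" by (rule p) (use xy ab in auto)
  have "((%s. g s - (p y * q s + Q x * p' s)) has_integral integral {x..y} g - (p y * (Q y - Q x) + Q x * (p y - p x))) {x..y}"
   by (intro has_integral_diff has_integral_add has_integral_mult_right h1 h2 integrable_integral gi)
  then have hh: "((%s. g s - (p y * q s + Q x * p' s)) has_integral H y - H x) {x..y}"
   unfolding e3 .
  have "norm (H y - H x) <= integral {x..y} (%s. K * (P y - P x) + K * (y - x) * \<bar>p' s\<bar>)"
   unfolding integral_unique[OF hh, symmetric]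
  proof (rule integral_norm_bound_integral)
   show "(%s. g s - (p y * q s + Q x * p' s)) integrable_on {x..y}" using hh by blast
   show "(%s. K * (P y - P x) + K * (y - x) * \<bar>p' s\<bar>) integrable_on {x..y}"
    using Pi[OF y1(2,1)] by (intro integrable_add integrable_on_mult_right integrable_const_ivl)
   fix s assume s: "s \<in> {x..y}"
   have ps: "\<bar>p s - p y\<bar> <= P y - P x"
   proof -
    have "(p' has_integral p y - p s) {s..y}" by (rule p) (use s xy ab in auto)
    then have "\<bar>p y - p s\<bar> = norm (integral {s..y} p')" by (simp add: integral_unique)
    also have "... <= integral {s..y} (%s. \<bar>p' s\<bar>)"
     using sub[of s y] Pi[of s y] s y1 by (intro integral_norm_bound_integral) (auto simp: absolutely_integrable_on_def)
    also have "... <= integral {x..y} (%s. \<bar>p' s\<bar>)"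
     using s y1 Pi[of s y] Pi[of x y] by (intro integral_subset_le) auto
    finally show ?thesis using Padd[OF xy] by (simp add: abs_minus_commute)
   qed
   have "\<bar>q s\<bar> * \<bar>p s - p y\<bar> <= K * (P y - P x)"
    using ps q(2)[of s] s y1 K by (intro mult_mono) auto
   moreover have "\<bar>Q s - Q x\<bar> * \<bar>p' s\<bar> <= K * (y - x) * \<bar>p' s\<bar>"
   proof (rule mult_right_mono)
    have "\<bar>Q s - Q x\<bar> <= K * (s - x)" using Qb[of x s] s xy y1 by auto
    also have "... <= K * (y - x)" using s K by (intro mult_left_mono) auto
    finally show "\<bar>Q s - Q x\<bar> <= K * (y - x)" .
   qed simp
   moreover have "g s - (p y * q s + Q x * p' s) = q s * (p s - p y) + (Q s - Q x) * p' s"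
    by (simp add: g_def algebra_simps)
   ultimately show "norm (g s - (p y * q s + Q x * p' s)) <= K * (P y - P x) + K * (y - x) * \<bar>p' s\<bar>"
    using abs_triangle_ineq[of "q s * (p s - p y)" "(Q s - Q x) * p' s"] by (simp add: abs_mult)
  qed
  also have "... = K * (P y - P x) * (y - x) + K * (y - x) * (P y - P x)"
  proof -
   have "((%s. \<bar>p' s\<bar>) has_integral P y - P x) {x..y}"
    unfolding Padd[OF xy] by (rule integrable_integral[OF Pi[OF y1(2,1)]])
   then have "((%s. K * (P y - P x) + K * (y - x) * \<bar>p' s\<bar>) has_integral
     measure lborel {x..y} *\<^sub>R (K * (P y - P x)) + K * (y - x) * (P y - P x)) {x..y}"
    by (intro has_integral_add has_integral_mult_right has_integral_const_real)
   then show ?thesis using xy by (simp add: integral_unique)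
  qed
  finally show ?thesis by (simp add: algebra_simps)
 qed
 have "\<exists>c. \<forall>x\<in>{a..b}. H x = c"
 proof (rule has_derivative_zero_constant)
  fix x assume x: "x \<in> {a..b}"
  show "(H has_derivative (%h. 0)) (at x within {a..b})"
   unfolding has_derivative_within_alt
  proof (intro conjI allI impI)
   fix e :: real assume e: "e > 0"
   have "e / (2 * K + 1) > 0" using e K by simp
   then obtain d where d: "d > 0" "!!y. y \<in> {a..b} ==> dist y x < d ==> dist (P y) (P x) < e / (2 * K + 1)"
    using Pc x unfolding continuous_on_iff by metis
   show "\<exists>d>0. \<forall>y\<in>{a..b}. norm (y - x) < d --> norm (H y - H x - 0) <= e * norm (y - x)"
   proof (intro exI[of _ d] conjI d ballI impI)
    fix y assume y: "y \<in> {a..b}" "norm (y - x) < d"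
    have dP: "\<bar>P y - P x\<bar> < e / (2 * K + 1)" using d(2)[OF y(1)] y(2) by (simp add: dist_real_def)
    have "\<bar>H y - H x\<bar> <= 2 * K * \<bar>y - x\<bar> * \<bar>P y - P x\<bar>"
    proof (cases "x <= y")
     case True
     have "\<bar>H y - H x\<bar> <= 2 * K * (y - x) * (P y - P x)" using Hinc[of x y] True x y by auto
     also have "... <= 2 * K * (y - x) * \<bar>P y - P x\<bar>" using True K by (intro mult_left_mono) auto
     finally show ?thesis using True by simp
    next
     case False
     have "\<bar>H x - H y\<bar> <= 2 * K * (x - y) * (P x - P y)" using Hinc[of y x] False x y by auto
     also have "... <= 2 * K * (x - y) * \<bar>P x - P y\<bar>" using False K by (intro mult_left_mono) auto
     finally show ?thesis using False by (simp add: abs_minus_commute)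
    qed
    also have "... = (2 * K * \<bar>P y - P x\<bar>) * \<bar>y - x\<bar>" by simp
    also have "... <= e * \<bar>y - x\<bar>"
    proof (rule mult_right_mono)
     have "2 * K * \<bar>P y - P x\<bar> <= (2 * K + 1) * \<bar>P y - P x\<bar>" by (simp add: algebra_simps)
     also have "... <= (2 * K + 1) * (e / (2 * K + 1))" using dP K by (intro mult_left_mono) auto
     also have "... = e" using K by simp
     finally show "2 * K * \<bar>P y - P x\<bar> <= e" .
    qed simp
    finally show "norm (H y - H x - 0) <= e * norm (y - x)" by simp
   qed
  qed simp
 qed simp
 then have "H b = H a" using ab by auto
 then have "integral {a..b} g = Q b * p b" by (simp add: H_def Q_def)
 then have "(g has_integral Q b * p b) {a..b}" using g by (metis integrable_integral)
 moreover have "((%s. Q s * p' s) has_integral integral {a..b} (%s. Q s * p' s)) {a..b}"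
  using Qp by (intro integrable_integral) (simp add: absolutely_integrable_on_def)
 ultimately have "((%x. g x - Q x * p' x) has_integral Q b * p b - integral {a..b} (%s. Q s * p' s)) {a..b}"
  by (rule has_integral_diff)
 then show "((%x. q x * p x) has_integral p b * integral {a..b} q - integral {a..b} (%s. integral {a..s} q * p' s)) {a..b}"
  by (simp add: g_def Q_def mult.commute)
qed

text \<open>On each cell the discrepancy between the weighted sample sum and the integral of a
 function is integrated by parts against the discrepancies on left-anchored subintervals.\<close>

lemma weighted_discrepancy_cell:
 fixes p p' q :: "real => real" and u x :: "'i => real"
 assumes I: "finite I"
  and p': "p' absolutely_integrable_on {0..1}"
  and p: "!!x y. 0 <= x ==> x <= y ==> y <= 1 ==> (p' has_integral p y - p x) {x..y}"
  and q: "q \<in> borel_measurable leb01" "!!x. x \<in> {0..1} ==> \<bar>q x\<bar> <= K"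
  and ab: "0 <= a" "a < b" "b <= 1"
  and B: "!!s. s \<in> {a..b} ==> \<bar>(SUM i:I. u i * indicator {a<..s} (x i)) - integral {a..s} q\<bar> <= B"
 shows "\<bar>(SUM i:I. u i * indicator {a<..b} (x i) * p (x i)) - integral {a..b} (%x. q x * p x)\<bar> <=
  B * (integral {a..b} (%x. \<bar>p x\<bar>) / (b - a) + 2 * integral {a..b} (%x. \<bar>p' x\<bar>))"
proof -
 have ab': "a <= b" using ab by simp
 have sub: "p' absolutely_integrable_on {x..y}" if "0 <= x" "y <= 1" for x y
  by (rule absolutely_integrable_on_subinterval[OF p']) (use that in auto)
 have Pi: "(%s. \<bar>p' s\<bar>) integrable_on {x..y}" if "0 <= x" "y <= 1" for x y
  using sub[OF that] by (simp add: absolutely_integrable_on_def)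
 have pc: "continuous_on {a..b} p"
 proof -
  have "continuous_on {a..b} (%x. integral {a..x} p')"
   using sub[of a b] ab by (intro indefinite_integral_continuous_1) (auto simp: absolutely_integrable_on_def)
  then have "continuous_on {a..b} (%x. p a + integral {a..x} p')" by (intro continuous_intros)
  then show ?thesis by (rule continuous_on_eq) (use integral_unique[OF p[of a]] ab in auto)
 qed
 note parts = indefinite_integral_by_parts[OF p' p q ab(1) ab' ab(3)]
 \<comment> \<open>A value of \<open>p\<close> at a sample point is expressed through the integral
   of \<open>p'\<close> from that point to \<open>b\<close>, so the sample sum turns into an
   integral of the counting function \<open>?N\<close> against \<open>p'\<close>.\<close>
 have one: "((%s. indicator {a<..s} (x i) * p' s) has_integral indicator {a<..b} (x i) * (p b - p (x i))) {a..b}" for i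
 proof (cases "x i \<in> {a<..b}")
  case True
  have "(p' has_integral p b - p (x i)) {x i..b}" by (rule p) (use True ab in auto)
  then have "((%s. if s \<in> {x i..b} then p' s else 0) has_integral p b - p (x i)) {a..b}"
   using True by (subst has_integral_restrict) auto
  then have "((%s. indicator {a<..s} (x i) * p' s) has_integral p b - p (x i)) {a..b}"
   by (rule has_integral_eq[rotated]) (use True in auto)
  then show ?thesis using True by simp
 next
  case False
  then have "((%s. indicator {a<..s} (x i) * p' s) has_integral 0) {a..b}"
   by (intro has_integral_is_0) auto
  then show ?thesis using False by simp
 qed
 let ?N = "%s. SUM i:I. u i * indicator {a<..s} (x i)"
 have "((%s. SUM i:I. u i * (indicator {a<..s} (x i) * p' s)) has_integral (SUM i:I. u i * (indicator {a<..b} (x i) * (p b - p (x i))))) {a..b}"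
  by (intro has_integral_sum I has_integral_mult_right one)
 then have N: "((%s. ?N s * p' s) has_integral p b * ?N b - (SUM i:I. u i * indicator {a<..b} (x i) * p (x i))) {a..b}"
  by (simp add: sum_distrib_right sum_distrib_left sum_subtractf algebra_simps)
 have Ni: "((%s. (?N s - integral {a..s} q) * p' s) has_integral
  (p b * ?N b - (SUM i:I. u i * indicator {a<..b} (x i) * p (x i))) - integral {a..b} (%s. integral {a..s} q * p' s)) {a..b}"
  using has_integral_diff[OF N integrable_integral[OF parts(2)]] by (simp add: left_diff_distrib)
 have eq: "(SUM i:I. u i * indicator {a<..b} (x i) * p (x i)) - integral {a..b} (%x. q x * p x) =
  p b * (?N b - integral {a..b} q) - integral {a..b} (%s. (?N s - integral {a..s} q) * p' s)"
  using integral_unique[OF parts(1)] integral_unique[OF Ni] by (simp add: algebra_simps)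
 have B0: "0 <= B" using B[of a] ab by auto
 have "norm (integral {a..b} (%s. (?N s - integral {a..s} q) * p' s)) <= integral {a..b} (%s. B * \<bar>p' s\<bar>)"
 proof (rule integral_norm_bound_integral)
  show "(%s. (?N s - integral {a..s} q) * p' s) integrable_on {a..b}" using Ni by blast
  show "(%s. B * \<bar>p' s\<bar>) integrable_on {a..b}" using Pi[OF ab(1,3)] by (rule integrable_on_mult_right)
  fix s assume "s \<in> {a..b}"
  then show "norm ((?N s - integral {a..s} q) * p' s) <= B * \<bar>p' s\<bar>"
   using B[of s] by (simp add: abs_mult mult_right_mono)
 qed
 then have t2: "\<bar>integral {a..b} (%s. (?N s - integral {a..s} q) * p' s)\<bar> <= B * integral {a..b} (%s. \<bar>p' s\<bar>)" by simp
 \<comment> \<open>The boundary value at \<open>b\<close> is at most the mean of |p| over the cell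
   plus the variation of \<open>p\<close> there; together with \<open>t2\<close> this explains the
   factor 2.\<close>
 have "continuous_on {a..b} (%x. \<bar>p x\<bar>)" using pc by (intro continuous_intros)
 then obtain s where s: "s \<in> {a..b}" "(b - a) * \<bar>p s\<bar> <= integral {a..b} (%x. \<bar>p x\<bar>)"
  by (rule integral_ge_min[OF _ ab'])
 have "(p' has_integral p b - p s) {s..b}" by (rule p) (use s ab in auto)
 then have "\<bar>p b - p s\<bar> = norm (integral {s..b} p')" by (simp add: integral_unique)
 also have "... <= integral {s..b} (%s. \<bar>p' s\<bar>)"
  using sub[of s b] Pi[of s b] s ab by (intro integral_norm_bound_integral) (auto simp: absolutely_integrable_on_def)
 also have "... <= integral {a..b} (%s. \<bar>p' s\<bar>)"
  using s ab Pi[of s b] Pi[of a b] by (intro integral_subset_le) auto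
 finally have "\<bar>p b\<bar> <= \<bar>p s\<bar> + integral {a..b} (%s. \<bar>p' s\<bar>)" by linarith
 moreover have "\<bar>p s\<bar> <= integral {a..b} (%x. \<bar>p x\<bar>) / (b - a)"
  using s(2) ab by (simp add: field_simps)
 ultimately have pb: "\<bar>p b\<bar> <= integral {a..b} (%x. \<bar>p x\<bar>) / (b - a) + integral {a..b} (%s. \<bar>p' s\<bar>)" by linarith
 have "\<bar>p b * (?N b - integral {a..b} q)\<bar> <= B * \<bar>p b\<bar>"
  using mult_left_mono[OF B[of b], of "\<bar>p b\<bar>"] ab by (simp add: abs_mult mult.commute)
 also have "... <= B * (integral {a..b} (%x. \<bar>p x\<bar>) / (b - a) + integral {a..b} (%s. \<bar>p' s\<bar>))"
  using pb B0 by (intro mult_left_mono)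
 finally have "\<bar>p b * (?N b - integral {a..b} q)\<bar> <= B * (integral {a..b} (%x. \<bar>p x\<bar>) / (b - a) + integral {a..b} (%s. \<bar>p' s\<bar>))" .
 with t2 show ?thesis unfolding eq
  using abs_triangle_ineq4[of "p b * (?N b - integral {a..b} q)" "integral {a..b} (%s. (?N s - integral {a..s} q) * p' s)"]
  by (simp add: distrib_left)
qed

text \<open>The half-open cells \<open>{c j<..c (Suc j)}\<close> partition \<open>{0<..1}\<close>,
  so every sample point is counted in exactly one cell and the cell bounds add up.\<close>

lemma weighted_discrepancy:
 fixes p p' q :: "real => real" and u x :: "'i => real"
 assumes I: "finite I" "!!i. i \<in> I ==> x i \<in> {0<..1}"
  and p': "p' absolutely_integrable_on {0..1}"
  and p: "!!x y. 0 <= x ==> x <= y ==> y <= 1 ==> (p' has_integral p y - p x) {x..y}"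
  and q: "q \<in> borel_measurable leb01" "!!x. x \<in> {0..1} ==> \<bar>q x\<bar> <= K"
  and J: "J > 0"
  and B: "!!j s. j < J ==> s \<in> {real j / real J..real (Suc j) / real J} ==>
   \<bar>(SUM i:I. u i * indicator {real j / real J<..s} (x i)) - integral {real j / real J..s} q\<bar> <= B"
 shows "\<bar>(SUM i:I. u i * p (x i)) - int01 (%x. q x * p x)\<bar> <=
  B * (real J * int01 (%x. \<bar>p x\<bar>) + 2 * int01 (%x. \<bar>p' x\<bar>))"
proof -
 define c where "c j = real j / real J" for j
 have c: "0 <= c j" "c j < c (Suc j)" "c (Suc j) - c j = 1 / real J" for j
  using J by (auto simp: c_def divide_strict_right_mono add_divide_distrib)
 have c1: "c (Suc j) <= 1" if "j < J" for j using that J by (auto simp: c_def field_simps)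
 have c1': "c j <= 1" if "j <= J" for j using that J by (auto simp: c_def field_simps)
 have part: "(SUM j<n. integral {c j..c (Suc j)} g) = integral {0..c n} g"
  if "g integrable_on {0..1}" "n <= J" for g :: "real => real" and n
  using that(2)
 proof (induction n)
  case 0 then show ?case by (simp add: c_def)
 next
  case (Suc n)
  have "integral {0..c n} g + integral {c n..c (Suc n)} g = integral {0..c (Suc n)} g"
   by (rule Henstock_Kurzweil_Integration.integral_combine)
    (use c[of n] c1'[OF Suc.prems] in \<open>auto intro: integrable_on_subinterval[OF that(1)]\<close>)
  then show ?case using Suc by simp
 qed
 have cJ: "c J = 1" using J by (simp add: c_def)
 have pc: "continuous_on {0..1} p"
 proof -
  have "continuous_on {0..1} (%x. integral {0..x} p')"
   using p' by (intro indefinite_integral_continuous_1) (auto simp: absolutely_integrable_on_def)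
  then have "continuous_on {0..1} (%x. p 0 + integral {0..x} p')" by (intro continuous_intros)
  then show ?thesis by (rule continuous_on_eq) (use integral_unique[OF p[of 0]] in auto)
 qed
 have qp: "(%x. q x * p x) integrable_on {0..1}"
  using indefinite_integral_by_parts(1)[OF p' p q, of 0 1] by auto
 have i1: "(%x. \<bar>p x\<bar>) integrable_on {0..1}" using pc by (intro integrable_continuous_interval continuous_intros)
 have i2: "(%x. \<bar>p' x\<bar>) integrable_on {0..1}" using p' by (simp add: absolutely_integrable_on_def)
 have ind: "(SUM j<J. indicator {c j<..c (Suc j)} (x i)) = (1::real)" if i: "i \<in> I" for i
 proof -
  have "(SUM j<n. indicator {c j<..c (Suc j)} (x i)) = (indicator {0<..c n} (x i) :: real)" for n
  proof (induction n)
   case 0 then show ?case by (simp add: c_def)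
  next
   case (Suc n)
   have "indicator {0<..c (Suc n)} (x i) = (indicator {0<..c n} (x i) + indicator {c n<..c (Suc n)} (x i) :: real)"
    using c(1,2)[of n] by (auto simp: indicator_def)
   then show ?case using Suc by simp
  qed
  then show ?thesis using I(2)[OF i] cJ by simp
 qed
 have "(SUM i:I. u i * p (x i)) = (SUM i:I. SUM j<J. u i * indicator {c j<..c (Suc j)} (x i) * p (x i))"
 proof (rule sum.cong)
  fix i assume i: "i \<in> I"
  have "(SUM j<J. u i * indicator {c j<..c (Suc j)} (x i) * p (x i)) = u i * (SUM j<J. indicator {c j<..c (Suc j)} (x i)) * p (x i)"
   by (simp only: sum_distrib_left sum_distrib_right)
  then show "u i * p (x i) = (SUM j<J. u i * indicator {c j<..c (Suc j)} (x i) * p (x i))" using ind[OF i] by simp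
 qed simp
 also have "... = (SUM j<J. SUM i:I. u i * indicator {c j<..c (Suc j)} (x i) * p (x i))" by (rule sum.swap)
 finally have eq: "(SUM i:I. u i * p (x i)) - int01 (%x. q x * p x) =
  (SUM j<J. (SUM i:I. u i * indicator {c j<..c (Suc j)} (x i) * p (x i)) - integral {c j..c (Suc j)} (%x. q x * p x))"
  using part[OF qp order_refl] cJ by (simp add: sum_subtractf)
 have "\<bar>...\<bar> <= (SUM j<J. \<bar>(SUM i:I. u i * indicator {c j<..c (Suc j)} (x i) * p (x i)) - integral {c j..c (Suc j)} (%x. q x * p x)\<bar>)"
  by (rule sum_abs)
 also have "... <= (SUM j<J. B * (real J * integral {c j..c (Suc j)} (%x. \<bar>p x\<bar>) + 2 * integral {c j..c (Suc j)} (%x. \<bar>p' x\<bar>)))"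
 proof (rule sum_mono)
  fix j assume j: "j \<in> {..<J}"
  have "\<bar>(SUM i:I. u i * indicator {c j<..c (Suc j)} (x i) * p (x i)) - integral {c j..c (Suc j)} (%x. q x * p x)\<bar> <=
   B * (integral {c j..c (Suc j)} (%x. \<bar>p x\<bar>) / (c (Suc j) - c j) + 2 * integral {c j..c (Suc j)} (%x. \<bar>p' x\<bar>))"
   by (rule weighted_discrepancy_cell[OF I(1) p' p q c(1,2)]) (use c1 B[of j] j in \<open>auto simp: c_def\<close>)
  then show "\<bar>(SUM i:I. u i * indicator {c j<..c (Suc j)} (x i) * p (x i)) - integral {c j..c (Suc j)} (%x. q x * p x)\<bar> <=
   B * (real J * integral {c j..c (Suc j)} (%x. \<bar>p x\<bar>) + 2 * integral {c j..c (Suc j)} (%x. \<bar>p' x\<bar>))"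
   unfolding c(3) by (simp add: mult.commute)
 qed
 also have "... = B * (real J * (SUM j<J. integral {c j..c (Suc j)} (%x. \<bar>p x\<bar>)) + 2 * (SUM j<J. integral {c j..c (Suc j)} (%x. \<bar>p' x\<bar>)))"
  by (simp add: sum_distrib_left sum.distrib distrib_left)
 also have "... = B * (real J * int01 (%x. \<bar>p x\<bar>) + 2 * int01 (%x. \<bar>p' x\<bar>))"
  using part[OF i1 order_refl] part[OF i2 order_refl] cJ by simp
 finally show ?thesis unfolding eq .
qed

section \<open>Natural splines and the smoother\<close>

lemma absolutely_continuous_fun_on_add:
 assumes f: "absolutely_continuous_fun_on S f" and g: "absolutely_continuous_fun_on S g"
 shows "absolutely_continuous_fun_on S (%x. f x + g x)"
 unfolding absolutely_continuous_fun_on_def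
proof (intro allI impI)
 fix e :: real assume "e > 0"
 then have e: "e/2 > 0" by simp
 obtain d1 where d1: "d1 > 0" "\<forall>(N::nat) a b. (\<forall>i<N. a i <= b i & {a i..b i} <= S) -->
   (\<forall>i<N. \<forall>j<N. i ~= j --> {a i<..<b i} Int {a j<..<b j} = {}) -->
   (SUM i<N. b i - a i) < d1 --> (SUM i<N. \<bar>f (b i) - f (a i)\<bar>) < e/2"
  using f e unfolding absolutely_continuous_fun_on_def by blast
 obtain d2 where d2: "d2 > 0" "\<forall>(N::nat) a b. (\<forall>i<N. a i <= b i & {a i..b i} <= S) -->
   (\<forall>i<N. \<forall>j<N. i ~= j --> {a i<..<b i} Int {a j<..<b j} = {}) -->
   (SUM i<N. b i - a i) < d2 --> (SUM i<N. \<bar>g (b i) - g (a i)\<bar>) < e/2"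
  using g e unfolding absolutely_continuous_fun_on_def by blast
 show "\<exists>d>0. \<forall>(N::nat) a b. (\<forall>i<N. a i <= b i & {a i..b i} <= S) -->
   (\<forall>i<N. \<forall>j<N. i ~= j --> {a i<..<b i} Int {a j<..<b j} = {}) -->
   (SUM i<N. b i - a i) < d --> (SUM i<N. \<bar>(f (b i) + g (b i)) - (f (a i) + g (a i))\<bar>) < e"
 proof (intro exI[of _ "min d1 d2"] conjI allI impI)
  show "0 < min d1 d2" using d1 d2 by simp
  fix N :: nat and a b :: "nat => real"
  assume ab: "\<forall>i<N. a i <= b i & {a i..b i} <= S"
   and dis: "\<forall>i<N. \<forall>j<N. i ~= j --> {a i<..<b i} Int {a j<..<b j} = {}"
   and s: "(SUM i<N. b i - a i) < min d1 d2"
  have "(SUM i<N. \<bar>(f (b i) + g (b i)) - (f (a i) + g (a i))\<bar>) <= (SUM i<N. \<bar>f (b i) - f (a i)\<bar> + \<bar>g (b i) - g (a i)\<bar>)"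
   by (rule sum_mono) linarith
  moreover have "(SUM i<N. \<bar>f (b i) - f (a i)\<bar>) < e/2" using d1(2)[rule_format, of N a b] ab dis s by simp
  moreover have "(SUM i<N. \<bar>g (b i) - g (a i)\<bar>) < e/2" using d2(2)[rule_format, of N a b] ab dis s by simp
  ultimately show "(SUM i<N. \<bar>(f (b i) + g (b i)) - (f (a i) + g (a i))\<bar>) < e"
   by (simp add: sum.distrib)
 qed
qed

lemma absolutely_continuous_fun_on_const: "absolutely_continuous_fun_on S (%_. c)"
 by (rule absolutely_continuous_fun_on_Lipschitz[of _ _ 0]) auto

lemma absolutely_continuous_fun_on_sum:
 assumes "finite I" "!!i. i \<in> I ==> absolutely_continuous_fun_on S (f i)"
 shows "absolutely_continuous_fun_on S (%x. SUM i:I. f i x)"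
 using assms by (induction I rule: finite_induct) (auto intro: absolutely_continuous_fun_on_add absolutely_continuous_fun_on_const)

lemma absolutely_continuous_fun_on_power:
 assumes "AC01 f"
 shows "AC01 (%x. f x ^ k)"
 by (induction k) (auto intro: absolutely_continuous_fun_on_const absolutely_continuous_fun_on_mult[OF assms])

lemma absolutely_continuous_fun_on_cong:
 assumes "!!x. x \<in> S ==> f x = g x" "absolutely_continuous_fun_on S f"
 shows "absolutely_continuous_fun_on S g"
 unfolding absolutely_continuous_fun_on_def
proof (intro allI impI)
 fix e :: real assume "e > 0"
 then obtain d where d: "d > 0" "\<forall>(N::nat) a b. (\<forall>i<N. a i <= b i & {a i..b i} <= S) -->
   (\<forall>i<N. \<forall>j<N. i ~= j --> {a i<..<b i} Int {a j<..<b j} = {}) -->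
   (SUM i<N. b i - a i) < d --> (SUM i<N. \<bar>f (b i) - f (a i)\<bar>) < e"
  using assms(2) unfolding absolutely_continuous_fun_on_def by blast
 show "\<exists>d>0. \<forall>(N::nat) a b. (\<forall>i<N. a i <= b i & {a i..b i} <= S) -->
   (\<forall>i<N. \<forall>j<N. i ~= j --> {a i<..<b i} Int {a j<..<b j} = {}) -->
   (SUM i<N. b i - a i) < d --> (SUM i<N. \<bar>g (b i) - g (a i)\<bar>) < e"
 proof (intro exI[of _ d] conjI d(1) allI impI)
  fix N :: nat and a b :: "nat => real"
  assume ab: "\<forall>i<N. a i <= b i & {a i..b i} <= S"
   and dis: "\<forall>i<N. \<forall>j<N. i ~= j --> {a i<..<b i} Int {a j<..<b j} = {}"
   and s: "(SUM i<N. b i - a i) < d"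
  have "(SUM i<N. \<bar>g (b i) - g (a i)\<bar>) = (SUM i<N. \<bar>f (b i) - f (a i)\<bar>)"
  proof (rule sum.cong)
   fix i assume "i \<in> {..<N}"
   then have "a i \<in> {a i..b i}" "b i \<in> {a i..b i}" "{a i..b i} <= S" using ab by auto
   then have "a i \<in> S" "b i \<in> S" by blast+
   then show "\<bar>g (b i) - g (a i)\<bar> = \<bar>f (b i) - f (a i)\<bar>" using assms(1) by simp
  qed simp
  then show "(SUM i<N. \<bar>g (b i) - g (a i)\<bar>) < e" using d(2)[rule_format, of N a b] ab dis s by simp
 qed
qed

text \<open>The one-sided power is cut off strictly at the knot, so that the exponent 0 gives an indicator
 function rather than the junk value of 0 to the power 0.\<close>

definition tpow :: "nat => real => real => real" where
 "tpow r X x = (if x < X then (X - x) ^ r / fact r else 0)"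

lemma tpow_max: "r >= 1 ==> tpow r X x = (max 0 (X - x)) ^ r / fact r"
 by (auto simp: tpow_def max_def)

lemma tpow_deriv:
 assumes "r >= 1 | x ~= X"
 shows "(tpow (Suc r) X has_real_derivative - tpow r X x) (at x)"
proof -
 have d1: "((%x. (X - x) ^ Suc r / fact (Suc r)) has_real_derivative - ((X - x) ^ r / fact r)) (at x)"
  by (rule derivative_eq_intros refl | simp)+
 consider "x < X" | "x > X" | "x = X" "r >= 1" using assms by linarith
 then show ?thesis
 proof cases
  case 1
  have "(tpow (Suc r) X has_real_derivative - ((X - x) ^ r / fact r)) (at x)"
   by (rule has_field_derivative_transform_within_open[OF d1, of "{..<X}"]) (use 1 in \<open>auto simp: tpow_def\<close>)
  then show ?thesis using 1 by (simp add: tpow_def)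
 next
  case 2
  have "(tpow (Suc r) X has_real_derivative 0) (at x)"
   by (rule has_field_derivative_transform_within_open[OF DERIV_const[of 0], of "{X<..}"]) (use 2 in \<open>auto simp: tpow_def\<close>)
  then show ?thesis using 2 by (simp add: tpow_def)
 next
  case 3
  have "(tpow (Suc r) X has_derivative (%_. 0)) (at x)"
   unfolding has_derivative_at_alt
  proof (intro conjI allI impI)
   fix e :: real assume e: "e > 0"
   show "\<exists>d>0. \<forall>y. norm (y - x) < d --> norm (tpow (Suc r) X y - tpow (Suc r) X x - 0) <= e * norm (y - x)"
   proof (intro exI[of _ "min 1 e"] conjI allI impI)
    fix y assume y: "norm (y - x) < min 1 e"
    have "\<bar>tpow (Suc r) X y\<bar> <= \<bar>y - x\<bar> ^ Suc r"
    proof -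
     show ?thesis
     proof (cases "y < X")
      case True
      have "(X - y) ^ Suc r / fact (Suc r) <= (X - y) ^ Suc r / 1"
       by (rule divide_left_mono) (use True in \<open>auto simp del: fact_Suc power_Suc intro: fact_ge_1\<close>)
      moreover have "0 <= (X - y) ^ Suc r / fact (Suc r)" using True by (intro divide_nonneg_pos zero_le_power) auto
      moreover have "\<bar>y - x\<bar> = X - y" using True 3 by simp
      ultimately show ?thesis using True by (simp add: tpow_def del: fact_Suc power_Suc)
     qed (simp add: tpow_def)
    qed
    also have "... = \<bar>y - x\<bar> ^ r * \<bar>y - x\<bar>" by simp
    also have "... <= e * \<bar>y - x\<bar>"
    proof (rule mult_right_mono)
     have "\<bar>y - x\<bar> ^ r <= \<bar>y - x\<bar> ^ 1" using y 3 by (intro power_decreasing) auto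
     then show "\<bar>y - x\<bar> ^ r <= e" using y by simp
    qed simp
    finally show "norm (tpow (Suc r) X y - tpow (Suc r) X x - 0) <= e * norm (y - x)"
     using 3 by (simp add: tpow_def)
   qed (use e in simp)
  qed simp
  then show ?thesis using 3 by (simp add: has_field_derivative_def tpow_def lambda_zero)
 qed
qed

lemma tpow_absolutely_continuous:
 assumes "r >= 1" shows "AC01 (tpow r X)"
proof -
 have "AC01 (%x. max 0 (X - x))"
  by (rule absolutely_continuous_fun_on_Lipschitz[of _ _ 1]) auto
 then have "AC01 (%x. (1 / fact r) * (max 0 (X - x)) ^ r)"
  by (intro absolutely_continuous_fun_on_mult absolutely_continuous_fun_on_const absolutely_continuous_fun_on_power)
 then show ?thesis by (rule absolutely_continuous_fun_on_cong[rotated]) (simp add: tpow_max[OF assms])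
qed

lemma tpow_bound: "x \<in> {0..1} ==> \<bar>tpow r X x\<bar> <= (\<bar>X\<bar> + 1) ^ r"
proof (cases "x < X")
 case True
 assume x: "x \<in> {0..1}"
 have "\<bar>(X - x) ^ r / fact r\<bar> = \<bar>X - x\<bar> ^ r / fact r" by (simp add: power_abs)
 also have "... <= \<bar>X - x\<bar> ^ r / 1" by (rule divide_left_mono) (auto intro: fact_ge_1)
 also have "... <= (\<bar>X\<bar> + 1) ^ r" using x True by (simp add: power_mono)
 finally show ?thesis using True by (simp add: tpow_def)
qed (simp add: tpow_def)

lemma tpow_measurable [measurable]: "tpow r X \<in> borel_measurable borel"
 unfolding tpow_def by measurable

text \<open>Derivative of order \<open>j\<close> of a spline of degree 2m - 1 with knots
  \<open>x i\<close>: a polynomial with Taylor coefficients \<open>a\<close> plus powers supported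
  to the left of their knots. Each differentiation of \<open>tpow\<close> changes the sign, and the
  initial sign (-1)^m makes the derivative of order m the sum of
  \<open>c i * tpow (m - 1) (x i)\<close>, a combination of remainder kernels of Taylor's
  formula.\<close>

definition natspline_deriv :: "nat => nat => nat => (nat => real) => (nat => real) => (nat => real) => real => real" where
 "natspline_deriv j m n x a c t =
  (SUM k<m. a k * (if j <= k then t ^ (k - j) / fact (k - j) else 0)) +
  (SUM i=1..n. c i * ((-1) ^ (m + j) * tpow (2 * m - 1 - j) (x i) t))"

abbreviation natspline where "natspline \<equiv> natspline_deriv 0"

lemma natspline_deriv_has_derivative:
 assumes "j < m" and "Suc j < m | (\<forall>i\<in>{1..n}. t ~= x i)"
 shows "(natspline_deriv j m n x a c has_real_derivative natspline_deriv (Suc j) m n x a c t) (at t)"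
proof -
 have p: "((%t. if j <= k then t ^ (k - j) / fact (k - j) else 0) has_real_derivative
  (if Suc j <= k then t ^ (k - Suc j) / fact (k - Suc j) else 0)) (at t)" for k
 proof (cases "Suc j <= k")
  case True
  then obtain d where d: "k = Suc j + d" using le_Suc_ex by blast
  have "((%t. t ^ Suc d / fact (Suc d)) has_real_derivative t ^ d / fact d) (at t)"
   by (rule derivative_eq_intros refl | simp)+
  then show ?thesis using d by simp
 next
  case False
  then have "(if j <= k then t ^ (k - j) / fact (k - j) else 0) = (if j = k then 1 else 0)" for t :: real by auto
  then show ?thesis using False by simp
 qed
 have q: "((%t. (-1) ^ (m + j) * tpow (2 * m - 1 - j) (x i) t) has_real_derivative
  (-1) ^ (m + Suc j) * tpow (2 * m - 1 - Suc j) (x i) t) (at t)" if "i \<in> {1..n}" for i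
 proof -
  have e: "2 * m - 1 - j = Suc (2 * m - 1 - Suc j)" using assms(1) by simp
  have "(tpow (2 * m - 1 - j) (x i) has_real_derivative - tpow (2 * m - 1 - Suc j) (x i) t) (at t)"
   unfolding e by (rule tpow_deriv) (use assms that in auto)
  from DERIV_cmult[OF this, of "(-1) ^ (m + j)"] show ?thesis by simp
 qed
 show ?thesis unfolding natspline_deriv_def
  by (intro DERIV_add DERIV_sum DERIV_cmult p q)
qed

text \<open>At order \<open>m\<close> the knots are excluded, since for m = 1 the derivative jumps
  there.\<close>

lemma natspline_deriv01:
 assumes "j <= m" "t \<in> {0..1}" "j < m | (\<forall>i\<in>{1..n}. t ~= x i)"
 shows "deriv01 j (natspline m n x a c) t = natspline_deriv j m n x a c t"
 using assms
proof (induction j arbitrary: t)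
 case (Suc j)
 have d: "(natspline_deriv j m n x a c has_vector_derivative natspline_deriv (Suc j) m n x a c t) (at t within {0..1})"
  using natspline_deriv_has_derivative[of j m n t x a c] Suc.prems
  by (auto simp: has_real_derivative_iff_has_vector_derivative[symmetric] has_field_derivative_at_within)
 have "(deriv01 j (natspline m n x a c) has_vector_derivative natspline_deriv (Suc j) m n x a c t) (at t within {0..1})"
  by (rule has_vector_derivative_transform[OF _ _ d]) (use Suc in auto)
 then show ?case
  unfolding deriv01_Suc using Suc.prems by (intro vector_derivative_within_closed_interval) auto
qed simp

lemma natspline_deriv01_has_derivative:
 assumes "Suc j < m" "t \<in> {0..1}"
 shows "(deriv01 j (natspline m n x a c) has_vector_derivative natspline_deriv (Suc j) m n x a c t) (at t within {0..1})"
proof (rule has_vector_derivative_transform[OF assms(2)])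
 show "(natspline_deriv j m n x a c has_vector_derivative natspline_deriv (Suc j) m n x a c t) (at t within {0..1})"
  using natspline_deriv_has_derivative[of j m n t x a c] assms
  by (auto simp: has_real_derivative_iff_has_vector_derivative[symmetric] has_field_derivative_at_within)
qed (use assms natspline_deriv01 in auto)

lemma natspline_sobolev2:
 assumes m: "m >= 1"
 shows "natspline m n x a c \<in> sobolev2 m"
proof -
 let ?f = "natspline m n x a c"
 have t_ac: "AC01 (%t::real. t ^ k)" for k
  by (rule absolutely_continuous_fun_on_power, rule absolutely_continuous_fun_on_Lipschitz[of _ _ 1]) auto
 have poly_ac: "AC01 (%t. if j <= k then t ^ (k - j) / fact (k - j) else 0)" for j k
 proof (cases "j <= k")
  case True
  have "AC01 (%t. 1 / fact (k - j) * t ^ (k - j))"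
   by (intro absolutely_continuous_fun_on_mult t_ac absolutely_continuous_fun_on_const)
  then show ?thesis using True by simp
 qed (simp add: absolutely_continuous_fun_on_const)
 have ac: "AC01 (natspline_deriv (m - 1) m n x a c)"
  unfolding natspline_deriv_def[abs_def]
  by (intro absolutely_continuous_fun_on_add absolutely_continuous_fun_on_sum absolutely_continuous_fun_on_mult
    absolutely_continuous_fun_on_const poly_ac tpow_absolutely_continuous) (use m in auto)
 have ac': "AC01 (deriv01 (m - 1) ?f)"
  by (rule absolutely_continuous_fun_on_cong[OF _ ac]) (use m natspline_deriv01[of "m-1" m] in auto)
 \<comment> \<open>At the knots the values of \<open>deriv01 m\<close> may be unspecified.
   Measurability is therefore drawn from integrability, which the fundamental theorem
   provides.\<close>
 have "((%t. vector_derivative (deriv01 (m - 1) ?f) (at t within {0..1})) has_integral deriv01 (m - 1) ?f 1 - deriv01 (m - 1) ?f 0) {0..1}"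
  by (rule absolutely_continuous_fun_on_has_integral[OF ac']) auto
 then have "deriv01 m ?f integrable_on {0..1}"
  using m deriv01_Suc[of "m-1" ?f] by auto
 then have meas: "deriv01 m ?f \<in> borel_measurable leb01" by (rule integrable_imp_measurable)
 have N: "negligible (x ` {1..n})" by (rule negligible_finite) simp
 define K where "K = (SUM i=1..n. \<bar>c i\<bar> * (\<bar>x i\<bar> + 1) ^ (2 * m - 1 - m))"
 have "(%t. (natspline_deriv m m n x a c t)^2) absolutely_integrable_on {0..1}"
 proof (rule measurable_bounded_by_integrable_imp_absolutely_integrable[of _ _ "%_. K^2"])
  have "(%t. (natspline_deriv m m n x a c t)^2) \<in> borel_measurable borel"
   unfolding natspline_deriv_def by measurable
  then show "(%t. (natspline_deriv m m n x a c t)^2) \<in> borel_measurable leb01"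
   by (intro measurable_restrict_space1) (simp add: measurable_completion)
  fix t :: real assume t: "t \<in> {0..1}"
  have "\<bar>natspline_deriv m m n x a c t\<bar> <= K"
  proof -
   have "natspline_deriv m m n x a c t = (SUM i=1..n. c i * ((-1) ^ (m + m) * tpow (2 * m - 1 - m) (x i) t))"
    by (simp add: natspline_deriv_def)
   also have "\<bar>...\<bar> <= (SUM i=1..n. \<bar>c i * ((-1) ^ (m + m) * tpow (2 * m - 1 - m) (x i) t)\<bar>)" by (rule sum_abs)
   also have "... <= K" unfolding K_def
    by (rule sum_mono) (use tpow_bound[OF t] in \<open>simp add: abs_mult mult_left_mono\<close>)
   finally show ?thesis .
  qed
  then show "norm ((natspline_deriv m m n x a c t)^2) <= K^2"
   by (metis abs_ge_zero norm_power power2_abs power_mono real_norm_def)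
 qed (auto simp: integrable_const_ivl)
 then have "(%t. (deriv01 m ?f t)^2) absolutely_integrable_on {0..1}"
 proof (rule absolutely_integrable_spike[OF _ N])
  fix t assume "t \<in> {0..1} - x ` {1..n}"
  then have "deriv01 m ?f t = natspline_deriv m m n x a c t" by (intro natspline_deriv01) auto
  then show "(deriv01 m ?f t)^2 = (natspline_deriv m m n x a c t)^2" by simp
 qed
 then have int: "integrable leb01 (%t. (deriv01 m ?f t)^2)"
  by (simp add: integrable_restrict_space set_integrable_def)
 have "deriv01 k ?f differentiable_on {0..1}" if "k < m - 1" for k
  unfolding differentiable_on_def
 proof
  fix t :: real assume "t \<in> {0..1}"
  moreover have "Suc k < m" using that by simp
  ultimately show "deriv01 k ?f differentiable (at t within {0..1})"
   by (intro differentiableI_vector[OF natspline_deriv01_has_derivative])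
 qed
 then show ?thesis
  unfolding sobolev2_def using ac' meas int absolutely_continuous_fun_on_imp_continuous_on[OF ac'] by blast
qed

text \<open>The derivative of order m of the spline combines the Taylor kernels of the knots.
  Pairing it with that of \<open>f\<close> gives, for each knot, f (x i) minus a Taylor polynomial
  of degree below m, and \<open>orth\<close> cancels the polynomials.\<close>

lemma natspline_energy:
 assumes m: "m >= 1" and f: "f \<in> sobolev2 m"
  and c: "!!i. i \<in> {1..n} ==> c i ~= 0 ==> x i \<in> {0..1}"
  and orth: "!!k. k < m ==> (SUM i=1..n. c i * x i ^ k) = 0"
 shows "((%t. deriv01 m (natspline m n x a c) t * deriv01 m f t) has_integral (SUM i=1..n. c i * f (x i))) {0..1}"
proof -
 have N: "negligible (x ` {1..n})" by (rule negligible_finite) simp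
 let ?P = "%X. SUM k<=m-1. deriv01 k f 0 * X ^ k / fact k"
 have one: "((%t. c i * (tpow (m - 1) (x i) t * deriv01 m f t)) has_integral c i * (f (x i) - ?P (x i))) {0..1}"
  if i: "i \<in> {1..n}" for i
 proof (cases "c i = 0")
  case False
  have X: "x i \<in> {0..1}" using c[OF i False] .
  have "((%t. (x i - t) ^ (m-1) / fact (m-1) * deriv01 (Suc (m-1)) f t) has_integral f (x i) - ?P (x i)) {0..x i}"
   by (rule sobolev2_Taylor[OF f _ X]) (use m in auto)
  then have "((%t. if t \<in> {0..x i} then (x i - t) ^ (m-1) / fact (m-1) * deriv01 m f t else 0) has_integral f (x i) - ?P (x i)) {0..1}"
   using m X by (subst has_integral_restrict) auto
  then have "((%t. tpow (m - 1) (x i) t * deriv01 m f t) has_integral f (x i) - ?P (x i)) {0..1}"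
   by (rule has_integral_spike[OF N, rotated]) (use i in \<open>auto simp: tpow_def\<close>)
  then show ?thesis by (rule has_integral_mult_right)
 qed simp
 have "((%t. SUM i=1..n. c i * (tpow (m - 1) (x i) t * deriv01 m f t)) has_integral (SUM i=1..n. c i * (f (x i) - ?P (x i)))) {0..1}"
  by (intro has_integral_sum one) auto
 moreover have "(SUM i=1..n. c i * (f (x i) - ?P (x i))) = (SUM i=1..n. c i * f (x i))"
 proof -
  have "(SUM i=1..n. c i * ?P (x i)) = (SUM k<=m-1. deriv01 k f 0 / fact k * (SUM i=1..n. c i * x i ^ k))"
   unfolding sum_distrib_left by (subst sum.swap) (simp add: mult_ac)
  also have "... = 0" using orth m by (intro sum.neutral) auto
  finally show ?thesis by (simp add: algebra_simps sum_subtractf)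
 qed
 ultimately have h: "((%t. SUM i=1..n. c i * (tpow (m - 1) (x i) t * deriv01 m f t)) has_integral (SUM i=1..n. c i * f (x i))) {0..1}"
  by simp
 show ?thesis
 proof (rule has_integral_spike[OF N _ h])
  fix t assume "t \<in> {0..1} - x ` {1..n}"
  then have "deriv01 m (natspline m n x a c) t = natspline_deriv m m n x a c t" by (intro natspline_deriv01) auto
  also have "... = (SUM i=1..n. c i * tpow (m - 1) (x i) t)"
  proof -
   have "2 * m - 1 - m = m - 1" by simp
   moreover have "(-1::real) ^ (m + m) = 1" by simp
   ultimately show ?thesis by (simp add: natspline_deriv_def)
  qed
  finally show "deriv01 m (natspline m n x a c) t * deriv01 m f t = (SUM i=1..n. c i * (tpow (m - 1) (x i) t * deriv01 m f t))"
   by (simp add: sum_distrib_right mult.assoc)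
 qed
qed

section \<open>Normal equations and uniqueness of the minimizer\<close>

lemma sobolev2_penalty_eq:
 assumes "f \<in> sobolev2 m"
 shows "(LINT t|leb01. (deriv01 m f t)^2) = dnorm2 m f"
 using assms by (intro lebesgue_integral_eq_integral) (auto simp: sobolev2_def)

lemma sobolev2_sq_diff_has_integral:
 assumes "f \<in> sobolev2 m" "g \<in> sobolev2 m"
 shows "((%t. (deriv01 m f t - deriv01 m g t)^2) has_integral
  dnorm2 m f - 2 * int01 (%t. deriv01 m g t * deriv01 m f t)
   + dnorm2 m g) {0..1}"
proof -
 have f: "square_integrable01 (deriv01 m f)" and g: "square_integrable01 (deriv01 m g)"
  using sobolev2_square_integrable assms by auto
 have "((%t. (deriv01 m f t)^2 - 2 * (deriv01 m g t * deriv01 m f t) + (deriv01 m g t)^2) has_integral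
  dnorm2 m f - 2 * int01 (%t. deriv01 m g t * deriv01 m f t)
   + dnorm2 m g) {0..1}"
  using f g square_integrable01_product[OF g f]
  by (intro has_integral_add has_integral_diff has_integral_mult_right integrable_integral)
   (auto simp: square_integrable01_def absolutely_integrable_on_def)
 then show ?thesis by (rule has_integral_eq[rotated]) (simp add: power2_diff mult_ac)
qed

text \<open>The Taylor formulas of \<open>f\<close> and \<open>g\<close> are subtracted; the
  Cauchy-Schwarz inequality kills the difference of the remainders, and the Taylor polynomials
  remain.\<close>

lemma sobolev2_deriv_eq_imp_polynomial:
 assumes f: "f \<in> sobolev2 m" and g: "g \<in> sobolev2 m" and m: "m >= 1"
  and 0: "int01 (%t. (deriv01 m f t - deriv01 m g t)^2) = 0"
 shows "\<exists>b. \<forall>t\<in>{0..1}. f t - g t = (SUM k<m. b k * t ^ k / fact k)"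
proof (intro exI[of _ "%k. deriv01 k f 0 - deriv01 k g 0"] ballI)
 fix t :: real assume t: "t \<in> {0..1}"
 let ?h = "%x. deriv01 m f x - deriv01 m g x" and ?u = "%x. (t - x) ^ (m - 1) / fact (m - 1)"
 have Sm: "Suc (m - 1) = m" using m by simp
 have sf: "square_integrable01 (deriv01 m f)" and sg: "square_integrable01 (deriv01 m g)"
  using sobolev2_square_integrable f g by auto
 have sh: "square_integrable01 ?h"
  unfolding square_integrable01_def
  using sf sg sobolev2_sq_diff_has_integral[OF f g] by (auto simp: square_integrable01_def)
 have su: "square_integrable01 ?u" by (intro square_integrable01_continuous continuous_intros) auto
 have "((%x. ?u x * deriv01 m f x - ?u x * deriv01 m g x) has_integral
  (f t - (SUM k<=m-1. deriv01 k f 0 * t ^ k / fact k)) - (g t - (SUM k<=m-1. deriv01 k g 0 * t ^ k / fact k))) {0..t}"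
  using has_integral_diff[OF sobolev2_Taylor[OF f, of "m-1" t] sobolev2_Taylor[OF g, of "m-1" t]] m t unfolding Sm by simp
 then have h: "((%x. ?u x * ?h x) has_integral
  (f t - (SUM k<=m-1. deriv01 k f 0 * t ^ k / fact k)) - (g t - (SUM k<=m-1. deriv01 k g 0 * t ^ k / fact k))) {0..t}"
  by (simp add: right_diff_distrib)
 have t1: "0 <= (0::real)" "t <= 1" using t by auto
 have "integral {0..t} (%x. (?h x)^2) <= int01 (%x. (?h x)^2)"
  by (rule integral_mono_set01) (use sh t in \<open>auto simp: square_integrable01_def\<close>)
 moreover have "0 <= integral {0..t} (%x. (?h x)^2)"
  using square_integrable01_subinterval(2)[OF sh sh t1] by (intro integral_nonneg) auto
 ultimately have "integral {0..t} (%x. (?h x)^2) = 0" using 0 by linarith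
 then have "(integral {0..t} (%x. \<bar>?u x * ?h x\<bar>))^2 <= 0"
  using square_integrable01_Cauchy_Schwarz[OF su sh t1] by simp
 then have "integral {0..t} (%x. \<bar>?u x * ?h x\<bar>) = 0" by simp
 moreover have "norm (integral {0..t} (%x. ?u x * ?h x)) <= integral {0..t} (%x. \<bar>?u x * ?h x\<bar>)"
  using square_integrable01_subinterval(1)[OF su sh t1]
  by (intro integral_norm_bound_integral) (auto simp: absolutely_integrable_on_def)
 ultimately have "norm (integral {0..t} (%x. ?u x * ?h x)) <= 0" by linarith
 then have "integral {0..t} (%x. ?u x * ?h x) = 0" unfolding norm_le_zero_iff .
 then have eq: "f t - g t = (SUM k<=m-1. deriv01 k f 0 * t ^ k / fact k) - (SUM k<=m-1. deriv01 k g 0 * t ^ k / fact k)"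
  using integral_unique[OF h] by simp
 have "{..m-1} = {..<m}" using m by auto
 then show "f t - g t = (SUM k<m. (deriv01 k f 0 - deriv01 k g 0) * t ^ k / fact k)"
  unfolding eq by (simp add: sum_subtractf[symmetric] left_diff_distrib diff_divide_distrib)
qed

text \<open>Membership in the Sobolev space leaves the values outside the unit interval free, so
  only these observations compete with the penalty.\<close>

definition inside_obs :: "nat => (nat => real) => nat set" where
 "inside_obs n x = {i\<in>{1..n}. x i \<in> {0..1}}"

definition inside_objective ::
  "nat => nat => real => (nat => real) => (nat => real) => (real => real) => real" where
 "inside_objective m n h x y f = 1 / real n * (SUM i:inside_obs n x. (f (x i) - y i)^2) +
  h ^ (2 * m) * dnorm2 m f"

lemma finite_inside_obs [simp]: "finite (inside_obs n x)" "inside_obs n x <= {1..n}"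
 by (auto simp: inside_obs_def)

lemma spline_objective_split:
 assumes "f \<in> sobolev2 m"
 shows "spline_objective m n h x y f = inside_objective m n h x y f +
  1 / real n * (SUM i:{1..n} - inside_obs n x. (f (x i) - y i)^2)"
proof -
 have "(SUM i=1..n. (f (x i) - y i)^2) = (SUM i:{1..n} - inside_obs n x. (f (x i) - y i)^2) + (SUM i:inside_obs n x. (f (x i) - y i)^2)"
  by (rule sum.subset_diff) (auto simp: inside_obs_def)
 then show ?thesis
  unfolding spline_objective_def inside_objective_def sobolev2_penalty_eq[OF assms] by (simp add: algebra_simps add_divide_distrib)
qed

text \<open>The Euler equations of the fit: no knots outside, coefficients orthogonal to polynomials
  of degree below m (so that the derivative of order m vanishes to the left of all active knots),
  and residuals balanced against the coefficients.\<close>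

definition natspline_solves ::
  "nat => nat => real => (nat => real) => (nat => real) => (nat => real) => (nat => real) => bool" where
 "natspline_solves m n h x y a c \<longleftrightarrow>
  (\<forall>i\<in>{1..n} - inside_obs n x. c i = 0) &
  (\<forall>k<m. (SUM i=1..n. c i * x i ^ k) = 0) &
  (\<forall>i\<in>inside_obs n x. (natspline m n x a c (x i) - y i) / real n + h ^ (2 * m) * c i = 0)"

text \<open>By \<open>natspline_energy\<close> both terms become sums over the observations, which
  the third normal equation cancels one by one.\<close>

lemma natspline_solves_orth:
 assumes m: "m >= 1" and s: "natspline_solves m n h x y a c" and f: "f \<in> sobolev2 m"
 shows "1 / real n * (SUM i:inside_obs n x. (natspline m n x a c (x i) - y i) * f (x i)) +
  h ^ (2 * m) * int01 (%t. deriv01 m (natspline m n x a c) t * deriv01 m f t) = 0"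
proof -
 let ?\<phi> = "natspline m n x a c"
 have "((%t. deriv01 m ?\<phi> t * deriv01 m f t) has_integral (SUM i=1..n. c i * f (x i))) {0..1}"
  by (rule natspline_energy[OF m f]) (use s in \<open>auto simp: natspline_solves_def inside_obs_def\<close>)
 then have "int01 (%t. deriv01 m ?\<phi> t * deriv01 m f t) = (SUM i=1..n. c i * f (x i))" by (rule integral_unique)
 also have "... = (SUM i:inside_obs n x. c i * f (x i))"
  by (rule sum.mono_neutral_right) (use s finite_inside_obs(2)[of n x] in \<open>auto simp: natspline_solves_def inside_obs_def\<close>)
 finally have e: "int01 (%t. deriv01 m ?\<phi> t * deriv01 m f t) = (SUM i:inside_obs n x. c i * f (x i))" .
 have "(SUM i:inside_obs n x. ((?\<phi> (x i) - y i) / real n + h ^ (2 * m) * c i) * f (x i)) = 0"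
  by (rule sum.neutral) (use s in \<open>auto simp: natspline_solves_def\<close>)
 moreover have "(SUM i:inside_obs n x. ((?\<phi> (x i) - y i) / real n + h ^ (2 * m) * c i) * f (x i)) =
  1 / real n * (SUM i:inside_obs n x. (?\<phi> (x i) - y i) * f (x i)) + h ^ (2 * m) * (SUM i:inside_obs n x. c i * f (x i))"
  unfolding sum_distrib_left sum.distrib[symmetric] by (intro sum.cong refl) (simp add: distrib_right)
 ultimately show ?thesis unfolding e by simp
qed

text \<open>Completing the square: the cross terms vanish by the weak form of the normal equations,
  tested with \<open>f\<close> and with the spline itself.\<close>

lemma natspline_solves_objective:
 assumes m: "m >= 1" and s: "natspline_solves m n h x y a c" and f: "f \<in> sobolev2 m"
 defines "\<phi> \<equiv> natspline m n x a c"
 shows "inside_objective m n h x y f = inside_objective m n h x y \<phi> +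
  1 / real n * (SUM i:inside_obs n x. (f (x i) - \<phi> (x i))^2) +
  h ^ (2 * m) * int01 (%t. (deriv01 m f t - deriv01 m \<phi> t)^2)"
proof -
 have \<phi>: "\<phi> \<in> sobolev2 m" unfolding \<phi>_def by (rule natspline_sobolev2[OF m])
 define If where "If = int01 (%t. deriv01 m \<phi> t * deriv01 m f t)"
 define Ip where "Ip = int01 (%t. deriv01 m \<phi> t * deriv01 m \<phi> t)"
 define Jf where "Jf = dnorm2 m f"
 define Sf where "Sf = (SUM i:inside_obs n x. (\<phi> (x i) - y i) * f (x i))"
 define Sp where "Sp = (SUM i:inside_obs n x. (\<phi> (x i) - y i) * \<phi> (x i))"
 have Ip2: "dnorm2 m \<phi> = Ip" by (simp add: Ip_def power2_eq_square)
 have o: "1 / real n * Sf + h ^ (2 * m) * If = 0" "1 / real n * Sp + h ^ (2 * m) * Ip = 0"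
  using natspline_solves_orth[OF m s f] natspline_solves_orth[OF m s \<phi>] unfolding \<phi>_def Sf_def Sp_def If_def Ip_def by auto
 have d: "int01 (%t. (deriv01 m f t - deriv01 m \<phi> t)^2) = Jf - 2 * If + Ip"
  using integral_unique[OF sobolev2_sq_diff_has_integral[OF f \<phi>]] unfolding Ip2 Jf_def If_def by simp
 have q: "(SUM i:inside_obs n x. (f (x i) - y i)^2) = (SUM i:inside_obs n x. (\<phi> (x i) - y i)^2)
  + 2 * (Sf - Sp) + (SUM i:inside_obs n x. (f (x i) - \<phi> (x i))^2)"
  unfolding Sf_def Sp_def
  by (simp add: sum.distrib[symmetric] sum_subtractf[symmetric] sum_distrib_left power2_eq_square algebra_simps)
 have "h ^ (2 * m) * Jf - h ^ (2 * m) * (Jf - 2 * If + Ip) - h ^ (2 * m) * Ip + 2 * (1 / real n * (Sf - Sp)) = 0"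
 proof -
  have "1 / real n * (Sf - Sp) = h ^ (2 * m) * Ip - h ^ (2 * m) * If"
   unfolding right_diff_distrib using o by linarith
  moreover have "W * J - W * (J - 2 * A + B) - W * B + 2 * T = 0" if "T = W * B - W * A" for W J A B T :: real
   by (simp add: that algebra_simps)
  ultimately show ?thesis by blast
 qed
 then show ?thesis unfolding inside_objective_def q d Ip2 Jf_def[symmetric]
  by (simp add: distrib_left)
qed

definition unisolvent :: "nat => nat => (nat => real) => bool" where
 "unisolvent m n x \<longleftrightarrow> (\<forall>b. (\<forall>i\<in>inside_obs n x. (SUM k<m. b k * x i ^ k / fact k) = 0) --> (\<forall>k<m. b k = 0))"

lemma unisolvent_if_distinct:
 assumes "inj_on x {1..n}" "x ` {1..n} <= {0..1}" "m <= n"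
 shows "unisolvent m n x"
 unfolding unisolvent_def
proof (intro allI impI, rule ccontr)
 fix b :: "nat => real" and k assume z: "\<forall>i\<in>inside_obs n x. (SUM k<m. b k * x i ^ k / fact k) = 0" and k: "k < m" "b k ~= 0"
 have I: "inside_obs n x = {1..n}" using assms(2) by (auto simp: inside_obs_def)
 have e: "{..m-1} = {..<m}" using k by auto
 let ?Z = "{z. (SUM k<=m-1. (b k / fact k) * z ^ k) = 0}"
 have Z: "finite ?Z & card ?Z <= m - 1"
 proof (rule polyfun_rootbound)
  show "\<exists>k\<le>m-1. b k / fact k ~= 0" using k by (intro exI[of _ k]) auto
 qed
 have "x ` {1..n} <= ?Z" using z unfolding I e by auto
 then have "card (x ` {1..n}) <= m - 1" using Z card_mono by (meson order_trans)
 then show False using assms k by (simp add: card_image)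
qed

text \<open>With zero data the weak equation tested with the spline itself is a vanishing sum of
  nonnegative terms. So the spline vanishes at the observations, the normal equations give c = 0,
  and a polynomial is left.\<close>

lemma natspline_solves_homogeneous:
 assumes m: "m >= 1" and h: "h > 0" and n: "n > 0" and s: "natspline_solves m n h x (%_. 0) a c"
 shows "\<forall>i\<in>{1..n}. c i = 0" "\<forall>i\<in>inside_obs n x. (SUM k<m. a k * x i ^ k / fact k) = 0"
proof -
 let ?\<phi> = "natspline m n x a c"
 have \<phi>: "?\<phi> \<in> sobolev2 m" by (rule natspline_sobolev2[OF m])
 have o: "1 / real n * (SUM i:inside_obs n x. (?\<phi> (x i))^2) + h ^ (2 * m) * int01 (%t. (deriv01 m ?\<phi> t)^2) = 0"
  using natspline_solves_orth[OF m s \<phi>] by (simp add: power2_eq_square)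
 have "0 <= h ^ (2 * m) * int01 (%t. (deriv01 m ?\<phi> t)^2)"
  using sobolev2_integral_sq_nonneg[OF \<phi> order_refl] h by simp
 moreover have nn: "0 <= (SUM i:inside_obs n x. (?\<phi> (x i))^2)" by (intro sum_nonneg) auto
 moreover have "0 <= 1 / real n * (SUM i:inside_obs n x. (?\<phi> (x i))^2)" using nn by simp
 ultimately have "1 / real n * (SUM i:inside_obs n x. (?\<phi> (x i))^2) = 0" using o by linarith
 then have "(SUM i:inside_obs n x. (?\<phi> (x i))^2) = 0" using n by simp
 then have z: "?\<phi> (x i) = 0" if "i \<in> inside_obs n x" for i
  using that by (simp add: sum_nonneg_eq_0_iff)
 have "c i = 0" if i: "i \<in> inside_obs n x" for i
 proof -
  have "(?\<phi> (x i) - 0) / real n + h ^ (2 * m) * c i = 0" using s i unfolding natspline_solves_def by blast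
  then show ?thesis using z[OF i] h by simp
 qed
 then show c: "\<forall>i\<in>{1..n}. c i = 0" using s unfolding natspline_solves_def by blast
 show "\<forall>i\<in>inside_obs n x. (SUM k<m. a k * x i ^ k / fact k) = 0"
 proof
  fix i assume "i \<in> inside_obs n x"
  from z[OF this] show "(SUM k<m. a k * x i ^ k / fact k) = 0" using c by (simp add: natspline_deriv_def)
 qed
qed

text \<open>In the completed square both excess terms must vanish, so the competitor differs from
  the spline by a polynomial of degree below m that vanishes at the observations.\<close>

lemma natspline_solves_unique:
 assumes m: "m >= 1" and h: "h > 0" and n: "n > 0" and s: "natspline_solves m n h x y a c"
  and u: "unisolvent m n x" and f: "f \<in> sobolev2 m"
  and le: "inside_objective m n h x y f <= inside_objective m n h x y (natspline m n x a c)"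
 shows "\<forall>t\<in>{0..1}. f t = natspline m n x a c t"
proof -
 let ?\<phi> = "natspline m n x a c"
 have \<phi>: "?\<phi> \<in> sobolev2 m" by (rule natspline_sobolev2[OF m])
 let ?A = "SUM i:inside_obs n x. (f (x i) - ?\<phi> (x i))^2" and ?B = "int01 (%t. (deriv01 m f t - deriv01 m ?\<phi> t)^2)"
 have "1 / real n * ?A + h ^ (2 * m) * ?B <= 0"
  using natspline_solves_objective[OF m s f] le by linarith
 moreover have A: "0 <= ?A" by (intro sum_nonneg) auto
 moreover have B: "0 <= ?B"
  using sobolev2_sq_diff_has_integral[OF f \<phi>] by (intro integral_nonneg) auto
 moreover have "0 <= 1 / real n * ?A" "0 <= h ^ (2 * m) * ?B" using A B h by simp_all
 ultimately have "1 / real n * ?A = 0" "h ^ (2 * m) * ?B = 0" by linarith+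
 then have A0: "?A = 0" and B0: "?B = 0" using n h by auto
 obtain b where b: "!!t. t \<in> {0..1} ==> f t - ?\<phi> t = (SUM k<m. b k * t ^ k / fact k)"
  using sobolev2_deriv_eq_imp_polynomial[OF f \<phi> m B0] by blast
 have "(SUM k<m. b k * x i ^ k / fact k) = 0" if i: "i \<in> inside_obs n x" for i
 proof -
  have "f (x i) - ?\<phi> (x i) = 0" using A0 i by (simp add: sum_nonneg_eq_0_iff)
  then show ?thesis using b[of "x i"] i by (simp add: inside_obs_def)
 qed
 then have "\<forall>k<m. b k = 0" using u unfolding unisolvent_def by blast
 then show ?thesis using b by (force intro: sum.neutral)
qed

lemma vector_derivative_cong01:
 assumes "!!s. s \<in> {0..1} ==> f s = g s" "t \<in> {0..1}"
 shows "vector_derivative f (at t within {0..1}) = vector_derivative g (at t within {0..1})"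
proof -
 have "(f has_vector_derivative d) (at t within {0..1}) \<longleftrightarrow> (g has_vector_derivative d) (at t within {0..1})" for d
  using assms has_vector_derivative_transform[of t "{0..1}" f g d] has_vector_derivative_transform[of t "{0..1}" g f d] by auto
 then show ?thesis by (simp add: vector_derivative_def)
qed

lemma deriv01_cong:
 assumes "!!t. t \<in> {0..1} ==> f t = g t" "t \<in> {0..1}"
 shows "deriv01 k f t = deriv01 k g t"
 using assms(2)
proof (induction k arbitrary: t)
 case (Suc k)
 then show ?case unfolding deriv01_Suc by (intro vector_derivative_cong01) auto
qed (use assms(1) in simp)

lemma sobolev2_cong:
 assumes eq: "!!t. t \<in> {0..1} ==> f t = g t" and f: "f \<in> sobolev2 m"
 shows "g \<in> sobolev2 m"
proof -
 note d = deriv01_cong[of f g, OF eq]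
 have "deriv01 k g differentiable_on {0..1}" if "deriv01 k f differentiable_on {0..1}" for k
  unfolding differentiable_on_def
 proof
  fix t :: real assume t: "t \<in> {0..1}"
  show "deriv01 k g differentiable (at t within {0..1})"
   by (rule differentiable_transform_within[of "deriv01 k f" _ _ 1]) (use that t d in \<open>auto simp: differentiable_on_def\<close>)
 qed
 moreover have "continuous_on {0..1} (deriv01 k g)" if "continuous_on {0..1} (deriv01 k f)" for k
  by (rule continuous_on_eq[OF that d])
 moreover have "AC01 (deriv01 k g)" if "AC01 (deriv01 k f)" for k
  by (rule absolutely_continuous_fun_on_cong[OF d that])
 moreover have "deriv01 m g \<in> borel_measurable leb01"
  by (rule measurable_cong[THEN iffD1, of "leb01" "deriv01 m f"]) (use d f in \<open>auto simp: sobolev2_def\<close>)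
 moreover have "integrable leb01 (%x. (deriv01 m g x)^2)"
  by (rule Bochner_Integration.integrable_cong[THEN iffD1, of "leb01" _ "%x. (deriv01 m f x)^2"]) (use d f in \<open>auto simp: sobolev2_def\<close>)
 ultimately show ?thesis using f unfolding sobolev2_def by blast
qed

lemma sobolev2_add_polynomial:
 fixes b c x :: "nat => real"
 assumes f: "f \<in> sobolev2 m" and m: "m >= 1"
 defines "g \<equiv> %t. f t + natspline m 0 x b c t"
 shows "g \<in> sobolev2 m" "!!t. t \<in> {0..1} ==> deriv01 m g t = deriv01 m f t"
proof -
 \<comment> \<open>Without knots, the spline is the polynomial with Taylor coefficients
   \<open>b\<close>.\<close>
 let ?p = "natspline m 0 x b c"
 have p: "?p \<in> sobolev2 m" by (rule natspline_sobolev2[OF m])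
 have k: "deriv01 k g t = deriv01 k f t + deriv01 k ?p t" if "k < m" "t \<in> {0..1}" for k t
  using that
 proof (induction k arbitrary: t)
  case (Suc k)
  have "((%t. deriv01 k f t + deriv01 k ?p t) has_vector_derivative deriv01 (Suc k) f t + deriv01 (Suc k) ?p t) (at t within {0..1})"
   using Suc.prems by (intro has_vector_derivative_add sobolev2_deriv[OF f] sobolev2_deriv[OF p]) auto
  then have "(deriv01 k g has_vector_derivative deriv01 (Suc k) f t + deriv01 (Suc k) ?p t) (at t within {0..1})"
   by (rule has_vector_derivative_transform[rotated 2]) (use Suc in auto)
  then show ?case
   unfolding deriv01_Suc[of k g] using Suc.prems by (intro vector_derivative_within_closed_interval) auto
 qed (simp add: g_def)
 have pc: "deriv01 (m - 1) ?p t = b (m - 1)" if "t \<in> {0..1}" for t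
 proof -
  have "deriv01 (m - 1) ?p t = natspline_deriv (m - 1) m 0 x b c t"
   using m that by (intro natspline_deriv01) auto
  also have "... = (SUM k<m. if k = m - 1 then b k else 0)"
  proof -
   have "b k * (if m - 1 <= k then t ^ (k - (m - 1)) / fact (k - (m - 1)) else 0) = (if k = m - 1 then b k else 0)" if "k < m" for k
    using that by (cases "k = m - 1") auto
   then show ?thesis unfolding natspline_deriv_def by simp
  qed
  also have "... = b (m - 1)" using m by simp
  finally show ?thesis .
 qed
 show dm: "deriv01 m g t = deriv01 m f t" if t: "t \<in> {0..1}" for t
 proof -
  have "deriv01 (Suc (m - 1)) g t = vector_derivative (%t. deriv01 (m - 1) f t + b (m - 1)) (at t within {0..1})"
   unfolding deriv01_Suc using m t k[of "m-1"] pc by (intro vector_derivative_cong01) auto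
  \<comment> \<open>Adding a constant does not change which numbers are derivatives, so both sides
    agree even where no derivative exists and the value is unspecified.\<close>
  also have "... = vector_derivative (deriv01 (m - 1) f) (at t within {0..1})"
  proof -
   have "((%t. deriv01 (m - 1) f t + b (m - 1)) has_vector_derivative d) (at t within {0..1}) \<longleftrightarrow> (deriv01 (m - 1) f has_vector_derivative d) (at t within {0..1})" for d
    using has_derivative_add_const[of "deriv01 (m - 1) f" "%h. h *\<^sub>R d" "at t within {0..1}" "b (m - 1)"]
     has_derivative_add_const[of "%t. deriv01 (m - 1) f t + b (m - 1)" "%h. h *\<^sub>R d" "at t within {0..1}" "- b (m - 1)"]
    by (auto simp: has_vector_derivative_def)
   then show ?thesis by (simp add: vector_derivative_def)
  qed
  finally show ?thesis using m deriv01_Suc[of "m-1" f] by simp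
 qed
 have "deriv01 j g differentiable_on {0..1}" if "j < m - 1" for j
 proof -
  have "(%t. deriv01 j f t + deriv01 j ?p t) differentiable_on {0..1}"
   using f p that by (intro differentiable_on_add) (auto simp: sobolev2_def)
  moreover have "j < m" using that by simp
  ultimately show ?thesis unfolding differentiable_on_def
   using k[of j] differentiable_transform_within[of "%t. deriv01 j f t + deriv01 j ?p t" _ "{0..1}" 1 "deriv01 j g"] by auto
 qed
 moreover have ac: "AC01 (deriv01 (m - 1) g)"
  by (rule absolutely_continuous_fun_on_cong[OF _ absolutely_continuous_fun_on_add[OF sobolev2_absolutely_continuous[OF f] sobolev2_absolutely_continuous[OF p]]])
   (use m k in auto)
 moreover have "deriv01 m g \<in> borel_measurable leb01"
  by (rule measurable_cong[THEN iffD1, of "leb01" "deriv01 m f"]) (use dm f in \<open>auto simp: sobolev2_def\<close>)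
 moreover have "integrable leb01 (%x. (deriv01 m g x)^2)"
  by (rule Bochner_Integration.integrable_cong[THEN iffD1, of "leb01" _ "%x. (deriv01 m f x)^2"]) (use dm f in \<open>auto simp: sobolev2_def\<close>)
 ultimately show "g \<in> sobolev2 m"
  unfolding sobolev2_def using absolutely_continuous_fun_on_imp_continuous_on[OF ac] by blast
qed

section \<open>The linear system and its solution by Cramer's rule\<close>

text \<open>The indicators remove an observation outside the unit interval from the orthogonality
  rows and reduce its own row to \<open>h ^ (2 * m)\<close> times its coefficient, so such data
  never make the system singular.\<close>

definition spline_entry :: "nat => nat => real => (nat => real) => nat => nat => real" where
 "spline_entry m n h x r s =
  (if r < m then
    (if s < m then 0 else indicator {0..1} (x (Suc (s - m))) * x (Suc (s - m)) ^ r)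
   else
    indicator {0..1} (x (Suc (r - m))) *
     (if s < m then x (Suc (r - m)) ^ s / fact s
     else (-1) ^ m * tpow (2 * m - 1) (x (Suc (s - m))) (x (Suc (r - m)))) / real n +
    (if r = s then h ^ (2 * m) else 0))"

text \<open>Coordinates below m are polynomial coefficients and coordinate m + i - 1 belongs to observation i;
 the rows are the orthogonality conditions followed by the normal equations at the observations.\<close>

definition spline_matrix :: "nat => nat => real => (nat => real) => real mat" where
 "spline_matrix m n h x = mat (m + n) (m + n) (%(r, s). spline_entry m n h x r s)"

lemma spline_matrix_carrier [simp]: "spline_matrix m n h x \<in> carrier_mat (m + n) (m + n)"
 by (simp add: spline_matrix_def)

lemma sum_split_coords:
 fixes f :: "nat => real"
 shows "(SUM s<m+n. f s) = (SUM s<m. f s) + (SUM i=1..n. f (m + i - 1))"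
proof -
 have "(SUM s<m+n. f s) = (SUM s<m. f s) + (SUM j<n. f (m + j))"
  using sum.atLeastLessThan_concat[of 0 m "m+n" f] sum.shift_bounds_nat_ivl[of f 0 m n]
  by (simp add: atLeast0LessThan add.commute)
 also have "(SUM j<n. f (m + j)) = (SUM i=1..n. f (m + i - 1))"
  by (rule sum.reindex_bij_witness[of _ "%i. i - 1" Suc]) auto
 finally show ?thesis .
qed

lemma spline_rows:
 fixes z :: "nat => real"
 assumes m: "m >= 1" and h: "h > 0" and n: "n > 0"
 shows "(\<forall>r<m+n. (SUM s<m+n. spline_entry m n h x r s * z s) =
    (if r < m then 0 else indicator {0..1} (x (Suc (r - m))) * y (Suc (r - m)) / real n)) \<longleftrightarrow>
  natspline_solves m n h x y z (%i. z (m + i - 1))" (is "?L \<longleftrightarrow> ?R")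
proof -
 define c where "c i = z (m + i - 1)" for i
 let ?in = "%i. indicator {0..1} (x i) :: real"
 have r1: "(SUM s<m+n. spline_entry m n h x r s * z s) = (SUM i=1..n. ?in i * (c i * x i ^ r))" if "r < m" for r
 proof -
  have "(SUM i=1..n. spline_entry m n h x r (m + i - 1) * z (m + i - 1)) = (SUM i=1..n. ?in i * (c i * x i ^ r))"
   by (rule sum.cong) (use that in \<open>auto simp: spline_entry_def c_def\<close>)
  moreover have "(SUM s<m. spline_entry m n h x r s * z s) = 0"
   by (rule sum.neutral) (use that in \<open>auto simp: spline_entry_def\<close>)
  ultimately show ?thesis by (simp add: sum_split_coords)
 qed
 have r2: "(SUM s<m+n. spline_entry m n h x (m + i - 1) s * z s) = ?in i * natspline m n x z c (x i) / real n + h ^ (2 * m) * c i"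
  if i: "i \<in> {1..n}" for i
 proof -
  have Si: "Suc (m + i - 1 - m) = i" "\<not> m + i - 1 < m" using i by auto
  have a: "(SUM s<m. spline_entry m n h x (m + i - 1) s * z s) = ?in i * (SUM k<m. z k * (x i ^ k / fact k)) / real n"
   unfolding sum_distrib_left sum_divide_distrib
  proof (rule sum.cong)
   fix s assume "s \<in> {..<m}"
   then have "spline_entry m n h x (m + i - 1) s = ?in i * (x i ^ s / fact s) / real n"
    unfolding spline_entry_def using i Si by auto
   then show "spline_entry m n h x (m + i - 1) s * z s = ?in i * (z s * (x i ^ s / fact s)) / real n" by simp
  qed simp
  have "(SUM j=1..n. spline_entry m n h x (m + i - 1) (m + j - 1) * z (m + j - 1)) =
    (SUM j=1..n. ?in i * (c j * ((-1) ^ m * tpow (2 * m - 1) (x j) (x i))) / real n + (if j = i then h ^ (2 * m) * c i else 0))"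
  proof (rule sum.cong)
   fix j assume j: "j \<in> {1..n}"
   have Sj: "Suc (m + j - 1 - m) = j" "\<not> m + j - 1 < m" "m + i - 1 = m + j - 1 \<longleftrightarrow> j = i" using i j by auto
   have "spline_entry m n h x (m + i - 1) (m + j - 1) = ?in i * ((-1) ^ m * tpow (2 * m - 1) (x j) (x i)) / real n + (if j = i then h ^ (2 * m) else 0)"
    unfolding spline_entry_def Si(1) Sj(1) Sj(3) using Si Sj by simp
   then show "spline_entry m n h x (m + i - 1) (m + j - 1) * z (m + j - 1) =
     ?in i * (c j * ((-1) ^ m * tpow (2 * m - 1) (x j) (x i))) / real n + (if j = i then h ^ (2 * m) * c i else 0)"
    by (simp add: c_def algebra_simps)
  qed simp
  also have "... = ?in i * (SUM j=1..n. c j * ((-1) ^ m * tpow (2 * m - 1) (x j) (x i))) / real n + h ^ (2 * m) * c i"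
  proof -
   have "(SUM j=1..n. if j = i then h ^ (2 * m) * c i else 0) = h ^ (2 * m) * c i" using i by simp
   then show ?thesis unfolding sum.distrib sum_distrib_left sum_divide_distrib by (rule arg_cong)
  qed
  finally show ?thesis using a unfolding sum_split_coords
   by (simp add: natspline_deriv_def add_divide_distrib distrib_left)
 qed
 have cz: "c i = 0" if "?in i * natspline m n x z c (x i) / real n + h ^ (2 * m) * c i = ?in i * y i / real n" "x i ~: {0..1}" for i
 proof -
  have "?in i = 0" using that(2) by simp
  then have "h ^ (2 * m) * c i = 0" using that(1) by (simp only:)
  then show ?thesis using h by simp
 qed
 have "?L \<longleftrightarrow> (\<forall>r<m. (SUM i=1..n. ?in i * (c i * x i ^ r)) = 0) &
  (\<forall>i\<in>{1..n}. ?in i * natspline m n x z c (x i) / real n + h ^ (2 * m) * c i = ?in i * y i / real n)"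
 proof (intro iffI conjI allI impI ballI)
  fix r assume L: ?L and r: "r < m"
  then show "(SUM i=1..n. ?in i * (c i * x i ^ r)) = 0" using r1[OF r] spec[OF L, of r] by simp
 next
  fix i assume L: ?L and i: "i \<in> {1..n}"
  then show "?in i * natspline m n x z c (x i) / real n + h ^ (2 * m) * c i = ?in i * y i / real n"
   using r2[OF i] spec[OF L, of "m + i - 1"] by auto
 next
  fix r assume H: "(\<forall>r<m. (SUM i=1..n. ?in i * (c i * x i ^ r)) = 0) &
  (\<forall>i\<in>{1..n}. ?in i * natspline m n x z c (x i) / real n + h ^ (2 * m) * c i = ?in i * y i / real n)" and r: "r < m + n"
  show "(SUM s<m+n. spline_entry m n h x r s * z s) =
    (if r < m then 0 else indicator {0..1} (x (Suc (r - m))) * y (Suc (r - m)) / real n)"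
  proof (cases "r < m")
   case False
   then have i: "Suc (r - m) \<in> {1..n}" "m + Suc (r - m) - 1 = r" using r by auto
   show ?thesis using r2[OF i(1)] H i False by auto
  qed (use r1 H in auto)
 qed
 also have "... \<longleftrightarrow> natspline_solves m n h x y z c"
 proof
  assume H: "(\<forall>r<m. (SUM i=1..n. ?in i * (c i * x i ^ r)) = 0) &
  (\<forall>i\<in>{1..n}. ?in i * natspline m n x z c (x i) / real n + h ^ (2 * m) * c i = ?in i * y i / real n)"
  have c0: "\<forall>i\<in>{1..n} - inside_obs n x. c i = 0"
  proof
   fix i assume "i \<in> {1..n} - inside_obs n x"
   then have "i \<in> {1..n}" "x i ~: {0..1}" by (auto simp: inside_obs_def)
   then show "c i = 0" using cz[of i] H by blast
  qed
  have "(SUM i=1..n. c i * x i ^ k) = (SUM i=1..n. ?in i * (c i * x i ^ k))" for k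
   by (rule sum.cong) (use c0 in \<open>auto simp: inside_obs_def indicator_def\<close>)
  moreover have "(natspline m n x z c (x i) - y i) / real n + h ^ (2 * m) * c i = 0" if "i \<in> inside_obs n x" for i
  proof -
   have "i \<in> {1..n}" "?in i = 1" using that by (auto simp: inside_obs_def)
   then have "1 * natspline m n x z c (x i) / real n + h ^ (2 * m) * c i = 1 * y i / real n" using H by metis
   then show ?thesis by (simp add: diff_divide_distrib)
  qed
  ultimately show "natspline_solves m n h x y z c" using H c0 unfolding natspline_solves_def by auto
 next
  assume R: "natspline_solves m n h x y z c"
  then have c0: "\<forall>i\<in>{1..n} - inside_obs n x. c i = 0" by (simp add: natspline_solves_def)
  have "(SUM i=1..n. ?in i * (c i * x i ^ k)) = (SUM i=1..n. c i * x i ^ k)" for k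
   by (rule sum.cong) (use c0 in \<open>auto simp: inside_obs_def indicator_def\<close>)
  moreover have "?in i * natspline m n x z c (x i) / real n + h ^ (2 * m) * c i = ?in i * y i / real n" if i: "i \<in> {1..n}" for i
  proof (cases "i \<in> inside_obs n x")
   case True
   then have "(natspline m n x z c (x i) - y i) / real n + h ^ (2 * m) * c i = 0" using R by (simp add: natspline_solves_def)
   then show ?thesis using True by (simp add: inside_obs_def diff_divide_distrib)
  next
   case False
   then show ?thesis using c0 i by (simp add: inside_obs_def)
  qed
  ultimately show "(\<forall>r<m. (SUM i=1..n. ?in i * (c i * x i ^ r)) = 0) &
  (\<forall>i\<in>{1..n}. ?in i * natspline m n x z c (x i) / real n + h ^ (2 * m) * c i = ?in i * y i / real n)"
   using R by (simp add: natspline_solves_def)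
 qed
 finally show ?thesis unfolding c_def .
qed

lemma spline_matrix_mult_vec:
 assumes "v \<in> carrier_vec (m + n)" "r < m + n"
 shows "vec_index (spline_matrix m n h x *\<^sub>v v) r = (SUM s<m+n. spline_entry m n h x r s * vec_index v s)"
 using assms by (simp add: spline_matrix_def scalar_prod_def atLeast0LessThan)

text \<open>Kernel vectors of the matrix are the splines that solve the problem with zero data.
  These have c = 0 and a polynomial part vanishing at the inside observations, so they are trivial
  exactly in the unisolvent case, whatever \<open>h\<close> is.\<close>

lemma spline_det_nonzero_iff:
 assumes m: "m >= 1" and h: "h > 0" and n: "n > 0"
 shows "Determinant.det (spline_matrix m n h x) ~= 0 \<longleftrightarrow> unisolvent m n x"
proof -
 have kernel: "(\<exists>v. v \<in> carrier_vec (m+n) & v ~= 0\<^sub>v (m+n) & spline_matrix m n h x *\<^sub>v v = 0\<^sub>v (m+n)) \<longleftrightarrow>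
  (\<exists>z. (\<exists>s<m+n. z s ~= 0) & natspline_solves m n h x (%_. 0) z (%i. z (m + i - 1)))"
 proof
  assume "\<exists>v. v \<in> carrier_vec (m+n) & v ~= 0\<^sub>v (m+n) & spline_matrix m n h x *\<^sub>v v = 0\<^sub>v (m+n)"
  then obtain v where v: "v \<in> carrier_vec (m+n)" "v ~= 0\<^sub>v (m+n)" "spline_matrix m n h x *\<^sub>v v = 0\<^sub>v (m+n)" by blast
  have "\<exists>s<m+n. vec_index v s ~= 0" using v(1,2) by (auto intro!: eq_vecI)
  moreover have "natspline_solves m n h x (%_. 0) (vec_index v) (%i. vec_index v (m + i - 1))"
  proof (rule spline_rows[OF m h n, THEN iffD1], intro allI impI)
   fix r assume r: "r < m + n"
   then show "(SUM s<m+n. spline_entry m n h x r s * vec_index v s) = (if r < m then 0 else indicator {0..1} (x (Suc (r - m))) * 0 / real n)"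
    using spline_matrix_mult_vec[OF v(1) r, of h x] v(3) by simp
  qed
  ultimately show "\<exists>z. (\<exists>s<m+n. z s ~= 0) & natspline_solves m n h x (%_. 0) z (%i. z (m + i - 1))" by blast
 next
  assume "\<exists>z. (\<exists>s<m+n. z s ~= 0) & natspline_solves m n h x (%_. 0) z (%i. z (m + i - 1))"
  then obtain z where z: "\<exists>s<m+n. z s ~= 0" "natspline_solves m n h x (%_. 0) z (%i. z (m + i - 1))" by blast
  define v where "v = vec (m + n) z"
  have v: "v \<in> carrier_vec (m+n)" by (simp add: v_def)
  have "v ~= 0\<^sub>v (m+n)" using z(1) by (metis index_vec index_zero_vec(1) v_def)
  moreover have "spline_matrix m n h x *\<^sub>v v = 0\<^sub>v (m+n)"
  proof (rule eq_vecI)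
   fix r assume "r < dim_vec (0\<^sub>v (m+n) :: real vec)"
   then have r: "r < m + n" by simp
   have "vec_index (spline_matrix m n h x *\<^sub>v v) r = (SUM s<m+n. spline_entry m n h x r s * z s)"
    unfolding spline_matrix_mult_vec[OF v r] by (rule sum.cong) (auto simp: v_def)
   also have "... = 0" using spline_rows[OF m h n, THEN iffD2, OF z(2), rule_format, OF r] by simp
   finally show "vec_index (spline_matrix m n h x *\<^sub>v v) r = vec_index (0\<^sub>v (m+n)) r" using r by simp
  qed (simp add: spline_matrix_def)
  ultimately show "\<exists>v. v \<in> carrier_vec (m+n) & v ~= 0\<^sub>v (m+n) & spline_matrix m n h x *\<^sub>v v = 0\<^sub>v (m+n)" using v by blast
 qed
 have "\<not> unisolvent m n x \<longleftrightarrow> (\<exists>z. (\<exists>s<m+n. z s ~= 0) & natspline_solves m n h x (%_. 0) z (%i. z (m + i - 1)))"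
 proof
  assume "\<not> unisolvent m n x"
  then obtain b k where b: "\<forall>i\<in>inside_obs n x. (SUM k<m. b k * x i ^ k / fact k) = 0" "k < m" "b k ~= 0"
   unfolding unisolvent_def by blast
  define z where "z s = (if s < m then b s else 0)" for s
  have c: "z (m + i - 1) = 0" if "i \<in> {1..n}" for i using that by (auto simp: z_def)
  have "natspline m n x z (%i. z (m + i - 1)) t = (SUM k<m. b k * t ^ k / fact k)" for t
   using c by (simp add: natspline_deriv_def z_def)
  then have "natspline_solves m n h x (%_. 0) z (%i. z (m + i - 1))"
   unfolding natspline_solves_def using b(1) c by (auto simp: inside_obs_def)
  moreover have "\<exists>s<m+n. z s ~= 0" using b by (intro exI[of _ k]) (auto simp: z_def)
  ultimately show "\<exists>z. (\<exists>s<m+n. z s ~= 0) & natspline_solves m n h x (%_. 0) z (%i. z (m + i - 1))" by blast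
 next
  assume "\<exists>z. (\<exists>s<m+n. z s ~= 0) & natspline_solves m n h x (%_. 0) z (%i. z (m + i - 1))"
  then obtain z s where z: "s < m + n" "z s ~= 0" "natspline_solves m n h x (%_. 0) z (%i. z (m + i - 1))" by blast
  note hom = natspline_solves_homogeneous[OF m h n z(3)]
  have "s < m"
  proof (rule ccontr)
   assume "\<not> s < m"
   then have "Suc (s - m) \<in> {1..n}" "m + Suc (s - m) - 1 = s" using z(1) by auto
   then show False using hom(1) z(2) by metis
  qed
  then show "\<not> unisolvent m n x" using hom(2) z(2) unfolding unisolvent_def by blast
 qed
 then show ?thesis
  using det_0_iff_vec_prod_zero_field[OF spline_matrix_carrier, of m n h x] kernel by blast
qed

text \<open>Cramer's rule: ratios of determinants are visibly measurable in the design and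
  continuous in \<open>h\<close>. For a singular matrix division by zero gives 0, in agreement with
  the default value of \<open>smoothing_spline\<close>.\<close>

definition spline_coef :: "nat => nat => real => (nat => real) => nat => nat => real" where
 "spline_coef m n h x s i = adj_mat (spline_matrix m n h x) $$ (s, m + i - 1) / Determinant.det (spline_matrix m n h x) *
  (indicator {0..1} (x i) / real n)"

definition spline_solution :: "nat => nat => real => (nat => real) => (nat => real) => nat => real" where
 "spline_solution m n h x y s = (SUM i=1..n. spline_coef m n h x s i * y i)"

text \<open>For a nonsingular matrix this is the spline fitted to the i-th unit vector of
  data.\<close>

definition smoother_weight :: "nat => nat => real => (nat => real) => nat => real => real" where
 "smoother_weight m n h x i t = natspline m n x (%k. spline_coef m n h x k i) (%j. spline_coef m n h x (m + j - 1) i) t"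

lemma spline_solution_solves:
 assumes m: "m >= 1" and h: "h > 0" and n: "n > 0" and u: "unisolvent m n x"
 shows "natspline_solves m n h x y (spline_solution m n h x y) (%i. spline_solution m n h x y (m + i - 1))"
proof (rule spline_rows[OF m h n, THEN iffD1], intro allI impI)
 let ?A = "spline_matrix m n h x"
 have det: "Determinant.det ?A ~= 0" using spline_det_nonzero_iff[OF m h n] u by simp
 fix r assume r: "r < m + n"
 have adj: "(SUM s<m+n. spline_entry m n h x r s * adj_mat ?A $$ (s, q)) = (if r = q then Determinant.det ?A else 0)" if q: "q < m + n" for q
 proof -
  have c: "adj_mat ?A \<in> carrier_mat (m+n) (m+n)" by (rule adj_mat(1)[OF spline_matrix_carrier])
  have "(?A * adj_mat ?A) $$ (r, q) = (SUM s<m+n. ?A $$ (r, s) * adj_mat ?A $$ (s, q))"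
   using r q c by (simp add: scalar_prod_def atLeast0LessThan spline_matrix_def)
  also have "... = (SUM s<m+n. spline_entry m n h x r s * adj_mat ?A $$ (s, q))"
   by (rule sum.cong) (use r in \<open>auto simp: spline_matrix_def\<close>)
  finally have "(SUM s<m+n. spline_entry m n h x r s * adj_mat ?A $$ (s, q)) = (Determinant.det ?A \<cdot>\<^sub>m 1\<^sub>m (m+n)) $$ (r, q)"
   unfolding adj_mat(2)[OF spline_matrix_carrier] by (rule sym)
  then show ?thesis using r q by simp
 qed
 have "(SUM s<m+n. spline_entry m n h x r s * spline_solution m n h x y s) =
  (SUM i=1..n. (SUM s<m+n. spline_entry m n h x r s * adj_mat ?A $$ (s, m + i - 1)) / Determinant.det ?A * (indicator {0..1} (x i) / real n) * y i)"
  unfolding spline_solution_def spline_coef_def sum_distrib_left sum_distrib_right sum_divide_distrib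
  by (subst sum.swap) (simp add: mult_ac)
 also have "... = (SUM i=1..n. (if r = m + i - 1 then indicator {0..1} (x i) * y i / real n else 0))"
  by (rule sum.cong) (use det adj in auto)
 also have "... = (if r < m then 0 else indicator {0..1} (x (Suc (r - m))) * y (Suc (r - m)) / real n)"
 proof (cases "r < m")
  case True
  then show ?thesis by (auto intro!: sum.neutral)
 next
  case False
  have "(SUM i=1..n. (if r = m + i - 1 then indicator {0..1} (x i) * y i / real n else 0)) =
   (SUM i=1..n. (if i = Suc (r - m) then indicator {0..1} (x i) * y i / real n else 0))"
   by (rule sum.cong) (use False in auto)
  then show ?thesis using False r by auto
 qed
 finally show "(SUM s<m+n. spline_entry m n h x r s * spline_solution m n h x y s) =
  (if r < m then 0 else indicator {0..1} (x (Suc (r - m))) * y (Suc (r - m)) / real n)" .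
qed

lemma natspline_solution:
 "natspline m n x (spline_solution m n h x y) (%i. spline_solution m n h x y (m + i - 1)) t =
  (SUM i=1..n. smoother_weight m n h x i t * y i)"
proof -
 have 1: "(SUM k<m. spline_solution m n h x y k * B k) = (SUM i=1..n. (SUM k<m. spline_coef m n h x k i * B k) * y i)" for B
  unfolding spline_solution_def sum_distrib_right by (subst sum.swap) (simp add: mult_ac)
 have 2: "(SUM j=1..n. spline_solution m n h x y (m + j - 1) * B j) = (SUM i=1..n. (SUM j=1..n. spline_coef m n h x (m + j - 1) i * B j) * y i)" for B
  unfolding spline_solution_def sum_distrib_right by (subst sum.swap) (simp add: mult_ac)
 show ?thesis unfolding smoother_weight_def natspline_deriv_def 1 2 by (simp add: sum.distrib distrib_right)
qed

text \<open>An extensional minimiser takes the value undefined at design points outside the unit interval,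
 whereas its competitors are unconstrained there. It is therefore only optimal when that value
 happens to be the mean of the observations at each such point. This is a null event, but it has to be
 described exactly to obtain measurability of the estimator on the whole probability space.\<close>

definition outside_fit :: "nat => (nat => real) => (nat => real) => bool" where
 "outside_fit n x y \<longleftrightarrow> (\<forall>i\<in>{1..n}. x i \<in> {0..1} | (SUM j=1..n. if x j = x i then undefined - y j else 0) = 0)"

section \<open>Minimizers and the linear smoother\<close>

text \<open>Observations that share an outside point are grouped: \<open>undefined\<close> is their
  mean, hence the least squares constant of the group.\<close>

lemma outside_fit_le:
 assumes "outside_fit n x y"
 shows "(SUM i:{1..n} - inside_obs n x. (undefined - y i)^2) <= (SUM i:{1..n} - inside_obs n x. (g (x i) - y i)^2)"
proof -
 let ?O = "{1..n} - inside_obs n x"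
 have grp: "(SUM j:{j\<in>?O. x j = z}. undefined - y j) = 0" if z: "z \<in> x ` ?O" for z
 proof -
  obtain i where i: "i \<in> ?O" "z = x i" using z by blast
  then have "x i ~: {0..1}" "i \<in> {1..n}" by (auto simp: inside_obs_def)
  then have "(SUM j=1..n. if x j = x i then undefined - y j else 0) = 0" using assms unfolding outside_fit_def by blast
  moreover have "(SUM j=1..n. if x j = x i then undefined - y j else 0) = (SUM j:{j\<in>{1..n}. x j = x i}. undefined - y j)"
   by (rule sum.inter_filter[symmetric]) simp
  moreover have "{j\<in>{1..n}. x j = x i} = {j\<in>?O. x j = z}" using i \<open>x i ~: {0..1}\<close> by (auto simp: inside_obs_def)
  ultimately show ?thesis by simp
 qed
 have "(SUM i:?O. (g (x i) - undefined) * (undefined - y i)) = (SUM z:x ` ?O. SUM i:{i\<in>?O. x i = z}. (g (x i) - undefined) * (undefined - y i))"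
  by (rule sum.image_gen) simp
 also have "... = (SUM z:x ` ?O. (g z - undefined) * (SUM i:{i\<in>?O. x i = z}. undefined - y i))"
  unfolding sum_distrib_left by (intro sum.cong refl) auto
 also have "... = 0" using grp by (intro sum.neutral) auto
 finally have c: "(SUM i:?O. (g (x i) - undefined) * (undefined - y i)) = 0" .
 have "(SUM i:?O. (g (x i) - y i)^2) = (SUM i:?O. (undefined - y i)^2) + 2 * (SUM i:?O. (g (x i) - undefined) * (undefined - y i)) + (SUM i:?O. (g (x i) - undefined)^2)"
  unfolding sum_distrib_left sum.distrib[symmetric] by (intro sum.cong refl) (simp add: power2_eq_square algebra_simps)
 then show ?thesis using c sum_nonneg[of ?O "%i. (g (x i) - undefined)^2"] by simp
qed

text \<open>The competitor is redefined off the unit interval to agree with \<open>f\<close> there.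
  This leaves it in the Sobolev space and cancels the outside residuals.\<close>

lemma is_smoothing_spline_inside:
 assumes f: "f \<in> sobolev2 m" and n: "n > 0" and s: "is_smoothing_spline m n h x y f" and g: "g \<in> sobolev2 m"
 shows "inside_objective m n h x y f <= inside_objective m n h x y g"
proof -
 define g' where "g' t = (if t \<in> {0..1} then g t else f t)" for t
 have g': "g' \<in> sobolev2 m" by (rule sobolev2_cong[OF _ g]) (simp add: g'_def)
 have "inside_objective m n h x y g' = inside_objective m n h x y g"
 proof -
  have "int01 (%t. (deriv01 m g' t)^2) = dnorm2 m g"
   by (rule integral_cong) (use deriv01_cong[of g' g _ m] in \<open>auto simp: g'_def\<close>)
  moreover have "(SUM i:inside_obs n x. (g' (x i) - y i)^2) = (SUM i:inside_obs n x. (g (x i) - y i)^2)"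
   by (rule sum.cong) (auto simp: g'_def inside_obs_def)
  ultimately show ?thesis by (simp add: inside_objective_def)
 qed
 moreover have "(SUM i:{1..n} - inside_obs n x. (g' (x i) - y i)^2) = (SUM i:{1..n} - inside_obs n x. (f (x i) - y i)^2)"
  by (rule sum.cong) (auto simp: g'_def inside_obs_def)
 moreover have "spline_objective m n h x y f <= spline_objective m n h x y g'"
  using s g' by (simp add: is_smoothing_spline_def)
 ultimately show ?thesis using spline_objective_split[OF f] spline_objective_split[OF g'] by simp
qed

lemma is_smoothing_spline_outside_fit:
 assumes f: "f \<in> sobolev2 m" and n: "n > 0" and s: "is_smoothing_spline m n h x y f" and e: "f \<in> extensional {0..1}"
 shows "outside_fit n x y"
 unfolding outside_fit_def
proof (intro ballI, rule ccontr)
 fix i assume i: "i \<in> {1..n}" and "\<not> (x i \<in> {0..1} | (SUM j=1..n. if x j = x i then undefined - y j else 0) = 0)"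
 then have xi: "x i ~: {0..1}" and S: "(SUM j=1..n. if x j = x i then undefined - y j else 0) ~= 0" by auto
 define S where "S = (SUM j=1..n. if x j = x i then undefined - y j else 0)"
 \<comment> \<open>Moving the value at \<open>x i\<close> by \<open>d\<close> changes the residual
   sum by at most 2 d S + n d^2, and this choice makes that bound - S^2 / n, which is
   negative.\<close>
 define d where "d = - S / real n"
 define g where "g t = (if t = x i then f t + d else f t)" for t
 have g: "g \<in> sobolev2 m" by (rule sobolev2_cong[OF _ f]) (use xi in \<open>auto simp: g_def\<close>)
 have fu: "f (x j) = undefined" if "x j = x i" for j using that xi e by (simp add: extensional_def)
 have "(LINT t|leb01. (deriv01 m g t)^2) = (LINT t|leb01. (deriv01 m f t)^2)"
  by (rule Bochner_Integration.integral_cong) (use deriv01_cong[of g f _ m] xi in \<open>auto simp: g_def\<close>)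
 then have "(SUM j=1..n. (f (x j) - y j)^2) <= (SUM j=1..n. (g (x j) - y j)^2)"
  using s g n by (auto simp: is_smoothing_spline_def spline_objective_def divide_le_cancel)
 also have "... = (SUM j=1..n. (f (x j) - y j)^2 + (2 * d * (if x j = x i then undefined - y j else 0) + (if x j = x i then d^2 else 0)))"
  by (intro sum.cong refl) (auto simp: g_def fu power2_eq_square algebra_simps)
 also have "... = (SUM j=1..n. (f (x j) - y j)^2) + (2 * d * S + (SUM j=1..n. if x j = x i then d^2 else 0))"
  by (simp only: sum.distrib sum_distrib_left[symmetric] S_def)
 finally have "0 <= 2 * d * S + (SUM j=1..n. if x j = x i then d^2 else 0)" by simp
 also have "(SUM j=1..n. if x j = x i then d^2 else 0) <= (SUM j=1..n. d^2)" by (rule sum_mono) auto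
 also have "(SUM j=1..n. d^2) = real n * d^2" by simp
 finally have "0 <= 2 * d * S + real n * d^2" by simp
 also have "2 * d * S + real n * d^2 = - (S^2 / real n)" using n by (simp add: d_def power2_eq_square field_simps)
 finally have "S^2 / real n <= 0" by simp
 moreover have "S ~= 0" using S unfolding S_def .
 then have "0 < S^2 / real n" using n by simp
 ultimately show False by linarith
qed

text \<open>A nonzero polynomial of degree below m that vanishes at the inside observations can be
  added to a minimizer. Having finitely many zeros, it changes the function somewhere on the unit
  interval.\<close>

lemma not_unisolvent_not_unique:
 assumes m: "m >= 1" and n: "n > 0" and u: "\<not> unisolvent m n x"
 shows "\<not> (\<exists>!f. f \<in> extensional {0..1} & is_smoothing_spline m n h x y f)"
proof
 assume "\<exists>!f. f \<in> extensional {0..1} & is_smoothing_spline m n h x y f"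
 then obtain f where f: "f \<in> extensional {0..1}" "is_smoothing_spline m n h x y f"
  and uniq: "!!g. g \<in> extensional {0..1} ==> is_smoothing_spline m n h x y g ==> g = f" by blast
 have fs: "f \<in> sobolev2 m" using f by (simp add: is_smoothing_spline_def)
 obtain b k where b: "\<forall>i\<in>inside_obs n x. (SUM k<m. b k * x i ^ k / fact k) = 0" "k < m" "b k ~= 0"
  using u unfolding unisolvent_def by blast
 define p where "p t = (SUM k<m. b k * t ^ k / fact k)" for t
 have p: "natspline m 0 x b b t = p t" for t by (simp add: natspline_deriv_def p_def)
 define g where "g = restrict (%t. f t + p t) {0..1}"
 note poly = sobolev2_add_polynomial[OF fs m, where x=x and b=b and c=b, unfolded p]
 have g: "g \<in> sobolev2 m" by (rule sobolev2_cong[OF _ poly(1)]) (simp add: g_def)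
 have pen: "(LINT t|leb01. (deriv01 m g t)^2) = (LINT t|leb01. (deriv01 m f t)^2)"
  by (rule Bochner_Integration.integral_cong)
   (use deriv01_cong[of g "%t. f t + p t" _ m] poly(2) in \<open>auto simp: g_def\<close>)
 have gx: "g (x i) = f (x i)" if i: "i \<in> {1..n}" for i
 proof (cases "i \<in> inside_obs n x")
  case True
  then show ?thesis using b(1) by (simp add: g_def p_def inside_obs_def)
 next
  case False
  then have "x i ~: {0..1}" using i by (simp add: inside_obs_def)
  then show ?thesis using f(1) unfolding g_def extensional_def by (simp del: atLeastAtMost_iff)
 qed
 have "(SUM i=1..n. \<bar>g (x i) - y i\<bar>^2) = (SUM i=1..n. \<bar>f (x i) - y i\<bar>^2)"
  by (rule sum.cong) (use gx in auto)
 then have "is_smoothing_spline m n h x y g"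
  using f(2) g pen unfolding is_smoothing_spline_def spline_objective_def by simp
 then have gf: "g = f" by (intro uniq) (simp_all add: g_def)
 have z: "p t = 0" if "t \<in> {0..1}" for t
 proof -
  have "g t = f t + p t" using that by (simp add: g_def)
  then show ?thesis unfolding gf by simp
 qed
 have e: "{..m-1} = {..<m}" using m by auto
 let ?Z = "{z. (SUM k<=m-1. (b k / fact k) * z ^ k) = 0}"
 have "finite ?Z & card ?Z <= m - 1"
 proof (rule polyfun_rootbound)
  show "\<exists>k\<le>m-1. b k / fact k ~= 0" using b by (intro exI[of _ k]) auto
 qed
 moreover have "{0..1} <= ?Z" using z unfolding e p_def by auto
 ultimately show False using finite_subset[of "{0..1::real}" ?Z] infinite_Icc[of 0 "1::real"] by (simp only: zero_less_one) blast
qed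

text \<open>Valid for all data, including those with several or no minimizers, so that measurability
  of the estimator can be read off the right-hand side.\<close>

theorem smoothing_spline_eq:
 assumes m: "m >= 1" and h: "h > 0" and n: "n > 0" and t: "t \<in> {0..1}"
 shows "smoothing_spline m n h x y t = (if outside_fit n x y then SUM i=1..n. smoother_weight m n h x i t * y i else 0)"
proof (cases "unisolvent m n x")
 case False
 \<comment> \<open>The determinant vanishes, so all weights are 0 by division by zero, just as the
   estimator is 0 by default when its minimizer is not unique.\<close>
 then have "Determinant.det (spline_matrix m n h x) = 0" using spline_det_nonzero_iff[OF m h n, of x] by simp
 then have "spline_coef m n h x s i = 0" for s i by (simp add: spline_coef_def)
 then have "smoother_weight m n h x i t = 0" for i by (simp add: smoother_weight_def natspline_deriv_def)
 then show ?thesis using not_unisolvent_not_unique[OF m n False] by (simp add: smoothing_spline_def)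
next
 case True
 define a where "a = spline_solution m n h x y"
 define c where "c i = spline_solution m n h x y (m + i - 1)" for i
 have s: "natspline_solves m n h x y a c" unfolding a_def c_def by (rule spline_solution_solves[OF m h n True])
 let ?\<phi> = "natspline m n x a c"
 have \<phi>: "?\<phi> \<in> sobolev2 m" by (rule natspline_sobolev2[OF m])
 define F where "F = restrict ?\<phi> {0..1}"
 have F: "F \<in> sobolev2 m" by (rule sobolev2_cong[OF _ \<phi>]) (simp add: F_def)
 have Fe: "F \<in> extensional {0..1}" by (simp add: F_def)
 have uniq: "f = F" if f: "f \<in> extensional {0..1}" "is_smoothing_spline m n h x y f" for f
 proof -
  have fs: "f \<in> sobolev2 m" using f by (simp add: is_smoothing_spline_def)
  have "\<forall>t\<in>{0..1}. f t = ?\<phi> t"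
   by (rule natspline_solves_unique[OF m h n s True fs is_smoothing_spline_inside[OF fs n f(2) \<phi>]])
  then show ?thesis using f(1) by (intro extensionalityI[OF _ Fe]) (auto simp: F_def)
 qed
 have val: "?\<phi> t = (SUM i=1..n. smoother_weight m n h x i t * y i)"
  unfolding a_def c_def by (rule natspline_solution)
 show ?thesis
 proof (cases "outside_fit n x y")
  case True
  have obj: "inside_objective m n h x y F = inside_objective m n h x y ?\<phi>"
  proof -
   have "dnorm2 m F = int01 (%t. (deriv01 m ?\<phi> t)^2)"
    by (rule integral_cong) (use deriv01_cong[of F ?\<phi> _ m] in \<open>auto simp: F_def\<close>)
   moreover have "(SUM i:inside_obs n x. (F (x i) - y i)^2) = (SUM i:inside_obs n x. (?\<phi> (x i) - y i)^2)"
    by (rule sum.cong) (auto simp: F_def inside_obs_def)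
   ultimately show ?thesis by (simp add: inside_objective_def)
  qed
  have "is_smoothing_spline m n h x y F"
   unfolding is_smoothing_spline_def
  proof (intro conjI F ballI)
   fix g assume g: "g \<in> sobolev2 m"
   have gd: "0 <= int01 (%t. (deriv01 m g t - deriv01 m ?\<phi> t)^2)"
    using sobolev2_sq_diff_has_integral[OF g \<phi>] by (intro integral_nonneg) auto
   have "0 <= 1 / real n * (SUM i:inside_obs n x. (g (x i) - ?\<phi> (x i))^2)" by (intro mult_nonneg_nonneg sum_nonneg) auto
   moreover have "0 <= h ^ (2 * m) * int01 (%t. (deriv01 m g t - deriv01 m ?\<phi> t)^2)" using gd h by simp
   ultimately have in_le: "inside_objective m n h x y F <= inside_objective m n h x y g"
    using natspline_solves_objective[OF m s g] obj by linarith
   have "(SUM i:{1..n} - inside_obs n x. (F (x i) - y i)^2) = (SUM i:{1..n} - inside_obs n x. (undefined - y i)^2)"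
    by (rule sum.cong) (auto simp: F_def inside_obs_def)
   also have "... <= (SUM i:{1..n} - inside_obs n x. (g (x i) - y i)^2)" by (rule outside_fit_le[OF True])
   finally have "1 / real n * (SUM i:{1..n} - inside_obs n x. (F (x i) - y i)^2) <= 1 / real n * (SUM i:{1..n} - inside_obs n x. (g (x i) - y i)^2)"
    by (intro mult_left_mono) auto
   then show "spline_objective m n h x y F <= spline_objective m n h x y g"
    using in_le unfolding spline_objective_split[OF F] spline_objective_split[OF g] by linarith
  qed
  then have ex: "\<exists>!f. f \<in> extensional {0..1} & is_smoothing_spline m n h x y f"
   using Fe uniq by blast
  then have "(THE f. f \<in> extensional {0..1} & is_smoothing_spline m n h x y f) = F"
   using uniq by (metis (no_types, lifting) theI')
  then have "smoothing_spline m n h x y = F" using ex by (simp add: smoothing_spline_def)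
  then show ?thesis using True t val by (simp add: F_def)
 next
  case False
  have "\<not> (\<exists>f. f \<in> extensional {0..1} & is_smoothing_spline m n h x y f)"
   using is_smoothing_spline_outside_fit[OF _ n, of _ m h x y] False is_smoothing_spline_def by blast
  then show ?thesis using False by (auto simp: smoothing_spline_def)
 qed
qed

section \<open>Dependence of the smoother on the design and the bandwidth\<close>

lemma measurable_det:
 assumes "!!i j. i < N ==> j < N ==> (%w. A w $$ (i, j)) \<in> borel_measurable M" "!!w. A w \<in> carrier_mat N N"
 shows "(%w. Determinant.det (A w) :: real) \<in> borel_measurable M"
 unfolding det_def'[OF assms(2)]
 by (intro borel_measurable_sum borel_measurable_times borel_measurable_const borel_measurable_prod assms(1))
  (auto dest!: permutes_in_image)

lemma continuous_on_det:
 assumes "!!i j. i < N ==> j < N ==> continuous_on S (%w. A w $$ (i, j))" "!!w. A w \<in> carrier_mat N N"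
 shows "continuous_on S (%w. Determinant.det (A w) :: real)"
 unfolding det_def'[OF assms(2)]
 by (intro continuous_intros assms(1)) (auto dest!: permutes_in_image)

lemma adj_mat_entry:
 assumes "A \<in> carrier_mat N N" "i < N" "j < N"
 shows "adj_mat A $$ (i, j) = (-1) ^ (j + i) * Determinant.det (mat_delete A j i)"
 using assms by (simp add: adj_mat_def cofactor_def)

lemma mat_delete_entry:
 assumes "A \<in> carrier_mat N N" "i' < N - 1" "j' < N - 1"
 shows "mat_delete A i j $$ (i', j') = A $$ (if i' < i then i' else Suc i', if j' < j then j' else Suc j')"
 using assms by (simp add: mat_delete_def)

lemma spline_matrix_entry: "r < m + n ==> s < m + n ==> spline_matrix m n h x $$ (r, s) = spline_entry m n h x r s"
 by (simp add: spline_matrix_def)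

lemma measurable_spline_coef:
 assumes x: "!!i. i \<in> {1..n} ==> (%w. x w i) \<in> borel_measurable M" and si: "s < m + n" "i \<in> {1..n}"
 shows "(%w. spline_coef m n h (x w) s i) \<in> borel_measurable M"
proof -
 have e: "(%w. spline_matrix m n h (x w) $$ (r, q)) \<in> borel_measurable M" if rq: "r < m + n" "q < m + n" for r q
 proof -
  have [measurable]: "\<not> r < m ==> (%w. x w (Suc (r - m))) \<in> borel_measurable M" "\<not> q < m ==> (%w. x w (Suc (q - m))) \<in> borel_measurable M"
   using rq by (auto intro!: x)
  have tp: "(%w. tpow k (f w) (g w)) \<in> borel_measurable M" if [measurable]: "f \<in> borel_measurable M" "g \<in> borel_measurable M" for f g k
   unfolding tpow_def by measurable
  show ?thesis unfolding spline_matrix_entry[OF rq] spline_entry_def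
   by (cases "r < m"; cases "q < m") (auto intro!: borel_measurable_add borel_measurable_times borel_measurable_divide borel_measurable_power tp borel_measurable_const measurable_compose[OF _ borel_measurable_indicator, of _ M borel])
 qed
 have idx: "m + i - 1 < m + n" using si by auto
 have "(%w. Determinant.det (mat_delete (spline_matrix m n h (x w)) (m + i - 1) s)) \<in> borel_measurable M"
 proof (rule measurable_det[of "m + n - 1"])
  fix i' j' assume ij: "i' < m + n - 1" "j' < m + n - 1"
  show "(%w. mat_delete (spline_matrix m n h (x w)) (m + i - 1) s $$ (i', j')) \<in> borel_measurable M"
   unfolding mat_delete_entry[OF spline_matrix_carrier ij] by (rule e) (use ij in auto)
 qed (rule mat_delete_carrier[OF spline_matrix_carrier])
 moreover have "(%w. Determinant.det (spline_matrix m n h (x w))) \<in> borel_measurable M"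
  by (rule measurable_det[OF e spline_matrix_carrier])
 moreover have "(%w. indicator {0..1} (x w i) :: real) \<in> borel_measurable M"
  using x[OF si(2)] by measurable
 ultimately show ?thesis
  unfolding spline_coef_def adj_mat_entry[OF spline_matrix_carrier si(1) idx]
  by (intro borel_measurable_times borel_measurable_divide borel_measurable_const)
qed

lemma measurable_smoother_weight:
 assumes x: "!!i. i \<in> {1..n} ==> (%w. x w i) \<in> borel_measurable M" and i: "i \<in> {1..n}"
 shows "(%w. smoother_weight m n h (x w) i t) \<in> borel_measurable M"
 unfolding smoother_weight_def natspline_deriv_def
proof (intro borel_measurable_add borel_measurable_sum borel_measurable_times borel_measurable_const measurable_spline_coef[OF x _ i])
 fix j assume j: "j \<in> {1..n}"
 show "(%w. tpow (2 * m - 1 - 0) (x w j) t) \<in> borel_measurable M"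
  unfolding tpow_def using x[OF j] by measurable
qed auto

lemma measurable_outside_fit:
 assumes x: "!!i. i \<in> {1..n} ==> (%w. x w i) \<in> borel_measurable M"
  and y: "!!i. i \<in> {1..n} ==> (%w. y w i) \<in> borel_measurable M"
 shows "Measurable.pred M (%w. outside_fit n (x w) (y w))"
 unfolding outside_fit_def
proof (rule pred_intros_finite(3))
 fix i assume i: "i \<in> {1..n}"
 note [measurable] = x[OF i]
 have [measurable]: "(%w. SUM j=1..n. if x w j = x w i then undefined - y w j else 0) \<in> borel_measurable M"
 proof (rule borel_measurable_sum)
  fix j assume j: "j \<in> {1..n}"
  note [measurable] = x[OF j] y[OF j]
  show "(%w. if x w j = x w i then undefined - y w j else 0) \<in> borel_measurable M" by measurable
 qed
 show "Measurable.pred M (%w. x w i \<in> {0..1} | (SUM j=1..n. if x w j = x w i then undefined - y w j else 0) = 0)"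
  by measurable
qed simp

text \<open>Unisolvence does not depend on \<open>h\<close>, so the determinant has no zero at any h
  > 0 and the quotients are continuous.\<close>

lemma continuous_on_smoother_weight:
 assumes m: "m >= 1" and n: "n > 0" and u: "unisolvent m n x" and i: "i \<in> {1..n}"
 shows "continuous_on ({0<..} \<times> {0..1}) (%(h, t). smoother_weight m n h x i t)"
proof -
 have e: "continuous_on {0<..} (%h. spline_matrix m n h x $$ (r, q))" if rq: "r < m + n" "q < m + n" for r q
  unfolding spline_matrix_entry[OF rq] spline_entry_def
  by (cases "r < m"; cases "q < m"; cases "r = q") (auto intro!: continuous_intros)
 have idx: "m + i - 1 < m + n" using i by auto
 have coef: "continuous_on {0<..} (%h. spline_coef m n h x s i)" if s: "s < m + n" for s
 proof -
  have "continuous_on {0<..} (%h. Determinant.det (mat_delete (spline_matrix m n h x) (m + i - 1) s))"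
  proof (rule continuous_on_det[of "m + n - 1"])
   fix i' j' assume ij: "i' < m + n - 1" "j' < m + n - 1"
   show "continuous_on {0<..} (%h. mat_delete (spline_matrix m n h x) (m + i - 1) s $$ (i', j'))"
    unfolding mat_delete_entry[OF spline_matrix_carrier ij] by (rule e) (use ij in auto)
  qed (rule mat_delete_carrier[OF spline_matrix_carrier])
  moreover have "continuous_on {0<..} (%h. Determinant.det (spline_matrix m n h x))"
   by (rule continuous_on_det[OF e spline_matrix_carrier])
  moreover have "Determinant.det (spline_matrix m n h x) ~= 0" if "h \<in> {0<..}" for h
   using spline_det_nonzero_iff[OF m _ n] that u by simp
  ultimately show ?thesis
   unfolding spline_coef_def adj_mat_entry[OF spline_matrix_carrier s idx]
   by (intro continuous_on_mult continuous_on_divide continuous_on_const) auto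
 qed
 have coef': "continuous_on ({0<..} \<times> {0..1}) (%z. spline_coef m n (fst z) x s i)" if s: "s < m + n" for s
  by (rule continuous_on_compose2[OF coef[OF s] continuous_on_fst[OF continuous_on_id]]) auto
 have tp: "continuous_on ({0<..} \<times> {0..1}) (%z. tpow (2 * m - 1 - 0) X (snd z))" for X
  by (rule continuous_on_compose2[OF absolutely_continuous_fun_on_imp_continuous_on[OF tpow_absolutely_continuous] continuous_on_snd[OF continuous_on_id]])
   (use m in auto)
 show ?thesis
  unfolding smoother_weight_def natspline_deriv_def case_prod_beta
  by (intro continuous_on_add continuous_on_sum continuous_on_mult continuous_on_const tp coef')
   (use m in \<open>auto intro!: continuous_intros\<close>)
qed

section \<open>Maximal inequalities\<close>

lemma exp_le_quadratic:
 fixes x :: real assumes "\<bar>x\<bar> <= 1" shows "exp x <= 1 + x + x^2"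
proof (cases "0 <= x")
 case True
 then show ?thesis using exp_bound[of x] assms by simp
next
 case False
 define y where "y = - x"
 have y: "0 <= y" using False by (simp add: y_def)
 have low: "1 + y + y^2 / 2 <= exp y" using exp_lower_Taylor_quadratic[OF y] .
 \<comment> \<open>The claimed bound at -y times a Taylor lower bound of exp y is at least 1;
   dividing by exp y gives the claim.\<close>
 have q: "(1 - y + y^2) * (1 + y + y^2 / 2) = 1 + (y^2 + y ^ 3 + y ^ 4) / 2"
  by (simp add: power2_eq_square power3_eq_cube power4_eq_xxxx field_simps)
 have pos: "0 <= 1 - y + y^2"
  using sum_power2_ge_zero[of "1 - y/2" "y/2"] zero_le_power2[of "1/2 - y"] by (simp add: power2_eq_square algebra_simps)
 have "1 <= (1 - y + y^2) * (1 + y + y^2 / 2)" unfolding q using y by simp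
 also have "... <= (1 - y + y^2) * exp y" by (rule mult_left_mono[OF low pos])
 finally have "exp (- y) * 1 <= exp (- y) * ((1 - y + y^2) * exp y)" by (intro mult_left_mono) auto
 also have "... = 1 - y + y^2" by (simp add: exp_minus)
 finally show ?thesis by (simp add: y_def)
qed

context prob_space
begin

lemma expectation_exp_le:
 fixes \<xi> :: "'a => real" and b s V :: real
 assumes [measurable]: "\<xi> \<in> borel_measurable M" and b: "!!w. w \<in> space M ==> \<bar>\<xi> w\<bar> <= b" and s: "0 <= s" "s * b <= 1"
  and 0: "expectation \<xi> = 0" and V: "expectation (%w. (\<xi> w)^2) <= V"
 shows "expectation (%w. exp (s * \<xi> w)) <= exp (s^2 * V)" "integrable M (%w. exp (s * \<xi> w))"
proof -
 have sb: "\<bar>s * \<xi> w\<bar> <= 1" if "w \<in> space M" for w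
 proof -
  have "\<bar>s * \<xi> w\<bar> = s * \<bar>\<xi> w\<bar>" using s by (simp add: abs_mult)
  also have "... <= s * b" using b[OF that] s by (intro mult_left_mono)
  finally show ?thesis using s by simp
 qed
 have i1: "integrable M \<xi>" by (rule integrable_const_bound[of _ b]) (use b in auto)
 have i2: "integrable M (%w. (\<xi> w)^2)"
 proof (rule integrable_const_bound[of _ "b^2"])
  show "AE w in M. norm ((\<xi> w)^2) <= b^2"
  proof (rule AE_I2)
   fix w assume "w \<in> space M"
   then have "\<bar>\<xi> w\<bar>^2 <= b^2" by (intro power_mono b) auto
   then show "norm ((\<xi> w)^2) <= b^2" by simp
  qed
 qed auto
 show ie: "integrable M (%w. exp (s * \<xi> w))"
  by (rule integrable_const_bound[of _ "exp 1"]) (use sb in \<open>auto simp: abs_le_iff\<close>)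
 have "expectation (%w. exp (s * \<xi> w)) <= expectation (%w. 1 + s * \<xi> w + s^2 * (\<xi> w)^2)"
 proof (rule integral_mono[OF ie])
  show "integrable M (%w. 1 + s * \<xi> w + s^2 * (\<xi> w)^2)" using i1 i2 by auto
  fix w assume "w \<in> space M"
  from exp_le_quadratic[OF sb[OF this]] show "exp (s * \<xi> w) <= 1 + s * \<xi> w + s^2 * (\<xi> w)^2"
   by (simp add: power_mult_distrib)
 qed
 also have "... = 1 + s^2 * expectation (%w. (\<xi> w)^2)" using i1 i2 0 by (simp add: prob_space)
 also have "... <= 1 + s^2 * V" using V by (intro add_left_mono mult_left_mono) auto
 also have "... <= exp (s^2 * V)" by (rule exp_ge_add_one_self)
 finally show "expectation (%w. exp (s * \<xi> w)) <= exp (s^2 * V)" .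
qed

text \<open>The exponential supermartingale is stopped at the first passage above the level.\<close>

primrec stopped_process :: "(nat => 'a => bool) => (nat => 'a => real) => nat => 'a => real" where
 "stopped_process H E 0 = E 0"
| "stopped_process H E (Suc n) = (%w. if H n w then stopped_process H E n w else E (Suc n) w)"

text \<open>The stopped process has expectation at most 1, and once the level has been reached it is
  at least \<open>exp (s * l - real N * v)\<close>. Markov's inequality thus covers all n <= N at
  the price of the last one, which is what makes blocks of sample sizes affordable.\<close>

lemma exp_maximal_inequality:
 fixes \<xi> :: "nat => 'a => real" and b s V l :: real
 assumes ind: "indep_vars (%_. borel) \<xi> {1..N}"
  and b: "!!i w. i \<in> {1..N} ==> w \<in> space M ==> \<bar>\<xi> i w\<bar> <= b" and s: "0 <= s" "s * b <= 1"
  and 0: "!!i. i \<in> {1..N} ==> expectation (\<xi> i) = 0"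
  and V: "!!i. i \<in> {1..N} ==> expectation (%w. (\<xi> i w)^2) <= V" and Vn: "0 <= V"
 shows "prob {w\<in>space M. \<exists>n\<le>N. l <= (SUM i=1..n. \<xi> i w)} <= exp (s^2 * (real N * V) - s * l)"
proof -
 define v where "v = s^2 * V"
 have v: "0 <= v" using Vn by (simp add: v_def)
 define S where "S n w = (SUM i=1..n. \<xi> i w)" for n w
 define H where "H n w \<longleftrightarrow> (\<exists>k\<le>n. l <= S k w)" for n w
 define E where "E n w = exp (s * S n w - real n * v)" for n w
 have mx: "\<xi> i \<in> borel_measurable M" if "i \<in> {1..N}" for i using ind that by (simp add: indep_vars_def)
 have mS: "S n \<in> borel_measurable M" if "n <= N" for n
  unfolding S_def using that by (intro borel_measurable_sum mx) auto
 have mH: "Measurable.pred M (H n)" if n: "n <= N" for n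
 proof -
  have "Measurable.pred M (%w. \<exists>k\<in>{..n}. l <= S k w)"
  proof (rule pred_intros_finite(4))
   fix k assume "k \<in> {..n}"
   then have [measurable]: "S k \<in> borel_measurable M" using n by (intro mS) auto
   show "Measurable.pred M (%w. l <= S k w)" by measurable
  qed simp
  then show ?thesis unfolding Bex_def atMost_iff H_def .
 qed
 have mE: "E n \<in> borel_measurable M" if "n <= N" for n
 proof -
  note [measurable] = mS[OF that]
  show ?thesis unfolding E_def by measurable
 qed
 have E0: "0 <= E n w" for n w by (simp add: E_def)
 let ?W = "stopped_process H E"
 have mW: "?W n \<in> borel_measurable M" if "n <= N" for n
  using that
 proof (induction n)
  case 0 then show ?case using mE by simp
 next
  case (Suc n)
  have n: "n <= N" using Suc.prems by simp
  note [measurable] = Suc.IH[OF n] mH[OF n] mE[OF Suc.prems]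
  show ?case unfolding stopped_process.simps by measurable
 qed
 have W0: "0 <= ?W n w" for n w by (induction n) (auto simp: E0)
 have cl: "S n w <= real n * b" if "n <= N" "w \<in> space M" for n w
 proof -
  have "S n w <= (SUM i=1..n. b)" unfolding S_def
  proof (rule sum_mono)
   fix i assume "i \<in> {1..n}"
   then show "\<xi> i w <= b" using b[of i w] that by auto
  qed
  then show ?thesis by simp
 qed
 have eb: "E n w <= exp (s * (real n * b))" if "n <= N" "w \<in> space M" for n w
 proof -
  have "s * S n w <= s * (real n * b)" using cl[OF that] s by (intro mult_left_mono) auto
  moreover have "0 <= real n * v" using v by simp
  ultimately show ?thesis by (simp add: E_def)
 qed
 have iE: "integrable M (E n)" if n: "n <= N" for n
 proof (rule integrable_const_bound[OF AE_I2 mE[OF n]])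
  fix w assume "w \<in> space M"
  then show "norm (E n w) <= exp (s * (real n * b))" using eb[OF n] E0[of n w] by simp
 qed
 have iW: "integrable M (?W n)" if "n <= N" for n
  using that
 proof (induction n)
  case 0 then show ?case using iE by simp
 next
  case (Suc n)
  have n: "n <= N" using Suc.prems by simp
  have "integrable M (%w. ?W n w + E (Suc n) w)" using Suc.IH[OF n] iE[OF Suc.prems] by simp
  then show ?case
  proof (rule Bochner_Integration.integrable_bound[OF _ mW[OF Suc.prems] AE_I2])
   fix w assume "w \<in> space M"
   then show "norm (?W (Suc n) w) <= norm (?W n w + E (Suc n) w)"
    using E0[of "Suc n" w] W0[of n w] by simp
  qed
 qed
 \<comment> \<open>The part of the process that is not yet stopped. It is a function of the first n
   variables, hence independent of the next one, while the stopped part no longer moves.\<close>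
 define G where "G n w = (if H n w then 0 else E n w)" for n w
 have WG: "?W n w = (if H n w then ?W n w else 0) + G n w" for n w
 proof (cases n)
  case (Suc k)
  have "H k w ==> H (Suc k) w" unfolding H_def using le_SucI by blast
  then show ?thesis using Suc by (auto simp: G_def)
 qed (simp add: G_def)
 have EW: "expectation (?W n) <= 1" if "n <= N" for n
  using that
 proof (induction n)
  case 0 then show ?case by (simp add: E_def S_def prob_space)
 next
  case (Suc n)
  have n: "n <= N" "Suc n \<in> {1..N}" using Suc.prems by auto
  note [measurable] = mW[OF n(1)] mS[OF n(1)] mH[OF n(1)] mE[OF n(1)] mx[OF n(2)]
  let ?A = "%w. if H n w then ?W n w else 0"
  have iA: "integrable M ?A" by (rule Bochner_Integration.integrable_bound[OF iW[OF n(1)]]) auto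
  have mG: "G n \<in> borel_measurable M" unfolding G_def by measurable
  have iG: "integrable M (G n)" by (rule Bochner_Integration.integrable_bound[OF iE[OF n(1)] mG]) (auto simp: G_def)
  have iX: "integrable M (%w. exp (s * \<xi> (Suc n) w))" "expectation (%w. exp (s * \<xi> (Suc n) w)) <= exp v"
   using expectation_exp_le[OF mx[OF n(2)] b[OF n(2)] s 0[OF n(2)] V[OF n(2)]] by (auto simp: v_def)
  have G0: "0 <= expectation (G n)" by (rule Bochner_Integration.integral_nonneg) (simp add: G_def E0)
  have ivar: "indep_var borel (G n) borel (%w. exp (s * \<xi> (Suc n) w))"
  proof -
   define S' where "S' k f = (SUM i=1..k. f i)" for k and f :: "nat => real"
   define H' where "H' f \<longleftrightarrow> (\<exists>k\<le>n. l <= S' k f)" for f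
   define g where "g f = (if H' f then 0 else exp (s * S' n f - real n * v))" for f
   have mf: "S' k \<in> borel_measurable (PiM {1..n} (%_. borel :: real measure))" if "k <= n" for k
    unfolding S'_def using that by (intro borel_measurable_sum measurable_component_singleton) auto
   have pf: "Measurable.pred (PiM {1..n} (%_. borel :: real measure)) H'"
   proof -
    have "Measurable.pred (PiM {1..n} (%_. borel :: real measure)) (%f. \<exists>k\<in>{..n}. l <= S' k f)"
    proof (rule pred_intros_finite(4))
     fix k assume "k \<in> {..n}"
     then have [measurable]: "S' k \<in> borel_measurable (PiM {1..n} (%_. borel :: real measure))" by (intro mf) auto
     show "Measurable.pred (PiM {1..n} (%_. borel :: real measure)) (%f. l <= S' k f)" by measurable
    qed simp
    then show ?thesis unfolding Bex_def atMost_iff H'_def .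
   qed
   note [measurable] = mf[OF order_refl] pf
   have g: "g \<in> borel_measurable (PiM {1..n} (%_. borel))" unfolding g_def by measurable
   have h: "(%f :: nat => real. exp (s * f (Suc n))) \<in> borel_measurable (PiM {Suc n} (%_. borel))"
   proof -
    have [measurable]: "(%f. f (Suc n)) \<in> borel_measurable (PiM {Suc n} (%_. borel :: real measure))"
     by (rule measurable_component_singleton) simp
    show ?thesis by measurable
   qed
   have "indep_var (PiM {1..n} (%_. borel)) (%w. restrict (%i. \<xi> i w) {1..n}) (PiM {Suc n} (%_. borel)) (%w. restrict (%i. \<xi> i w) {Suc n})"
    by (rule indep_var_restrict[OF ind]) (use n in auto)
   from indep_var_compose[OF this g h]
   have iv: "indep_var borel (g \<circ> (%w. restrict (%i. \<xi> i w) {1..n})) borel ((%f. exp (s * f (Suc n))) \<circ> (%w. restrict (%i. \<xi> i w) {Suc n}))" .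
   have SS: "S' k (restrict (%i. \<xi> i w) {1..n}) = S k w" if "k <= n" for k w
    unfolding S_def S'_def by (rule sum.cong) (use that in auto)
   have HH: "H' (restrict (%i. \<xi> i w) {1..n}) = H n w" for w
    unfolding H_def H'_def using SS by (metis (no_types, lifting))
   have "g \<circ> (%w. restrict (%i. \<xi> i w) {1..n}) = G n"
    by (rule ext) (simp only: g_def G_def o_def HH SS[OF order_refl] E_def)
   then show ?thesis using iv by (simp add: o_def)
  qed
  have SSuc: "S (Suc n) w = S n w + \<xi> (Suc n) w" for w by (simp add: S_def)
  have step: "?W (Suc n) w = ?A w + G n w * exp (s * \<xi> (Suc n) w) * exp (- v)" for w
   by (simp add: G_def E_def SSuc exp_add[symmetric] algebra_simps)
  have iP: "integrable M (%w. G n w * exp (s * \<xi> (Suc n) w))" by (rule indep_var_integrable[OF ivar iG iX(1)])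
  have "expectation (?W (Suc n)) = expectation ?A + expectation (%w. G n w * exp (s * \<xi> (Suc n) w)) * exp (- v)"
   unfolding step using iA iP by simp
  also have "expectation (%w. G n w * exp (s * \<xi> (Suc n) w)) = expectation (G n) * expectation (%w. exp (s * \<xi> (Suc n) w))"
   by (rule indep_var_lebesgue_integral[OF ivar iG iX(1)])
  also have "expectation ?A + expectation (G n) * expectation (%w. exp (s * \<xi> (Suc n) w)) * exp (- v)
    <= expectation ?A + expectation (G n) * exp v * exp (- v)"
   using iX(2) G0 by (intro add_left_mono mult_right_mono mult_left_mono) auto
  also have "... = expectation ?A + expectation (G n)" by (simp add: exp_minus)
  also have "expectation ?A + expectation (G n) = expectation (%w. ?A w + G n w)"
   by (rule Bochner_Integration.integral_add[OF iA iG, symmetric])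
  also have "... = expectation (?W n)" by (rule Bochner_Integration.integral_cong) (simp_all only: WG[symmetric])
  finally show ?case using Suc.IH[OF n(1)] by simp
 qed
 have low: "exp (s * l - real N * v) <= ?W n w" if "H n w" "n <= N" for n w
  using that
 proof (induction n)
  case 0
  then have "l <= 0" by (simp add: H_def S_def)
  then have "s * l <= 0" using s by (simp add: mult_nonneg_nonpos)
  moreover have "0 <= real N * v" using v by simp
  ultimately show ?case by (simp add: E_def S_def)
 next
  case (Suc n)
  show ?case
  proof (cases "H n w")
   case True then show ?thesis using Suc by simp
  next
   case False
   then have "l <= S (Suc n) w" using Suc.prems(1) unfolding H_def by (metis le_Suc_eq)
   then have "s * l <= s * S (Suc n) w" using s by (intro mult_left_mono) auto
   moreover have "real (Suc n) * v <= real N * v" using Suc.prems v by (intro mult_right_mono) auto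
   ultimately show ?thesis using False by (simp add: E_def)
  qed
 qed
 define A where "A = {w\<in>space M. H N w}"
 have A: "A \<in> events" using mH[OF order_refl] unfolding A_def pred_def .
 have "exp (s * l - real N * v) * prob A = expectation (%w. exp (s * l - real N * v) * indicator A w)"
  using A by simp
 also have "... <= expectation (?W N)"
 proof (rule integral_mono)
  show "integrable M (%w. exp (s * l - real N * v) * indicator A w)"
   using A by (intro integrable_mult_right integrable_real_indicator) (auto simp: emeasure_eq_measure)
  fix w assume "w \<in> space M"
  then show "exp (s * l - real N * v) * indicator A w <= ?W N w"
   using low[of N w] W0[of N w] by (cases "H N w") (auto simp: A_def)
 qed (rule iW, simp)
 also have "... <= 1" by (rule EW) simp
 finally have "prob A <= 1 / exp (s * l - real N * v)"
  by (simp add: field_simps)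
 also have "... = exp (real N * v - s * l)" by (simp add: exp_diff)
 finally show ?thesis by (simp add: v_def mult_ac A_def H_def S_def)
qed

lemma exp_maximal_inequality_abs:
 fixes \<xi> :: "nat => 'a => real" and b s V l :: real
 assumes ind: "indep_vars (%_. borel) \<xi> {1..N}"
  and b: "!!i w. i \<in> {1..N} ==> w \<in> space M ==> \<bar>\<xi> i w\<bar> <= b" and s: "0 <= s" "s * b <= 1"
  and 0: "!!i. i \<in> {1..N} ==> expectation (\<xi> i) = 0"
  and V: "!!i. i \<in> {1..N} ==> expectation (%w. (\<xi> i w)^2) <= V" and Vn: "0 <= V"
 shows "prob {w\<in>space M. \<exists>n\<le>N. l <= \<bar>SUM i=1..n. \<xi> i w\<bar>} <= 2 * exp (s^2 * (real N * V) - s * l)"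
  "{w\<in>space M. \<exists>n\<le>N. l <= \<bar>SUM i=1..n. \<xi> i w\<bar>} \<in> events"
proof -
 have mx: "\<xi> i \<in> borel_measurable M" if "i \<in> {1..N}" for i using ind that by (simp add: indep_vars_def)
 define S where "S n w = (SUM i=1..n. \<xi> i w)" for n w
 have mS: "S n \<in> borel_measurable M" if "n <= N" for n
  unfolding S_def using that by (intro borel_measurable_sum mx) auto
 define A where "A f = {w\<in>space M. \<exists>n\<le>N. l <= f (S n w)}" for f :: "real => real"
 have ev: "A f \<in> events" if f: "f \<in> borel_measurable borel" for f
 proof -
  have "Measurable.pred M (%w. \<exists>n\<in>{..N}. l <= f (S n w))"
  proof (rule pred_intros_finite(4))
   fix n assume "n \<in> {..N}"
   then have [measurable]: "S n \<in> borel_measurable M" by (intro mS) auto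
   note [measurable] = f
   show "Measurable.pred M (%w. l <= f (S n w))" by measurable
  qed simp
  then show ?thesis unfolding Bex_def atMost_iff pred_def A_def .
 qed
 have e0: "A abs \<in> events" by (rule ev) simp
 have e1: "A (%x. x) \<in> events" by (rule ev) simp
 have e2: "A (%x. - x) \<in> events" by (rule ev) simp
 have Aabs: "{w\<in>space M. \<exists>n\<le>N. l <= \<bar>SUM i=1..n. \<xi> i w\<bar>} = A abs" unfolding A_def S_def ..
 show "{w\<in>space M. \<exists>n\<le>N. l <= \<bar>SUM i=1..n. \<xi> i w\<bar>} \<in> events" unfolding Aabs by (rule e0)
 have ind': "indep_vars (%_. borel) (%i w. - \<xi> i w) {1..N}"
  by (rule indep_vars_compose2[OF ind, where Y="%_ x. - x" and N="%_. borel"]) simp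
 have p1: "prob (A (%x. x)) <= exp (s^2 * (real N * V) - s * l)"
  unfolding A_def S_def by (rule exp_maximal_inequality[OF ind b s 0 V Vn])
 have p2: "prob (A (%x. - x)) <= exp (s^2 * (real N * V) - s * l)"
  unfolding A_def S_def sum_negf[symmetric] by (rule exp_maximal_inequality[OF ind' _ s _ _ Vn]) (simp_all add: b 0 V)
 have sub: "A abs <= A (%x. x) Un A (%x. - x)"
 proof
  fix w assume "w \<in> A abs"
  then obtain n where n: "w \<in> space M" "n <= N" "l <= \<bar>S n w\<bar>" unfolding A_def by blast
  then have "l <= S n w | l <= - S n w" by linarith
  then show "w \<in> A (%x. x) Un A (%x. - x)" using n(1,2) unfolding A_def by blast
 qed
 have "prob (A abs) <= prob (A (%x. x) Un A (%x. - x))" by (rule finite_measure_mono[OF sub sets.Un[OF e1 e2]])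
 also have "... <= prob (A (%x. x)) + prob (A (%x. - x))" by (rule measure_Un_le[OF e1 e2])
 finally have "prob (A abs) <= 2 * exp (s^2 * (real N * V) - s * l)" using p1 p2 by linarith
 then show "prob {w\<in>space M. \<exists>n\<le>N. l <= \<bar>SUM i=1..n. \<xi> i w\<bar>} <= 2 * exp (s^2 * (real N * V) - s * l)" unfolding Aabs .
qed

end

section \<open>Averages of an integrable sequence along powers of two\<close>

context prob_space
begin

lemma second_moment_sum:
 fixes \<xi> :: "nat => 'a => real"
 assumes ind: "indep_vars (%_. borel) \<xi> {1..N}"
  and b: "!!i z. i \<in> {1..N} ==> z \<in> space M ==> \<bar>\<xi> i z\<bar> <= b"
  and 0: "!!i. i \<in> {1..N} ==> expectation (\<xi> i) = 0"
  and V: "!!i. i \<in> {1..N} ==> expectation (%z. (\<xi> i z)^2) <= V"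
 shows "expectation (%z. (SUM i=1..N. \<xi> i z)^2) <= real N * V"
proof -
 have mx: "\<xi> i \<in> borel_measurable M" if "i \<in> {1..N}" for i using ind that by (simp add: indep_vars_def)
 have ix: "integrable M (\<xi> i)" if "i \<in> {1..N}" for i
  by (rule integrable_const_bound[where B=b, OF AE_I2 mx[OF that]]) (use b[OF that] in simp)
 have ip: "integrable M (%z. \<xi> i z * \<xi> j z)" if "i \<in> {1..N}" "j \<in> {1..N}" for i j
 proof (rule integrable_const_bound[OF AE_I2 borel_measurable_times[OF mx[OF that(1)] mx[OF that(2)]]])
  fix z assume w: "z \<in> space M"
  show "norm (\<xi> i z * \<xi> j z) <= b * b" using mult_mono[OF b[OF that(1) w] b[OF that(2) w]] b[OF that(1) w] by (simp add: abs_mult)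
 qed
 have orth: "expectation (%z. \<xi> i z * \<xi> j z) = 0" if ij: "i \<in> {1..N}" "j \<in> {1..N}" "i ~= j" for i j
 proof -
  have "indep_var (PiM {i} (%_. borel)) (%z. restrict (%i. \<xi> i z) {i}) (PiM {j} (%_. borel)) (%z. restrict (%i. \<xi> i z) {j})"
   by (rule indep_var_restrict[OF ind]) (use ij in auto)
  from indep_var_compose[OF this, of "%f. f i" borel "%f. f j" borel]
  have "indep_var borel (\<xi> i) borel (\<xi> j)"
   by (simp add: o_def measurable_component_singleton)
  from indep_var_lebesgue_integral[OF this ix[OF ij(1)] ix[OF ij(2)]] show ?thesis using 0 ij by simp
 qed
 have "(%z. (SUM i=1..N. \<xi> i z)^2) = (%z. SUM i=1..N. SUM j=1..N. \<xi> i z * \<xi> j z)"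
  by (simp add: power2_eq_square sum_product)
 then have "expectation (%z. (SUM i=1..N. \<xi> i z)^2) = (SUM i=1..N. SUM j=1..N. expectation (%z. \<xi> i z * \<xi> j z))"
  using ip by (simp only:) (subst Bochner_Integration.integral_sum, (intro Bochner_Integration.integrable_sum, simp), intro sum.cong refl Bochner_Integration.integral_sum, simp)
 also have "... <= (SUM i=1..N. V)"
 proof (rule sum_mono)
  fix i assume i: "i \<in> {1..N}"
  have "(SUM j=1..N. expectation (%z. \<xi> i z * \<xi> j z)) = (SUM j=1..N. if j = i then expectation (%z. \<xi> i z * \<xi> i z) else 0)"
   by (rule sum.cong) (use orth i in auto)
  also have "... = expectation (%z. \<xi> i z * \<xi> i z)" using i by simp
  also have "... <= V" using V[OF i] by (simp add: power2_eq_square)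
  finally show "(SUM j=1..N. expectation (%z. \<xi> i z * \<xi> j z)) <= V" .
 qed
 also have "... = real N * V" by simp
 finally show ?thesis .
qed

end

text \<open>The terms grow geometrically until 2^k passes \<open>v\<close> and decay geometrically
  afterwards, so the sum is comparable with \<open>v\<close>.\<close>

lemma dyadic_truncation_sum_le:
 fixes v :: real assumes v: "0 <= v"
 shows "(SUM k<K. if 2 ^ k < v then 2 ^ k else v^2 / 2 ^ k) <= 4 * v"
proof -
 \<comment> \<open>Once 2^K has passed \<open>v\<close>, the induction keeps 2 v^2 / 2^K in reserve:
   the tail that is still to come.\<close>
 have "(SUM k<K. if 2 ^ k < v then 2 ^ k else v^2 / 2 ^ k) <= (if 2 ^ K < v then 2 ^ K else 4 * v - 2 * v^2 / 2 ^ K)"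
 proof (induction K)
  case 0
  have "v^2 <= v" if "v <= 1" using mult_left_mono[OF that v] by (simp add: power2_eq_square)
  then show ?case using v by auto
 next
  case (Suc K)
  show ?case
  proof (cases "2 ^ K < v")
   case True
   then have le: "(SUM k<Suc K. if 2 ^ k < v then 2 ^ k else v^2 / 2 ^ k) <= 2 * 2 ^ K" using Suc by simp
   show ?thesis
   proof (cases "2 ^ Suc K < v")
    case False
    then have "(v - 2 ^ K) * (v - 2 * 2 ^ K) <= 0" using True by (intro mult_nonneg_nonpos) auto
    then have "v^2 + 2 * (2 ^ K)^2 <= 3 * v * 2 ^ K" by (simp add: algebra_simps power2_eq_square)
    moreover have "(0::real) <= v * 2 ^ K" using v by simp
    ultimately have "2 * (2 ^ K)^2 <= (4 * v) * 2 ^ K - v^2" by linarith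
    then have "2 * 2 ^ K <= 4 * v - v^2 / 2 ^ K" by (simp add: field_simps power2_eq_square)
    then show ?thesis using le False by simp
   qed (use le in simp)
  next
   case False
   have "(2::real) ^ K <= 2 ^ Suc K" by simp
   then have "\<not> 2 ^ Suc K < v" using False by linarith
   moreover have "2 * v^2 / 2 ^ Suc K = v^2 / 2 ^ K" "2 * v^2 / 2 ^ K = 2 * (v^2 / 2 ^ K)" by simp_all
   ultimately show ?thesis using Suc False unfolding sum.lessThan_Suc by simp
  qed
 qed
 also have "... <= 4 * v" using v by auto
 finally show ?thesis .
qed

context prob_space
begin

text \<open>A one-sided law of large numbers along n = 2^k under a first moment. The variables are
  truncated at 2^k. Chebyshev's inequality for the truncated sum and a union bound for the
  exceedances together cost the mean of \<open>g k\<close>, and by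
  \<open>dyadic_truncation_sum_le\<close> these means add up to at most 4 times the mean of
  \<open>V 1\<close>.\<close>

lemma dyadic_average_bound:
 fixes V :: "nat => 'a => real"
 assumes ind: "indep_vars (%_. borel) V {1..}"
  and nn: "!!i z. i >= 1 ==> z \<in> space M ==> 0 <= V i z"
  and id: "!!i. i >= 1 ==> distr M borel (V i) = distr M borel (V 1)"
  and int: "integrable M (V 1)"
 shows "AE z in M. eventually (%k. (SUM i=1..2^k. V i z) <= (expectation (V 1) + 1) * 2 ^ k) sequentially"
proof -
 have mV: "V i \<in> borel_measurable M" if "i >= 1" for i using ind that by (simp add: indep_vars_def)
 have tr: "expectation (%z. f (V i z)) = expectation (%z. f (V 1 z))" if f: "f \<in> borel_measurable borel" and i: "i >= 1" for f :: "real => real" and i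
  using integral_distr[OF mV[OF i] f] integral_distr[OF mV[of 1] f] id[OF i] by simp
 define S where "S k z = (SUM i=1..2^k. V i z)" for k :: nat and z
 have mS: "S k \<in> borel_measurable M" for k unfolding S_def by (intro borel_measurable_sum mV) auto
 define A where "A k = {z\<in>space M. (expectation (V 1) + 1) * 2 ^ k < S k z}" for k
 have A: "A k \<in> events" for k unfolding A_def using mS[of k] by measurable
 define g :: "nat => real => real" where "g k x = (if 2 ^ k < x then 2 ^ k else x^2 / 2 ^ k)" for k x
 have mg: "g k \<in> borel_measurable borel" for k unfolding g_def by measurable
 have g0: "0 <= g k x" for k x by (simp add: g_def)
 have ig: "integrable M (%z. g k (V 1 z))" for k
 proof (rule integrable_const_bound[OF AE_I2 measurable_compose[OF mV[of 1] mg]])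
  fix z assume w: "z \<in> space M"
  have "(V 1 z)^2 / 2 ^ k <= 2 ^ k" if "V 1 z <= 2 ^ k"
   using power_mono[OF that nn[OF order_refl w], of 2] by (simp add: field_simps power2_eq_square)
  then show "norm (g k (V 1 z)) <= 2 ^ k" by (simp add: g_def)
 qed simp
 have PA: "prob (A k) <= expectation (%z. g k (V 1 z))" for k
 proof -
  define T :: "real => real" where "T x = (if x <= 2 ^ k then x else 0)" for x
  define e where "e = expectation (%z. T (V 1 z))"
  have mT: "T \<in> borel_measurable borel" unfolding T_def by measurable
  have mTV: "(%z. T (V i z)) \<in> borel_measurable M" if "i >= 1" for i by (rule measurable_compose[OF mV[OF that] mT])
  have T: "0 <= T (V i z)" "T (V i z) <= 2 ^ k" "T (V i z) <= V i z" if "i >= 1" "z \<in> space M" for i z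
   using nn[OF that] by (auto simp: T_def)
  have iT: "integrable M (%z. T (V i z))" if "i >= 1" for i
   by (rule integrable_const_bound[OF AE_I2 mTV[OF that], where B="2 ^ k"]) (use T[OF that] in simp)
  have iT2: "integrable M (%z. (T (V i z))^2)" if "i >= 1" for i
  proof (rule integrable_const_bound[OF AE_I2 borel_measurable_power[OF mTV[OF that]], where B="(2 ^ k)^2"])
   fix z assume "z \<in> space M"
   then show "norm ((T (V i z))^2) <= (2 ^ k)^2" using power_mono[OF T(2)[OF that] T(1)[OF that]] by simp
  qed
  have e: "e <= expectation (V 1)" unfolding e_def
   by (rule integral_mono[OF iT[OF order_refl] int]) (rule T(3), simp_all)
  have e0: "0 <= e" "e <= 2 ^ k"
  proof -
   show "0 <= e" unfolding e_def by (rule Bochner_Integration.integral_nonneg) (rule T(1), simp_all)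
   have "e <= expectation (%_. 2 ^ k)" unfolding e_def by (rule integral_mono[OF iT[OF order_refl]]) (simp, rule T(2), simp_all)
   then show "e <= 2 ^ k" by (simp add: prob_space)
  qed
  define \<xi> where "\<xi> i z = T (V i z) - e" for i z
  have ind': "indep_vars (%_. borel) \<xi> {1..2^k}"
   unfolding \<xi>_def
  proof (rule indep_vars_compose2[where Y="%_ x. T x - e" and X=V and M'="%_. borel"])
   show "indep_vars (%_. borel) V {1..2^k}" by (rule indep_vars_subset[OF ind]) auto
  qed (use mT in measurable)
  have ex: "expectation (\<xi> i) = 0" if "i \<in> {1..2^k}" for i
   using that iT[of i] tr[OF mT, of i] by (simp add: \<xi>_def[abs_def] e_def prob_space)
  have ex2: "expectation (%z. (\<xi> i z)^2) <= expectation (%z. (T (V 1 z))^2)" if "i \<in> {1..2^k}" for i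
  proof -
   have i: "i >= 1" using that by simp
   have "expectation (%z. (\<xi> i z)^2) = expectation (%z. (T (V i z))^2 - 2 * e * T (V i z) + e^2)"
    unfolding \<xi>_def by (simp add: power2_diff algebra_simps)
   also have "... = expectation (%z. (T (V i z))^2) - 2 * e * expectation (%z. T (V i z)) + e^2"
    using iT[OF i] iT2[OF i] by (simp add: prob_space)
   also have "... = expectation (%z. (T (V 1 z))^2) - e^2"
    using tr[OF mT i] tr[OF borel_measurable_power[OF mT, of 2] i] by (simp add: e_def power2_eq_square)
   finally show ?thesis by simp
  qed
  have b: "\<bar>\<xi> i z\<bar> <= 2 ^ k" if "i \<in> {1..2^k}" "z \<in> space M" for i z
   using T[of i z] that e0 by (auto simp: \<xi>_def abs_le_iff)
  define Z where "Z z = (SUM i=1..2^k. \<xi> i z)" for z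
  have Z2: "expectation (%z. (Z z)^2) <= real (2 ^ k) * expectation (%z. (T (V 1 z))^2)"
   unfolding Z_def by (rule second_moment_sum[OF ind' b ex ex2])
  have mZ: "Z \<in> borel_measurable M" unfolding Z_def \<xi>_def using mTV by (intro borel_measurable_sum borel_measurable_diff) auto
  have iZ: "integrable M (%z. (Z z)^2)"
  proof (rule integrable_const_bound[OF AE_I2 borel_measurable_power[OF mZ], where B="(2 ^ k * 2 ^ k)^2"])
   fix z assume w: "z \<in> space M"
   have "\<bar>Z z\<bar> <= (SUM i=1..2^k. \<bar>\<xi> i z\<bar>)" unfolding Z_def by (rule sum_abs)
   also have "... <= (SUM i=1..2^k::nat. 2 ^ k)" by (rule sum_mono) (use b w in auto)
   finally have "\<bar>Z z\<bar> <= 2 ^ k * 2 ^ k" by simp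
   then have "\<bar>Z z\<bar>^2 <= (2 ^ k * 2 ^ k)^2" by (rule power_mono) simp
   then show "norm ((Z z)^2) <= (2 ^ k * 2 ^ k)^2" by simp
  qed
  define B where "B = {z\<in>space M. 2 ^ k <= \<bar>Z z\<bar>}"
  define C where "C i = {z\<in>space M. 2 ^ k < V i z}" for i
  have B: "B \<in> events" unfolding B_def using mZ by measurable
  have C: "C i \<in> events" if "i >= 1" for i unfolding C_def using mV[OF that] by measurable
  have pB: "prob B <= expectation (%z. (T (V 1 z))^2 / 2 ^ k)"
  proof -
   have "prob B <= expectation (%z. (Z z)^2) / (2 ^ k)^2"
    unfolding B_def by (rule second_moment_method[OF mZ iZ]) simp
   also have "... <= (real (2 ^ k) * expectation (%z. (T (V 1 z))^2)) / (2 ^ k)^2"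
    by (rule divide_right_mono[OF Z2]) simp
   finally show ?thesis by (simp add: power2_eq_square)
  qed
  have pC: "prob (C i) = expectation (%z. if 2 ^ k < V 1 z then 1 else 0)" if i: "i >= 1" for i
  proof -
   have "prob (C i) = expectation (%z. indicator (C i) z)" using C[OF i] by simp
   also have "... = expectation (%z. if 2 ^ k < V i z then 1 else 0)"
    by (rule Bochner_Integration.integral_cong) (auto simp: C_def)
   also have "... = expectation (%z. if 2 ^ k < V 1 z then 1 else 0)" by (rule tr[OF _ i]) measurable
   finally show ?thesis .
  qed
  have iC: "integrable M (%z. if 2 ^ k < V 1 z then 1 else 0 :: real)"
   by (rule integrable_const_bound[of _ 1]) (use mV[of 1] in auto)
  have sub: "A k <= B Un (\<Union>i\<in>{1..2^k}. C i)"
  proof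
   fix z assume w: "z \<in> A k"
   then have wM: "z \<in> space M" and big: "(expectation (V 1) + 1) * 2 ^ k < S k z" by (auto simp: A_def)
   show "z \<in> B Un (\<Union>i\<in>{1..2^k}. C i)"
   proof (cases "\<exists>i\<in>{1..2^k}. 2 ^ k < V i z")
    case False
    then have "\<xi> i z = V i z - e" if "i \<in> {1..2^k}" for i using that by (auto simp: \<xi>_def T_def not_less)
    then have "Z z = (SUM i=1..2^k. V i z - e)" unfolding Z_def by (rule sum.cong[OF refl])
    also have "... = S k z - 2 ^ k * e" by (simp add: S_def sum_subtractf)
    finally have "Z z = S k z - 2 ^ k * e" .
    moreover have "2 ^ k * e <= 2 ^ k * expectation (V 1)" using e by simp
    ultimately have "2 ^ k <= Z z" using big distrib_right[of "expectation (V 1)" 1 "2 ^ k"] mult.commute[of "2 ^ k" "expectation (V 1)"] by linarith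
    then show ?thesis using wM by (auto simp: B_def)
   qed (use wM in \<open>auto simp: C_def\<close>)
  qed
  have "prob (A k) <= prob (B Un (\<Union>i\<in>{1..2^k}. C i))"
   by (rule finite_measure_mono[OF sub]) (use B C in \<open>auto intro!: sets.finite_UN\<close>)
  also have "... <= prob B + prob (\<Union>i\<in>{1..2^k}. C i)"
   by (rule measure_Un_le) (use B C in \<open>auto intro!: sets.finite_UN\<close>)
  also have "prob (\<Union>i\<in>{1..2^k}. C i) <= (SUM i:{1..2^k}. prob (C i))"
   by (rule finite_measure_subadditive_finite) (use C in auto)
  also have "... = 2 ^ k * expectation (%z. if 2 ^ k < V 1 z then 1 else 0)" using pC by simp
  also have "... = expectation (%z. 2 ^ k * (if 2 ^ k < V 1 z then 1 else 0))" by simp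
  also have "prob B + expectation (%z. 2 ^ k * (if 2 ^ k < V 1 z then 1 else 0)) <=
   expectation (%z. (T (V 1 z))^2 / 2 ^ k) + expectation (%z. 2 ^ k * (if 2 ^ k < V 1 z then 1 else 0))"
   using pB by simp
  also have "... = expectation (%z. (T (V 1 z))^2 / 2 ^ k + 2 ^ k * (if 2 ^ k < V 1 z then 1 else 0))"
   by (rule Bochner_Integration.integral_add[symmetric]) (use iT2[OF order_refl] iC in auto)
  also have "... = expectation (%z. g k (V 1 z))"
   by (rule Bochner_Integration.integral_cong) (auto simp: g_def T_def)
  finally show ?thesis by simp
 qed
 have sm: "summable (%k. prob (A k))"
 proof (rule bounded_imp_summable[where B="4 * expectation (V 1)"])
  fix n
  have "(SUM k<=n. prob (A k)) <= (SUM k<=n. expectation (%z. g k (V 1 z)))" by (rule sum_mono[OF PA])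
  also have "... = expectation (%z. SUM k<=n. g k (V 1 z))" by (rule Bochner_Integration.integral_sum[symmetric]) (rule ig)
  also have "... <= expectation (%z. 4 * V 1 z)"
  proof (rule integral_mono)
   show "integrable M (%z. SUM k<=n. g k (V 1 z))" by (rule Bochner_Integration.integrable_sum) (rule ig)
   fix z assume "z \<in> space M"
   from dyadic_truncation_sum_le[OF nn[OF order_refl this], of "Suc n"]
   show "(SUM k<=n. g k (V 1 z)) <= 4 * V 1 z" by (simp only: g_def lessThan_Suc_atMost)
  qed (use int in simp)
  finally show "(SUM k<=n. prob (A k)) <= 4 * expectation (V 1)" by simp
 qed simp
 have "AE z in M. eventually (%k. z \<in> space M - A k) sequentially"
  by (rule borel_cantelli_AE1[OF A]) (simp_all add: sm emeasure_eq_measure)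
 then show ?thesis
  by (rule AE_mp) (rule AE_I2, auto elim!: eventually_mono simp: A_def S_def not_less)
qed

end

section \<open>Dyadic chaining\<close>

text \<open>\<open>low\<close> says that \<open>D\<close> cannot drop by more than \<open>L\<close>
  within one grid step. The grid point to the left of \<open>s\<close> therefore gives a lower bound
  and the one to its right an upper bound; the latter lengthens the interval by at most one
  step.\<close>

lemma grid_deviation_bound:
 fixes D :: "real => real => real" and G :: "real => real" and L s :: real
 assumes add: "!!a b c. 0 <= a ==> a <= b ==> b <= c ==> c <= 1 ==> D a c = D a b + D b c"
  and low: "!!a b. 0 <= a ==> a <= b ==> b <= 1 ==> - (L * 2 ^ k * (b - a)) <= D a b"
  and grid: "!!i j. i <= j ==> j <= 2 ^ k ==> \<bar>D (real i / 2 ^ k) (real j / 2 ^ k)\<bar> <= G ((real j - real i) / 2 ^ k)"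
  and G: "mono G" and L: "0 <= L" and s: "real i / 2 ^ k <= s" "s <= 1"
 shows "\<bar>D (real i / 2 ^ k) s\<bar> <= G (s - real i / 2 ^ k + 1 / 2 ^ k) + L"
proof -
 define a where "a = real i / 2 ^ k"
 have a: "0 <= a" "a <= s" using s by (simp_all add: a_def)
 define j where "j = nat \<lfloor>s * 2 ^ k\<rfloor>"
 have s0: "0 <= s * 2 ^ k" using a by simp
 have j: "real j <= s * 2 ^ k" "s * 2 ^ k < real j + 1" using s0 unfolding j_def by linarith+
 have ij: "i <= j" using s by (simp add: j_def le_nat_floor field_simps)
 have "real j <= 2 ^ k" using j s(2) by (smt (verit) mult_left_le_one_le mult_right_mono mult_cancel_right1 zero_le_power)
 then have j2: "j <= 2 ^ k" by (metis numeral_power_le_of_nat_cancel_iff of_nat_le_iff of_nat_numeral of_nat_power)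
 have js: "real j / 2 ^ k <= s" "s < (real j + 1) / 2 ^ k" using j by (simp_all add: field_simps)
 have aj: "a <= real j / 2 ^ k" using ij by (simp add: a_def divide_right_mono)
 have L1: "L * 2 ^ k * d <= L" if "d <= 1 / 2 ^ k" for d
  using mult_left_mono[OF that, of "L * 2 ^ k"] L by simp
 have G': "G ((real j' - real i) / 2 ^ k) <= G (s - a + 1 / 2 ^ k)" if "real j' / 2 ^ k <= s + 1 / 2 ^ k" for j' :: nat
  using that by (intro monoD[OF G]) (simp add: a_def field_simps)
 have lower: "- (G (s - a + 1 / 2 ^ k) + L) <= D a s"
 proof -
  have "D a s = D a (real j / 2 ^ k) + D (real j / 2 ^ k) s" by (rule add) (use a aj js s in auto)
  moreover have "\<bar>D a (real j / 2 ^ k)\<bar> <= G (s - a + 1 / 2 ^ k)"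
   unfolding a_def by (rule order_trans[OF grid[OF ij j2] G'[unfolded a_def]]) (rule add_increasing2[of "1 / 2 ^ k" _ s, OF _ js(1)], simp)
  moreover have "- L <= D (real j / 2 ^ k) s"
  proof -
   have "s - real j / 2 ^ k <= 1 / 2 ^ k" using js(2) by (simp add: add_divide_distrib)
   from L1[OF this] show ?thesis using low[OF _ js(1) s(2)] by fastforce
  qed
  ultimately show ?thesis by linarith
 qed
 have upper: "D a s <= G (s - a + 1 / 2 ^ k) + L"
 \<comment> \<open>For j = 2^k the point \<open>s\<close> is 1 and has no grid point to its
   right.\<close>
 proof (cases "j = 2 ^ k")
  case True
  then have "s = real j / 2 ^ k" using js(1) s(2) by simp
  moreover have "\<bar>D a (real j / 2 ^ k)\<bar> <= G (s - a + 1 / 2 ^ k)"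
   unfolding a_def by (rule order_trans[OF grid[OF ij j2] G'[unfolded a_def]]) (rule add_increasing2[of "1 / 2 ^ k" _ s, OF _ js(1)], simp)
  ultimately show ?thesis using L by (simp add: abs_le_iff)
 next
  case False
  then have j3: "Suc j <= 2 ^ k" using j2 by simp
  have "real (Suc j) <= 2 ^ k" using j3 by (metis numeral_power_le_of_nat_cancel_iff of_nat_le_iff of_nat_numeral of_nat_power)
  then have j4: "real (Suc j) / 2 ^ k <= 1" by simp
  have js2: "s <= real (Suc j) / 2 ^ k" using js(2) by (simp add: add.commute)
  have "D a (real (Suc j) / 2 ^ k) = D a s + D s (real (Suc j) / 2 ^ k)" by (rule add) (use a js2 j4 in auto)
  moreover have "\<bar>D a (real (Suc j) / 2 ^ k)\<bar> <= G (s - a + 1 / 2 ^ k)"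
   unfolding a_def by (rule order_trans[OF grid[OF le_SucI[OF ij] j3] G'[unfolded a_def]]) (use js(1) in \<open>simp add: add_divide_distrib\<close>)
  moreover have "- L <= D s (real (Suc j) / 2 ^ k)"
  proof -
   have "real (Suc j) / 2 ^ k - s <= 1 / 2 ^ k" using js(1) by (simp add: add_divide_distrib)
   from L1[OF this] show ?thesis using low[OF _ js2 j4] a by fastforce
  qed
  ultimately show ?thesis by linarith
 qed
 show ?thesis using lower upper unfolding a_def by (simp add: abs_le_iff)
qed

text \<open>Follow the binary expansion of \<open>s\<close>: refining the mesh by one level moves
  the grid point to the left of \<open>s\<close> by at most one dyadic interval of the new
  level.\<close>

lemma dyadic_chain_bound:
 fixes D :: "real => real => real" and B :: "nat => real"
 assumes add: "!!a b c. 0 <= a ==> a <= b ==> b <= c ==> c <= 1 ==> D a c = D a b + D b c"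
  and dyad: "!!j p. l <= j ==> j <= r ==> p < 2 ^ j ==> \<bar>D (real p / 2 ^ j) ((real p + 1) / 2 ^ j)\<bar> <= B j"
  and B: "!!j. 0 <= B j" and lr: "l <= r" and s: "real p / 2 ^ l <= s" "s < (real p + 1) / 2 ^ l" "s < 1"
 shows "\<exists>q. q < 2 ^ r & real p / 2 ^ l <= real q / 2 ^ r & real q / 2 ^ r <= s & s < (real q + 1) / 2 ^ r &
  \<bar>D (real p / 2 ^ l) (real q / 2 ^ r)\<bar> <= (SUM j:{Suc l..r}. B j)"
 using lr dyad
proof (induction r rule: dec_induct)
 case base
 have "real p < 2 ^ l" using s by (smt (verit) divide_less_eq_1 zero_less_power less_divide_eq_1_pos)
 then have "p < 2 ^ l" by (metis of_nat_less_iff of_nat_numeral of_nat_power)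
 moreover have "D (real p / 2 ^ l) (real p / 2 ^ l) = 0"
 proof -
  have "real p / 2 ^ l <= 1" using s by linarith
  from add[OF _ order_refl order_refl this] show ?thesis by simp
 qed
 ultimately show ?case using s by (intro exI[of _ p]) auto
next
 case (step r)
 have "\<exists>q. q < 2 ^ r & real p / 2 ^ l <= real q / 2 ^ r & real q / 2 ^ r <= s & s < (real q + 1) / 2 ^ r &
  \<bar>D (real p / 2 ^ l) (real q / 2 ^ r)\<bar> <= (SUM j:{Suc l..r}. B j)"
  by (rule step.IH) (use step.prems in auto)
 then obtain q where q: "q < 2 ^ r" "real p / 2 ^ l <= real q / 2 ^ r" "real q / 2 ^ r <= s" "s < (real q + 1) / 2 ^ r"
  "\<bar>D (real p / 2 ^ l) (real q / 2 ^ r)\<bar> <= (SUM j:{Suc l..r}. B j)" by blast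
 have e1: "real q / 2 ^ r = real (2 * q) / 2 ^ Suc r" and e2: "(real q + 1) / 2 ^ r = (real (2 * q + 1) + 1) / 2 ^ Suc r"
  by (simp_all add: field_simps)
 have sB: "(SUM j:{Suc l..Suc r}. B j) = (SUM j:{Suc l..r}. B j) + B (Suc r)" using step.hyps by simp
 show ?case
 proof (cases "s < (real (2 * q) + 1) / 2 ^ Suc r")
  case True
  have "2 * q < 2 ^ Suc r" using q(1) by simp
  then show ?thesis using True q(2,3,5) B[of "Suc r"] unfolding sB e1 by (intro exI[of _ "2 * q"]) auto
 next
  case False
  define x where "x = real (2 * q + 1) / 2 ^ Suc r"
  have x: "x = (real (2 * q) + 1) / 2 ^ Suc r" by (simp add: x_def)
  have lt: "2 * q + 1 < 2 ^ Suc r" using q(1) by simp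
  have xs: "x <= s" using False by (simp add: x)
  have qx: "real q / 2 ^ r <= x" unfolding e1 x by (intro divide_right_mono) auto
  have "D (real p / 2 ^ l) x = D (real p / 2 ^ l) (real q / 2 ^ r) + D (real q / 2 ^ r) x"
   by (rule add) (use q qx xs s in auto)
  moreover have "\<bar>D (real q / 2 ^ r) x\<bar> <= B (Suc r)"
   unfolding e1 x by (rule step.prems) (use q(1) step.hyps in auto)
  ultimately have "\<bar>D (real p / 2 ^ l) x\<bar> <= (SUM j:{Suc l..Suc r}. B j)" using q(5) unfolding sB by linarith
  then show ?thesis using lt q(2,4) qx xs unfolding e2 by (intro exI[of _ "2 * q + 1"]) (auto simp: x_def)
 qed
qed

lemma geometric_sqrt_sum_le:
 fixes A c :: real assumes A: "1 <= A" and c: "0 <= c" and u: "0 <= u" and cu: "1 + real l + u <= A"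
 shows "(SUM j:{Suc l..r}. sqrt (c / 2 ^ j * (1 + real j + u))) <= 11 * sqrt (c / 2 ^ l * A)"
proof -
 \<comment> \<open>The bound 1 + i <= 2 (3/2)^i against the factor 2^(-i) leaves the ratio 3/4 under
   the root. It is raised to 49/64, and the constant 2 to 9/4, to have rational roots; the series of
   powers of 7/8 then gives 7 * 3/2 <= 11.\<close>
 have tm: "sqrt (c / 2 ^ (l + i) * (1 + real (l + i) + u)) <= 3 / 2 * (7 / 8) ^ i * sqrt (c / 2 ^ l * A)" for i
 proof -
  have "1 + real i / 2 <= (3 / 2) ^ i" using Bernoulli_inequality[of "1/2" i] by simp
  then have b: "1 + real i <= 2 * (3 / 2) ^ i" by simp
  have "1 + real (l + i) + u <= (1 + real i) * A" using A cu mult_left_mono[OF A, of "real i"] by (simp add: algebra_simps)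
  also have "... <= 2 * (3 / 2) ^ i * A" using b A by (intro mult_right_mono) auto
  finally have "c / 2 ^ (l + i) * (1 + real (l + i) + u) <= c / 2 ^ (l + i) * (2 * (3 / 2) ^ i * A)"
   using c by (intro mult_left_mono) auto
  also have "... = (c / 2 ^ l * A) * (2 * (3 / 4) ^ i)"
   by (simp add: power_add power_divide field_simps flip: power_mult_distrib)
  also have "... <= (c / 2 ^ l * A) * (9 / 4 * (49 / 64) ^ i)"
   using A c by (intro mult_left_mono mult_mono power_mono) auto
  also have "... = (c / 2 ^ l * A) * (3 / 2 * (7 / 8) ^ i)^2"
  proof -
   have "((7 / 8 :: real) ^ i)^2 = (49 / 64) ^ i" by (simp add: power2_eq_square flip: power_mult_distrib)
   then show ?thesis by (simp add: power_mult_distrib power2_eq_square)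
  qed
  finally have "sqrt (c / 2 ^ (l + i) * (1 + real (l + i) + u)) <= sqrt ((c / 2 ^ l * A) * (3 / 2 * (7 / 8) ^ i)^2)" by simp
  also have "... = sqrt (c / 2 ^ l * A) * (3 / 2 * (7 / 8) ^ i)" unfolding real_sqrt_mult by simp
  finally show ?thesis by (simp only: mult_ac)
 qed
 have geo: "(SUM i:{1..n}. (7 / 8 :: real) ^ i) <= 7" for n
 proof -
  have "(SUM i:{1..n}. (7 / 8 :: real) ^ i) = 7 - 7 * (7 / 8) ^ n" by (induction n) (auto simp: field_simps)
  then show ?thesis by simp
 qed
 show ?thesis
 proof (cases "l <= r")
  case True
  have "(SUM j:{Suc l..r}. sqrt (c / 2 ^ j * (1 + real j + u))) = (SUM i:{1..r - l}. sqrt (c / 2 ^ (l + i) * (1 + real (l + i) + u)))"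
   by (rule sum.reindex_bij_witness[of _ "%i. l + i" "%j. j - l"]) (use True in auto)
  also have "... <= (SUM i:{1..r - l}. 3 / 2 * (7 / 8) ^ i * sqrt (c / 2 ^ l * A))" by (rule sum_mono[OF tm])
  also have "... = 3 / 2 * (SUM i:{1..r - l}. (7 / 8) ^ i) * sqrt (c / 2 ^ l * A)"
   by (simp add: sum_distrib_left sum_distrib_right mult.assoc)
  also have "... <= 3 / 2 * 7 * sqrt (c / 2 ^ l * A)" using A c by (intro mult_right_mono mult_left_mono geo) auto
  also have "... <= 11 * sqrt (c / 2 ^ l * A)" using A c by (intro mult_right_mono) auto
  finally show ?thesis .
 qed (use A c in simp)
qed

section \<open>Blocks of sample sizes and the target rate\<close>

definition lev :: "nat => nat" where "lev n = nat \<lceil>log 2 (real n)\<rceil>"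

lemma lev_bounds:
 assumes n: "n >= 2"
 shows "real n <= 2 ^ lev n" "2 ^ lev n <= 2 * real n" "real (lev n) <= 4 * ln (real n)" "1 <= lev n" "n <= 2 ^ lev n"
proof -
 have l1: "1 <= log 2 (real n)" using n by simp
 then have c: "log 2 (real n) <= real (lev n)" "real (lev n) <= log 2 (real n) + 1" unfolding lev_def by linarith+
 have p: "(2::real) ^ lev n = 2 powr (real (lev n))" by (simp add: powr_realpow)
 have e: "2 powr (log 2 (real n)) = real n" using n by simp
 show 1: "real n <= 2 ^ lev n" unfolding p using c(1) e by (metis powr_mono numeral_le_iff one_le_numeral)
 have "2 powr (real (lev n)) <= 2 powr (log 2 (real n) + 1)" using c(2) by (intro powr_mono) auto
 then show "2 ^ lev n <= 2 * real n" unfolding p powr_add e by simp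
 have "ln 2 >= (1/2::real)" using ln_approx_bounds[of 2 0] ln2_ge_two_thirds by linarith
 then have "log 2 (real n) <= 2 * ln (real n)" "1 <= 2 * ln (real n)"
 proof -
  assume g: "ln 2 >= (1/2::real)"
  have "ln (real n) >= ln 2" using n by simp
  then show "1 <= 2 * ln (real n)" using g by linarith
  have "ln (real n) * 1 <= ln (real n) * (2 * ln 2)" using g \<open>ln (real n) >= ln 2\<close> by (intro mult_left_mono) auto
  then show "log 2 (real n) <= 2 * ln (real n)" by (simp add: log_def field_simps)
 qed
 then show "real (lev n) <= 4 * ln (real n)" using c by linarith
 show "1 <= lev n" using c(1) l1 by linarith
 show "n <= 2 ^ lev n" using 1 by (metis of_nat_le_iff of_nat_numeral of_nat_power)
qed

lemma filterlim_lev: "filterlim lev sequentially sequentially"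
 unfolding filterlim_at_top
proof
 fix Z
 show "eventually (%n. Z <= lev n) sequentially"
  unfolding eventually_sequentially
 proof (intro exI allI impI)
  fix n :: nat assume n: "2 ^ Z + 2 <= n"
  then have "(2::nat) ^ Z <= 2 ^ lev n" using lev_bounds(5)[of n] by linarith
  then show "Z <= lev n" by simp
 qed
qed

text \<open>Every bound that occurs in block k is converted to \<open>Q\<close>. There are two
  regimes. For wide bandwidths, 2 l <= \<delta> k, powers of k are beaten by powers of
  \<open>y\<close>, which itself is at least 2^l. Otherwise k is at most a multiple of l, hence of
  \<open>Lf\<close>, which absorbs it; here the lower end of the bandwidth range enters through
  \<open>hk2\<close>.\<close>

lemma rate_bounds:
 fixes \<delta> \<gamma> h Lf hk Q M :: real and k l n :: nat
 assumes \<delta>: "0 < \<delta>" "\<delta> < 1/2" and \<gamma>: "0 < \<gamma>" and k: "1 + 4 * real k <= 2 powr (\<delta> * real k / 2)" "1 <= k"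
  and n: "2 <= n" "real n <= 2 ^ k" "2 ^ k <= 2 * real n" "real k <= 4 * ln (real n)" "ln (real k) <= 2 * ln (ln (real n))"
  and h: "\<gamma> * (ln (real n) / real n) powr (2 * \<delta>) <= h" "h <= 1/2" "1 / real n <= h" "(1/2) ^ l <= h" "h < 2 * (1/2) ^ l"
  and hk: "hk = (real k / 2 ^ k) powr (2 * \<delta>)" and Lf: "Lf = max (ln (1 / h)) (ln (ln (real n)))"
  and Q: "Q = sqrt (real n * h * Lf)" and M: "M = 4 + sqrt (48 * (1 + 1 / \<gamma>) / \<delta>)"
 shows "sqrt (2 ^ k * hk * real k) <= M * Q" "l <= k"
  "2 * real l <= \<delta> * real k ==> sqrt (2 ^ k / 2 ^ l * (1 + real l + ln (real k))) <= 4 * Q"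
  "2 * real l <= \<delta> * real k ==> sqrt (2 ^ k * max (2 / 2 ^ nat \<lfloor>\<delta> * real k\<rfloor>) hk * real k) <= 2 * Q"
  "\<not> 2 * real l <= \<delta> * real k ==> sqrt (2 ^ k * max (2 / 2 ^ l) hk * real k) <= M * Q"
proof -
 define \<mu> where "\<mu> = nat \<lfloor>\<delta> * real k\<rfloor>"
 have half: "(1/2::real) ^ l = 1 / 2 ^ l" by (simp add: power_one_over)
 have h0: "0 < h" using h(4) by (smt (verit) zero_less_power half_gt_zero)
 have ln2: "2/3 <= ln (2::real)" by (rule ln2_ge_two_thirds)
 have lnh: "ln 2 <= ln (1 / h)" using h(2) h0 by (subst ln_le_cancel_iff) (auto simp: field_simps)
 have L: "2/3 <= Lf" "ln (1 / h) <= Lf" "ln (ln (real n)) <= Lf" using ln2 lnh unfolding Lf by linarith+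
 have lL: "real l <= 3 * Lf"
 proof -
  have "2 ^ l < 2 * (1 / h)" using h(5) h0 unfolding half by (simp add: field_simps)
  then have "ln (2 ^ l) < ln (2 * (1 / h))" using h0 by (subst ln_less_cancel_iff) auto
  moreover have "ln (2 * (1 / h)) = ln 2 + ln (1 / h)" using h0 by (intro ln_mult_pos) auto
  ultimately have "real l * ln 2 < ln 2 + ln (1 / h)" by (simp only: ln_realpow zero_less_numeral)
  then have "real l * ln 2 <= 2 * ln (1 / h)" using lnh by linarith
  moreover have "real l * (2/3) <= real l * ln 2" by (intro mult_left_mono ln2) simp
  ultimately show ?thesis using L(2) by linarith
 qed
 have n0: "0 < real n" using n by simp
 have nhL: "0 <= real n * h" "0 <= real n * h * Lf" using h0 L by auto
 have Q2: "c * Q = sqrt (c^2 * (real n * h * Lf))" if "0 <= c" for c using that by (simp add: Q real_sqrt_mult)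
 have Q0: "0 <= Q" using nhL by (simp add: Q)
 have kl: "2 ^ k / 2 ^ l <= 2 * (real n * h)"
 proof -
  have "2 ^ k * (1/2) ^ l <= (2 * real n) * h" by (rule mult_mono[OF n(3) h(4)]) auto
  then show ?thesis by (simp add: half)
 qed
 have k1: "real k / 2 ^ k <= 1" by (simp add: of_nat_less_two_power less_imp_le)
 have hk1: "hk <= real k * 2 powr (- (2 * \<delta> * real k))"
 proof -
  have "hk = real k powr (2 * \<delta>) * 2 powr (- (2 * \<delta> * real k))"
   unfolding hk by (simp add: powr_divide powr_minus powr_realpow[symmetric] powr_powr field_simps)
  moreover have "real k powr (2 * \<delta>) <= real k powr 1" using k \<delta> by (intro powr_mono) auto
  ultimately show ?thesis using k by (simp add: mult_right_mono)
 qed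
 have hk0: "0 <= hk" by (simp add: hk)
 \<comment> \<open>The square root of 2^(\<delta> k). By \<open>k\<close> it is at least 1 + 4 k,
   and \<open>hk\<close> is at most k / y^4.\<close>
 define y where "y = 2 powr (\<delta> * real k / 2)"
 have y: "1 + 4 * real k <= y" using k by (simp add: y_def)
 have y0: "0 < y" by (simp add: y_def)
 have y4: "2 powr (- (2 * \<delta> * real k)) = 1 / y ^ 4"
 proof -
  have "y ^ 4 = y powr 4" using y0 by simp
  also have "... = 2 powr (2 * \<delta> * real k)" by (simp add: y_def powr_powr mult.assoc)
  finally show ?thesis by (simp add: powr_minus_divide)
 qed
 have yk: "real k <= y" "real k >= 1" "1 <= y" using y k(2) by auto
 have big_hk: "hk * real k <= 1 / y"
 proof -
  have "hk * real k <= (real k * (1 / y ^ 4)) * real k" using hk1 unfolding y4 by (intro mult_right_mono) auto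
  also have "... = (real k * real k) * (1 / y ^ 4)" by simp
  also have "... <= (y * y) * (1 / y ^ 4)" using yk by (intro mult_right_mono mult_mono) auto
  also have "... = 1 / (y * y)" using y0 by (simp add: power4_eq_xxxx field_simps)
  also have "... <= 1 / y" using yk by (simp add: field_simps)
  finally show ?thesis .
 qed
 have big_l: "1 / y <= 1 / 2 ^ l" if "2 * real l <= \<delta> * real k"
 proof -
  have "2 powr real l <= y" unfolding y_def using that by (intro powr_mono) auto
  then have "2 ^ l <= y" by (simp add: powr_realpow)
  then show ?thesis using y0 by (simp add: field_simps)
 qed
 have sq_big: "sqrt (2 ^ k * z) <= 2 * Q" if "z <= 1 / 2 ^ l" for z
 proof -
  have "2 ^ k * z <= 2 ^ k / 2 ^ l" using mult_left_mono[OF that, of "2 ^ k"] by simp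
  also have "... <= 2 * (real n * h)" by (rule kl)
  also have "... <= 3 * Lf * (real n * h)" by (rule mult_right_mono) (use L nhL in auto)
  also have "... <= 2^2 * (real n * h * Lf)" using nhL by (simp add: mult_ac)
  finally show ?thesis unfolding Q2[OF zero_le_numeral] by simp
 qed
 have hk2: "hk <= 4 / \<gamma> * h"
 proof -
  have "real k / 2 ^ k <= 4 * ln (real n) / real n"
   by (rule frac_le) (use n k in auto)
  then have "hk <= (4 * (ln (real n) / real n)) powr (2 * \<delta>)" unfolding hk using \<delta> by (intro powr_mono2) auto
  also have "... = 4 powr (2 * \<delta>) * (ln (real n) / real n) powr (2 * \<delta>)" using n by (subst powr_mult) auto
  also have "... <= 4 powr 1 * (ln (real n) / real n) powr (2 * \<delta>)" using \<delta> by (intro mult_right_mono powr_mono) auto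
  also have "... <= 4 * (h / \<gamma>)" using h(1) \<gamma> by (simp add: field_simps)
  finally show ?thesis by simp
 qed
 \<comment> \<open>The number under the root in \<open>M\<close> is 2 * (2 + 4/\<gamma>) *
   6/\<delta>, rounded up to a simpler form.\<close>
 have small: "sqrt (2 ^ k * z * real k) <= M * Q" if nl: "\<not> 2 * real l <= \<delta> * real k" and z: "z <= (2 + 4 / \<gamma>) * h" for z
 proof -
  have kk: "real k <= 6 / \<delta> * Lf" using nl lL \<delta> by (simp add: field_simps)
  have "2 ^ k * z * real k <= 2 ^ k * ((2 + 4 / \<gamma>) * h) * real k" using z by (intro mult_right_mono mult_left_mono) auto
  also have "... <= (2 * real n) * ((2 + 4 / \<gamma>) * h) * (6 / \<delta> * Lf)"
   using n kk h0 \<gamma> by (intro mult_mono) auto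
  also have "... = (12 * (2 + 4 / \<gamma>) / \<delta>) * (real n * h * Lf)" by simp
  also have "... <= (48 * (1 + 1 / \<gamma>) / \<delta>) * (real n * h * Lf)"
   using \<gamma> \<delta> nhL by (intro mult_right_mono divide_right_mono) (auto simp: field_simps)
  finally have "sqrt (2 ^ k * z * real k) <= sqrt ((48 * (1 + 1 / \<gamma>) / \<delta>) * (real n * h * Lf))" by simp
  also have "... = sqrt (48 * (1 + 1 / \<gamma>) / \<delta>) * Q" unfolding Q by (rule real_sqrt_mult)
  also have "... <= M * Q" unfolding M by (intro mult_right_mono Q0) simp
  finally show ?thesis .
 qed
 have M4: "2 * Q <= M * Q" using \<gamma> \<delta> unfolding M by (intro mult_right_mono Q0) (simp add: add_increasing2)
 show "sqrt (2 ^ k * hk * real k) <= M * Q"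
 proof (cases "2 * real l <= \<delta> * real k")
  case True
  from sq_big[OF order_trans[OF big_hk big_l[OF True]]] M4 show ?thesis by (simp add: mult.assoc)
 next
  case False
  show ?thesis by (rule small[OF False]) (use hk2 h0 in \<open>simp add: algebra_simps add_increasing\<close>)
 qed
 show lk: "l <= k"
 proof (rule ccontr)
  assume "\<not> l <= k"
  then have "(2::real) ^ Suc k <= 2 ^ l" by (intro power_increasing) auto
  then have "2 * real n <= 2 ^ l" using n(2) unfolding power_Suc by linarith
  then have "2 * (1 / 2 ^ l) <= 1 / real n" using n0 by (simp add: field_simps)
  then show False using h(3,5) unfolding half by linarith
 qed
 show "sqrt (2 ^ k / 2 ^ l * (1 + real l + ln (real k))) <= 4 * Q"
 proof -
  have "1 + real l + ln (real k) <= 7 * Lf" using lL n(5) L by linarith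
  then have "2 ^ k / 2 ^ l * (1 + real l + ln (real k)) <= 2 ^ k / 2 ^ l * (7 * Lf)" by (rule mult_left_mono) simp
  also have "... <= 2 * (real n * h) * (7 * Lf)" by (rule mult_right_mono[OF kl]) (use L in simp)
  also have "... = 14 * (real n * h * Lf)" by simp
  also have "... <= 4^2 * (real n * h * Lf)" by (rule mult_right_mono) (use nhL in auto)
  finally show ?thesis unfolding Q2[OF zero_le_numeral] by simp
 qed
 show "sqrt (2 ^ k * max (2 / 2 ^ nat \<lfloor>\<delta> * real k\<rfloor>) hk * real k) <= 2 * Q" if bigl: "2 * real l <= \<delta> * real k"
 proof -
  have "y * y = 2 powr (\<delta> * real k)" by (simp add: y_def powr_add[symmetric])
  also have "... <= 2 powr (real \<mu> + 1)" unfolding \<mu>_def using \<delta> by (intro powr_mono) linarith+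
  also have "... = 2 * 2 ^ \<mu>" by (simp add: powr_add powr_realpow)
  finally have "y * y <= 2 * 2 ^ \<mu>" .
  then have "2 / 2 ^ \<mu> <= 4 / (y * y)" using y0 by (simp add: field_simps)
  then have "2 / 2 ^ \<mu> * real k <= 4 / (y * y) * real k" by (rule mult_right_mono) simp
  also have "... = (4 * real k / y) * (1 / y)" by simp
  also have "... <= 1 * (1 / y)" using y y0 by (intro mult_right_mono) auto
  finally have "max (2 / 2 ^ \<mu>) hk * real k <= 1 / y" using big_hk by (auto simp: max_def)
  from sq_big[OF order_trans[OF this big_l[OF bigl]]] show ?thesis unfolding \<mu>_def by (simp add: mult.assoc)
 qed
 show "sqrt (2 ^ k * max (2 / 2 ^ l) hk * real k) <= M * Q" if nl: "\<not> 2 * real l <= \<delta> * real k"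
 proof (rule small[OF nl])
  have "2 / 2 ^ l <= 2 * h" using h(4) by (simp add: half)
  moreover have "2 * h <= (2 + 4 / \<gamma>) * h" "4 / \<gamma> * h <= (2 + 4 / \<gamma>) * h" using h0 \<gamma> by (simp_all add: distrib_right)
  ultimately show "max (2 / 2 ^ l) hk <= (2 + 4 / \<gamma>) * h" using hk2 by simp
 qed
qed

text \<open>In the wide regime the interval is chained from level \<open>l\<close> to the finer
  level \<open>\<mu>\<close>, up to which the sharper bound \<open>dyad\<close> is available, and
  only the rest is left to the grid bound: 11 * 4 from the chain and 2 from the grid make 46. In the
  other regime the grid bound alone suffices and costs \<open>M\<close>.\<close>

lemma interval_deviation_bound:
 fixes D :: "real => real => real" and \<delta> \<gamma> h Lf hk Q M c L s :: real and k l n p :: nat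
 assumes add: "!!a b c. 0 <= a ==> a <= b ==> b <= c ==> c <= 1 ==> D a c = D a b + D b c"
  and low: "!!a b. 0 <= a ==> a <= b ==> b <= 1 ==> - (L * 2 ^ k * (b - a)) <= D a b"
  and grid: "!!i j. i <= j ==> j <= 2 ^ k ==> \<bar>D (real i / 2 ^ k) (real j / 2 ^ k)\<bar> <= c * sqrt (2 ^ k * max ((real j - real i) / 2 ^ k) hk * real k)"
  and dyad: "!!j p. j <= nat \<lfloor>\<delta> * real k\<rfloor> ==> p < 2 ^ j ==>
   \<bar>D (real p / 2 ^ j) ((real p + 1) / 2 ^ j)\<bar> <= c * sqrt (2 ^ k / 2 ^ j * (1 + real j + ln (real k)))"
  and c: "0 <= c" and L: "0 <= L"
  and \<delta>: "0 < \<delta>" "\<delta> < 1/2" and \<gamma>: "0 < \<gamma>" and k: "1 + 4 * real k <= 2 powr (\<delta> * real k / 2)" "1 <= k"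
  and n: "2 <= n" "real n <= 2 ^ k" "2 ^ k <= 2 * real n" "real k <= 4 * ln (real n)" "ln (real k) <= 2 * ln (ln (real n))"
  and h: "\<gamma> * (ln (real n) / real n) powr (2 * \<delta>) <= h" "h <= 1/2" "1 / real n <= h" "(1/2) ^ l <= h" "h < 2 * (1/2) ^ l"
  and hk: "hk = (real k / 2 ^ k) powr (2 * \<delta>)" and Lf: "Lf = max (ln (1 / h)) (ln (ln (real n)))"
  and Q: "Q = sqrt (real n * h * Lf)" and M: "M = 4 + sqrt (48 * (1 + 1 / \<gamma>) / \<delta>)"
  and p: "p < 2 ^ l" and s: "real p / 2 ^ l <= s" "s <= (real p + 1) / 2 ^ l"
 shows "\<bar>D (real p / 2 ^ l) s\<bar> <= c * (46 + M) * Q + L"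
proof -
 note R = rate_bounds[OF \<delta> \<gamma> k n h hk Lf Q M]
 define \<mu> where "\<mu> = nat \<lfloor>\<delta> * real k\<rfloor>"
 have hk0: "0 <= hk" by (simp add: hk)
 have p1: "(real p + 1) / 2 ^ l <= 1"
 proof -
  have "real (Suc p) <= 2 ^ l" using p by (metis Suc_leI of_nat_le_iff of_nat_numeral of_nat_power)
  then show ?thesis by (simp add: add.commute)
 qed
 have s1: "s <= 1" using s p1 by linarith
 have Q0: "0 <= Q" unfolding Q Lf using h n by (smt (verit) real_sqrt_ge_zero mult_nonneg_nonneg of_nat_0_le_iff ln_ge_zero_iff divide_pos_pos zero_less_power half_gt_zero le_divide_eq_1_pos max.coboundedI1)
 have M0: "0 <= M" unfolding M using \<gamma> \<delta> by (simp add: add_nonneg_nonneg)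
 define G where "G x = c * sqrt (2 ^ k * max x hk * real k)" for x
 have Gm: "mono G" unfolding G_def by (intro monoI mult_left_mono c real_sqrt_le_mono mult_right_mono mult_left_mono) auto
 have rem: "\<bar>D (real i / 2 ^ k) s'\<bar> <= G (s' - real i / 2 ^ k + 1 / 2 ^ k) + L" if "real i / 2 ^ k <= s'" "s' <= 1" for i s'
  by (rule grid_deviation_bound[OF add low grid[folded G_def] Gm L that])
 have rem2: "\<bar>D (real q / 2 ^ j) s\<bar> <= G (2 / 2 ^ j) + L"
  if j: "j <= k" and q: "real q / 2 ^ j <= s" "s <= (real q + 1) / 2 ^ j" for q j
 proof -
  have e: "real q / 2 ^ j = real (q * 2 ^ (k - j)) / 2 ^ k" 
  proof -
   have "(2::real) ^ k = 2 ^ j * 2 ^ (k - j)" using j by (simp flip: power_add)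
   then show ?thesis by simp
  qed
  have "s - real q / 2 ^ j <= 1 / 2 ^ j" using q(2) by (simp add: add_divide_distrib)
  moreover have "1 / 2 ^ k <= (1::real) / 2 ^ j" using j by (simp add: field_simps power_increasing)
  ultimately have "s - real q / 2 ^ j + 1 / 2 ^ k <= 2 / 2 ^ j" by simp
  from monoD[OF Gm this] rem[of "q * 2 ^ (k - j)" s] q(1) s1 show ?thesis unfolding e[symmetric] by linarith
 qed
 show ?thesis
 proof (cases "2 * real l <= \<delta> * real k")
  case False
  have "G (2 / 2 ^ l) <= c * (M * Q)" unfolding G_def using R(5)[OF False] c by (rule mult_left_mono)
  also have "... <= c * (46 + M) * Q" using c Q0 by (simp add: algebra_simps)
  finally show ?thesis using rem2[OF R(2) s] by linarith
 next
  case True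
  have "real l <= \<delta> * real k" using True by linarith
  then have l\<mu>: "l <= \<mu>" unfolding \<mu>_def by (simp add: le_nat_floor)
  have "real \<mu> <= \<delta> * real k" unfolding \<mu>_def using \<delta> by simp
  also have "... <= 1 * real k" using \<delta> by (intro mult_right_mono) auto
  finally have \<mu>k: "\<mu> <= k" by simp
  have lnk: "0 <= ln (real k)" using k by simp
  define B where "B j = c * sqrt (2 ^ k / 2 ^ j * (1 + real j + ln (real k)))" for j
  have B0: "0 <= B j" for j unfolding B_def using c lnk by simp
  have Bl: "B l <= c * (4 * Q)" unfolding B_def by (rule mult_left_mono[OF R(3)[OF True] c])
  show ?thesis
  \<comment> \<open>At its right end point the cell is itself a dyadic interval of level
    \<open>l\<close>.\<close>
  proof (cases "s < (real p + 1) / 2 ^ l")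
   case slt: True
   have dy: "\<bar>D (real q / 2 ^ j) ((real q + 1) / 2 ^ j)\<bar> <= B j" if "l <= j" "j <= \<mu>" "q < 2 ^ j" for j q
    unfolding B_def by (rule dyad) (use that in \<open>auto simp: \<mu>_def\<close>)
   from dyadic_chain_bound[where D=D and B=B, OF add dy B0 l\<mu> s(1) slt] slt p1
   obtain q where q: "q < 2 ^ \<mu>" "real p / 2 ^ l <= real q / 2 ^ \<mu>" "real q / 2 ^ \<mu> <= s" "s < (real q + 1) / 2 ^ \<mu>"
    "\<bar>D (real p / 2 ^ l) (real q / 2 ^ \<mu>)\<bar> <= (SUM j:{Suc l..\<mu>}. B j)" by auto
   have "(SUM j:{Suc l..\<mu>}. B j) = c * (SUM j:{Suc l..\<mu>}. sqrt (2 ^ k / 2 ^ j * (1 + real j + ln (real k))))"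
    by (simp add: B_def sum_distrib_left)
   also have "... <= c * (11 * sqrt (2 ^ k / 2 ^ l * (1 + real l + ln (real k))))"
    by (rule mult_left_mono[OF geometric_sqrt_sum_le c]) (use lnk in auto)
   also have "... <= c * (11 * (4 * Q))" using R(3)[OF True] c by (intro mult_left_mono) auto
   finally have ch: "(SUM j:{Suc l..\<mu>}. B j) <= c * (44 * Q)" by simp
   have "G (2 / 2 ^ \<mu>) <= c * (2 * Q)" unfolding G_def \<mu>_def by (rule mult_left_mono[OF R(4)[OF True] c])
   then have "\<bar>D (real q / 2 ^ \<mu>) s\<bar> <= c * (2 * Q) + L" using rem2[OF \<mu>k q(3)] q(4) by linarith
   moreover have "D (real p / 2 ^ l) s = D (real p / 2 ^ l) (real q / 2 ^ \<mu>) + D (real q / 2 ^ \<mu>) s"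
    by (rule add) (use q s1 in auto)
   ultimately have "\<bar>D (real p / 2 ^ l) s\<bar> <= c * (44 * Q) + (c * (2 * Q) + L)" using q(5) ch by linarith
   also have "... <= c * (46 + M) * Q + L" using c Q0 M0 by (simp add: algebra_simps)
   finally show ?thesis .
  next
   case False
   then have "s = (real p + 1) / 2 ^ l" using s by simp
   then have "\<bar>D (real p / 2 ^ l) s\<bar> <= B l" unfolding B_def using dyad[OF _ p] l\<mu> by (simp add: \<mu>_def)
   also have "... <= c * (4 * Q)" by (rule Bl)
   also have "... <= c * (46 + M) * Q" using c Q0 M0 mult_nonneg_nonneg[OF c Q0] mult_nonneg_nonneg[OF mult_nonneg_nonneg[OF c M0] Q0] by (simp add: algebra_simps)
   finally show ?thesis using L by linarith
  qed
 qed
qed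

lemma dyadic_ratio_powr_le:
 fixes \<delta> :: real assumes \<delta>: "0 < \<delta>" "\<delta> < 1/2" and k: "1 <= k"
 shows "(real k / 2 ^ k) powr (2 * \<delta>) <= real k * 2 powr (- (2 * \<delta> * real k))"
proof -
 have "(real k / 2 ^ k) powr (2 * \<delta>) = real k powr (2 * \<delta>) * 2 powr (- (2 * \<delta> * real k))"
  by (simp add: powr_divide powr_minus powr_realpow[symmetric] powr_powr field_simps)
 moreover have "real k powr (2 * \<delta>) <= real k powr 1" using k \<delta> by (intro powr_mono) auto
 ultimately show ?thesis using k by (simp add: mult_right_mono)
qed

lemma (in prob_space) AE_eventually_avoid:
 assumes P: "!!k. finite (P k)" and ev: "!!k z. z \<in> P k ==> bad k z \<in> events"
  and s: "\<forall>\<^sub>F k in sequentially. (SUM z:P k. prob (bad k z)) <= s k" "summable s"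
 shows "AE w in M. \<forall>\<^sub>F k in sequentially. \<forall>z\<in>P k. w ~: bad (k::nat) z"
proof -
 define A where "A k = (\<Union>z\<in>P k. bad k z)" for k
 have A: "A k \<in> events" for k unfolding A_def by (rule sets.finite_UN[OF P ev])
 have AS: "prob (A k) <= (SUM z:P k. prob (bad k z))" for k unfolding A_def by (rule measure_UNION_le[OF P ev])
 have "\<forall>\<^sub>F k in sequentially. norm (prob (A k)) <= s k"
  by (rule eventually_mono[OF s(1)]) (use AS order_trans in fastforce)
 then have "summable (%k. prob (A k))" by (rule summable_comparison_test_ev[OF _ s(2)])
 then have "AE w in M. \<forall>\<^sub>F k in sequentially. w \<in> space M - A k"
  by (intro borel_cantelli_AE1[OF A]) (simp_all add: emeasure_eq_measure)
 then show ?thesis by (rule AE_mp) (rule AE_I2, auto elim!: eventually_mono simp: A_def)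
qed

section \<open>Samples with nonnegative marks\<close>

text \<open>Marks are nonnegative so that sums over intervals are monotone, which gives the lower
  bound in \<open>grid_deviation_bound\<close>. The design is the case of marks 1, and the noise
  enters through its positive and its negative part.\<close>

locale iid_marks = prob_space +
 fixes X U :: "nat => 'a => real" and \<kappa> K :: real
 assumes ind: "indep_vars (%_. borel) (%i w. (X i w, U i w)) {1..}"
  and id: "!!i. i >= 1 ==> distr M borel (%w. (X i w, U i w)) = distr M borel (%w. (X 1 w, U 1 w))"
  and U_nonneg: "!!i w. i >= 1 ==> w \<in> space M ==> 0 <= U i w"
  and kappa: "\<kappa> > 2" and K: "0 <= K"
  and integrable_moment: "integrable M (%w. U 1 w powr \<kappa>)"
  and mass: "!!a b. 0 <= a ==> a <= b ==> b <= 1 ==> prob {w\<in>space M. X 1 w \<in> {a<..b}} <= K * (b - a)"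
  and moment: "!!a b. 0 <= a ==> a <= b ==> b <= 1 ==>
   expectation (%w. U 1 w powr \<kappa> * indicator {a<..b} (X 1 w)) <= K * (b - a)"
begin

lemma measurable_XU: "i >= 1 ==> (%w. (X i w, U i w)) \<in> borel_measurable M"
 using ind by (simp add: indep_vars_def)

lemma measurable_X: assumes "i >= 1" shows "X i \<in> borel_measurable M"
proof -
 have "fst \<in> borel_measurable (borel :: (real \<times> real) measure)" by (intro borel_measurable_continuous_onI continuous_intros)
 from measurable_compose[OF measurable_XU[OF assms] this] show ?thesis by simp
qed

lemma measurable_U: assumes "i >= 1" shows "U i \<in> borel_measurable M"
proof -
 have "snd \<in> borel_measurable (borel :: (real \<times> real) measure)" by (intro borel_measurable_continuous_onI continuous_intros)
 from measurable_compose[OF measurable_XU[OF assms] this] show ?thesis by simp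
qed

lemma expectation_XU:
 assumes "f \<in> borel_measurable borel" "i >= 1"
 shows "expectation (%w. f (X i w, U i w)) = expectation (%w. f (X 1 w, U 1 w) :: real)"
 using integral_distr[OF measurable_XU[OF assms(2)] assms(1)] integral_distr[OF measurable_XU[of 1] assms(1)] id[OF assms(2)] by simp

definition trunc :: "real => real => real => real \<times> real => real" where
 "trunc \<tau> a b z = (if snd z <= \<tau> then snd z else 0) * indicator {a<..b} (fst z)"

definition trunc_mean :: "real => real => real => real" where
 "trunc_mean \<tau> a b = expectation (%w. trunc \<tau> a b (X 1 w, U 1 w))"

definition Dev :: "real => nat => 'a => real => real => real" where
 "Dev \<tau> n w a b = (SUM i=1..n. trunc \<tau> a b (X i w, U i w) - trunc_mean \<tau> a b)"

lemma measurable_trunc: "trunc \<tau> a b \<in> borel_measurable borel"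
 unfolding trunc_def borel_prod[symmetric] by measurable

lemma measurable_trunc_XU: "i >= 1 ==> (%w. trunc \<tau> a b (X i w, U i w)) \<in> borel_measurable M"
 by (rule measurable_compose[OF measurable_XU measurable_trunc])

lemma trunc_bounds:
 assumes "0 <= \<tau>" "i >= 1" "w \<in> space M"
 shows "0 <= trunc \<tau> a b (X i w, U i w)" "trunc \<tau> a b (X i w, U i w) <= \<tau>"
 using U_nonneg[OF assms(2,3)] assms(1) by (auto simp: trunc_def indicator_def)

lemma integrable_trunc:
 assumes "0 <= \<tau>" "i >= 1"
 shows "integrable M (%w. trunc \<tau> a b (X i w, U i w))"
 by (rule integrable_const_bound[where B=\<tau>, OF AE_I2 measurable_trunc_XU[OF assms(2)]]) (use trunc_bounds[OF assms] in simp)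

lemma integrable_trunc_sq:
 assumes "0 <= \<tau>" "i >= 1"
 shows "integrable M (%w. (trunc \<tau> a b (X i w, U i w))^2)"
proof (rule integrable_const_bound[where B="\<tau>^2", OF AE_I2 borel_measurable_power[OF measurable_trunc_XU[OF assms(2)]]])
 fix w assume "w \<in> space M"
 from power_mono[OF trunc_bounds(2)[OF assms this, of a b] trunc_bounds(1)[OF assms this, of a b], where n=2]
 show "norm ((trunc \<tau> a b (X i w, U i w))^2) <= \<tau>^2" by simp
qed

lemma measurable_cell: "(%w. indicator {a<..b} (X 1 w) :: real) \<in> borel_measurable M"
 by (rule measurable_compose[OF measurable_X]) auto

lemma integrable_moment_cell: "integrable M (%w. U 1 w powr \<kappa> * indicator {a<..b} (X 1 w))"
 by (rule Bochner_Integration.integrable_bound[OF integrable_moment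
   borel_measurable_times[OF borel_measurable_integrable[OF integrable_moment] measurable_cell]])
  (auto simp: indicator_def)

lemma integrable_cell: "integrable M (%w. indicator {a<..b} (X 1 w) :: real)"
 by (rule integrable_const_bound[where B=1, OF AE_I2 measurable_cell]) (auto simp: indicator_def)

lemma expectation_cell:
 "expectation (%w. indicator {a<..b} (X 1 w) :: real) = prob {w\<in>space M. X 1 w \<in> {a<..b}}"
proof -
 have m: "{w\<in>space M. X 1 w \<in> {a<..b}} \<in> events" using measurable_X[of 1] by measurable
 have "expectation (%w. indicator {a<..b} (X 1 w) :: real) = expectation (indicator {w\<in>space M. X 1 w \<in> {a<..b}})"
  by (rule Bochner_Integration.integral_cong) (auto simp: indicator_def)
 then show ?thesis using m by simp
qed

text \<open>For u >= 0 both u and u^2 are at most 1 + u^\<kappa>, so \<open>mass\<close> and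
  \<open>moment\<close> give bounds that are uniform in the truncation level.\<close>

lemma trunc_moments:
 assumes \<tau>: "0 <= \<tau>" and ab: "0 <= a" "a <= b" "b <= 1"
 shows "trunc_mean \<tau> a b <= 2 * K * (b - a)"
  "expectation (%z. (trunc \<tau> a b (X 1 z, U 1 z))^2) <= 2 * K * (b - a)"
proof -
 let ?F = "%z. indicator {a<..b} (X 1 z) + U 1 z powr \<kappa> * indicator {a<..b} (X 1 z)"
 have F: "integrable M ?F" using integrable_cell integrable_moment_cell by simp
 have "expectation ?F = prob {z\<in>space M. X 1 z \<in> {a<..b}} + expectation (%z. U 1 z powr \<kappa> * indicator {a<..b} (X 1 z))"
  unfolding expectation_cell[symmetric] by (rule Bochner_Integration.integral_add[OF integrable_cell integrable_moment_cell])
 then have EF: "expectation ?F <= 2 * K * (b - a)" using mass[OF ab] moment[OF ab] by linarith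
 have u: "u powr r <= 1 + u powr \<kappa>" if "0 <= u" "0 < r" "r <= \<kappa>" for u r :: real
 proof (cases "u <= 1")
  case True
  then have "u powr r <= 1" using that by (simp add: powr_le1)
  then show ?thesis using powr_ge_zero[of u \<kappa>] by linarith
 next
  case False
  then have "u powr r <= u powr \<kappa>" using that by (intro powr_mono) auto
  then show ?thesis by simp
 qed
 have pw: "trunc \<tau> a b (X 1 z, U 1 z) <= ?F z" "(trunc \<tau> a b (X 1 z, U 1 z))^2 <= ?F z" if w: "z \<in> space M" for z
 proof -
  have n: "0 <= U 1 z" using U_nonneg[OF order_refl w] .
  have "U 1 z <= 1 + U 1 z powr \<kappa>" using u[OF n, of 1] kappa n by simp
  then show "trunc \<tau> a b (X 1 z, U 1 z) <= ?F z" using n by (auto simp: trunc_def indicator_def add_nonneg_nonneg)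
  have "U 1 z powr 2 = (U 1 z)^2" using n by simp
  then have "(U 1 z)^2 <= 1 + U 1 z powr \<kappa>" using u[OF n, of 2] kappa by simp
  then show "(trunc \<tau> a b (X 1 z, U 1 z))^2 <= ?F z" using n by (auto simp: trunc_def indicator_def add_nonneg_nonneg)
 qed
 show "trunc_mean \<tau> a b <= 2 * K * (b - a)" unfolding trunc_mean_def
  by (rule order_trans[OF integral_mono[OF integrable_trunc[OF \<tau>] F pw(1)] EF]) auto
 show "expectation (%z. (trunc \<tau> a b (X 1 z, U 1 z))^2) <= 2 * K * (b - a)"
  by (rule order_trans[OF integral_mono[OF integrable_trunc_sq[OF \<tau>] F pw(2)] EF]) auto
qed

lemma trunc_mean_bounds:
 assumes "0 <= \<tau>" shows "0 <= trunc_mean \<tau> a b" "trunc_mean \<tau> a b <= \<tau>"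
proof -
 show "0 <= trunc_mean \<tau> a b" unfolding trunc_mean_def
  by (rule Bochner_Integration.integral_nonneg) (rule trunc_bounds[OF assms], auto)
 have "trunc_mean \<tau> a b <= expectation (%_. \<tau>)" unfolding trunc_mean_def
  by (rule integral_mono[OF integrable_trunc[OF assms]]) (simp, simp, rule trunc_bounds[OF assms], auto)
 then show "trunc_mean \<tau> a b <= \<tau>" by (simp add: prob_space)
qed

lemma trunc_add: "a <= b ==> b <= c ==> trunc \<tau> a c z = trunc \<tau> a b z + trunc \<tau> b c z"
 by (auto simp: trunc_def indicator_def)

lemma Dev_add:
 assumes "0 <= \<tau>" "a <= b" "b <= c"
 shows "Dev \<tau> n w a c = Dev \<tau> n w a b + Dev \<tau> n w b c"
proof -
 have "trunc_mean \<tau> a c = trunc_mean \<tau> a b + trunc_mean \<tau> b c"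
  unfolding trunc_mean_def trunc_add[OF assms(2,3)] using integrable_trunc[OF assms(1) order_refl] by simp
 then show ?thesis unfolding Dev_def trunc_add[OF assms(2,3)] by (simp add: sum.distrib[symmetric] algebra_simps)
qed

lemma Dev_ge:
 assumes \<tau>: "0 <= \<tau>" and ab: "0 <= a" "a <= b" "b <= 1" and w: "z \<in> space M" and n: "real n <= N"
 shows "- (2 * K * N * (b - a)) <= Dev \<tau> n z a b"
proof -
 have "(SUM i=1..n. - (2 * K * (b - a))) <= Dev \<tau> n z a b" unfolding Dev_def
 proof (rule sum_mono)
  fix i assume "i \<in> {1..n}"
  then show "- (2 * K * (b - a)) <= trunc \<tau> a b (X i z, U i z) - trunc_mean \<tau> a b"
   using trunc_bounds(1)[OF \<tau> _ w, of i a b] trunc_moments(1)[OF \<tau> ab] by simp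
 qed
 then have "- (real n * (2 * K * (b - a))) <= Dev \<tau> n z a b" by simp
 moreover have "real n * (2 * K * (b - a)) <= N * (2 * K * (b - a))" using n K ab by (intro mult_right_mono) auto
 ultimately show ?thesis by (simp add: mult_ac)
qed

text \<open>The exponential inequality with s = sqrt (c / (N v)): the variance term becomes 2 K c
  and the level contributes (2 K + q) c. The condition \<tau>^2 c <= N v says s \<tau> <= 1. As
  \<open>v\<close> may exceed the length of the interval, short intervals can be treated with a
  larger \<open>v\<close> that meets this condition.\<close>

lemma deviation_prob:
 assumes \<tau>: "0 <= \<tau>" and ab: "0 <= a" "a <= b" "b <= 1"
 shows "{w\<in>space M. \<exists>n\<le>N. r <= \<bar>Dev \<tau> n w a b\<bar>} \<in> events"
  "b - a <= v ==> 0 < v ==> 0 < c ==> 0 < N ==> \<tau>^2 * c <= real N * v ==>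
   prob {w\<in>space M. \<exists>n\<le>N. (2 * K + q) * sqrt (real N * v * c) <= \<bar>Dev \<tau> n w a b\<bar>} <= 2 * exp (- q * c)"
proof -
 define \<xi> where "\<xi> i w = trunc \<tau> a b (X i w, U i w) - trunc_mean \<tau> a b" for i w
 have ind\<xi>: "indep_vars (%_. borel) \<xi> {1..N}" unfolding \<xi>_def
 proof (rule indep_vars_compose2[where Y="%_ z. trunc \<tau> a b z - trunc_mean \<tau> a b" and X="%i w. (X i w, U i w)" and M'="%_. borel"])
  show "indep_vars (%_. borel) (%i w. (X i w, U i w)) {1..N}" by (rule indep_vars_subset[OF ind]) auto
 qed (intro borel_measurable_diff measurable_trunc borel_measurable_const)
 have b: "\<bar>\<xi> i w\<bar> <= \<tau>" if "i \<in> {1..N}" "w \<in> space M" for i w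
  using trunc_bounds[OF \<tau> _ that(2), of i a b] trunc_mean_bounds[OF \<tau>, of a b] that(1) by (auto simp: \<xi>_def abs_le_iff)
 have 0: "expectation (\<xi> i) = 0" if "i \<in> {1..N}" for i
  using expectation_XU[OF measurable_trunc, of i \<tau> a b] integrable_trunc[OF \<tau>, of i a b] that
  by (simp add: \<xi>_def[abs_def] trunc_mean_def prob_space)
 have V: "expectation (%w. (\<xi> i w)^2) <= 2 * K * (b - a)" if "i \<in> {1..N}" for i
 proof -
  have i: "i >= 1" using that by simp
  have "expectation (%w. (\<xi> i w)^2) = expectation (%w. (trunc \<tau> a b (X i w, U i w))^2 - 2 * trunc_mean \<tau> a b * trunc \<tau> a b (X i w, U i w) + (trunc_mean \<tau> a b)^2)"
   unfolding \<xi>_def by (simp add: power2_diff algebra_simps)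
  also have "... = expectation (%w. (trunc \<tau> a b (X i w, U i w))^2) - 2 * trunc_mean \<tau> a b * expectation (%w. trunc \<tau> a b (X i w, U i w)) + (trunc_mean \<tau> a b)^2"
   using integrable_trunc[OF \<tau> i, of a b] integrable_trunc_sq[OF \<tau> i, of a b] by (simp add: prob_space)
  also have "... = expectation (%w. (trunc \<tau> a b (X 1 w, U 1 w))^2) - (trunc_mean \<tau> a b)^2"
   using expectation_XU[OF measurable_trunc i, of \<tau> a b] expectation_XU[OF borel_measurable_power[OF measurable_trunc, where n=2] i, of \<tau> a b]
   by (simp add: trunc_mean_def power2_eq_square)
  also have "... <= 2 * K * (b - a)" using trunc_moments(2)[OF \<tau> ab] zero_le_power2[of "trunc_mean \<tau> a b"] by linarith
  finally show ?thesis .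
 qed
 have K0: "0 <= 2 * K * (b - a)" using K ab by simp
 have DE: "Dev \<tau> n w a b = (SUM i=1..n. \<xi> i w)" for n w by (simp add: Dev_def \<xi>_def)
 have z: "0 * \<tau> <= 1" unfolding mult_zero_left by (rule zero_le_one)
 show "{w\<in>space M. \<exists>n\<le>N. r <= \<bar>Dev \<tau> n w a b\<bar>} \<in> events" unfolding DE
  by (rule exp_maximal_inequality_abs(2)[OF ind\<xi> b order_refl z 0 V K0])
 assume v: "b - a <= v" "0 < v" and c: "0 < c" and N: "0 < N" and cond: "\<tau>^2 * c <= real N * v"
 define s where "s = sqrt (c / (real N * v))"
 have s0: "0 <= s" using c v N by (simp add: s_def)
 have s2: "s^2 = c / (real N * v)" using c v N by (simp add: s_def)
 have "(s * \<tau>)^2 <= 1^2" using cond v N by (simp add: power_mult_distrib s2 field_simps)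
 then have s1: "s * \<tau> <= 1" by (rule power2_le_imp_le) simp
 have V': "expectation (%w. (\<xi> i w)^2) <= 2 * K * v" if "i \<in> {1..N}" for i
  using V[OF that] mult_left_mono[OF v(1), of "2 * K"] K by simp
 have Kv: "0 <= 2 * K * v" using K v by simp
 have sl: "s * sqrt (real N * v * c) = c"
 proof -
  have "s * sqrt (real N * v * c) = sqrt (c / (real N * v) * (real N * v * c))" by (simp only: s_def real_sqrt_mult)
  also have "c / (real N * v) * (real N * v * c) = c^2" using v N by (simp add: power2_eq_square)
  finally show ?thesis using c by simp
 qed
 have "s^2 * (real N * (2 * K * v)) - s * ((2 * K + q) * sqrt (real N * v * c)) = c * (2 * K) - (2 * K + q) * (s * sqrt (real N * v * c))"
  using v N unfolding s2 by simp
 also have "... = - q * c" unfolding sl by (simp add: algebra_simps)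
 finally have e: "s^2 * (real N * (2 * K * v)) - s * ((2 * K + q) * sqrt (real N * v * c)) = - q * c" .
 show "prob {w\<in>space M. \<exists>n\<le>N. (2 * K + q) * sqrt (real N * v * c) <= \<bar>Dev \<tau> n w a b\<bar>} <= 2 * exp (- q * c)"
  unfolding DE using exp_maximal_inequality_abs(1)[OF ind\<xi> b s0 s1 0 V' Kv, of "(2 * K + q) * sqrt (real N * v * c)"] unfolding e .
qed

text \<open>\<open>2 * \<delta>\<close> is the exponent of the bandwidth range. The level
  \<open>\<tau> k\<close> is fixed by \<open>(\<tau> k)^2 * real k = 2 ^ k * hk k\<close>, the limit
  of the exponential inequality for intervals of length \<open>hk k\<close>. The same choice makes
  \<open>\<tau> k powr (1 - \<kappa>) * 2 ^ k\<close>, the order of the discarded part, equal to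
  \<open>sqrt (2 ^ k * hk k * real k)\<close>.\<close>

definition \<delta> :: real where "\<delta> = (1 - 2 / \<kappa>) / 2"
definition \<tau> :: "nat => real" where "\<tau> k = (2 ^ k / real k) powr (1 / \<kappa>)"
definition hk :: "nat => real" where "hk k = (real k / 2 ^ k) powr (2 * \<delta>)"

lemma delta: "0 < \<delta>" "\<delta> < 1/2" "2 * \<delta> = 1 - 2 / \<kappa>"
 using kappa by (auto simp: \<delta>_def)

lemma tau:
 assumes k: "1 <= k"
 shows "0 <= \<tau> k" "1 <= \<tau> k" "(\<tau> k)^2 * real k = 2 ^ k * hk k" "\<tau> k powr (1 - \<kappa>) * 2 ^ k = real k * \<tau> k"
  "real k * \<tau> k = sqrt (2 ^ k * hk k * real k)"
proof -
 define x where "x = 2 ^ k / real k"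
 have x1: "1 <= x" using k by (simp add: x_def of_nat_less_two_power less_imp_le)
 have tx: "\<tau> k = x powr (1 / \<kappa>)" by (simp add: \<tau>_def x_def)
 show t0: "0 <= \<tau> k" by (simp add: \<tau>_def)
 show "1 <= \<tau> k" unfolding tx using x1 kappa by (intro ge_one_powr_ge_zero) auto
 have hx: "hk k = x powr (- (2 * \<delta>))"
  unfolding hk_def x_def using k by (simp add: powr_minus_divide powr_divide)
 have "(\<tau> k)^2 = x powr (2 / \<kappa>)" unfolding tx by (simp add: power2_eq_square powr_add[symmetric])
 also have "2 / \<kappa> = 1 + - (2 * \<delta>)" using delta(3) by simp
 also have "x powr (1 + - (2 * \<delta>)) = x * hk k" unfolding hx using x1 by (subst powr_add) simp
 finally show t2: "(\<tau> k)^2 * real k = 2 ^ k * hk k" using k by (simp add: x_def)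
 have "\<tau> k powr (1 - \<kappa>) = x powr (1 / \<kappa> - 1)" unfolding tx powr_powr using kappa by (simp add: field_simps)
 also have "... = \<tau> k / x" unfolding tx using x1 by (simp add: powr_diff)
 finally show "\<tau> k powr (1 - \<kappa>) * 2 ^ k = real k * \<tau> k" using k by (simp add: x_def)
 have "sqrt (2 ^ k * hk k * real k) = sqrt ((real k * \<tau> k)^2)" unfolding t2[symmetric] by (simp add: power2_eq_square mult_ac)
 then show "real k * \<tau> k = sqrt (2 ^ k * hk k * real k)" using t0 by simp
qed

definition grid_bad :: "nat => nat \<times> nat => 'a set" where
 "grid_bad k = (%(i, j). {w\<in>space M. \<exists>n\<le>2^k. (2 * K + 4) * sqrt (2 ^ k * max ((real j - real i) / 2 ^ k) (hk k) * real k)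
  <= \<bar>Dev (\<tau> k) n w (real i / 2 ^ k) (real j / 2 ^ k)\<bar>})"

text \<open>Block k has at most 4 * 4^k pairs of grid points, each bad with probability at most 2
  exp (-4 k) <= 2 * 8^(-k). Replacing shorter lengths by \<open>hk k\<close> keeps the truncation
  level within the range of the exponential inequality at c = k.\<close>

lemma AE_grid:
 "AE w in M. eventually (%k. \<forall>i j n. i <= j --> j <= 2 ^ k --> n <= 2 ^ k -->
  \<bar>Dev (\<tau> k) n w (real i / 2 ^ k) (real j / 2 ^ k)\<bar> <= (2 * K + 4) * sqrt (2 ^ k * max ((real j - real i) / 2 ^ k) (hk k) * real k)) sequentially"
proof -
 define P where "P k = {(i, j). i <= j & j <= (2::nat) ^ k}" for k
 have Psub: "P k <= {..2 ^ k} \<times> {..2 ^ k}" for k by (auto simp: P_def)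
 have Pfin: "finite (P k)" for k by (rule finite_subset[OF Psub]) simp
 have Pcard: "real (card (P k)) <= 4 * 4 ^ k" for k
 proof -
  have "card (P k) <= card ({..2 ^ k} \<times> {..2 ^ k} :: (nat \<times> nat) set)" by (rule card_mono[OF _ Psub]) simp
  also have "... = (2 ^ k + 1) * (2 ^ k + 1)" by (simp add: card_cartesian_product)
  also have "... <= (2 * 2 ^ k) * (2 * 2 ^ k)" by (intro mult_mono) auto
  also have "... = 4 * 4 ^ k" by (simp flip: power_mult_distrib)
  finally have "real (card (P k)) <= real (4 * 4 ^ k)" by (rule of_nat_mono)
  then show ?thesis by simp
 qed
 have unit: "0 <= real i / 2 ^ k" "real i / 2 ^ k <= real j / 2 ^ k" "real j / 2 ^ k <= 1" if "(i, j) \<in> P k" for i j k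
 proof -
  have "real j <= 2 ^ k" using that by (simp add: P_def)
  then show "0 <= real i / 2 ^ k" "real i / 2 ^ k <= real j / 2 ^ k" "real j / 2 ^ k <= 1"
   using that by (auto simp: P_def divide_right_mono)
 qed
 have t0: "0 <= \<tau> k" for k by (simp add: \<tau>_def)
 have ev: "grid_bad k z \<in> events" if "z \<in> P k" for k z
 proof (cases z)
  case (Pair i j)
  show ?thesis unfolding grid_bad_def Pair prod.case by (rule deviation_prob(1)[OF t0 unit]) (use that Pair in simp_all)
 qed
 have pr: "prob (grid_bad k z) <= 2 * (1/8) ^ k" if z: "z \<in> P k" and k: "1 <= k" for k z
 proof -
  obtain i j where zz: "z = (i, j)" by (cases z)
  note u = unit[OF z[unfolded zz]]
  have hk0: "0 < hk k" using k by (simp add: hk_def)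
  let ?v = "max ((real j - real i) / 2 ^ k) (hk k)"
  have "real j / 2 ^ k - real i / 2 ^ k <= ?v" by (simp add: diff_divide_distrib)
  moreover have "0 < ?v" using hk0 by simp
  moreover have "0 < real k" using k by simp
  moreover have "(0::nat) < 2 ^ k" by simp
  moreover have "(\<tau> k)^2 * real k <= real (2 ^ k) * ?v" unfolding tau(3)[OF k] by simp
  ultimately have "prob (grid_bad k z) <= 2 * exp (- 4 * real k)"
   using deviation_prob(2)[OF t0[of k] u, of ?v "real k" "2 ^ k" 4]
   unfolding grid_bad_def zz prod.case by simp
  also have "exp (- 4 * real k) = exp (- 4) ^ k" by (simp flip: exp_of_nat_mult)
  also have "exp (- 4 :: real) <= 1 / 8" using exp_lower_Taylor_quadratic[of 4] by (simp add: exp_minus field_simps)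
  then have "exp (- 4 :: real) ^ k <= (1 / 8) ^ k" by (intro power_mono) auto
  finally show ?thesis by simp
 qed
 have pA: "(SUM z:P k. prob (grid_bad k z)) <= 8 * (1/2) ^ k" if k: "1 <= k" for k
 proof -
  have "(SUM z:P k. prob (grid_bad k z)) <= (SUM z:P k. 2 * (1/8) ^ k)" by (rule sum_mono[OF pr[OF _ k]])
  also have "... = real (card (P k)) * (2 * (1/8) ^ k)" by simp
  also have "... <= 4 * 4 ^ k * (2 * (1/8) ^ k)" by (rule mult_right_mono[OF Pcard]) simp
  also have "... = 8 * (1/2) ^ k" by (simp flip: power_mult_distrib)
  finally show ?thesis .
 qed
 have "AE w in M. \<forall>\<^sub>F k in sequentially. \<forall>z\<in>P k. w ~: grid_bad k z"
 proof (rule AE_eventually_avoid[OF Pfin ev])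
  show "summable (%k. 8 * (1/2::real) ^ k)" by (intro summable_mult summable_geometric) simp
  show "\<forall>\<^sub>F k in sequentially. (SUM z:P k. prob (grid_bad k z)) <= 8 * (1/2) ^ k"
   using eventually_ge_at_top[of 1] by eventually_elim (rule pA)
 qed
 then show ?thesis
 proof (rule AE_mp, intro AE_I2 impI, elim eventually_mono, intro allI impI)
  fix w and k i j n :: nat assume "w \<in> space M" "\<forall>z\<in>P k. w ~: grid_bad k z" "i <= j" "j <= 2 ^ k" "n <= 2 ^ k"
  then show "\<bar>Dev (\<tau> k) n w (real i / 2 ^ k) (real j / 2 ^ k)\<bar> <= (2 * K + 4) * sqrt (2 ^ k * max ((real j - real i) / 2 ^ k) (hk k) * real k)"
   by (force simp: P_def grid_bad_def)
 qed
qed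

definition dyadic_bad :: "nat => nat \<times> nat => 'a set" where
 "dyadic_bad k = (%(l, p). {w\<in>space M. \<exists>n\<le>2^k. (2 * K + 4) * sqrt (2 ^ k / 2 ^ l * (1 + real l + ln (real k)))
  <= \<bar>Dev (\<tau> k) n w (real p / 2 ^ l) ((real p + 1) / 2 ^ l)\<bar>})"

lemma eventually_exponent: "eventually (%k. 1 + 4 * real k <= 2 powr (\<delta> * real k / 2) & 1 <= k) sequentially"
proof -
 have "eventually (%k. 1 + 4 * real k <= 2 powr (\<delta> * real k / 2)) sequentially"
  using delta(1) by real_asymp
 moreover have "eventually (%k::nat. 1 <= k) sequentially" by (rule eventually_ge_at_top)
 ultimately show ?thesis by (rule eventually_conj)
qed

text \<open>There are only 2^l dyadic intervals of level l, so the exponent 4 (1 + l + ln k) is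
  enough: its part in l pays for their number, and ln k makes the sum over the blocks converge. With
  k of order log n, this ln k is the origin of the iterated logarithm. Stopping at level \<delta> k
  keeps the truncation level admissible.\<close>

lemma AE_dyadic:
 "AE w in M. eventually (%k. \<forall>l p n. l <= nat \<lfloor>\<delta> * real k\<rfloor> --> p < 2 ^ l --> n <= 2 ^ k -->
  \<bar>Dev (\<tau> k) n w (real p / 2 ^ l) ((real p + 1) / 2 ^ l)\<bar> <= (2 * K + 4) * sqrt (2 ^ k / 2 ^ l * (1 + real l + ln (real k)))) sequentially"
proof -
 define P where "P k = (SIGMA l:{..nat \<lfloor>\<delta> * real k\<rfloor>}. {..<(2::nat) ^ l})" for k
 have Pfin: "finite (P k)" for k by (simp add: P_def)
 have unit: "0 <= real p / 2 ^ l" "real p / 2 ^ l <= (real p + 1) / 2 ^ l" "(real p + 1) / 2 ^ l <= 1" if "(l, p) \<in> P k" for l p k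
 proof -
  have "Suc p <= 2 ^ l" using that by (simp add: P_def)
  then have "real (Suc p) <= 2 ^ l" by (metis of_nat_le_iff of_nat_numeral of_nat_power)
  then show "0 <= real p / 2 ^ l" "real p / 2 ^ l <= (real p + 1) / 2 ^ l" "(real p + 1) / 2 ^ l <= 1"
   by (auto simp: divide_right_mono)
 qed
 have t0: "0 <= \<tau> k" for k by (simp add: \<tau>_def)
 have ev: "dyadic_bad k z \<in> events" if "z \<in> P k" for k z
 proof (cases z)
  case (Pair i j)
  show ?thesis unfolding dyadic_bad_def Pair prod.case by (rule deviation_prob(1)[OF t0 unit]) (use that Pair in simp_all)
 qed
 have pr: "prob (dyadic_bad k (l, p)) <= 2 * (1 / (real k)^2 * (1/4) ^ l)"
  if z: "(l, p) \<in> P k" and k: "1 + 4 * real k <= 2 powr (\<delta> * real k / 2)" "1 <= k" for k l p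
 proof -
  note u = unit[OF z]
  have lnk: "0 <= ln (real k)" "ln (real k) <= real k" using k(2) ln_le_minus_one[of "real k"] by auto
  define y where "y = 2 powr (\<delta> * real k / 2)"
  have y: "1 + 4 * real k <= y" "1 <= y" using k by (auto simp: y_def)
  have y2: "2 powr (\<delta> * real k) = y * y" by (simp add: y_def mult.commute flip: powr_add)
  have ll: "real l <= \<delta> * real k" using z delta(1) by (simp add: P_def le_nat_iff le_floor_iff)
  also have "... <= 1 * real k" using delta by (intro mult_right_mono) auto
  finally have lk: "real l <= real k" by simp
  have "2 powr real l <= y * y" unfolding y2[symmetric] using ll by (intro powr_mono) auto
  then have l2: "2 ^ l <= y * y" by (simp add: powr_realpow)
  have "hk k <= real k * (1 / (y * y * (y * y)))"
  proof -
   have "2 powr (- (2 * \<delta> * real k)) = 1 / (y * y * (y * y))" unfolding y2[symmetric] by (simp add: powr_minus_divide mult_ac flip: powr_add)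
   then show ?thesis using dyadic_ratio_powr_le[OF delta(1,2) k(2)] by (simp add: hk_def)
  qed
  then have t2: "(\<tau> k)^2 <= 2 ^ k * (1 / (y * y * (y * y)))"
  proof -
   assume h: "hk k <= real k * (1 / (y * y * (y * y)))"
   have "(\<tau> k)^2 * real k <= 2 ^ k * (real k * (1 / (y * y * (y * y))))" unfolding tau(3)[OF k(2)] using h by (intro mult_left_mono) auto
   also have "... = 2 ^ k * (1 / (y * y * (y * y))) * real k" by simp
   finally show ?thesis using k(2) by (simp only: mult_le_cancel_right)
  qed
  \<comment> \<open>2^l is at most y^2 and 1 + l + ln k at most y, while the squared truncation
    level is at most 2^k / y^4, so one power of y is to spare.\<close>
  have cond: "(\<tau> k)^2 * (1 + real l + ln (real k)) <= 2 ^ k * (1 / 2 ^ l)"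
  proof -
   have "(\<tau> k)^2 * (1 + real l + ln (real k)) <= 2 ^ k * (1 / (y * y * (y * y))) * y"
    by (rule mult_mono[OF t2]) (use y lk lnk in auto)
   also have "... = 2 ^ k * (1 / (y * y * y))" using y by (simp add: field_simps)
   also have "... <= 2 ^ k * (1 / 2 ^ l)"
   proof (intro mult_left_mono frac_le)
    show "2 ^ l <= y * y * y" using l2 mult_left_mono[OF y(2), of "y * y"] by simp
   qed auto
   finally show ?thesis .
  qed
  have c0: "0 < 1 + real l + ln (real k)" using lnk by linarith
  have "prob (dyadic_bad k (l, p)) <= 2 * exp (- 4 * (1 + real l + ln (real k)))"
   unfolding dyadic_bad_def prod.case
   using deviation_prob(2)[OF t0[of k] u, where N="2 ^ k" and q=4 and v="1 / 2 ^ l" and c="1 + real l + ln (real k)"] cond c0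
   by (simp add: add_divide_distrib)
  also have "- 4 * (1 + real l + ln (real k)) <= - 2 * ln (real k) + real l * (- 2)" using lnk by simp
  then have "exp (- 4 * (1 + real l + ln (real k))) <= exp (- 2 * ln (real k) + real l * (- 2))" by simp
  also have "... = exp (- 2 * ln (real k)) * exp (- 2) ^ l" unfolding exp_add exp_of_nat_mult ..
  also have "exp (- 2 * ln (real k)) = 1 / (real k)^2"
  proof -
   have "exp (- 2 * ln (real k)) = real k powr (- 2)" using k(2) by (simp add: powr_def)
   then show ?thesis using k(2) by (simp add: powr_minus_divide)
  qed
  also have "1 / (real k)^2 * exp (- 2) ^ l <= 1 / (real k)^2 * (1/4) ^ l"
  proof (intro mult_left_mono power_mono)
   show "exp (- 2) <= 1 / (4::real)" using exp_lower_Taylor_quadratic[of 2] by (simp add: exp_minus field_simps)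
  qed auto
  finally show ?thesis by simp
 qed
 have pA: "(SUM z:P k. prob (dyadic_bad k z)) <= 4 * (1 / (real k)^2)" if k: "1 + 4 * real k <= 2 powr (\<delta> * real k / 2)" "1 <= k" for k
 proof -
  have "(SUM z:P k. prob (dyadic_bad k z)) <= (SUM z:P k. 2 * (1 / (real k)^2 * (1/4) ^ (fst z)))"
  proof (rule sum_mono)
   fix z assume "z \<in> P k"
   then show "prob (dyadic_bad k z) <= 2 * (1 / (real k)^2 * (1/4) ^ (fst z))" using pr[OF _ k, of "fst z" "snd z"] by simp
  qed
  also have "... = (SUM l<=nat \<lfloor>\<delta> * real k\<rfloor>. SUM p<(2::nat)^l. 2 * (1 / (real k)^2 * (1/4) ^ l))"
   unfolding P_def by (subst sum.Sigma) (auto simp: case_prod_beta)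
  also have "... = (SUM l<=nat \<lfloor>\<delta> * real k\<rfloor>. 2 * (1 / (real k)^2) * (1/2) ^ l)"
  proof (rule sum.cong[OF refl])
   fix l
   have "(2::real) ^ l * (1/4) ^ l = (1/2) ^ l" by (simp flip: power_mult_distrib)
   then show "(SUM p<(2::nat)^l. 2 * (1 / (real k)^2 * (1/4) ^ l)) = 2 * (1 / (real k)^2) * (1/2) ^ l"
    by simp
  qed
  also have "... = 2 * (1 / (real k)^2) * (SUM l<=nat \<lfloor>\<delta> * real k\<rfloor>. (1/2) ^ l)" by (simp only: sum_distrib_left)
  also have "... <= 2 * (1 / (real k)^2) * 2"
  proof (rule mult_left_mono)
   have "(SUM l<=N. (1/2::real) ^ l) = 2 - (1/2) ^ N" for N :: nat by (induction N) auto
   then show "(SUM l<=nat \<lfloor>\<delta> * real k\<rfloor>. (1/2::real) ^ l) <= 2" by simp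
  qed simp
  finally show ?thesis by simp
 qed
 have "AE w in M. \<forall>\<^sub>F k in sequentially. \<forall>z\<in>P k. w ~: dyadic_bad k z"
 proof (rule AE_eventually_avoid[OF Pfin ev])
  show "summable (%k. 4 * (1 / (real k)^2))"
   using inverse_power_summable[of 2, where 'a=real] by (intro summable_mult) (simp add: inverse_eq_divide)
  show "\<forall>\<^sub>F k in sequentially. (SUM z:P k. prob (dyadic_bad k z)) <= 4 * (1 / (real k)^2)"
   using eventually_exponent by eventually_elim (use pA in blast)
 qed
 then show ?thesis
 proof (rule AE_mp, intro AE_I2 impI, elim eventually_mono, intro allI impI)
  fix w and k l p n :: nat assume "w \<in> space M" "\<forall>z\<in>P k. w ~: dyadic_bad k z" "l <= nat \<lfloor>\<delta> * real k\<rfloor>" "p < 2 ^ l" "n <= 2 ^ k"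
  then show "\<bar>Dev (\<tau> k) n w (real p / 2 ^ l) ((real p + 1) / 2 ^ l)\<bar> <= (2 * K + 4) * sqrt (2 ^ k / 2 ^ l * (1 + real l + ln (real k)))"
   by (force simp: P_def dyadic_bad_def)
 qed
qed

end

text \<open>The mesh width (1/2)^l lies between h/2 and h, and the intervals start at the left end
  of a cell, as integration by parts on the cells requires.\<close>

definition (in prob_space) cell_rate ::
  "real => real => (nat => 'a => real) => (nat => 'a => real) => real => bool" where
 "cell_rate \<kappa> \<gamma> X U C \<longleftrightarrow> (AE w in M. \<forall>\<^sub>F n in sequentially. \<forall>h\<in>bandwidths \<kappa> \<gamma> n. \<forall>l p s.
  (1/2) ^ l <= h --> h < 2 * (1/2) ^ l --> p < (2::nat) ^ l --> real p / 2 ^ l <= s --> s <= (real p + 1) / 2 ^ l -->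
  \<bar>(SUM i=1..n. U i w * indicator {real p / 2 ^ l<..s} (X i w)) -
   real n * expectation (%w. U 1 w * indicator {real p / 2 ^ l<..s} (X 1 w))\<bar>
  <= C * sqrt (real n * h * max (ln (1 / h)) (ln (ln (real n)))))"

section \<open>Removing the truncation\<close>

context iid_marks
begin

lemma AE_moment_average:
 "AE w in M. eventually (%k. (SUM i=1..2^k. U i w powr \<kappa>) <= (expectation (%w. U 1 w powr \<kappa>) + 1) * 2 ^ k) sequentially"
proof (rule dyadic_average_bound)
 have m: "(%z. snd z powr \<kappa>) \<in> borel_measurable (borel :: (real \<times> real) measure)"
  unfolding borel_prod[symmetric] by measurable
 show "indep_vars (%_. borel) (%i w. U i w powr \<kappa>) {1..}"
  using indep_vars_compose2[OF ind, where Y="%_ z. snd z powr \<kappa>" and N="%_. borel"] m by simp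
 show "0 <= U i w powr \<kappa>" for i w by simp
 show "distr M borel (%w. U i w powr \<kappa>) = distr M borel (%w. U 1 w powr \<kappa>)" if i: "i >= 1" for i
  using distr_distr[OF m measurable_XU[OF i]] distr_distr[OF m measurable_XU[of 1]] id[OF i] by (simp add: o_def)
qed (rule integrable_moment)

lemma integrable_U_cell: "integrable M (%w. U 1 w * indicator {a<..b} (X 1 w))"
proof (rule Bochner_Integration.integrable_bound[where f="%w. 1 + U 1 w powr \<kappa>"])
 show "integrable M (%w. 1 + U 1 w powr \<kappa>)" using integrable_moment by simp
 show "(%w. U 1 w * indicator {a<..b} (X 1 w)) \<in> borel_measurable M"
  using measurable_U[of 1] measurable_cell by (intro borel_measurable_times) auto
 show "AE w in M. norm (U 1 w * indicator {a<..b} (X 1 w)) <= norm (1 + U 1 w powr \<kappa>)"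
 proof (rule AE_I2)
  fix w assume "w \<in> space M"
  then have u: "0 <= U 1 w" by (rule U_nonneg[OF order_refl])
  have "U 1 w <= 1 + U 1 w powr \<kappa>"
  proof (cases "U 1 w <= 1")
   case False
   then have "U 1 w powr 1 <= U 1 w powr \<kappa>" using kappa by (intro powr_mono) auto
   then show ?thesis using u by simp
  qed (simp add: add_increasing2)
  then show "norm (U 1 w * indicator {a<..b} (X 1 w)) <= norm (1 + U 1 w powr \<kappa>)" using u by (auto simp: indicator_def)
 qed
qed

lemma trunc_error:
 assumes u: "0 <= u" and t: "0 < t"
 shows "0 <= u * indicator {a<..b} x - trunc t a b (x, u)"
  "u * indicator {a<..b} x - trunc t a b (x, u) <= t powr (1 - \<kappa>) * u powr \<kappa>"
proof -
 show "0 <= u * indicator {a<..b} x - trunc t a b (x, u)" using u by (auto simp: trunc_def indicator_def)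
 have "u <= t powr (1 - \<kappa>) * u powr \<kappa>" if "t < u"
 proof -
  have "u powr (1 - \<kappa>) <= t powr (1 - \<kappa>)" using that t kappa by (intro powr_mono2') auto
  then have "u powr (1 - \<kappa>) * u powr \<kappa> <= t powr (1 - \<kappa>) * u powr \<kappa>" by (rule mult_right_mono) simp
  then show ?thesis using that t by (simp flip: powr_add)
 qed
 then show "u * indicator {a<..b} x - trunc t a b (x, u) <= t powr (1 - \<kappa>) * u powr \<kappa>"
  by (auto simp: trunc_def indicator_def not_le)
qed

text \<open>The truncation errors are nonnegative and dominated by t^(1 - \<kappa>) times the
  \<kappa>-th powers of the marks. Their sum over the whole block is controlled by
  \<open>av\<close>, their mean by the moment, and two numbers between 0 and a common bound differ
  by at most that bound.\<close>

lemma Dev_untruncated: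
 fixes t :: real
 assumes t: "0 < t" and w: "z \<in> space M" and n: "n <= 2 ^ k"
  and av: "(SUM i=1..2^k. U i z powr \<kappa>) <= (expectation (%z. U 1 z powr \<kappa>) + 1) * 2 ^ k"
 shows "\<bar>(SUM i=1..n. U i z * indicator {a<..b} (X i z)) - real n * expectation (%z. U 1 z * indicator {a<..b} (X 1 z))
   - Dev t n z a b\<bar> <= (expectation (%z. U 1 z powr \<kappa>) + 1) * (t powr (1 - \<kappa>) * 2 ^ k)"
proof -
 let ?W = "expectation (%z. U 1 z powr \<kappa>)"
 let ?e = "%i z. U i z * indicator {a<..b} (X i z) - trunc t a b (X i z, U i z)"
 have W: "0 <= ?W" by (rule Bochner_Integration.integral_nonneg) simp
 have S: "0 <= (SUM i=1..n. ?e i z)" by (rule sum_nonneg) (use trunc_error(1)[OF U_nonneg t] w in auto)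
 have "(SUM i=1..n. ?e i z) <= (SUM i=1..n. t powr (1 - \<kappa>) * U i z powr \<kappa>)"
  by (rule sum_mono) (use trunc_error(2)[OF U_nonneg t] w in auto)
 also have "... <= (SUM i=1..2^k. t powr (1 - \<kappa>) * U i z powr \<kappa>)" by (rule sum_mono2) (use n in auto)
 also have "... = t powr (1 - \<kappa>) * (SUM i=1..2^k. U i z powr \<kappa>)" by (simp add: sum_distrib_left)
 also have "... <= t powr (1 - \<kappa>) * ((?W + 1) * 2 ^ k)" by (rule mult_left_mono[OF av]) simp
 finally have S2: "(SUM i=1..n. ?e i z) <= (?W + 1) * (t powr (1 - \<kappa>) * 2 ^ k)" by (simp add: mult_ac)
 have ie: "integrable M (?e 1)" using integrable_U_cell integrable_trunc[of t 1 a b] t by simp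
 have E: "0 <= expectation (?e 1)"
  by (rule integral_ge_const[THEN order_trans[rotated]], rule ie, rule AE_I2, rule trunc_error(1)[OF U_nonneg[OF order_refl] t], simp_all)
 have "expectation (?e 1) <= expectation (%z. t powr (1 - \<kappa>) * U 1 z powr \<kappa>)"
  by (rule integral_mono[OF ie]) (use integrable_moment trunc_error(2)[OF U_nonneg[OF order_refl] t] in auto)
 then have E2: "expectation (?e 1) <= t powr (1 - \<kappa>) * ?W" by simp
 have n': "real n <= 2 ^ k" using n by (metis of_nat_le_iff of_nat_numeral of_nat_power)
 have "real n * expectation (?e 1) <= 2 ^ k * (t powr (1 - \<kappa>) * ?W)" using n' E2 E by (intro mult_mono) auto
 also have "... <= (?W + 1) * (t powr (1 - \<kappa>) * 2 ^ k)" by (simp add: algebra_simps)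
 finally have nE: "real n * expectation (?e 1) <= (?W + 1) * (t powr (1 - \<kappa>) * 2 ^ k)" .
 have nE0: "0 <= real n * expectation (?e 1)" using E by simp
 have eq: "expectation (?e 1) = expectation (%z. U 1 z * indicator {a<..b} (X 1 z)) - trunc_mean t a b"
  unfolding trunc_mean_def using integrable_U_cell integrable_trunc[of t 1 a b] t by simp
 have "(SUM i=1..n. U i z * indicator {a<..b} (X i z)) - real n * expectation (%z. U 1 z * indicator {a<..b} (X 1 z))
   - Dev t n z a b = (SUM i=1..n. ?e i z) - real n * expectation (?e 1)"
  unfolding eq Dev_def by (simp add: sum_subtractf right_diff_distrib)
 then show ?thesis using S S2 nE nE0 by (simp add: abs_le_iff)
qed

theorem interval_deviation:
 fixes \<gamma> :: real assumes \<gamma>: "0 < \<gamma>"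
 shows "\<exists>C>0. cell_rate \<kappa> \<gamma> X U C"
proof -
 define W where "W = expectation (%z. U 1 z powr \<kappa>)"
 have W: "0 <= W" unfolding W_def by (rule Bochner_Integration.integral_nonneg) simp
 define Mc where "Mc = 4 + sqrt (48 * (1 + 1 / \<gamma>) / \<delta>)"
 have Mc: "0 < Mc" unfolding Mc_def using \<gamma> delta by (intro add_pos_nonneg) auto
 \<comment> \<open>In order: chaining and grid, the possible drop 2 K within one grid step, and the
   discarded large marks.\<close>
 define C where "C = (2 * K + 4) * (46 + Mc) + 2 * K * Mc + (W + 1) * Mc"
 have C: "0 < C" 
 proof -
  have "0 < (2 * K + 4) * (46 + Mc)" using K Mc by (intro mult_pos_pos) auto
  moreover have "0 <= 2 * K * Mc" "0 <= (W + 1) * Mc" using K Mc W by auto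
  ultimately show ?thesis unfolding C_def by linarith
 qed
 \<comment> \<open>The last condition keeps every bandwidth above 1/n, so that the cells are not
   finer than the grid of the block.\<close>
 have asym: "\<forall>\<^sub>F n in sequentially. 2 <= n & 4 <= ln (real n) & 1 / real n <= \<gamma> * (ln (real n) / real n) powr (2 * \<delta>)"
 proof (intro eventually_conj)
  show "\<forall>\<^sub>F n::nat in sequentially. 2 <= n" by (rule eventually_ge_at_top)
  show "\<forall>\<^sub>F n::nat in sequentially. 4 <= ln (real n)" by real_asymp
  define e where "e = 1 - 2 * \<delta>"
  have "0 < e" using delta(2) by (simp add: e_def)
  then have "\<forall>\<^sub>F n::nat in sequentially. 1 <= \<gamma> * real n powr e" using \<gamma> by real_asymp
  moreover have "\<forall>\<^sub>F n::nat in sequentially. 1 <= ln (real n)" by real_asymp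
  moreover have "\<forall>\<^sub>F n::nat in sequentially. 1 <= n" by (rule eventually_ge_at_top)
  ultimately show "\<forall>\<^sub>F n::nat in sequentially. 1 / real n <= \<gamma> * (ln (real n) / real n) powr (2 * \<delta>)"
  proof eventually_elim
   case (elim n)
   have "real n powr (- (2 * \<delta>)) = (1 / real n) powr (2 * \<delta>)" using elim(3) by (simp add: powr_minus_divide powr_divide)
   also have "... <= (ln (real n) / real n) powr (2 * \<delta>)"
    using elim(2) delta by (intro powr_mono2 divide_right_mono) auto
   finally have "\<gamma> * real n powr (- (2 * \<delta>)) <= \<gamma> * (ln (real n) / real n) powr (2 * \<delta>)" using \<gamma> by (intro mult_left_mono) auto
   moreover have "1 / real n <= \<gamma> * real n powr (- (2 * \<delta>))"
   proof -
    have "real n powr (- (2 * \<delta>)) = real n powr (e - 1)" by (simp add: e_def)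
    also have "... = real n powr e / real n" using elim(3) by (simp add: powr_diff)
    finally show ?thesis using elim(1,3) by (simp add: divide_right_mono)
   qed
   ultimately show ?case by linarith
  qed
 qed
 have "cell_rate \<kappa> \<gamma> X U C"
  unfolding cell_rate_def using AE_grid AE_dyadic AE_moment_average AE_space
 proof eventually_elim
  case (elim z)
  note w = elim(4)
  have lev3: "\<forall>\<^sub>F n in sequentially. P (lev n)" if "eventually P sequentially" for P
   using that filterlim_lev unfolding filterlim_iff by blast
  from asym lev3[OF elim(1)] lev3[OF elim(2)] lev3[OF elim(3)] lev3[OF eventually_exponent]
  show ?case
  proof eventually_elim
   case (elim n)
   define k where "k = lev n"
   have n2: "2 <= n" and ln4: "4 <= ln (real n)" and n1: "1 / real n <= \<gamma> * (ln (real n) / real n) powr (2 * \<delta>)"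
    using elim(1) by auto
   note lv = lev_bounds[OF n2, folded k_def]
   have k: "1 + 4 * real k <= 2 powr (\<delta> * real k / 2)" "1 <= k" using elim(5) by (simp_all add: k_def)
   have lnk: "ln (real k) <= 2 * ln (ln (real n))"
   proof -
    have "4 * ln (real n) <= ln (real n) * ln (real n)" using ln4 by (intro mult_right_mono) auto
    then have "real k <= (ln (real n))^2" using lv(3) by (simp add: power2_eq_square)
    then have "ln (real k) <= ln ((ln (real n))^2)" using k(2) ln4 by (subst ln_le_cancel_iff) auto
    then show ?thesis using ln4 by (simp add: ln_realpow)
   qed
   have t: "0 < \<tau> k" using tau(2)[OF k(2)] by linarith
   show ?case
   proof (intro ballI allI impI)
    fix h l p s
    assume h: "h \<in> bandwidths \<kappa> \<gamma> n" and l: "(1/2) ^ l <= h" "h < 2 * (1/2) ^ l" and p: "p < (2::nat) ^ l"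
     and s: "real p / 2 ^ l <= s" "s <= (real p + 1) / 2 ^ l"
    have h1: "\<gamma> * (ln (real n) / real n) powr (2 * \<delta>) <= h" "h <= 1/2"
     using h unfolding bandwidths_def delta(3) by auto
    have h2: "1 / real n <= h" using n1 h1 by linarith
    define Q where "Q = sqrt (real n * h * max (ln (1 / h)) (ln (ln (real n))))"
    have rate: "sqrt (2 ^ k * hk k * real k) <= Mc * Q"
     by (rule rate_bounds(1)[OF delta(1,2) \<gamma> k n2 lv(1-3) lnk h1 h2 l hk_def refl Q_def Mc_def])
    have dev: "\<bar>Dev (\<tau> k) n z (real p / 2 ^ l) s\<bar> <= (2 * K + 4) * (46 + Mc) * Q + 2 * K"
    proof (rule interval_deviation_bound[OF _ _ _ _ _ _ delta(1,2) \<gamma> k n2 lv(1-3) lnk h1 h2 l hk_def refl Q_def Mc_def p s])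
     show "Dev (\<tau> k) n z a c = Dev (\<tau> k) n z a b + Dev (\<tau> k) n z b c" if "a <= b" "b <= c" for a b c
      by (rule Dev_add[OF less_imp_le[OF t] that])
     show "- (2 * K * 2 ^ k * (b - a)) <= Dev (\<tau> k) n z a b" if "0 <= a" "a <= b" "b <= 1" for a b
      by (rule Dev_ge[OF less_imp_le[OF t] that w lv(1)])
     show "\<bar>Dev (\<tau> k) n z (real i / 2 ^ k) (real j / 2 ^ k)\<bar> <= (2 * K + 4) * sqrt (2 ^ k * max ((real j - real i) / 2 ^ k) (hk k) * real k)"
      if "i <= j" "j <= 2 ^ k" for i j using elim(2) that lv(5) unfolding k_def by blast
     show "\<bar>Dev (\<tau> k) n z (real p / 2 ^ j) ((real p + 1) / 2 ^ j)\<bar> <= (2 * K + 4) * sqrt (2 ^ k / 2 ^ j * (1 + real j + ln (real k)))"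
      if "j <= nat \<lfloor>\<delta> * real k\<rfloor>" "p < 2 ^ j" for j p using elim(3) that lv(5) unfolding k_def by blast
    qed (use K in auto)
    have un: "\<bar>(SUM i=1..n. U i z * indicator {real p / 2 ^ l<..s} (X i z)) - real n * expectation (%z. U 1 z * indicator {real p / 2 ^ l<..s} (X 1 z))
   - Dev (\<tau> k) n z (real p / 2 ^ l) s\<bar> <= (W + 1) * (real k * \<tau> k)"
     unfolding tau(4)[OF k(2), symmetric] W_def
     by (rule Dev_untruncated[OF t w lv(5)]) (use elim(4) in \<open>simp add: k_def\<close>)
    have kt: "real k * \<tau> k <= Mc * Q" using rate unfolding tau(5)[OF k(2)] .
    \<comment> \<open>A constant is within the target order because k times the truncation level is
      at least 1.\<close>
    have "1 * 1 <= real k * \<tau> k" using k(2) tau(2)[OF k(2)] by (intro mult_mono) auto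
    then have "2 * K * 1 <= 2 * K * (Mc * Q)" using kt K by (intro mult_left_mono) auto
    moreover have "(W + 1) * (real k * \<tau> k) <= (W + 1) * (Mc * Q)" using kt W by (intro mult_left_mono) auto
    ultimately have "\<bar>(SUM i=1..n. U i z * indicator {real p / 2 ^ l<..s} (X i z)) - real n * expectation (%z. U 1 z * indicator {real p / 2 ^ l<..s} (X 1 z))\<bar>
     <= (2 * K + 4) * (46 + Mc) * Q + 2 * K * (Mc * Q) + (W + 1) * (Mc * Q)"
     using dev un unfolding mult_1_right by linarith
    also have "... = C * Q" by (simp add: C_def algebra_simps)
    finally show "\<bar>(SUM i=1..n. U i z * indicator {real p / 2 ^ l<..s} (X i z)) - real n * expectation (%z. U 1 z * indicator {real p / 2 ^ l<..s} (X 1 z))\<bar>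
     <= C * sqrt (real n * h * max (ln (1 / h)) (ln (ln (real n))))" unfolding Q_def .
   qed
  qed
 qed
 then show ?thesis using C by blast
qed

end

section \<open>Conditional means\<close>

text \<open>\<open>f\<close> is merely measurable. As \<open>real_cond_exp\<close> is the difference
  of the conditional expectations of the positive and the negative part, the indicator is pulled out
  of each of them.\<close>

lemma (in sigma_finite_subalgebra) real_cond_exp_indicator:
 assumes A: "A \<in> sets F" and f: "f \<in> borel_measurable M"
 shows "AE x in M. real_cond_exp M F (%x. indicator A x * f x) x = indicator A x * real_cond_exp M F f x"
proof -
 have iA: "indicator A \<in> borel_measurable F" using A by simp
 have e: "AE x in M. indicator A x * nn_cond_exp M F (%x. ennreal (g x)) x = nn_cond_exp M F (%x. indicator A x * ennreal (g x)) x"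
  if "g \<in> borel_measurable M" for g
  by (rule nn_cond_exp_prod[OF iA]) (use that in simp)
 have i: "ennreal (indicator A x * g x) = indicator A x * ennreal (g x)" for x and g :: "'a => real" by (auto simp: indicator_def)
 have m: "ennreal (- (indicator A x * f x)) = indicator A x * ennreal (- f x)" for x by (auto simp: indicator_def)
 from e[OF f] e[of "%x. - f x"] f
 have "AE x in M. indicator A x * nn_cond_exp M F (%x. ennreal (f x)) x = nn_cond_exp M F (%x. indicator A x * ennreal (f x)) x"
  "AE x in M. indicator A x * nn_cond_exp M F (%x. ennreal (- f x)) x = nn_cond_exp M F (%x. indicator A x * ennreal (- f x)) x"
  by simp_all
 then show ?thesis
 proof eventually_elim
  case (elim x)
  then show ?case unfolding real_cond_exp_def m i by (auto simp: indicator_def)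
 qed
qed

text \<open>The coefficients need not be integrable: localize to the sets where they are bounded.\<close>

lemma (in finite_measure_subalgebra) real_cond_exp_linear:
 assumes I: "finite I" and D: "!!i. i \<in> I ==> integrable M (D i)"
  and a: "!!i. i \<in> I ==> a i \<in> borel_measurable F" and g: "g \<in> borel_measurable F"
 shows "AE x in M. real_cond_exp M F (%x. (SUM i:I. a i x * D i x) + g x) x = (SUM i:I. a i x * real_cond_exp M F (D i) x) + (g x :: real)"
proof -
 let ?f = "%x. (SUM i:I. a i x * D i x) + g x"
 have spF: "space F = space M" using subalg by (simp add: subalgebra_def)
 have toM: "u \<in> borel_measurable M" if "u \<in> borel_measurable F" for u :: "'a => real" by (rule measurable_from_subalg[OF subalg that])
 define b where "b x = \<bar>g x\<bar> + (SUM i:I. \<bar>a i x\<bar>)" for x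
 have b: "b \<in> borel_measurable F" unfolding b_def using a g by (intro borel_measurable_add borel_measurable_sum borel_measurable_abs) auto
 define A where "A N = {x\<in>space F. b x <= real N}" for N :: nat
 have A: "A N \<in> sets F" for N unfolding A_def using b by measurable
 have bd: "\<bar>g x\<bar> <= b x" "i \<in> I ==> \<bar>a i x\<bar> <= b x" for i x
 proof -
  have s: "0 <= (SUM i:I. \<bar>a i x\<bar>)" by (rule sum_nonneg) simp
  then show "\<bar>g x\<bar> <= b x" by (simp add: b_def)
  show "\<bar>a i x\<bar> <= b x" if "i \<in> I"
  proof -
   have "\<bar>a i x\<bar> <= (SUM i:I. \<bar>a i x\<bar>)" by (rule member_le_sum[OF that _ I]) simp
   then show ?thesis by (simp add: b_def)
  qed
 qed
 have fM: "?f \<in> borel_measurable M"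
  using D toM[OF a] toM[OF g] by (intro borel_measurable_add borel_measurable_sum borel_measurable_times) auto
 have loc: "AE x in M. x \<in> A N --> real_cond_exp M F ?f x = (SUM i:I. a i x * real_cond_exp M F (D i) x) + g x" for N
 proof -
  let ?a = "%i x. indicator (A N) x * a i x" and ?g = "%x. indicator (A N) x * g x"
  have aF: "?a i \<in> borel_measurable F" if "i \<in> I" for i using A[of N] a[OF that] by measurable
  have gF: "?g \<in> borel_measurable F" using A[of N] g by measurable
  have ai: "integrable M (%x. ?a i x * D i x)" if i: "i \<in> I" for i
  proof (rule Bochner_Integration.integrable_bound[where f="%x. real N * D i x"])
   show "integrable M (%x. real N * D i x)" using D[OF i] by simp
   show "(%x. ?a i x * D i x) \<in> borel_measurable M" by (rule borel_measurable_times[OF toM[OF aF[OF i]] borel_measurable_integrable[OF D[OF i]]])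
   show "AE x in M. norm (?a i x * D i x) <= norm (real N * D i x)"
   proof (rule AE_I2)
    fix x
    have "\<bar>?a i x\<bar> <= real N" using bd(2)[OF i, of x] by (auto simp: A_def indicator_def)
    then show "norm (?a i x * D i x) <= norm (real N * D i x)" unfolding real_norm_def abs_mult by (intro mult_right_mono) auto
   qed
  qed
  have gi: "integrable M ?g"
  proof (rule integrable_const_bound[where B="real N", OF AE_I2 toM[OF gF]])
   fix x show "norm (?g x) <= real N" using bd(1)[of x] by (auto simp: A_def indicator_def)
  qed
  have e: "(%x. indicator (A N) x * ?f x) = (%x. (SUM i:I. ?a i x * D i x) + ?g x)"
   by (simp add: distrib_left sum_distrib_left mult.assoc)
  have 1: "AE x in M. real_cond_exp M F (%x. (SUM i:I. ?a i x * D i x) + ?g x) x =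
    real_cond_exp M F (%x. SUM i:I. ?a i x * D i x) x + real_cond_exp M F ?g x"
   by (rule real_cond_exp_add[OF Bochner_Integration.integrable_sum gi]) (rule ai)
  \<comment> \<open>The case distinction makes the summands integrable for every index, also outside
    \<open>I\<close>.\<close>
  have 2: "AE x in M. real_cond_exp M F (%x. SUM i:I. ?a i x * D i x) x = (SUM i:I. real_cond_exp M F (%x. if i \<in> I then ?a i x * D i x else 0) x)"
  proof -
   have "AE x in M. real_cond_exp M F (%x. SUM i:I. (if i \<in> I then ?a i x * D i x else 0)) x = (SUM i:I. real_cond_exp M F (%x. if i \<in> I then ?a i x * D i x else 0) x)"
   proof (rule real_cond_exp_sum)
    show "integrable M (%x. if i \<in> I then ?a i x * D i x else 0)" for i by (cases "i \<in> I") (simp_all add: ai)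
   qed
   then show ?thesis by (simp cong: sum.cong)
  qed
  have 3: "AE x in M. \<forall>i\<in>I. real_cond_exp M F (%x. if i \<in> I then ?a i x * D i x else 0) x = ?a i x * real_cond_exp M F (D i) x"
  proof (rule AE_finite_allI[OF I])
   fix i assume i: "i \<in> I"
   show "AE x in M. real_cond_exp M F (%x. if i \<in> I then ?a i x * D i x else 0) x = ?a i x * real_cond_exp M F (D i) x"
    using real_cond_exp_mult[OF aF[OF i] borel_measurable_integrable[OF D[OF i]] ai[OF i]] i by simp
  qed
  have 4: "AE x in M. real_cond_exp M F ?g x = ?g x" by (rule real_cond_exp_F_meas[OF gi gF])
  from real_cond_exp_indicator[OF A[of N] fM, unfolded e] 1 2 3 4
  show ?thesis
  proof eventually_elim
   case (elim x)
   have "(SUM i:I. real_cond_exp M F (%x. if i \<in> I then ?a i x * D i x else 0) x) = (SUM i:I. ?a i x * real_cond_exp M F (D i) x)"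
    by (rule sum.cong) (use elim(4) in auto)
   then show ?case using elim by (auto simp: indicator_def)
  qed
 qed
 have "AE x in M. \<forall>N. x \<in> A N --> real_cond_exp M F ?f x = (SUM i:I. a i x * real_cond_exp M F (D i) x) + g x"
  unfolding AE_all_countable using loc by blast
 then show ?thesis
 proof (rule AE_mp, intro AE_I2 impI)
  fix x assume x: "x \<in> space M" and all: "\<forall>N. x \<in> A N --> real_cond_exp M F ?f x = (SUM i:I. a i x * real_cond_exp M F (D i) x) + g x"
  obtain N where "b x <= real N" using real_arch_simple by blast
  then have "x \<in> A N" using x by (simp add: A_def spF)
  then show "real_cond_exp M F ?f x = (SUM i:I. a i x * real_cond_exp M F (D i) x) + g x" using all by blast
 qed
qed

lemma (in finite_measure) finite_measure_subalgebra_vimage: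
 assumes "X \<in> measurable M N"
 shows "finite_measure_subalgebra M (vimage_algebra (space M) X N)"
proof -
 have "sets (vimage_algebra (space M) X N) <= sets M"
  using assms by (auto simp: sets_vimage_algebra2[OF measurable_space[OF assms, THEN funcsetI]] measurable_sets)
 then show ?thesis
  by (intro finite_measure_subalgebra.intro finite_measure_subalgebra_axioms.intro finite_measure_axioms) (simp add: subalgebra_def)
qed

context prob_space
begin

text \<open>\<open>Y\<close> is not assumed integrable, only its deviation from g X. Linearity with
  an arbitrary measurable function of X as a summand shows that the deviation has conditional
  expectation 0.\<close>

lemma cond_mean_centered:
 assumes X: "X \<in> borel_measurable M" and c: "is_cond_mean M X Y g"
  and D: "integrable M (%w. Y w - g (X w))" and B: "B \<in> sets borel"
 shows "expectation (%w. indicator B (X w) * (Y w - g (X w))) = 0"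
proof -
 let ?F = "vimage_algebra (space M) X borel"
 interpret F: finite_measure_subalgebra M ?F by (rule finite_measure_subalgebra_vimage[OF X])
 have XF: "X \<in> borel_measurable ?F" by (rule measurable_vimage_algebra1) simp
 have g: "g \<in> borel_measurable borel" and rc: "AE w in M. real_cond_exp M ?F Y w = g (X w)"
  using c by (simp_all add: is_cond_mean_def)
 have gF: "(%w. g (X w)) \<in> borel_measurable ?F" by (rule measurable_compose[OF XF g])
 have iF: "(%w. indicator B (X w) :: real) \<in> borel_measurable ?F" by (rule measurable_compose[OF XF]) (use B in simp)
 let ?D = "%w. Y w - g (X w)"
 have "AE w in M. real_cond_exp M ?F (%w. (SUM i:{0::nat}. 1 * ?D w) + g (X w)) w = (SUM i:{0::nat}. 1 * real_cond_exp M ?F ?D w) + g (X w)"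
  by (rule F.real_cond_exp_linear) (use D gF in auto)
 then have "AE w in M. real_cond_exp M ?F Y w = real_cond_exp M ?F ?D w + g (X w)" by simp
 with rc have z: "AE w in M. real_cond_exp M ?F ?D w = 0" by eventually_elim simp
 have int: "integrable M (%w. indicator B (X w) * ?D w)"
  by (rule Bochner_Integration.integrable_bound[OF D borel_measurable_times[OF measurable_from_subalg[OF F.subalg iF] borel_measurable_integrable[OF D]]])
   (auto simp: indicator_def)
 have "expectation (%w. indicator B (X w) * ?D w) = expectation (%w. indicator B (X w) * real_cond_exp M ?F ?D w)"
  by (rule F.real_cond_exp_intg(2)[OF int iF borel_measurable_integrable[OF D], symmetric])
 also have "... = expectation (%w. 0)"
  by (rule integral_cong_AE) (use z measurable_from_subalg[OF F.subalg iF] in auto)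
 finally show ?thesis by simp
qed

text \<open>Kept in the extended nonnegative reals, because integrability of \<open>Z\<close> is to
  be derived from it. Finiteness of the conditional expectation identifies it with v X.\<close>

lemma cond_mean_moment:
 assumes X: "X \<in> borel_measurable M" "AE w in M. X w \<in> {0..1}" and c: "is_cond_mean M X Z v"
  and Z: "Z \<in> borel_measurable M" "!!w. 0 <= Z w" and S: "!!x. x \<in> {0..1} ==> v x <= S" and B: "B \<in> sets borel"
 shows "(\<integral>\<^sup>+ w. indicator B (X w) * ennreal (Z w) \<partial>M) <= ennreal S * emeasure M {w\<in>space M. X w \<in> B}"
proof -
 let ?F = "vimage_algebra (space M) X borel"
 interpret F: finite_measure_subalgebra M ?F by (rule finite_measure_subalgebra_vimage[OF X(1)])
 have XF: "X \<in> borel_measurable ?F" by (rule measurable_vimage_algebra1) simp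
 have iF: "(%w. indicator B (X w) :: ennreal) \<in> borel_measurable ?F" by (rule measurable_compose[OF XF]) (use B in simp)
 have zm: "(%w. ennreal (Z w)) \<in> borel_measurable M" using Z by simp
 have BM: "{w\<in>space M. X w \<in> B} \<in> events" using X(1) B by measurable
 have fin: "AE w in M. nn_cond_exp M ?F (%w. ennreal (Z w)) w < \<infinity>" and rc: "AE w in M. real_cond_exp M ?F Z w = v (X w)"
  using c Z(2) by (simp_all add: is_cond_mean_def)
 have neg: "(%w. ennreal (- Z w)) = (%w. 0)" using Z(2) by (simp add: ennreal_neg)
 have z: "AE w in M. 0 = nn_cond_exp M ?F (%w. 0) w" by (rule F.nn_cond_exp_F_meas) simp
 have le: "AE w in M. nn_cond_exp M ?F (%w. ennreal (Z w)) w <= ennreal S"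
  using fin rc z X(2)
 proof eventually_elim
  case (elim w)
  have "enn2real (nn_cond_exp M ?F (%w. ennreal (Z w)) w) = v (X w)"
   using elim(2) elim(3)[symmetric] unfolding real_cond_exp_def neg by simp
  then have "ennreal (enn2real (nn_cond_exp M ?F (%w. ennreal (Z w)) w)) <= ennreal S" using S[OF elim(4)] by (simp add: ennreal_leI)
  then show ?case using elim(1) by simp
 qed
 have "(\<integral>\<^sup>+ w. indicator B (X w) * ennreal (Z w) \<partial>M) = (\<integral>\<^sup>+ w. indicator B (X w) * nn_cond_exp M ?F (%w. ennreal (Z w)) w \<partial>M)"
  by (rule F.nn_cond_exp_intg[OF iF zm, symmetric])
 also have "... <= (\<integral>\<^sup>+ w. ennreal S * indicator {w\<in>space M. X w \<in> B} w \<partial>M)"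
 proof (rule nn_integral_mono_AE)
  show "AE w in M. indicator B (X w) * nn_cond_exp M ?F (%w. ennreal (Z w)) w <= ennreal S * indicator {w\<in>space M. X w \<in> B} w"
   using le AE_space by eventually_elim (auto simp: indicator_def)
 qed
 also have "... = ennreal S * emeasure M {w\<in>space M. X w \<in> B}" by (rule nn_integral_cmult_indicator[OF BM])
 finally show ?thesis .
qed

end

section \<open>The regression sample and its noise\<close>

locale regression_sample = prob_space +
 fixes X Y :: "'a => real" and Xs Ys :: "nat => 'a => real" and fo v w :: "real => real" and w1 w2 \<kappa> :: real
 assumes X: "X \<in> borel_measurable M" "AE z in M. X z \<in> {0..1}"
  and Y: "Y \<in> borel_measurable M"
  and indep: "indep_vars (%_. borel) (%i z. (Xs i z, Ys i z)) {1..}"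
  and ident: "!!i. i >= 1 ==> distr M borel (%z. (Xs i z, Ys i z)) = distr M borel (%z. (X z, Y z))"
  and fo: "is_cond_mean M X Y fo"
  and density: "!!i. i >= 1 ==> distributed M lborel (Xs i) (%x. ennreal (indicator {0<..<1} x * w x))"
  and w_pos: "0 < w1" "0 < w2"
  and w_bounds: "!!t. t \<in> {0..1} ==> w1 <= w t & w t <= w2"
  and \<kappa>: "\<kappa> > 2"
  and moment: "is_cond_mean M X (%z. \<bar>Y z - fo (X z)\<bar> powr \<kappa>) v" "bdd_above (v ` {0..1})"
begin

definition noise :: "real \<times> real => real" where "noise z = snd z - fo (fst z)"

abbreviation noise_at :: "nat => 'a => real" where "noise_at i z \<equiv> noise (Xs i z, Ys i z)"

abbreviation nmom :: "'a => real" where "nmom z \<equiv> \<bar>noise (X z, Y z)\<bar> powr \<kappa>"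
lemma measurable_fo: "fo \<in> borel_measurable borel" using fo by (simp add: is_cond_mean_def)

lemma measurable_noise: "noise \<in> borel_measurable borel"
 unfolding noise_def borel_prod[symmetric] using measurable_fo by measurable

lemma measurable_XYs: "i >= 1 ==> (%z. (Xs i z, Ys i z)) \<in> borel_measurable M"
 using indep by (simp add: indep_vars_def)

lemma measurable_Xs: assumes "i >= 1" shows "Xs i \<in> borel_measurable M"
proof -
 have "fst \<in> borel_measurable (borel :: (real \<times> real) measure)" by (intro borel_measurable_continuous_onI continuous_intros)
 from measurable_compose[OF measurable_XYs[OF assms] this] show ?thesis by simp
qed

lemma measurable_Ys: assumes "i >= 1" shows "Ys i \<in> borel_measurable M"
proof -
 have "snd \<in> borel_measurable (borel :: (real \<times> real) measure)" by (intro borel_measurable_continuous_onI continuous_intros)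
 from measurable_compose[OF measurable_XYs[OF assms] this] show ?thesis by simp
qed

lemma measurable_XY: "(%z. (X z, Y z)) \<in> borel_measurable M"
 using X Y by (simp add: borel_prod[symmetric])

lemma expectation_XYs:
 assumes "f \<in> borel_measurable borel" "i >= 1"
 shows "expectation (%z. f (Xs i z, Ys i z)) = expectation (%z. f (X z, Y z) :: real)"
 using integral_distr[OF measurable_XYs[OF assms(2)] assms(1)] integral_distr[OF measurable_XY assms(1)] ident[OF assms(2)] by simp

lemma integrable_XYs:
 fixes f :: "real \<times> real => real"
 assumes "f \<in> borel_measurable borel" "i >= 1"
 shows "integrable M (%z. f (Xs i z, Ys i z)) \<longleftrightarrow> integrable M (%z. f (X z, Y z))"
 using integrable_distr_eq[OF measurable_XYs[OF assms(2)] assms(1)] integrable_distr_eq[OF measurable_XY assms(1)] ident[OF assms(2)] by simp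

lemma emeasure_Xs: "i >= 1 ==> B \<in> sets borel ==>
 emeasure M {z\<in>space M. Xs i z \<in> B} = (\<integral>\<^sup>+ x. ennreal (indicator {0<..<1} x * w x) * indicator B x \<partial>lborel)"
 using distributed_emeasure[OF density, of i B] by (simp add: vimage_def Int_def conj_commute)

lemma emeasure_X: assumes B: "B \<in> sets borel" shows "emeasure M {z\<in>space M. X z \<in> B} = emeasure M {z\<in>space M. Xs 1 z \<in> B}"
proof -
 have C: "B \<times> UNIV \<in> sets (borel :: (real \<times> real) measure)" using B by (simp add: borel_prod[symmetric])
 have "emeasure (distr M borel (%z. (Xs 1 z, Ys 1 z))) (B \<times> UNIV) = emeasure (distr M borel (%z. (X z, Y z))) (B \<times> UNIV)"
  using ident[of 1] by simp
 then show ?thesis unfolding emeasure_distr[OF measurable_XYs[OF order_refl] C] emeasure_distr[OF measurable_XY C]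
  by (simp add: vimage_def Int_def conj_commute)
qed

lemma prob_Xs_interval:
 assumes i: "i >= 1" and ab: "a <= b"
 shows "prob {z\<in>space M. Xs i z \<in> {a<..b}} <= w2 * (b - a)"
proof -
 have "emeasure M {z\<in>space M. Xs i z \<in> {a<..b}} <= (\<integral>\<^sup>+ x. ennreal w2 * indicator {a<..b} x \<partial>lborel)"
  unfolding emeasure_Xs[OF i greaterThanAtMost_borel]
  by (rule nn_integral_mono) (use w_bounds w_pos in \<open>auto simp: indicator_def intro!: ennreal_leI\<close>)
 also have "... = ennreal (w2 * (b - a))" using ab w_pos by (subst nn_integral_cmult_indicator) (simp_all add: ennreal_mult')
 finally show ?thesis using ab w_pos by (simp add: emeasure_eq_measure)
qed

lemma moment_bound:
 obtains S where "0 <= S" "!!B. B \<in> sets borel ==>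
  (\<integral>\<^sup>+ z. indicator B (X z) * ennreal (nmom z) \<partial>M) <= ennreal S * emeasure M {z\<in>space M. Xs 1 z \<in> B}"
proof -
 obtain S where S: "!!x. x \<in> {0..1} ==> v x <= S" using moment(2) unfolding bdd_above_def by (meson imageI)
 have m: "(%z. \<bar>Y z - fo (X z)\<bar> powr \<kappa>) \<in> borel_measurable M"
  using measurable_compose[OF measurable_XY measurable_noise] unfolding noise_def by (simp add: powr_real_measurable)
 show ?thesis
 proof (rule that[of "max 0 S"])
  fix B :: "real set" assume B: "B \<in> sets borel"
  show "(\<integral>\<^sup>+ z. indicator B (X z) * ennreal (nmom z) \<partial>M) <= ennreal (max 0 S) * emeasure M {z\<in>space M. Xs 1 z \<in> B}"
   unfolding emeasure_X[OF B, symmetric] noise_def fst_conv snd_conv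
   by (rule cond_mean_moment[OF X moment(1) m _ _ B]) (use S in \<open>auto simp: le_max_iff_disj\<close>)
 qed simp
qed

lemma integrable_noise_powr: "integrable M (%z. nmom z)"
proof (rule integrableI_bounded)
 show "(%z. nmom z) \<in> borel_measurable M"
  using measurable_compose[OF measurable_XY measurable_noise] by (simp add: powr_real_measurable)
 obtain S where S: "0 <= S" "!!B. B \<in> sets borel ==>
  (\<integral>\<^sup>+ z. indicator B (X z) * ennreal (nmom z) \<partial>M) <= ennreal S * emeasure M {z\<in>space M. Xs 1 z \<in> B}"
  by (rule moment_bound) blast
 have "(\<integral>\<^sup>+ z. ennreal (nmom z) \<partial>M) <= ennreal S" using S(2)[of UNIV] by (simp add: emeasure_space_1)
 then show "(\<integral>\<^sup>+ z. ennreal (norm (nmom z)) \<partial>M) < \<infinity>" by (simp add: le_less_trans)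
qed

lemma integrable_noise: "integrable M (%z. noise (X z, Y z))"
proof (rule Bochner_Integration.integrable_bound[where f="%z. 1 + nmom z"])
 show "integrable M (%z. 1 + nmom z)" using integrable_noise_powr by simp
 show "(%z. noise (X z, Y z)) \<in> borel_measurable M" by (rule measurable_compose[OF measurable_XY measurable_noise])
 have "\<bar>u\<bar> <= 1 + \<bar>u\<bar> powr \<kappa>" for u :: real
 proof (cases "\<bar>u\<bar> <= 1")
  case False
  then have "\<bar>u\<bar> powr 1 <= \<bar>u\<bar> powr \<kappa>" using \<kappa> by (intro powr_mono) auto
  then show ?thesis by simp
 qed (simp add: add_increasing2)
 then show "AE z in M. norm (noise (X z, Y z)) <= norm (1 + nmom z)" by simp
qed

lemma noise_centered:
 assumes B: "B \<in> sets borel" and i: "i >= 1"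
 shows "expectation (%e. indicator B (Xs i e) * noise_at i e) = 0"
proof -
 have m: "(%z. indicator B (fst z) * noise z) \<in> borel_measurable borel"
  using measurable_noise B unfolding borel_prod[symmetric] by measurable
 have "expectation (%e. indicator B (X e) * (Y e - fo (X e))) = 0"
  by (rule cond_mean_centered[OF X(1) fo _ B]) (use integrable_noise in \<open>simp add: noise_def\<close>)
 then show ?thesis using expectation_XYs[OF m i] by (simp add: noise_def)
qed

lemma integrable_noise_i: "i >= 1 ==> integrable M (%z. noise_at i z)"
 using integrable_XYs[OF measurable_noise] integrable_noise by simp

text \<open>Covers the marks 1 (with c = 1) and the two parts of the noise (with c = 0).
  \<open>K\<close> is the sum of the bounds for the mass and for the moment.\<close>

lemma iid_marks_compose:
 assumes G: "G \<in> borel_measurable borel" "!!z. 0 <= G z" "!!z. G z powr \<kappa> <= c + \<bar>noise z\<bar> powr \<kappa>" and c: "0 <= c"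
 shows "\<exists>K. iid_marks M Xs (%i e. G (Xs i e, Ys i e)) \<kappa> K"
proof -
 obtain S where S: "0 <= S" "!!B. B \<in> sets borel ==>
  (\<integral>\<^sup>+ e. indicator B (X e) * ennreal (nmom e) \<partial>M) <= ennreal S * emeasure M {e\<in>space M. Xs 1 e \<in> B}"
  by (rule moment_bound) blast
 define K where "K = w2 + (c + S) * w2"
 have mG: "(%z. (fst z, G z)) \<in> borel_measurable borel"
  using G(1) unfolding borel_prod[symmetric] by measurable
 have mGk: "(%z. G z powr \<kappa>) \<in> borel_measurable borel" using G(1) by (simp add: powr_real_measurable)
 have iX: "integrable M (%e. G (X e, Y e) powr \<kappa>)"
 proof (rule Bochner_Integration.integrable_bound[where f="%e. c + nmom e"])
  show "integrable M (%e. c + nmom e)" using integrable_noise_powr by simp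
  show "(%e. G (X e, Y e) powr \<kappa>) \<in> borel_measurable M" by (rule measurable_compose[OF measurable_XY mGk])
  show "AE e in M. norm (G (X e, Y e) powr \<kappa>) <= norm (c + nmom e)"
   using G(3) c by simp
 qed
 have "iid_marks M Xs (%i e. G (Xs i e, Ys i e)) \<kappa> K"
 proof (intro iid_marks.intro iid_marks_axioms.intro)
  show "prob_space M" by (rule prob_space_axioms)
  show "indep_vars (%_. borel) (%i e. (Xs i e, G (Xs i e, Ys i e))) {1..}"
   using indep_vars_compose2[OF indep, where Y="%_ z. (fst z, G z)" and N="%_. borel"] mG by simp
  show "distr M borel (%e. (Xs i e, G (Xs i e, Ys i e))) = distr M borel (%e. (Xs 1 e, G (Xs 1 e, Ys 1 e)))" if i: "i >= 1" for i
   using distr_distr[OF mG measurable_XYs[OF i]] distr_distr[OF mG measurable_XYs[of 1]] ident[OF i] ident[of 1] by (simp add: o_def)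
  show "0 <= K" using c S w_pos by (simp add: K_def)
  show "integrable M (%e. G (Xs 1 e, Ys 1 e) powr \<kappa>)" using integrable_XYs[OF mGk, of 1] iX by simp
  fix a b :: real assume ab: "0 <= a" "a <= b" "b <= 1"
  have p: "prob {e\<in>space M. Xs 1 e \<in> {a<..b}} <= w2 * (b - a)" by (rule prob_Xs_interval) (use ab in auto)
  have p2: "0 <= (c + S) * w2 * (b - a)" using c S w_pos ab by simp
  show "prob {e\<in>space M. Xs 1 e \<in> {a<..b}} <= K * (b - a)" using p p2 by (simp add: K_def distrib_right)
  have mH: "(%z. G z powr \<kappa> * indicator {a<..b} (fst z)) \<in> borel_measurable borel"
   using mGk unfolding borel_prod[symmetric] by measurable
  have iH: "integrable M (%e. G (X e, Y e) powr \<kappa> * indicator {a<..b} (X e))"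
   by (rule Bochner_Integration.integrable_bound[OF iX measurable_compose[OF measurable_XY mH, unfolded fst_conv]]) (auto simp: indicator_def)
  have pe: "ennreal S * emeasure M {e\<in>space M. Xs 1 e \<in> {a<..b}} = ennreal (S * prob {e\<in>space M. Xs 1 e \<in> {a<..b}})"
   using S by (simp add: emeasure_eq_measure ennreal_mult')
  have "ennreal (expectation (%e. G (X e, Y e) powr \<kappa> * indicator {a<..b} (X e))) =
    (\<integral>\<^sup>+ e. ennreal (G (X e, Y e) powr \<kappa> * indicator {a<..b} (X e)) \<partial>M)"
   by (rule nn_integral_eq_integral[OF iH, symmetric]) simp
  also have "... <= (\<integral>\<^sup>+ e. ennreal c * indicator {e\<in>space M. X e \<in> {a<..b}} e + indicator {a<..b} (X e) * ennreal (nmom e) \<partial>M)"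
  proof (rule nn_integral_mono)
   fix e assume "e \<in> space M"
   have "ennreal (G (X e, Y e) powr \<kappa>) <= ennreal c + ennreal (nmom e)"
    using G(3)[of "(X e, Y e)"] c by (simp flip: ennreal_plus)
   then show "ennreal (G (X e, Y e) powr \<kappa> * indicator {a<..b} (X e)) <= ennreal c * indicator {e\<in>space M. X e \<in> {a<..b}} e + indicator {a<..b} (X e) * ennreal (nmom e)"
    using \<open>e \<in> space M\<close> by (auto simp: indicator_def)
  qed
  also have "... = (\<integral>\<^sup>+ e. ennreal c * indicator {e\<in>space M. X e \<in> {a<..b}} e \<partial>M) + (\<integral>\<^sup>+ e. indicator {a<..b} (X e) * ennreal (nmom e) \<partial>M)"
  proof (rule nn_integral_add)
   have "{e\<in>space M. X e \<in> {a<..b}} \<in> events" using X(1) by measurable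
   then show "(%e. ennreal c * indicator {e\<in>space M. X e \<in> {a<..b}} e) \<in> borel_measurable M" by simp
   have 1: "(%e. indicator {a<..b} (X e) :: ennreal) \<in> borel_measurable M" by (rule measurable_compose[OF X(1)]) simp
   have 2: "(%e. ennreal (nmom e)) \<in> borel_measurable M"
    using borel_measurable_integrable[OF integrable_noise_powr] by simp
   show "(%e. indicator {a<..b} (X e) * ennreal (nmom e)) \<in> borel_measurable M"
    by (rule borel_measurable_times_ennreal[OF 1 2])
  qed
  also have "(\<integral>\<^sup>+ e. ennreal c * indicator {e\<in>space M. X e \<in> {a<..b}} e \<partial>M) = ennreal c * emeasure M {e\<in>space M. Xs 1 e \<in> {a<..b}}"
  proof -
   have "{e\<in>space M. X e \<in> {a<..b}} \<in> events" using X(1) by measurable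
   then show ?thesis by (simp only: nn_integral_cmult_indicator emeasure_X[OF greaterThanAtMost_borel])
  qed
  also have "... = ennreal (c * prob {e\<in>space M. Xs 1 e \<in> {a<..b}})" using c by (simp add: emeasure_eq_measure ennreal_mult')
  also have "ennreal (c * prob {e\<in>space M. Xs 1 e \<in> {a<..b}}) + (\<integral>\<^sup>+ e. indicator {a<..b} (X e) * ennreal (nmom e) \<partial>M)
   <= ennreal (c * prob {e\<in>space M. Xs 1 e \<in> {a<..b}}) + ennreal (S * prob {e\<in>space M. Xs 1 e \<in> {a<..b}})"
   unfolding pe[symmetric] by (intro add_left_mono S(2)) simp
  also have "... = ennreal ((c + S) * prob {e\<in>space M. Xs 1 e \<in> {a<..b}})"
   using c S by (simp add: distrib_right flip: ennreal_plus)
  finally have "expectation (%e. G (X e, Y e) powr \<kappa> * indicator {a<..b} (X e)) <= (c + S) * prob {e\<in>space M. Xs 1 e \<in> {a<..b}}"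
   using c S by (simp add: ennreal_le_iff)
  also have "... <= (c + S) * (w2 * (b - a))" using p c S by (intro mult_left_mono) auto
  also have "... <= K * (b - a)" using w_pos ab by (simp add: K_def distrib_right)
  finally show "expectation (%e. G (Xs 1 e, Ys 1 e) powr \<kappa> * indicator {a<..b} (Xs 1 e)) <= K * (b - a)"
   using expectation_XYs[OF mH, of 1] by simp
 qed (use G(2) \<kappa> in auto)
 then show ?thesis by blast
qed

lemma subalgebra_design: "finite_measure_subalgebra M (design_algebra M Xs n)"
 unfolding design_algebra_def by (intro finite_measure_subalgebra_vimage measurable_restrict measurable_Xs) auto

lemma measurable_design:
 assumes "i \<in> {1..n}" shows "Xs i \<in> borel_measurable (design_algebra M Xs n)"
proof -
 have m: "(%z. \<lambda>i\<in>{1..n}. Xs i z) \<in> measurable (design_algebra M Xs n) (\<Pi>\<^sub>M i\<in>{1..n}. borel)"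
  unfolding design_algebra_def by (rule measurable_vimage_algebra1) (auto simp: space_PiM)
 have "(%f. f i) \<in> measurable (\<Pi>\<^sub>M i\<in>{1..n}. borel) (borel :: real measure)" by (rule measurable_component_singleton[OF assms])
 from measurable_compose[OF m this] show ?thesis using assms by simp
qed

text \<open>Conditioning is on the whole design. On rectangles independence factorizes the integral
  into one factor per observation, and the i-th factor is 0 because the noise is centred given its
  own design point. A Dynkin argument extends this to all events of the design.\<close>

lemma noise_design_centered:
 assumes i: "i \<in> {1..n}"
 shows "AE e in M. real_cond_exp M (design_algebra M Xs n) (%e. noise_at i e) e = 0"
proof -
 let ?F = "design_algebra M Xs n" and ?P = "\<Pi>\<^sub>M i\<in>{1..n}. (borel :: real measure)"
 interpret F: finite_measure_subalgebra M ?F by (rule subalgebra_design)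
 define D where "D e = noise_at i e" for e
 have D: "integrable M D" unfolding D_def using integrable_noise_i i by simp
 define x where "x e = (\<lambda>i\<in>{1..n}. Xs i e)" for e
 have x: "x \<in> measurable M ?P" unfolding x_def by (intro measurable_restrict measurable_Xs) auto
 have xsp: "x \<in> space M \<rightarrow> space ?P" using measurable_space[OF x] by auto
 define Q where "Q B \<longleftrightarrow> (\<integral>e\<in>x -` B Int space M. D e \<partial>M) = 0" for B
 have sI: "set_integrable M A D" if "A \<in> events" for A
  unfolding set_integrable_def using integrable_mult_indicator[OF that D] by simp
 have pre: "x -` B Int space M \<in> events" if "B \<in> sets ?P" for B by (rule measurable_sets[OF x that])
 have Q: "Q B" if B: "B \<in> sets ?P" for B
 proof -
  let ?G = "{\<Pi>\<^sub>E j\<in>{1..n}. A j | A. A \<in> (\<Pi> j\<in>{1..n}. sets (borel :: real measure))}"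
  let ?O = "\<Pi>\<^sub>E j\<in>{1..n}. space (borel :: real measure)"
  have eq: "sets ?P = sigma_sets ?O ?G" unfolding sets_PiM by (subst prod_algebra_eq_finite) simp_all
  have Qbasic: "Q (\<Pi>\<^sub>E j\<in>{1..n}. A j)" if A: "A \<in> (\<Pi> j\<in>{1..n}. sets (borel :: real measure))" for A
  proof -
   define g where "g j z = indicator (A j) (fst z) * (if j = i then noise z else 1)" for j and z :: "real \<times> real"
   have mg: "g j \<in> borel_measurable borel" if "j \<in> {1..n}" for j
   proof -
    have [measurable]: "A j \<in> sets borel" using A that by auto
    have "(%z. indicator (A j) (fst z) :: real) \<in> borel_measurable (borel :: (real \<times> real) measure)"
     unfolding borel_prod[symmetric] by measurable
    then show ?thesis unfolding g_def using measurable_noise by (cases "j = i") simp_all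
   qed
   have ig: "integrable M (%e. g j (Xs j e, Ys j e))" if j: "j \<in> {1..n}" for j
   proof (rule Bochner_Integration.integrable_bound[where f="%e. 1 + \<bar>noise_at j e\<bar>"])
    show "integrable M (%e. 1 + \<bar>noise_at j e\<bar>)" using integrable_noise_i[of j] j by simp
    show "(%e. g j (Xs j e, Ys j e)) \<in> borel_measurable M" by (rule measurable_compose[OF measurable_XYs mg[OF j]]) (use j in auto)
   qed (auto simp: g_def indicator_def)
   have "indep_vars (%_. borel) (%j e. g j (Xs j e, Ys j e)) {1..n}"
   proof (rule indep_vars_compose2[where Y=g and M'="%_. borel"])
    show "indep_vars (%_. borel) (%i e. (Xs i e, Ys i e)) {1..n}" by (rule indep_vars_subset[OF indep]) auto
   qed (rule mg)
   then have "expectation (%e. \<Prod>j\<in>{1..n}. g j (Xs j e, Ys j e)) = (\<Prod>j\<in>{1..n}. expectation (%e. g j (Xs j e, Ys j e)))"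
    by (rule indep_vars_lebesgue_integral[rotated]) (use ig in auto)
   also have "... = 0"
   proof (rule prod_zero)
    have "A i \<in> sets borel" using A i by auto
    then show "\<exists>j\<in>{1..n}. expectation (%e. g j (Xs j e, Ys j e)) = 0"
     using noise_centered[of "A i" i] i by (intro bexI[of _ i]) (auto simp: g_def)
   qed simp
   finally have z: "expectation (%e. \<Prod>j\<in>{1..n}. g j (Xs j e, Ys j e)) = 0" .
   have "(\<Prod>j\<in>{1..n}. g j (Xs j e, Ys j e)) = indicator (x -` (\<Pi>\<^sub>E j\<in>{1..n}. A j) Int space M) e *\<^sub>R D e" if "e \<in> space M" for e
   proof -
    have "(\<Prod>j\<in>{1..n}. g j (Xs j e, Ys j e)) = (\<Prod>j\<in>{1..n}. indicator (A j) (Xs j e)) * (\<Prod>j\<in>{1..n}. if j = i then D e else 1)"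
     unfolding g_def fst_conv prod.distrib by (intro arg_cong2[where f="(*)"] refl prod.cong) (auto simp: D_def)
    also have "(\<Prod>j\<in>{1..n}. if j = i then D e else 1) = D e" using i by simp
    also have "(\<Prod>j\<in>{1..n}. indicator (A j) (Xs j e)) = (indicator (x -` (\<Pi>\<^sub>E j\<in>{1..n}. A j) Int space M) e :: real)"
    proof (cases "\<forall>j\<in>{1..n}. Xs j e \<in> A j")
     case True
     then have "e \<in> x -` (\<Pi>\<^sub>E j\<in>{1..n}. A j) Int space M" using \<open>e \<in> space M\<close> by (auto simp: x_def)
     moreover have "(\<Prod>j\<in>{1..n}. indicator (A j) (Xs j e)) = (1::real)" by (rule prod.neutral) (use True in auto)
     ultimately show ?thesis by simp
    next
     case False
     then obtain j where j: "j \<in> {1..n}" "Xs j e ~: A j" by auto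
     then have "x e j ~: A j" by (simp add: x_def)
     then have "e ~: x -` (\<Pi>\<^sub>E j\<in>{1..n}. A j) Int space M" using j(1) by (auto simp: PiE_def Pi_def)
     moreover have "(\<Prod>j\<in>{1..n}. indicator (A j) (Xs j e)) = (0::real)" by (rule prod_zero) (use j in \<open>auto intro!: bexI[of _ j]\<close>)
     ultimately show ?thesis by simp
    qed
    finally show ?thesis by simp
   qed
   then have "(\<integral>e\<in>x -` (\<Pi>\<^sub>E j\<in>{1..n}. A j) Int space M. D e \<partial>M) = expectation (%e. \<Prod>j\<in>{1..n}. g j (Xs j e, Ys j e))"
    unfolding set_lebesgue_integral_def by (intro Bochner_Integration.integral_cong refl) auto
   then show ?thesis unfolding Q_def z .
  qed
  have tot: "Q ?O" using Qbasic[of "%_. UNIV"] by simp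
  have B': "B \<in> sigma_sets ?O ?G" using B unfolding eq .
  have sub: "?G <= Pow ?O" by (auto simp: PiE_def)
  have stable: "Int_stable ?G"
  proof (rule Int_stableI)
   fix a b assume "a \<in> ?G" "b \<in> ?G"
   then obtain A1 A2 where "a = (\<Pi>\<^sub>E j\<in>{1..n}. A1 j)" "A1 \<in> (\<Pi> j\<in>{1..n}. sets borel)" "b = (\<Pi>\<^sub>E j\<in>{1..n}. A2 j)" "A2 \<in> (\<Pi> j\<in>{1..n}. sets borel)"
    by auto
   then have "a Int b = (\<Pi>\<^sub>E j\<in>{1..n}. A1 j Int A2 j)" "(%j. A1 j Int A2 j) \<in> (\<Pi> j\<in>{1..n}. sets borel)"
    by (simp_all add: PiE_Int Pi_iff sets.Int)
   then show "a Int b \<in> ?G" by blast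
  qed
  show ?thesis
   using stable sub B'
  proof (induction rule: sigma_sets_induct_disjoint)
   case (basic A) then show ?case using Qbasic by auto
  next
   case empty then show ?case by (simp add: Q_def set_lebesgue_integral_def)
  next
   case (compl A)
   have A: "A \<in> sets ?P" using compl.hyps unfolding eq by simp
   have O: "?O \<in> sets ?P" using sets.top[of ?P] by (simp add: space_PiM)
   have "x -` ?O Int space M = (x -` A Int space M) Un (x -` (?O - A) Int space M)"
    using xsp by (auto simp: space_PiM)
   then have "(\<integral>e\<in>x -` ?O Int space M. D e \<partial>M) = (\<integral>e\<in>x -` A Int space M. D e \<partial>M) + (\<integral>e\<in>x -` (?O - A) Int space M. D e \<partial>M)"
    using pre[OF A] pre[OF sets.Diff[OF O A]] by (subst set_integral_Un[symmetric]) (auto intro!: sI)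
   then show ?case using tot compl.IH by (simp add: Q_def)
  next
   case (union A)
   have A: "A k \<in> sets ?P" for k using union.hyps unfolding eq by auto
   have "x -` (\<Union>k. A k) Int space M = (\<Union>k. x -` A k Int space M)" by auto
   moreover have "(\<integral>e\<in>(\<Union>k. x -` A k Int space M). D e \<partial>M) = (\<Sum>k. (\<integral>e\<in>x -` A k Int space M. D e \<partial>M))"
   proof (rule lebesgue_integral_countable_add)
    show "(x -` A k Int space M) Int (x -` A l Int space M) = {}" if "k ~= l" for k l
     using union.hyps(1) that by (auto simp: disjoint_family_on_def)
    show "set_integrable M (\<Union>k. x -` A k Int space M) D" by (rule sI, rule sets.countable_nat_UN) (use pre[OF A] in auto)
   qed (rule pre[OF A])
   ultimately show ?case using union.IH by (simp add: Q_def)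
  qed
 qed
 have "AE e in M. real_cond_exp M ?F D e = (%_. 0) e"
 proof (rule F.real_cond_exp_charact[OF _ D])
  fix A assume "A \<in> sets ?F"
  then obtain B where "B \<in> sets ?P" "A = x -` B Int space M"
   unfolding design_algebra_def x_def[symmetric, abs_def] sets_vimage_algebra2[OF xsp] by auto
  then show "(\<integral>e\<in>A. D e \<partial>M) = (\<integral>e\<in>A. 0 \<partial>M)" using Q by (simp add: Q_def set_lebesgue_integral_def)
 qed auto
 then show ?thesis unfolding D_def by simp
qed

text \<open>A density excludes atoms; for distinctness, Fubini's theorem for two independent points
  reduces the diagonal to single points.\<close>

lemma AE_design:
 "AE e in M. (\<forall>i\<ge>1. Xs i e \<in> {0<..<1}) & (\<forall>n. inj_on (%i. Xs i e) {1..n})"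
proof -
 have null: "AE e in M. Xs i e ~: N" if i: "i >= 1" and N: "N \<in> sets borel" and z: "AE x in lborel. x \<in> {0<..<1} --> x ~: N" for i N
 proof -
  have "AE x in lborel. ennreal (indicator {0<..<1} x * w x) * indicator N x = 0"
   using z by eventually_elim (auto simp: indicator_def)
  from nn_integral_cong_AE[OF this] have "emeasure M {e\<in>space M. Xs i e \<in> N} = 0"
   unfolding emeasure_Xs[OF i N] by simp
  then show ?thesis using measurable_Xs[OF i] N by (intro AE_I[of _ _ "{e\<in>space M. Xs i e \<in> N}"]) auto
 qed
 have inside: "AE e in M. Xs i e \<in> {0<..<1}" if "i >= 1" for i
  using null[OF that, of "- {0<..<1}"] by simp
 have distinct: "AE e in M. Xs i e ~= Xs j e" if ij: "i >= 1" "j >= 1" "i ~= j" for i j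
 proof -
  have iv: "indep_var borel (Xs i) borel (Xs j)"
  proof -
   have "indep_var (PiM {i} (%_. borel)) (%e. restrict (%i. (Xs i e, Ys i e)) {i}) (PiM {j} (%_. borel)) (%e. restrict (%i. (Xs i e, Ys i e)) {j})"
    by (rule indep_var_restrict[OF indep]) (use ij in auto)
   moreover have fm: "(%f. fst (f i)) \<in> borel_measurable (PiM {i} (%_. borel :: (real \<times> real) measure))" for i :: nat
    by (rule measurable_compose[OF measurable_component_singleton]) (auto intro!: borel_measurable_continuous_onI continuous_intros)
   ultimately have "indep_var borel ((%f. fst (f i)) \<circ> (%e. restrict (%i. (Xs i e, Ys i e)) {i})) borel ((%f. fst (f j)) \<circ> (%e. restrict (%i. (Xs i e, Ys i e)) {j}))"
    by (intro indep_var_compose[OF _ fm[of i] fm[of j]])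
   then show ?thesis by (simp add: o_def)
  qed
  let ?d = "{z. fst z = snd z} :: (real \<times> real) set"
  have d: "?d \<in> sets (borel \<Otimes>\<^sub>M borel)" unfolding borel_prod by (intro borel_closed closed_Collect_eq continuous_intros)
  interpret j: prob_space "distr M borel (Xs j)" by (rule prob_space_distr[OF measurable_Xs[OF ij(2)]])
  have pair: "(%e. (Xs i e, Xs j e)) \<in> measurable M (borel \<Otimes>\<^sub>M borel)" using measurable_Xs ij by simp
  have "emeasure M {e\<in>space M. Xs i e = Xs j e} = emeasure (distr M (borel \<Otimes>\<^sub>M borel) (%e. (Xs i e, Xs j e))) ?d"
   unfolding emeasure_distr[OF pair d] by (simp add: vimage_def Int_def conj_commute)
  also have "... = emeasure (distr M borel (Xs i) \<Otimes>\<^sub>M distr M borel (Xs j)) ?d"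
   using iv unfolding indep_var_distribution_eq by simp
  also have "... = (\<integral>\<^sup>+ a. emeasure (distr M borel (Xs j)) (Pair a -` ?d) \<partial>distr M borel (Xs i))"
   by (rule j.emeasure_pair_measure_alt) (use d in simp)
  also have "... = (\<integral>\<^sup>+ a. 0 \<partial>distr M borel (Xs i))"
  proof (rule nn_integral_cong)
   fix a :: real
   have "Pair a -` ?d = {a}" by auto
   moreover have "AE e in M. Xs j e ~: {a}" by (rule null[OF ij(2)]) (use AE_lborel_singleton[of a] in auto)
   then have "emeasure M {e\<in>space M. Xs j e \<in> {a}} = 0"
    using measurable_Xs[OF ij(2)] by (subst AE_iff_measurable[symmetric, where P="%e. Xs j e ~: {a}"]) auto
   ultimately show "emeasure (distr M borel (Xs j)) (Pair a -` ?d) = 0"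
    using measurable_Xs[OF ij(2)] by (simp add: emeasure_distr vimage_def Int_def conj_commute)
  qed
  finally have "emeasure M {e\<in>space M. Xs i e = Xs j e} = 0" by simp
  then show ?thesis using measurable_Xs ij by (intro AE_I[of _ _ "{e\<in>space M. Xs i e = Xs j e}"]) auto
 qed
 have "AE e in M. \<forall>i. i >= 1 --> Xs i e \<in> {0<..<1}" unfolding AE_all_countable using inside by auto
 moreover have "AE e in M. \<forall>i j. i >= 1 --> j >= 1 --> i ~= j --> Xs i e ~= Xs j e" unfolding AE_all_countable using distinct by auto
 ultimately show ?thesis 
 proof eventually_elim
  case (elim e)
  then show ?case unfolding inj_on_def by (metis atLeastAtMost_iff)
 qed
qed

end

section \<open>The error bound\<close>

text \<open>Deterministic counterpart of \<open>cell_rate\<close>: \<open>u\<close> are the weights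
  of the observations and \<open>q\<close> is the density they should reproduce, \<open>w\<close>
  for the design and 0 for the noise.\<close>

definition cell_discrepancy :: "nat => (nat => real) => (nat => real) => (real => real) => nat => real => bool" where
 "cell_discrepancy n x u q l B \<longleftrightarrow> (\<forall>p s. p < (2::nat) ^ l --> real p / 2 ^ l <= s --> s <= (real p + 1) / 2 ^ l -->
  \<bar>(SUM i=1..n. u i * indicator {real p / 2 ^ l<..s} (x i)) - integral {real p / 2 ^ l..s} q\<bar> <= B)"

lemma cell_discrepancy_nonneg:
 assumes "cell_discrepancy n x u q l B" shows "0 <= B"
 using assms[unfolded cell_discrepancy_def, rule_format, of 0 0] by simp

lemma dyadic_weighted_discrepancy:
 fixes p p' q :: "real => real" and x u :: "nat => real"
 assumes x: "!!i. i \<in> {1..n} ==> x i \<in> {0<..<1}"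
  and p': "p' absolutely_integrable_on {0..1}"
  and p: "!!x y. 0 <= x ==> x <= y ==> y <= 1 ==> (p' has_integral p y - p x) {x..y}"
  and q: "q \<in> borel_measurable leb01" "!!x. x \<in> {0..1} ==> \<bar>q x\<bar> <= K"
  and B: "cell_discrepancy n x u q l B" and h: "0 < h" "h < 2 * (1/2) ^ l"
  and P: "0 <= int01 (%x. \<bar>p x\<bar>)"
 shows "\<bar>(SUM i=1..n. u i * p (x i)) - int01 (%x. q x * p x)\<bar> <=
  2 * (B / h) * (int01 (%x. \<bar>p x\<bar>) + h * int01 (%x. \<bar>p' x\<bar>))"
proof -
 have B0: "0 <= B" by (rule cell_discrepancy_nonneg[OF B])
 have "\<bar>(SUM i:{1..n}. u i * p (x i)) - int01 (%x. q x * p x)\<bar> <=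
  B * (real (2 ^ l) * int01 (%x. \<bar>p x\<bar>) + 2 * int01 (%x. \<bar>p' x\<bar>))"
 proof (rule weighted_discrepancy[OF _ _ p' p q])
  show "x i \<in> {0<..1}" if "i \<in> {1..n}" for i using x[OF that] by auto
  show "\<bar>(SUM i:{1..n}. u i * indicator {real j / real (2 ^ l)<..s} (x i)) - integral {real j / real (2 ^ l)..s} q\<bar> <= B"
   if "j < 2 ^ l" "s \<in> {real j / real (2 ^ l)..real (Suc j) / real (2 ^ l)}" for j s
   using B[unfolded cell_discrepancy_def, rule_format, of j s] that by (simp add: add.commute)
 qed auto
 also have "... <= B * (2 / h * int01 (%x. \<bar>p x\<bar>) + 2 * int01 (%x. \<bar>p' x\<bar>))"
 proof (intro mult_left_mono add_right_mono mult_right_mono P B0)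
  have "2 ^ l * h <= 2 ^ l * (2 * (1/2) ^ l)" using h by (intro mult_left_mono) auto
  also have "... = 2" by (simp add: power_one_over)
  finally show "real (2 ^ l) <= 2 / h" using h by (simp add: field_simps)
 qed
 also have "... = 2 * (B / h) * (int01 (%x. \<bar>p x\<bar>) + h * int01 (%x. \<bar>p' x\<bar>))"
  using h by (simp add: field_simps)
 finally show ?thesis .
qed

lemma sobolev2_abs_product_le:
 assumes "square_integrable01 f" "square_integrable01 g"
  and "int01 (%x. (f x)^2) <= a" "int01 (%x. (g x)^2) <= b"
 shows "int01 (%x. \<bar>f x * g x\<bar>) <= sqrt a * sqrt b"
proof -
 have f0: "0 <= int01 (%x. (f x)^2)" and g0: "0 <= int01 (%x. (g x)^2)"
  using assms(1,2) by (auto intro!: integral_nonneg simp: square_integrable01_def)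
 have "(int01 (%x. \<bar>f x * g x\<bar>))^2 <= int01 (%x. (f x)^2) * int01 (%x. (g x)^2)"
  by (rule square_integrable01_Cauchy_Schwarz) (use assms in auto)
 also have "... <= a * b" using assms(3,4) f0 g0 by (intro mult_mono) auto
 finally have "int01 (%x. \<bar>f x * g x\<bar>) <= sqrt (a * b)" by (rule real_le_rsqrt)
 then show ?thesis by (simp add: real_sqrt_mult)
qed

text \<open>Cauchy-Schwarz bounds the L1 norms of the product and of \<open>h\<close> times its
  derivative by the energies; by interpolation \<open>h\<close> times a derivative counts like the
  function itself. The second estimate has one factor 1 and serves the noise term of the normal
  equations.\<close>

lemma sobolev2_discrepancy:
 assumes m: "m >= 1"
 obtains C where "C >= 1"
  "!!(x::nat => real) u q K n h l B \<phi> \<psi>. (!!i. i \<in> {1..n} ==> x i \<in> {0<..<1}) ==> \<phi> \<in> sobolev2 m ==> \<psi> \<in> sobolev2 m ==>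
   q \<in> borel_measurable leb01 ==> (!!x. x \<in> {0..1} ==> \<bar>q x\<bar> <= K) ==> cell_discrepancy n x u q l B ==>
   0 < h ==> h <= 1 ==> h < 2 * (1/2) ^ l ==>
   \<bar>(SUM i=1..n. u i * (\<phi> (x i) * \<psi> (x i))) - int01 (%x. q x * (\<phi> x * \<psi> x))\<bar> <= C * (B / h) * (sqrt (energy01 m h \<phi>) * sqrt (energy01 m h \<psi>))"
  "!!(x::nat => real) u n h l B \<psi>. (!!i. i \<in> {1..n} ==> x i \<in> {0<..<1}) ==> \<psi> \<in> sobolev2 m ==> cell_discrepancy n x u (%_. 0) l B ==>
   0 < h ==> h <= 1 ==> h < 2 * (1/2) ^ l ==>
   \<bar>SUM i=1..n. u i * \<psi> (x i)\<bar> <= C * (B / h) * sqrt (energy01 m h \<psi>)"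
proof -
 obtain C1 where C1: "C1 >= 1" "!!f h. f \<in> sobolev2 m ==> 0 < h ==> h <= 1 ==>
  h^2 * dnorm2 1 f <= C1 * energy01 m h f" using deriv_le_energy01[OF m] by blast
 define s1 where "s1 = sqrt C1"
 have s1: "1 <= s1" using C1(1) by (simp add: s1_def)
 have sq0: "square_integrable01 f" if "f \<in> sobolev2 m" for f using sobolev2_square_integrable[OF that, of 0] by simp
 have sq1: "square_integrable01 (deriv01 1 f)" if "f \<in> sobolev2 m" for f using sobolev2_square_integrable[OF that, of 1] m by simp
 have cont: "continuous_on {0..1} f" if "f \<in> sobolev2 m" for f using sobolev2_continuous[OF that, of 0] m by simp
 have d_le: "dnorm2 1 f <= C1 * energy01 m h f / h^2" if "f \<in> sobolev2 m" "0 < h" "h <= 1" for f h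
  using C1(2)[OF that] that by (simp add: field_simps)
 have sd: "sqrt (C1 * energy01 m h f / h^2) = s1 * sqrt (energy01 m h f) / h" if "0 < h" for f h
  using that by (simp add: real_sqrt_divide real_sqrt_mult s1_def)
 have e0: "int01 (%x. (f x)^2) <= energy01 m h f" if "f \<in> sobolev2 m" "0 < h" for f h
  using integral_sq_le_energy01[OF that(1)] that by simp
 show ?thesis
 proof (rule that[of "2 * (1 + 2 * s1)"])
  show "1 <= 2 * (1 + 2 * s1)" using s1 by simp
  fix x u :: "nat => real" and q :: "real => real" and K h B :: real and n l :: nat and \<phi> \<psi> :: "real => real"
  assume x: "!!i. i \<in> {1..n} ==> x i \<in> {0<..<1}" and f: "\<phi> \<in> sobolev2 m" "\<psi> \<in> sobolev2 m"
   and q: "q \<in> borel_measurable leb01" "!!x. x \<in> {0..1} ==> \<bar>q x\<bar> <= K"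
   and B: "cell_discrepancy n x u q l B" and h: "0 < h" "h <= 1" "h < 2 * (1/2) ^ l"
  define E where "E = sqrt (energy01 m h \<phi>) * sqrt (energy01 m h \<psi>)"
  let ?p = "%x. \<phi> x * \<psi> x" and ?p' = "%x. deriv01 1 \<phi> x * \<psi> x + \<phi> x * deriv01 1 \<psi> x"
  obtain N1 where N1: "negligible N1" "!!x. x \<in> {0..1} ==> x ~: N1 ==> (\<phi> has_vector_derivative deriv01 1 \<phi> x) (at x within {0..1})"
   using sobolev2_deriv_ae[OF f(1), of 0] m by auto
  obtain N2 where N2: "negligible N2" "!!x. x \<in> {0..1} ==> x ~: N2 ==> (\<psi> has_vector_derivative deriv01 1 \<psi> x) (at x within {0..1})"
   using sobolev2_deriv_ae[OF f(2), of 0] m by auto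
  have ac: "AC01 \<phi>" "AC01 \<psi>"
   using sobolev2_absolutely_continuous[OF f(1), of 0] sobolev2_absolutely_continuous[OF f(2), of 0] m by simp_all
  have ftc: "(?p' has_integral ?p b - ?p a) {a..b}" if "0 <= a" "a <= b" "b <= 1" for a b
   by (rule absolutely_continuous_fun_on_product_has_integral[OF ac negligible_Un[OF N1(1) N2(1)] _ _ that]) (use N1(2) N2(2) in auto)
  have p1: "(%x. deriv01 1 \<phi> x * \<psi> x) absolutely_integrable_on {0..1}" by (rule square_integrable01_product[OF sq1[OF f(1)] sq0[OF f(2)]])
  have p2: "(%x. \<phi> x * deriv01 1 \<psi> x) absolutely_integrable_on {0..1}" by (rule square_integrable01_product[OF sq0[OF f(1)] sq1[OF f(2)]])
  have p': "?p' absolutely_integrable_on {0..1}" by (rule set_integral_add(1)[OF p1 p2])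
  have i0: "int01 (%x. \<bar>?p x\<bar>) <= E"
   unfolding E_def by (rule sobolev2_abs_product_le[OF sq0[OF f(1)] sq0[OF f(2)] e0[OF f(1) h(1)] e0[OF f(2) h(1)]])
  have i1: "int01 (%x. \<bar>deriv01 1 \<phi> x * \<psi> x\<bar>) <= s1 * E / h"
   using sobolev2_abs_product_le[OF sq1[OF f(1)] sq0[OF f(2)] d_le[OF f(1) h(1,2)] e0[OF f(2) h(1)]]
   unfolding sd[OF h(1)] by (simp add: E_def)
  have i2: "int01 (%x. \<bar>\<phi> x * deriv01 1 \<psi> x\<bar>) <= s1 * E / h"
   using sobolev2_abs_product_le[OF sq0[OF f(1)] sq1[OF f(2)] e0[OF f(1) h(1)] d_le[OF f(2) h(1,2)]]
   unfolding sd[OF h(1)] by (simp add: E_def mult_ac)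
  have a1: "(%x. \<bar>deriv01 1 \<phi> x * \<psi> x\<bar>) integrable_on {0..1}" and a2: "(%x. \<bar>\<phi> x * deriv01 1 \<psi> x\<bar>) integrable_on {0..1}"
   using p1 p2 by (simp_all add: absolutely_integrable_on_def)
  have a: "(%x. \<bar>?p' x\<bar>) integrable_on {0..1}" using p' by (simp add: absolutely_integrable_on_def)
  have "int01 (%x. \<bar>?p' x\<bar>) <= int01 (%x. \<bar>deriv01 1 \<phi> x * \<psi> x\<bar> + \<bar>\<phi> x * deriv01 1 \<psi> x\<bar>)"
   by (rule integral_le[OF a integrable_add[OF a1 a2]]) (rule abs_triangle_ineq)
  also have "... = int01 (%x. \<bar>deriv01 1 \<phi> x * \<psi> x\<bar>) + int01 (%x. \<bar>\<phi> x * deriv01 1 \<psi> x\<bar>)"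
   by (rule Henstock_Kurzweil_Integration.integral_add[OF a1 a2])
  also have "... <= s1 * E / h + s1 * E / h" by (rule add_mono[OF i1 i2])
  also have "... = 2 * s1 * E / h" by simp
  finally have "h * int01 (%x. \<bar>?p' x\<bar>) <= 2 * s1 * E" using h by (simp add: field_simps)
  then have s: "int01 (%x. \<bar>?p x\<bar>) + h * int01 (%x. \<bar>?p' x\<bar>) <= (1 + 2 * s1) * E" using i0 by (simp add: algebra_simps)
  have Bh: "0 <= B / h" using cell_discrepancy_nonneg[OF B] h by simp
  have P: "0 <= int01 (%x. \<bar>?p x\<bar>)"
   using cont[OF f(1)] cont[OF f(2)] by (intro integral_nonneg integrable_continuous_interval continuous_intros) auto
  have "\<bar>(SUM i=1..n. u i * ?p (x i)) - int01 (%x. q x * ?p x)\<bar> <=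
   2 * (B / h) * (int01 (%x. \<bar>?p x\<bar>) + h * int01 (%x. \<bar>?p' x\<bar>))"
   by (rule dyadic_weighted_discrepancy[OF x p' ftc q B h(1,3) P])
  also have "... <= 2 * (B / h) * ((1 + 2 * s1) * E)" using s Bh by (intro mult_left_mono) auto
  finally show "\<bar>(SUM i=1..n. u i * (\<phi> (x i) * \<psi> (x i))) - int01 (%x. q x * (\<phi> x * \<psi> x))\<bar> <= 2 * (1 + 2 * s1) * (B / h) * (sqrt (energy01 m h \<phi>) * sqrt (energy01 m h \<psi>))"
   by (simp add: E_def mult_ac)
 next
  fix x u :: "nat => real" and h B :: real and n l :: nat and \<psi> :: "real => real"
  assume x: "!!i. i \<in> {1..n} ==> x i \<in> {0<..<1}" and f: "\<psi> \<in> sobolev2 m"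
   and B: "cell_discrepancy n x u (%_. 0) l B" and h: "0 < h" "h <= 1" "h < 2 * (1/2) ^ l"
  define E where "E = sqrt (energy01 m h \<psi>)"
  have one: "square_integrable01 (%x. 1)" "int01 (%x::real. (1::real)^2) <= 1"
   by (rule square_integrable01_continuous) (simp_all add: continuous_intros)
  have i0: "int01 (%x. \<bar>\<psi> x\<bar>) <= E"
   using sobolev2_abs_product_le[OF sq0[OF f] one(1) e0[OF f h(1)] one(2)] by (simp add: E_def)
  have i1: "int01 (%x. \<bar>deriv01 1 \<psi> x\<bar>) <= s1 * E / h"
   using sobolev2_abs_product_le[OF sq1[OF f] one(1) d_le[OF f h(1,2)] one(2)] unfolding sd[OF h(1)] by (simp add: E_def)
  have s: "int01 (%x. \<bar>\<psi> x\<bar>) + h * int01 (%x. \<bar>deriv01 1 \<psi> x\<bar>) <= (1 + 2 * s1) * E"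
  proof -
   have "h * int01 (%x. \<bar>deriv01 1 \<psi> x\<bar>) <= s1 * E" using i1 h by (simp add: field_simps)
   moreover have "0 <= s1 * E" using s1 energy01_nonneg[OF f, of h] h by (simp add: E_def)
   ultimately show ?thesis using i0 by (simp add: algebra_simps)
  qed
  have Bh: "0 <= B / h" using cell_discrepancy_nonneg[OF B] h by simp
  have P: "0 <= int01 (%x. \<bar>\<psi> x\<bar>)"
   using cont[OF f] by (intro integral_nonneg integrable_continuous_interval continuous_intros) auto
  have "\<bar>(SUM i=1..n. u i * \<psi> (x i)) - int01 (%x. 0 * \<psi> x)\<bar> <=
   2 * (B / h) * (int01 (%x. \<bar>\<psi> x\<bar>) + h * int01 (%x. \<bar>deriv01 1 \<psi> x\<bar>))"
  proof (rule dyadic_weighted_discrepancy[OF x square_integrable01_abs_int[OF sq1[OF f]] _ _ _ B h(1,3) P])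
   show "(deriv01 1 \<psi> has_integral \<psi> b - \<psi> a) {a..b}" if "0 <= a" "a <= b" "b <= 1" for a b
    using sobolev2_has_integral[OF f, of 0 a b] m that by simp
  qed auto
  also have "... <= 2 * (B / h) * ((1 + 2 * s1) * E)" using s Bh by (intro mult_left_mono) auto
  finally show "\<bar>SUM i=1..n. u i * \<psi> (x i)\<bar> <= 2 * (1 + 2 * s1) * (B / h) * sqrt (energy01 m h \<psi>)"
   by (simp add: E_def mult_ac)
 qed
qed

lemma sobolev2_weighted_product:
 assumes m: "m >= 1" and f: "f \<in> sobolev2 m" "g \<in> sobolev2 m"
  and w: "w \<in> borel_measurable leb01" "!!x. x \<in> {0..1} ==> \<bar>w x\<bar> <= K"
 shows "(%t. f t * g t * w t) absolutely_integrable_on {0..1}"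
proof -
 have fg: "(%t. f t * g t) absolutely_integrable_on {0..1}"
  using square_integrable01_product sobolev2_square_integrable[OF f(1), of 0] sobolev2_square_integrable[OF f(2), of 0] by simp
 have "(%t. w t * (f t * g t)) absolutely_integrable_on {0..1}"
  by (rule absolutely_integrable_bounded_measurable_product_real[OF w(1) _ _ fg]) (use w(2) in \<open>auto simp: bounded_iff intro!: exI[of _ K]\<close>)
 then show ?thesis by (simp add: mult_ac)
qed

lemma inner_wmh_eq:
 assumes m: "m >= 1" and f: "f \<in> sobolev2 m" "g \<in> sobolev2 m"
  and w: "w \<in> borel_measurable leb01" "!!x. x \<in> {0..1} ==> \<bar>w x\<bar> <= K"
 shows "inner_wmh w m h f g = int01 (%t. w t * (f t * g t)) + h ^ (2 * m) * int01 (%t. deriv01 m f t * deriv01 m g t)"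
proof -
 have 1: "(%t. f t * g t * w t) absolutely_integrable_on {0..1}" by (rule sobolev2_weighted_product[OF m f w])
 have 2: "(%t. deriv01 m f t * deriv01 m g t) absolutely_integrable_on {0..1}"
  using square_integrable01_product sobolev2_square_integrable[OF f(1), of m] sobolev2_square_integrable[OF f(2), of m] by simp
 have c: "(LINT t|leb01. F t) = integral {0..1} F" if "F absolutely_integrable_on {0..1}" for F :: "real => real"
  using that by (intro lebesgue_integral_eq_integral) (auto simp: integrable_restrict_space set_integrable_def)
 show ?thesis unfolding inner_wmh_def c[OF 1] c[OF 2] by (simp add: mult_ac)
qed

lemma energy01_le_inner_wmh:
 assumes m: "m >= 1" and f: "f \<in> sobolev2 m" and h: "0 < h"
  and w: "w \<in> borel_measurable leb01" "!!x. x \<in> {0..1} ==> w1 <= w x & w x <= w2" "0 < w1"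
 shows "min w1 1 * energy01 m h f <= inner_wmh w m h f f"
proof -
 have wb: "\<bar>w x\<bar> <= w2" if "x \<in> {0..1}" for x using w(2)[OF that] w(3) by linarith
 have i1: "(%t. w t * (f t * f t)) integrable_on {0..1}"
  using sobolev2_weighted_product[OF m f f w(1) wb] by (simp add: mult_ac absolutely_integrable_on_def)
 have s0: "(%t. (f t)^2) integrable_on {0..1}" "(%t. (deriv01 m f t)^2) integrable_on {0..1}"
  using sobolev2_square_integrable[OF f, of 0] sobolev2_square_integrable[OF f, of m] by (simp_all add: square_integrable01_def)
 have "min w1 1 * int01 (%t. (f t)^2) = int01 (%t. min w1 1 * (f t)^2)" by simp
 also have "... <= int01 (%t. w t * (f t * f t))"
 proof (rule integral_le[OF _ i1])
  show "(%t. min w1 1 * (f t)^2) integrable_on {0..1}" using integrable_cmul[OF s0(1), of "min w1 1"] by simp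
  fix t :: real assume "t \<in> {0..1}"
  then have "min w1 1 <= w t" using w(2) by force
  then show "min w1 1 * (f t)^2 <= w t * (f t * f t)" unfolding power2_eq_square by (rule mult_right_mono) simp
 qed
 finally have 1: "min w1 1 * int01 (%t. (f t)^2) <= int01 (%t. w t * (f t * f t))" .
 have "0 <= dnorm2 m f" by (rule integral_nonneg[OF s0(2)]) simp
 then have "0 <= h ^ (2 * m) * dnorm2 m f" using h by simp
 then have 2: "min w1 1 * (h ^ (2 * m) * dnorm2 m f) <= 1 * (h ^ (2 * m) * dnorm2 m f)"
  by (intro mult_right_mono) auto
 have "inner_wmh w m h f f = int01 (%t. w t * (f t * f t)) + h ^ (2 * m) * dnorm2 m f"
  unfolding power2_eq_square by (rule inner_wmh_eq[OF m f f w(1) wb])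
 then show ?thesis using 1 2 unfolding energy01_def distrib_left by linarith
qed

text \<open>Purely deterministic: the sample enters through the two discrepancies of size h \<eta>.
  The threshold \<open>c\<close> brings the design average of a squared function so close to its
  integral against w that the empirical quadratic form remains coercive.\<close>

theorem spline_error_bound:
 fixes m :: nat and w :: "real => real" and w1 w2 :: real
 assumes m: "m >= 1"
  and w: "w \<in> borel_measurable leb01" "!!x. x \<in> {0..1} ==> w1 <= w x & w x <= w2" "0 < w1"
 obtains C c where "C > 0" "c > 0"
  "!!n h l x d R \<eta> t. n > 0 ==> (!!i. i \<in> {1..n} ==> x i \<in> {0<..<1}) ==> unisolvent m n x ==>
   0 < h ==> h <= 1 ==> h < 2 * (1/2) ^ l ==> reproducing_kernel_wmh w m h R ==>
   cell_discrepancy n x (%_. 1 / real n) w l (h * \<eta>) ==> cell_discrepancy n x (%i. d i / real n) (%_. 0) l (h * \<eta>) ==> \<eta> <= c ==> t \<in> {0..1} ==>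
   \<bar>(SUM i=1..n. smoother_weight m n h x i t * d i) - 1 / real n * (SUM i=1..n. d i * R (x i) t)\<bar> <= C * \<eta>^2 / sqrt h"
proof -
 obtain A where A: "A >= 1"
  "!!(x::nat => real) u q K n h l B \<phi> \<psi>. (!!i. i \<in> {1..n} ==> x i \<in> {0<..<1}) ==> \<phi> \<in> sobolev2 m ==> \<psi> \<in> sobolev2 m ==>
   q \<in> borel_measurable leb01 ==> (!!x. x \<in> {0..1} ==> \<bar>q x\<bar> <= K) ==> cell_discrepancy n x u q l B ==>
   0 < h ==> h <= 1 ==> h < 2 * (1/2) ^ l ==>
   \<bar>(SUM i=1..n. u i * (\<phi> (x i) * \<psi> (x i))) - int01 (%x. q x * (\<phi> x * \<psi> x))\<bar> <= A * (B / h) * (sqrt (energy01 m h \<phi>) * sqrt (energy01 m h \<psi>))"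
  "!!(x::nat => real) u n h l B \<psi>. (!!i. i \<in> {1..n} ==> x i \<in> {0<..<1}) ==> \<psi> \<in> sobolev2 m ==> cell_discrepancy n x u (%_. 0) l B ==>
   0 < h ==> h <= 1 ==> h < 2 * (1/2) ^ l ==>
   \<bar>SUM i=1..n. u i * \<psi> (x i)\<bar> <= A * (B / h) * sqrt (energy01 m h \<psi>)"
  using sobolev2_discrepancy[OF m] by blast
 obtain C2 where C2: "C2 >= 1" "!!f h t. f \<in> sobolev2 m ==> 0 < h ==> h <= 1 ==> t \<in> {0..1} ==> (f t)^2 <= C2 / h * energy01 m h f"
  using sobolev2_pointwise_bound[OF m] by blast
 define b where "b = min w1 1"
 have b: "0 < b" using w(3) by (simp add: b_def)
 have wb: "\<bar>w x\<bar> <= w2" if "x \<in> {0..1}" for x using w(2)[OF that] w(3) by linarith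
 define C where "C = A * (2 * A / b) * (sqrt C2 / b)"
 define c where "c = b / (2 * A)"
 show ?thesis
 proof (rule that[of C c])
  show "C > 0" unfolding C_def using A(1) b C2(1) by simp
  show "c > 0" unfolding c_def using A(1) b by simp
  fix n l :: nat and h \<eta> t :: real and x d :: "nat => real" and R :: "real => real => real"
  assume n: "n > 0" and x: "!!i. i \<in> {1..n} ==> x i \<in> {0<..<1}" and u: "unisolvent m n x"
   and h: "0 < h" "h <= 1" "h < 2 * (1/2) ^ l" and R: "reproducing_kernel_wmh w m h R"
   and Dw: "cell_discrepancy n x (%_. 1 / real n) w l (h * \<eta>)" and Dd: "cell_discrepancy n x (%i. d i / real n) (%_. 0) l (h * \<eta>)"
   and \<eta>: "\<eta> <= c" and t: "t \<in> {0..1}"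
  have \<eta>0: "0 <= \<eta>" using cell_discrepancy_nonneg[OF Dw] h by (simp add: zero_le_mult_iff)
  define \<phi> where "\<phi> = natspline m n x (spline_solution m n h x d) (%i. spline_solution m n h x d (m + i - 1))"
  have sol: "natspline_solves m n h x d (spline_solution m n h x d) (%i. spline_solution m n h x d (m + i - 1))"
   by (rule spline_solution_solves[OF m h(1) n u])
  have \<phi>: "\<phi> \<in> sobolev2 m" unfolding \<phi>_def by (rule natspline_sobolev2[OF m])
  have \<phi>t: "\<phi> s = (SUM i=1..n. smoother_weight m n h x i s * d i)" for s unfolding \<phi>_def by (rule natspline_solution)
  have ins: "inside_obs n x = {1..n}" using x by (force simp: inside_obs_def)
  have orth: "(SUM i=1..n. 1 / real n * (\<phi> (x i) * f (x i))) + h ^ (2 * m) * int01 (%t. deriv01 m \<phi> t * deriv01 m f t) = (SUM i=1..n. d i / real n * f (x i))"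
   if f: "f \<in> sobolev2 m" for f
  proof -
   have "1 / real n * (SUM i=1..n. (\<phi> (x i) - d i) * f (x i)) = (SUM i=1..n. 1 / real n * (\<phi> (x i) * f (x i))) - (SUM i=1..n. d i / real n * f (x i))"
    by (simp add: sum_distrib_left left_diff_distrib right_diff_distrib sum_subtractf)
   then show ?thesis using natspline_solves_orth[OF m sol f] unfolding ins \<phi>_def[symmetric] by linarith
  qed
  have prodb: "\<bar>(SUM i=1..n. 1 / real n * (f (x i) * g (x i))) - int01 (%x. w x * (f x * g x))\<bar> <= A * \<eta> * (sqrt (energy01 m h f) * sqrt (energy01 m h g))"
   if "f \<in> sobolev2 m" "g \<in> sobolev2 m" for f g
   using A(2)[OF x that w(1) wb Dw h] h(1) by simp
  have noiseb: "\<bar>SUM i=1..n. d i / real n * f (x i)\<bar> <= A * \<eta> * sqrt (energy01 m h f)" if "f \<in> sobolev2 m" for f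
   using A(3)[OF x that Dd h] h(1) by simp
  have inner: "inner_wmh w m h f g = int01 (%t. w t * (f t * g t)) + h ^ (2 * m) * int01 (%t. deriv01 m f t * deriv01 m g t)"
   if "f \<in> sobolev2 m" "g \<in> sobolev2 m" for f g
   by (rule inner_wmh_eq[OF m that w(1) wb])
  have coercive: "b * energy01 m h f <= inner_wmh w m h f f" if "f \<in> sobolev2 m" for f
   unfolding b_def by (rule energy01_le_inner_wmh[OF m that h(1) w])
  define e where "e = sqrt (energy01 m h \<phi>)"
  have e2: "energy01 m h \<phi> = e * e" and e0: "0 <= e" using energy01_nonneg[OF \<phi>, of h] h by (simp_all add: e_def)
  \<comment> \<open>Test the normal equations with the spline itself. The discrepancy of the design
    costs at most half of the coercivity constant and is absorbed; the noise term is linear in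
    \<open>e\<close>, so one factor \<open>e\<close> cancels.\<close>
  have e: "e <= 2 * A * \<eta> / b"
  proof -
   have "b * (e * e) <= int01 (%t. w t * (\<phi> t * \<phi> t)) + h ^ (2 * m) * int01 (%t. deriv01 m \<phi> t * deriv01 m \<phi> t)"
    using coercive[OF \<phi>] unfolding e2 inner[OF \<phi> \<phi>] .
   also have "... <= (SUM i=1..n. d i / real n * \<phi> (x i)) + A * \<eta> * (e * e)"
    using prodb[OF \<phi> \<phi>] orth[OF \<phi>] unfolding e_def[symmetric] by linarith
   also have "... <= A * \<eta> * e + A * \<eta> * (e * e)" using noiseb[OF \<phi>] unfolding e_def[symmetric] by linarith
   also have "A * \<eta> * (e * e) <= b / 2 * (e * e)"
   proof (rule mult_right_mono)
    have "A * \<eta> <= A * c" using \<eta> A(1) by (intro mult_left_mono) auto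
    then show "A * \<eta> <= b / 2" using A(1) by (simp add: c_def)
   qed simp
   finally have "b / 2 * e * e <= A * \<eta> * e" by (simp add: algebra_simps)
   then have "b / 2 * e <= A * \<eta>" using e0 A(1) \<eta>0 by (cases "e = 0") (auto simp: mult_le_cancel_right)
   then show ?thesis using b by (simp add: field_simps)
  qed
  have RT: "R s \<in> sobolev2 m" "!!f. f \<in> sobolev2 m ==> f s = inner_wmh w m h f (R s)" if "s \<in> {0..1}" for s
   using R that by (auto simp: reproducing_kernel_wmh_def)
  note Rt = RT[OF t]
  define r where "r = sqrt (energy01 m h (R t))"
  have r2: "energy01 m h (R t) = r * r" and r0: "0 <= r" using energy01_nonneg[OF Rt(1), of h] h by (simp_all add: r_def)
  \<comment> \<open>The energy of the kernel is bounded by its value on the diagonal, and this value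
    by the square root of the energy over h; again one factor cancels.\<close>
  have r: "r <= sqrt C2 / b / sqrt h"
  proof -
   have "b * (r * r) <= R t t"
    using coercive[OF Rt(1)] unfolding r2 Rt(2)[OF Rt(1), symmetric] .
   also have "... <= sqrt (C2 / h * (r * r))" using C2(2)[OF Rt(1) h(1,2) t] unfolding r2 by (rule real_le_rsqrt)
   also have "... = sqrt C2 / sqrt h * r" using r0 by (simp add: real_sqrt_mult real_sqrt_divide)
   finally have "b * r * r <= sqrt C2 / sqrt h * r" by (simp add: mult.assoc)
   then have "b * r <= sqrt C2 / sqrt h"
    using r0 C2(1) h mult_right_le_imp_le[of "b * r" r "sqrt C2 / sqrt h"] by (cases "r = 0") auto
   then have "r <= (sqrt C2 / sqrt h) / b" using b by (simp only: pos_le_divide_eq mult.commute)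
   then show ?thesis by (simp add: mult.commute)
  qed
  \<comment> \<open>The noise sum contains \<open>R (x i) t\<close>, whereas the normal equations
    are tested with \<open>R t\<close>.\<close>
  have sym: "R (x i) t = R t (x i)" if i: "i \<in> {1..n}" for i
  proof -
   have xi: "x i \<in> {0..1}" using x[OF i] by auto
   have "R (x i) t = inner_wmh w m h (R (x i)) (R t)" by (rule Rt(2)[OF RT(1)[OF xi]])
   also have "... = inner_wmh w m h (R t) (R (x i))" by (simp add: inner_wmh_def mult_ac)
   also have "... = R t (x i)" by (rule RT(2)[OF xi Rt(1), symmetric])
   finally show ?thesis .
  qed
  have S: "1 / real n * (SUM i=1..n. d i * R (x i) t) = (SUM i=1..n. d i / real n * R t (x i))"
   using sym by (simp add: sum_distrib_left)
  have "\<phi> t = int01 (%s. w s * (\<phi> s * R t s)) + h ^ (2 * m) * int01 (%s. deriv01 m \<phi> s * deriv01 m (R t) s)"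
   using Rt(2)[OF \<phi>] unfolding inner[OF \<phi> Rt(1)] .
  then have "\<bar>\<phi> t - 1 / real n * (SUM i=1..n. d i * R (x i) t)\<bar> <= A * \<eta> * (e * r)"
   using prodb[OF \<phi> Rt(1)] orth[OF Rt(1)] unfolding S e_def[symmetric] r_def[symmetric] by linarith
  also have "... <= A * \<eta> * ((2 * A * \<eta> / b) * (sqrt C2 / b / sqrt h))"
   using e r e0 r0 A(1) \<eta>0 b by (intro mult_left_mono mult_mono) auto
  also have "... = C * \<eta>^2 / sqrt h" by (simp add: C_def power2_eq_square mult_ac)
  finally show "\<bar>(SUM i=1..n. smoother_weight m n h x i t * d i) - 1 / real n * (SUM i=1..n. d i * R (x i) t)\<bar> <= C * \<eta>^2 / sqrt h"
   unfolding \<phi>t .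
 qed
qed

section \<open>Conditional means for all bandwidths and points at once\<close>

text \<open>Approximation from below, and by positive numbers for positive \<open>s\<close>, keeps
  the bandwidths in \<open>{0<..1}\<close> and the points in \<open>{0..1}\<close>.\<close>

lemma rational_sequence_below:
 fixes s :: real assumes s: "0 <= s"
 shows "\<exists>r. (\<forall>k. r k \<in> \<rat> & 0 <= r k & r k <= s & (0 < s --> 0 < r k)) & r \<longlonglongrightarrow> s"
proof (cases "s = 0")
 case True
 then show ?thesis by (intro exI[of _ "%_. 0"]) simp
next
 case False
 then have s0: "0 < s" using s by simp
 have "\<forall>k. \<exists>r\<in>\<rat>. s - s / real (Suc k) < r & r < s" by (intro allI Rats_dense_in_real) (use s0 in simp)
 then obtain r where r: "!!k. r k \<in> \<rat>" "!!k. s - s / real (Suc k) < r k" "!!k. r k < s" by metis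
 have pos: "0 < r k" for k
 proof -
  have "s / real (Suc k) <= s / 1" by (rule divide_left_mono) (use s0 in auto)
  then show ?thesis using r(2)[of k] by simp
 qed
 have "r \<longlonglongrightarrow> s"
 proof (rule tendsto_sandwich)
  show "(%k. s - s / real (Suc k)) \<longlonglongrightarrow> s" by real_asymp
  show "\<forall>\<^sub>F k in sequentially. s - s / real (Suc k) <= r k" "\<forall>\<^sub>F k in sequentially. r k <= s"
   using r(2,3) by (simp_all add: less_imp_le)
 qed simp
 then show ?thesis using r pos by (intro exI[of _ r]) (simp add: less_imp_le)
qed

lemma continuous_eq_if_eq_on_rationals:
 fixes f g :: "real \<times> real => real"
 assumes f: "continuous_on ({0<..1} \<times> {0..1}) f" and g: "continuous_on ({0<..1} \<times> {0..1}) g"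
  and eq: "!!h t. h \<in> {0<..1} Int \<rat> ==> t \<in> {0..1} Int \<rat> ==> f (h, t) = g (h, t)"
  and ht: "h \<in> {0<..1}" "t \<in> {0..1}"
 shows "f (h, t) = g (h, t)"
proof -
 obtain a where a: "!!k. a k \<in> \<rat>" "!!k. 0 < a k" "!!k. a k <= h" "a \<longlonglongrightarrow> h"
  using rational_sequence_below[of h] ht by auto
 obtain b where b: "!!k. b k \<in> \<rat>" "!!k. 0 <= b k" "!!k. b k <= t" "b \<longlonglongrightarrow> t"
  using rational_sequence_below[of t] ht by auto
 have m: "(a k, b k) \<in> {0<..1} \<times> {0..1}" for k using a(2,3)[of k] b(2,3)[of k] ht by auto
 have l: "(%k. (a k, b k)) \<longlonglongrightarrow> (h, t)" by (rule tendsto_Pair[OF a(4) b(4)])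
 have "(%k. F (a k, b k)) \<longlonglongrightarrow> F (h, t)" if "continuous_on ({0<..1} \<times> {0..1}) F" for F :: "real \<times> real => real"
  by (rule continuous_on_tendsto_compose[OF that l]) (use ht m in auto)
 then have "(%k. f (a k, b k)) \<longlonglongrightarrow> f (h, t)" "(%k. g (a k, b k)) \<longlonglongrightarrow> g (h, t)" using f g by auto
 moreover have "f (a k, b k) = g (a k, b k)" for k using eq a(1) b(1) m[of k] by auto
 ultimately show ?thesis by (simp add: LIMSEQ_unique)
qed

lemma dyadic_scale:
 fixes h :: real assumes "0 < h" "h < 1"
 obtains l :: nat where "(1/2) ^ l <= h" "h < 2 * (1/2) ^ l"
proof -
 define l where "l = (LEAST l. (1/2::real) ^ l <= h)"
 have ex: "\<exists>l. (1/2::real) ^ l <= h" using real_arch_pow_inv[of h "1/2"] assms by (auto intro: less_imp_le)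
 have l: "(1/2) ^ l <= h" unfolding l_def by (rule LeastI_ex[OF ex])
 then have "l ~= 0" using assms by (cases l) auto
 then obtain k where k: "l = Suc k" by (cases l) auto
 have "\<not> (1/2) ^ k <= h" using not_less_Least[of k "%l. (1/2::real) ^ l <= h"] k unfolding l_def by simp
 then show ?thesis using that[of l] l by (simp add: k)
qed

context regression_sample
begin

lemma smoothing_spline_AE:
 "AE z in M. \<forall>m n h t. 1 <= m --> m <= n --> 0 < h --> t \<in> {0..1} -->
  smoothing_spline m n h (%i. Xs i z) (%i. Ys i z) t = (SUM i=1..n. smoother_weight m n h (%i. Xs i z) i t * Ys i z)"
 using AE_design
proof eventually_elim
 case (elim z)
 have "outside_fit n (%i. Xs i z) (%i. Ys i z)" for n
  using elim unfolding outside_fit_def by (auto simp: less_imp_le)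
 then show ?case by (auto simp: smoothing_spline_eq)
qed

lemma measurable_smoothing_spline:
 assumes "1 <= m" "m <= n" "0 < h" "t \<in> {0..1}"
 shows "(%z. smoothing_spline m n h (%i. Xs i z) (%i. Ys i z) t) \<in> borel_measurable M"
proof -
 have n: "n > 0" using assms by simp
 have [measurable]: "Measurable.pred M (%z. outside_fit n (%i. Xs i z) (%i. Ys i z))"
  by (rule measurable_outside_fit) (use measurable_Xs measurable_Ys in auto)
 have [measurable]: "(%z. SUM i=1..n. smoother_weight m n h (%i. Xs i z) i t * Ys i z) \<in> borel_measurable M"
  by (intro borel_measurable_sum borel_measurable_times measurable_smoother_weight measurable_Ys measurable_Xs) auto
 show ?thesis unfolding smoothing_spline_eq[OF assms(1,3) n assms(4)] by measurable
qed

text \<open>Almost surely the estimator is the smoother applied to the noise plus a function of the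
  design. The weights are only known to be measurable in the design, hence the localized form of
  linearity.\<close>

lemma cond_exp_smoothing_spline:
 assumes m: "1 <= m" "m <= n" and h: "0 < h" and t: "t \<in> {0..1}"
 shows "AE z in M. real_cond_exp M (design_algebra M Xs n) (%z. smoothing_spline m n h (%i. Xs i z) (%i. Ys i z) t) z
  = (SUM i=1..n. smoother_weight m n h (%i. Xs i z) i t * fo (Xs i z))"
proof -
 let ?F = "design_algebra M Xs n"
 interpret F: finite_measure_subalgebra M ?F by (rule subalgebra_design)
 define a where "a i z = smoother_weight m n h (%i. Xs i z) i t" for i z
 define g where "g z = (SUM i=1..n. a i z * fo (Xs i z))" for z
 let ?D = "%i z. noise_at i z"
 let ?f = "%z. (SUM i:{1..n}. a i z * ?D i z) + g z"
 have a: "a i \<in> borel_measurable ?F" if "i \<in> {1..n}" for i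
  unfolding a_def by (rule measurable_smoother_weight[OF measurable_design that])
 have g: "g \<in> borel_measurable ?F" unfolding g_def
  by (intro borel_measurable_sum borel_measurable_times a measurable_compose[OF measurable_design measurable_fo])
 have toM: "u \<in> borel_measurable M" if "u \<in> borel_measurable ?F" for u :: "'a => real" by (rule measurable_from_subalg[OF F.subalg that])
 have fM: "?f \<in> borel_measurable M"
  by (intro borel_measurable_add borel_measurable_sum borel_measurable_times toM[OF a] toM[OF g] borel_measurable_integrable[OF integrable_noise_i]) auto
 have feq: "?f z = (SUM i=1..n. a i z * Ys i z)" for z
  unfolding g_def by (simp add: noise_def right_diff_distrib sum_subtractf)
 have "AE z in M. smoothing_spline m n h (%i. Xs i z) (%i. Ys i z) t = ?f z"
  using smoothing_spline_AE
 proof eventually_elim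
  case (elim z)
  show ?case unfolding feq unfolding a_def using elim m h t by blast
 qed
 from F.real_cond_exp_cong[OF this measurable_smoothing_spline[OF m h t] fM]
 have 1: "AE z in M. real_cond_exp M ?F (%z. smoothing_spline m n h (%i. Xs i z) (%i. Ys i z) t) z = real_cond_exp M ?F ?f z" .
 have 2: "AE z in M. real_cond_exp M ?F ?f z = (SUM i:{1..n}. a i z * real_cond_exp M ?F (?D i) z) + g z"
  by (rule F.real_cond_exp_linear) (use integrable_noise_i a g in auto)
 have 3: "AE z in M. \<forall>i\<in>{1..n}. real_cond_exp M ?F (?D i) z = 0"
  by (rule AE_finite_allI) (use noise_design_centered in auto)
 from 1 2 3 show ?thesis
 proof eventually_elim
  case (elim z)
  have "(SUM i:{1..n}. a i z * real_cond_exp M ?F (?D i) z) = 0" by (rule sum.neutral) (use elim(3) in auto)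
  then show ?case using elim(1,2) by (simp add: g_def a_def)
 qed
qed

text \<open>The null set of a conditional expectation depends on (h, t). The countably many rational
  pairs have a common null set, and off it continuity of both sides extends the identity; the
  right-hand side is continuous because a design of distinct points is unisolvent.\<close>

lemma cond_mean_spline_continuous_version:
 fixes Ef :: "nat => real => 'a => real => real"
 assumes m: "1 <= m"
  and Ef: "!!n h t. n >= m ==> 0 < h ==> h <= 1 ==> t \<in> {0..1} ==>
   AE e in M. Ef n h e t = real_cond_exp M (design_algebra M Xs n) (%e. smoothing_spline m n h (%i. Xs i e) (%i. Ys i e) t) e"
  and cont: "AE e in M. \<forall>n\<ge>m. continuous_on ({0<..1} \<times> {0..1}) (%(h, t). Ef n h e t)"
 shows "AE e in M. \<forall>n h t. m <= n --> 0 < h --> h <= 1 --> t \<in> {0..1} -->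
  Ef n h e t = (SUM i=1..n. smoother_weight m n h (%i. Xs i e) i t * fo (Xs i e))"
proof -
 let ?P = "%e n h t. Ef n h e t = (SUM i=1..n. smoother_weight m n h (%i. Xs i e) i t * fo (Xs i e))"
 have one: "AE e in M. ?P e n h t" if n: "n >= m" and h: "h \<in> {0<..1} Int \<rat>" and t: "t \<in> {0..1} Int \<rat>" for n h t
 proof -
  have "AE e in M. Ef n h e t = real_cond_exp M (design_algebra M Xs n) (%e. smoothing_spline m n h (%i. Xs i e) (%i. Ys i e) t) e"
   by (rule Ef) (use n h t in auto)
  moreover have "AE e in M. real_cond_exp M (design_algebra M Xs n) (%e. smoothing_spline m n h (%i. Xs i e) (%i. Ys i e) t) e
  = (SUM i=1..n. smoother_weight m n h (%i. Xs i e) i t * fo (Xs i e))"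
   by (rule cond_exp_smoothing_spline[OF m n]) (use h t in auto)
  ultimately show ?thesis by eventually_elim simp
 qed
 have cr: "countable (A Int \<rat>)" for A :: "real set" by (rule countable_Int2[OF countable_rat])
 have "AE e in M. \<forall>n\<in>{m..}. \<forall>h\<in>{0<..1} Int \<rat>. \<forall>t\<in>{0..1} Int \<rat>. ?P e n h t"
  by (simp only: AE_ball_countable[OF cr] AE_ball_countable[OF countableI_type] ball_simps) (use one in blast)
 from this cont AE_design show ?thesis
 proof eventually_elim
  case (elim e)
  show ?case
  proof (intro allI impI)
   fix n h t assume n: "m <= n" and h: "0 < h" "h <= (1::real)" and t: "t \<in> {0..1::real}"
   have u: "unisolvent m n (%i. Xs i e)"
    using elim(3) n by (intro unisolvent_if_distinct) (auto simp: less_imp_le)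
   have n0: "n > 0" using m n by simp
   let ?g = "%(h, t). SUM i=1..n. smoother_weight m n h (%i. Xs i e) i t * fo (Xs i e)"
   have "continuous_on ({0<..1} \<times> {0..1}) (%z. SUM i=1..n. (case z of (h, t) => smoother_weight m n h (%i. Xs i e) i t) * fo (Xs i e))"
    by (intro continuous_on_sum continuous_on_mult continuous_on_const continuous_on_subset[OF continuous_on_smoother_weight[OF m n0 u]]) auto
   then have cg: "continuous_on ({0<..1} \<times> {0..1}) ?g" by (simp add: case_prod_beta)
   have cf: "continuous_on ({0<..1} \<times> {0..1}) (%(h, t). Ef n h e t)" using elim(2) n by blast
   have "(%(h, t). Ef n h e t) (h, t) = ?g (h, t)"
    by (rule continuous_eq_if_eq_on_rationals[OF cf cg]) (use elim(1) n h t in auto)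
   then show "?P e n h t" by simp
  qed
 qed
qed

section \<open>Discrepancies of the design and of the noise\<close>

lemma measurable_density: "(%x. indicator {0<..<1} x * w x) \<in> borel_measurable borel"
proof -
 have "(%x. ennreal (indicator {0<..<1} x * w x)) \<in> borel_measurable borel"
  using distributed_borel_measurable[OF density[of 1]] by simp
 then have "(%x. enn2real (ennreal (indicator {0<..<1} x * w x))) \<in> borel_measurable borel" by measurable
 moreover have "enn2real (ennreal (indicator {0<..<1} x * w x)) = indicator {0<..<1} x * w x" for x
  using w_bounds[of x] w_pos by (auto simp: indicator_def)
 ultimately show ?thesis by simp
qed

lemma measurable_w: "w \<in> borel_measurable leb01"
proof -
 \<comment> \<open>The density determines \<open>w\<close> on the open interval only, so the two end
   points are added separately.\<close>
 let ?u = "%x. indicator {0<..<1} x * w x + (if x = 0 then w 0 else 0) + (if x = 1 then w 1 else 0)"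
 have "?u \<in> borel_measurable borel" using measurable_density by measurable
 then have "?u \<in> borel_measurable leb01" by (intro measurable_restrict_space1 measurable_completion) simp
 moreover have "?u x = w x" if "x \<in> space leb01" for x using that by (auto simp: indicator_def)
 ultimately show ?thesis by (rule measurable_cong[THEN iffD1, rotated])
qed

lemma prob_Xs_interval_eq:
 assumes ab: "0 <= a" "a <= b" "b <= 1"
 shows "prob {z\<in>space M. Xs 1 z \<in> {a<..b}} = integral {a..b} w"
proof -
 let ?w = "%x. indicator {0<..<1} x * w x"
 have w0: "0 <= ?w x" "?w x <= w2" for x using w_bounds[of x] w_pos by (auto simp: indicator_def)
 have si: "set_integrable lborel {a..b} ?w"
  unfolding set_integrable_def
 proof (rule Bochner_Integration.integrable_bound[where f="%x. indicator {a..b} x *\<^sub>R w2"])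
  have "integrable lborel (indicator {a..b} :: real => real)" by (rule integrable_real_indicator) (use ab in auto)
  then show "integrable lborel (%x. indicator {a..b} x *\<^sub>R w2)" by simp
  show "(%x. indicator {a..b} x *\<^sub>R ?w x) \<in> borel_measurable lborel" using measurable_density by simp
  show "AE x in lborel. norm (indicator {a..b} x *\<^sub>R ?w x) <= norm (indicator {a..b} x *\<^sub>R w2)"
  proof (rule AE_I2)
   fix x show "norm (indicator {a..b} x *\<^sub>R ?w x) <= norm (indicator {a..b} x *\<^sub>R w2)"
    unfolding norm_scaleR using w0[of x] by (intro mult_left_mono) (unfold real_norm_def, linarith, simp)
  qed
 qed
 have "emeasure M {z\<in>space M. Xs 1 z \<in> {a<..b}} = (\<integral>\<^sup>+ x. ennreal (?w x) * indicator {a<..b} x \<partial>lborel)"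
  by (rule emeasure_Xs) auto
 also have "... = (\<integral>\<^sup>+ x. ennreal (indicator {a..b} x *\<^sub>R ?w x) \<partial>lborel)"
 proof (rule nn_integral_cong_AE)
  show "AE x in lborel. ennreal (?w x) * indicator {a<..b} x = ennreal (indicator {a..b} x *\<^sub>R ?w x)"
   using AE_lborel_singleton[of a] by eventually_elim (auto simp: indicator_def)
 qed
 also have "... = ennreal (\<integral>x. indicator {a..b} x *\<^sub>R ?w x \<partial>lborel)"
  by (rule nn_integral_eq_integral) (use si w0 in \<open>auto simp: set_integrable_def\<close>)
 also have J: "(\<integral>x. indicator {a..b} x *\<^sub>R ?w x \<partial>lborel) = integral {a..b} ?w"
  using set_borel_integral_eq_integral(2)[OF si] by (simp add: set_lebesgue_integral_def)
 also have J2: "integral {a..b} ?w = integral {a..b} w"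
  by (rule integral_spike[of "{0, 1}"]) (use ab in \<open>auto simp: indicator_def\<close>)
 finally have e: "emeasure M {z\<in>space M. Xs 1 z \<in> {a<..b}} = ennreal (integral {a..b} w)" .
 have "0 <= integral {a..b} w"
  unfolding J2[symmetric] J[symmetric] by (rule Bochner_Integration.integral_nonneg) (use w0 in simp)
 then show ?thesis using e by (simp add: emeasure_eq_measure)
qed

lemma weighted_deviation:
 assumes G: "G \<in> borel_measurable borel" "!!z. 0 <= G z" "!!z. G z powr \<kappa> <= c + \<bar>noise z\<bar> powr \<kappa>" and c: "0 <= c" and \<gamma>: "0 < \<gamma>"
 shows "\<exists>C>0. cell_rate \<kappa> \<gamma> Xs (%i e. G (Xs i e, Ys i e)) C"
 "!!a b. integrable M (%e. G (Xs 1 e, Ys 1 e) * indicator {a<..b} (Xs 1 e))"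
proof -
 obtain K where "iid_marks M Xs (%i e. G (Xs i e, Ys i e)) \<kappa> K" using iid_marks_compose[OF G c] by blast
 then interpret iid: iid_marks M Xs "%i e. G (Xs i e, Ys i e)" \<kappa> K .
 show "\<exists>C>0. cell_rate \<kappa> \<gamma> Xs (%i e. G (Xs i e, Ys i e)) C"
  by (rule iid.interval_deviation[OF \<gamma>])
 show "integrable M (%e. G (Xs 1 e, Ys 1 e) * indicator {a<..b} (Xs 1 e))" for a b by (rule iid.integrable_U_cell)
qed

text \<open>The rate is applied to the marks 1 and to the two parts of the noise. These parts have
  equal means on every interval because the noise is centred there, so the means cancel in the
  difference.\<close>

lemma cell_discrepancies:
 assumes \<gamma>: "0 < \<gamma>"
 shows "\<exists>C>0. AE y in M. \<forall>\<^sub>F n in sequentially. \<forall>h\<in>bandwidths \<kappa> \<gamma> n. \<forall>l.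
  (1/2) ^ l <= h --> h < 2 * (1/2) ^ l -->
  (let B = h * (C * sqrt (max (ln (1 / h)) (ln (ln (real n))) / (real n * h))) in
   cell_discrepancy n (%i. Xs i y) (%_. 1 / real n) w l B &
   cell_discrepancy n (%i. Xs i y) (%i. noise_at i y / real n) (%_. 0) l B)"
proof -
 have mp: "(%z. max 0 (noise z)) \<in> borel_measurable borel" and mn: "(%z. max 0 (- noise z)) \<in> borel_measurable borel"
  using measurable_noise by simp_all
 have bp: "max 0 (noise z) powr \<kappa> <= 0 + \<bar>noise z\<bar> powr \<kappa>" and bn: "max 0 (- noise z) powr \<kappa> <= 0 + \<bar>noise z\<bar> powr \<kappa>" for z
  using \<kappa> by (auto intro!: powr_mono2)
 obtain C1 where C1: "0 < C1" and A1: "cell_rate \<kappa> \<gamma> Xs (%i y. 1) C1"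
  using weighted_deviation(1)[of "%_. 1" 1 \<gamma>] \<gamma> by auto
 obtain CP where CP: "0 < CP" and AP: "cell_rate \<kappa> \<gamma> Xs (%i y. max 0 (noise_at i y)) CP"
  using weighted_deviation(1)[OF mp max.cobounded1 bp order_refl \<gamma>] by blast
 obtain CN where CN: "0 < CN" and AN: "cell_rate \<kappa> \<gamma> Xs (%i y. max 0 (- noise_at i y)) CN"
  using weighted_deviation(1)[OF mn max.cobounded1 bn order_refl \<gamma>] by blast
 have parts: "max 0 u - max 0 (- u) = u" for u :: real by (simp add: max_def)
 have parts': "max 0 u * i - max 0 (- u) * i = i * u" for u i :: real by (simp add: max_def)
 have centered: "expectation (%y. max 0 (noise_at 1 y) * indicator {a<..s} (Xs 1 y)) =
   expectation (%y. max 0 (- noise_at 1 y) * indicator {a<..s} (Xs 1 y))" for a s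
 proof -
  have "expectation (%y. max 0 (noise_at 1 y) * indicator {a<..s} (Xs 1 y)) -
   expectation (%y. max 0 (- noise_at 1 y) * indicator {a<..s} (Xs 1 y)) =
   expectation (%y. indicator {a<..s} (Xs 1 y) * noise_at 1 y)"
   (is "expectation ?P - expectation ?N = expectation ?D")
  proof -
   have "expectation ?P - expectation ?N = expectation (%y. ?P y - ?N y)"
    by (rule Bochner_Integration.integral_diff[symmetric])
     (rule weighted_deviation(2)[OF mp max.cobounded1 bp order_refl \<gamma>], rule weighted_deviation(2)[OF mn max.cobounded1 bn order_refl \<gamma>])
   also have "(%y. ?P y - ?N y) = ?D" by (simp only: parts')
   finally show ?thesis .
  qed
  also have "... = 0" by (rule noise_centered) auto
  finally show ?thesis by simp
 qed
 have mean: "expectation (%y. (1::real) * indicator {a<..s} (Xs 1 y)) = integral {a..s} w" if "0 <= a" "a <= s" "s <= 1" for a s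
 proof -
  have m: "{y\<in>space M. Xs 1 y \<in> {a<..s}} \<in> events" using measurable_Xs[of 1] by measurable
  have "expectation (%y. (1::real) * indicator {a<..s} (Xs 1 y)) = expectation (indicator {y\<in>space M. Xs 1 y \<in> {a<..s}})"
   by (rule Bochner_Integration.integral_cong) (auto simp: indicator_def)
  also have "... = prob {y\<in>space M. Xs 1 y \<in> {a<..s}}" using m by simp
  finally show ?thesis unfolding prob_Xs_interval_eq[OF that] .
 qed
 define C where "C = C1 + CP + CN"
 have C0: "0 < C" using C1 CP CN by (simp add: C_def)
 have ev2: "\<forall>\<^sub>F n in sequentially. (2::nat) <= n" by (rule eventually_ge_at_top)
 have "AE y in M. \<forall>\<^sub>F n in sequentially. \<forall>h\<in>bandwidths \<kappa> \<gamma> n. \<forall>l.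
  (1/2) ^ l <= h --> h < 2 * (1/2) ^ l -->
  (let B = h * (C * sqrt (max (ln (1 / h)) (ln (ln (real n))) / (real n * h))) in
   cell_discrepancy n (%i. Xs i y) (%_. 1 / real n) w l B &
   cell_discrepancy n (%i. Xs i y) (%i. noise_at i y / real n) (%_. 0) l B)"
  using A1[unfolded cell_rate_def] AP[unfolded cell_rate_def] AN[unfolded cell_rate_def]
 proof eventually_elim
  case (elim y)
  from elim ev2 show ?case
  proof eventually_elim
   case (elim n)
   note D = elim
   show ?case
   proof (intro ballI allI impI)
    fix h :: real and l :: nat
    assume h: "h \<in> bandwidths \<kappa> \<gamma> n" and l: "(1/2) ^ l <= h" "h < 2 * (1/2) ^ l"
    have h0: "0 < h" using l(1) by (smt (verit) zero_less_power half_gt_zero)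
    have n0: "0 < real n" using D(4) by simp
    define L where "L = max (ln (1 / h)) (ln (ln (real n)))"
    define r where "r = sqrt (L / (real n * h))"
    \<comment> \<open>Divided by n, the rate is h times sqrt (L / (n h)), the form in which
      \<open>spline_error_bound\<close> expects the discrepancies.\<close>
    have sq: "sqrt (real n * h * L) = real n * (h * r)"
    proof -
     have "real n * h * L = (real n * h)^2 * (L / (real n * h))" using n0 h0 by (simp add: power2_eq_square)
     then have "sqrt (real n * h * L) = sqrt ((real n * h)^2) * r" by (simp only: real_sqrt_mult r_def)
     then show ?thesis using n0 h0 by simp
    qed
    have "1 <= 1 / h" using h h0 by (simp add: bandwidths_def field_simps)
    then have "0 <= L" by (simp add: L_def le_max_iff_disj)
    then have r0: "0 <= h * r" using h0 n0 by (simp add: r_def)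
    define B where "B = h * (C * r)"
    have BC: "c * (h * r) <= B" if "c <= C" for c using mult_right_mono[OF that r0] by (simp add: B_def mult_ac)
    have scale: "\<bar>S - T\<bar> <= B" if "\<bar>real n * S - real n * T\<bar> <= c * (real n * (h * r))" "c <= C" for S T c
    proof -
     have "real n * \<bar>S - T\<bar> = \<bar>real n * S - real n * T\<bar>" by (simp add: abs_mult flip: right_diff_distrib)
     also have "... <= c * (real n * (h * r))" by (rule that(1))
     also have "... = real n * (c * (h * r))" by simp
     finally have "real n * \<bar>S - T\<bar> <= real n * (c * (h * r))" .
     then have "\<bar>S - T\<bar> <= c * (h * r)" using n0 by simp
     then show ?thesis using BC[OF that(2)] by linarith
    qed
    have cell1: "cell_discrepancy n (%i. Xs i y) (%_. 1 / real n) w l B"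
     unfolding cell_discrepancy_def
    proof (intro allI impI)
     fix p :: nat and s assume p: "p < 2 ^ l" and s: "real p / 2 ^ l <= s" "s <= (real p + 1) / 2 ^ l"
     have "real (Suc p) <= 2 ^ l" using p by (metis Suc_leI of_nat_le_iff of_nat_numeral of_nat_power)
     then have "(real p + 1) / 2 ^ l <= 1" by simp
     then have "s <= 1" using s by linarith
     note mean' = mean[OF _ s(1) this]
     have "real n * (SUM i=1..n. 1 / real n * indicator {real p / 2 ^ l<..s} (Xs i y)) = (SUM i=1..n. 1 * indicator {real p / 2 ^ l<..s} (Xs i y))"
      using n0 by (simp add: sum_distrib_left)
     then show "\<bar>(SUM i=1..n. 1 / real n * indicator {real p / 2 ^ l<..s} (Xs i y)) - integral {real p / 2 ^ l..s} w\<bar> <= B"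
      using D(1)[rule_format, OF h l p s] mean' CP CN unfolding L_def[symmetric] sq
      by (intro scale[of _ _ C1]) (simp_all add: C_def)
    qed
    have cell2: "cell_discrepancy n (%i. Xs i y) (%i. noise_at i y / real n) (%_. 0) l B"
     unfolding cell_discrepancy_def
    proof (intro allI impI)
     fix p :: nat and s assume p: "p < 2 ^ l" and s: "real p / 2 ^ l <= s" "s <= (real p + 1) / 2 ^ l"
     let ?i = "%i. indicator {real p / 2 ^ l<..s} (Xs i y) :: real"
     have "real n * (SUM i=1..n. noise_at i y / real n * ?i i) = (SUM i=1..n. noise_at i y * ?i i)"
      using n0 by (simp add: sum_distrib_left)
     also have "... = (SUM i=1..n. (max 0 (noise_at i y) - max 0 (- noise_at i y)) * ?i i)"
      unfolding parts ..
     also have "... = (SUM i=1..n. max 0 (noise_at i y) * ?i i) - (SUM i=1..n. max 0 (- noise_at i y) * ?i i)"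
      by (simp add: left_diff_distrib sum_subtractf)
     finally have e: "real n * (SUM i=1..n. noise_at i y / real n * ?i i) = ..." .
     have "\<bar>real n * (SUM i=1..n. noise_at i y / real n * ?i i) - real n * 0\<bar> <= (CP + CN) * (real n * (h * r))"
      unfolding e using D(2)[rule_format, OF h l p s, unfolded centered] D(3)[rule_format, OF h l p s]
      unfolding L_def[symmetric] sq distrib_right by linarith
     from scale[OF this] show "\<bar>(SUM i=1..n. noise_at i y / real n * ?i i) - integral {real p / 2 ^ l..s} (%_. 0)\<bar> <= B"
      using C1 by (simp add: C_def)
    qed
    show "let B = h * (C * sqrt (max (ln (1 / h)) (ln (ln (real n))) / (real n * h))) in
     cell_discrepancy n (%i. Xs i y) (%_. 1 / real n) w l B &
     cell_discrepancy n (%i. Xs i y) (%i. noise_at i y / real n) (%_. 0) l B"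
     using cell1 cell2 unfolding Let_def B_def r_def L_def by blast
   qed
  qed
 qed
 then show ?thesis using C0 by blast
qed

end

text \<open>Even at the lower end of the range the ratio is at most of order (log n /
  n)^(2/\<kappa>), which tends to 0. This brings \<eta> below the threshold of
  \<open>spline_error_bound\<close>, uniformly in the bandwidth.\<close>

lemma eventually_bandwidth_rate:
 fixes \<kappa> \<gamma> c :: real assumes \<kappa>: "2 < \<kappa>" and \<gamma>: "0 < \<gamma>" and c: "0 < c"
 shows "\<forall>\<^sub>F n in sequentially. \<forall>h\<in>bandwidths \<kappa> \<gamma> n. 0 < h & max (ln (1 / h)) (ln (ln (real n))) / (real n * h) <= c"
proof -
 define e where "e = 2 / \<kappa>"
 have e: "0 < e" "e < 1" using \<kappa> by (auto simp: e_def)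
 define c' where "c' = c * \<gamma> / 2"
 have c': "0 < c'" using c \<gamma> by (simp add: c'_def)
 have "((%n. (ln (real n) / real n) powr e) \<longlongrightarrow> 0) sequentially" using e(1) by real_asymp
 from order_tendstoD(2)[OF this c'] have 1: "\<forall>\<^sub>F n in sequentially. (ln (real n) / real n) powr e < c'" .
 have 2: "\<forall>\<^sub>F n::nat in sequentially. 1 <= ln (real n)" by real_asymp
 have 3: "\<forall>\<^sub>F n::nat in sequentially. - ln \<gamma> <= ln (real n)" by real_asymp
 from 1 2 3 eventually_ge_at_top[of 1] show ?thesis
 proof eventually_elim
  case (elim n)
  define y where "y = ln (real n) / real n"
  have n0: "0 < real n" using elim(4) by simp
  have ln1: "1 <= ln (real n)" using elim(2) .
  have y0: "0 < y" unfolding y_def by (rule divide_pos_pos) (use n0 ln1 in linarith)+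
  have y1: "y <= 1" unfolding y_def using n0 ln_le_minus_one[of "real n"] by simp
  show ?case
  proof
   fix h assume "h \<in> bandwidths \<kappa> \<gamma> n"
   then have h: "\<gamma> * y powr (1 - e) <= h" "h <= 1/2" by (auto simp: bandwidths_def e_def y_def)
   have hp: "0 < \<gamma> * y powr (1 - e)" using \<gamma> y0 by simp
   have h0: "0 < h" using h hp by linarith
   have "\<gamma> / real n <= \<gamma> * y powr 1" using \<gamma> n0 ln1 y0 by (simp add: y_def divide_right_mono)
   also have "... <= \<gamma> * y powr (1 - e)" using \<gamma> y0 y1 e by (intro mult_left_mono powr_mono') auto
   finally have "\<gamma> / real n <= h" using h(1) by linarith
   then have "1 / h <= real n / \<gamma>" using h0 \<gamma> n0 by (simp add: field_simps)
   then have "ln (1 / h) <= ln (real n / \<gamma>)" using h0 \<gamma> n0 by (subst ln_le_cancel_iff) auto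
   also have "... = ln (real n) - ln \<gamma>" using \<gamma> n0 by (intro ln_divide_pos) auto
   finally have l1: "ln (1 / h) <= 2 * ln (real n)" using elim(3) by linarith
   have l2: "ln (ln (real n)) <= 2 * ln (real n)" using ln_le_minus_one[of "ln (real n)"] ln1 by simp
   have nh: "real n * (\<gamma> * y powr (1 - e)) <= real n * h" using h(1) n0 by simp
   have "max (ln (1 / h)) (ln (ln (real n))) / (real n * h) <= 2 * ln (real n) / (real n * (\<gamma> * y powr (1 - e)))"
    by (rule frac_le) (use l1 l2 nh n0 hp ln1 in auto)
   also have "... = 2 / \<gamma> * (y / y powr (1 - e))" by (simp add: y_def)
   also have "y / y powr (1 - e) = y powr e" using y0 by (simp add: powr_diff)
   also have "2 / \<gamma> * y powr e <= 2 / \<gamma> * c'" using elim(1) \<gamma> by (intro mult_left_mono) (auto simp: y_def)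
   also have "... = c" using \<gamma> by (simp add: c'_def)
   finally show "0 < h & max (ln (1 / h)) (ln (ln (real n))) / (real n * h) <= c" using h0 by simp
  qed
 qed
qed

theorem theorem1:
  fixes M :: "'a measure"
    and X Y :: "'a \<Rightarrow> real"
    and Xs Ys :: "nat \<Rightarrow> 'a \<Rightarrow> real"
    and f\<^sub>o v w :: "real \<Rightarrow> real"
    and R :: "real \<Rightarrow> real \<Rightarrow> real \<Rightarrow> real"
    and fhat Ef \<epsilon> :: "nat \<Rightarrow> real \<Rightarrow> 'a \<Rightarrow> real \<Rightarrow> real"
    and m :: nat
    and w1 w2 \<kappa> \<gamma> :: real
  assumes m: "m \<ge> 1"
    and M: "prob_space M"
    \<comment> \<open>the random sample: i.i.d. copies, indexed by i = 1, 2, ..., of (X, Y)\<close>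
    and X: "X \<in> borel_measurable M" "AE \<omega> in M. X \<omega> \<in> {0..1}"
    and Y: "Y \<in> borel_measurable M"
    and indep: "prob_space.indep_vars M (\<lambda>_. borel) (\<lambda>i \<omega>. (Xs i \<omega>, Ys i \<omega>)) {1..}"
    and ident: "\<And>i. i \<ge> 1 \<Longrightarrow>
      distr M borel (\<lambda>\<omega>. (Xs i \<omega>, Ys i \<omega>)) = distr M borel (\<lambda>\<omega>. (X \<omega>, Y \<omega>))"
    and f\<^sub>o: "is_cond_mean M X Y f\<^sub>o"
    \<comment> \<open>(i), (ii), (iii)\<close>
    and density: "\<And>i. i \<ge> 1 \<Longrightarrow>
      distributed M lborel (Xs i) (\<lambda>x. ennreal (indicator {0<..<1} x * w x))"
    and w_pos: "0 < w1" "0 < w2"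
    and w_bounds: "\<And>t. t \<in> {0..1} \<Longrightarrow> w1 \<le> w t \<and> w t \<le> w2"
    and \<kappa>: "\<kappa> > 2"
    and moment: "is_cond_mean M X (\<lambda>\<omega>. \<bar>Y \<omega> - f\<^sub>o (X \<omega>)\<bar> powr \<kappa>) v" "bdd_above (v ` {0..1})"
    and kernel: "\<And>h. 0 < h \<Longrightarrow> h \<le> 1 \<Longrightarrow> reproducing_kernel_wmh w m h (R h)"
    and fhat: "\<And>n h \<omega> t.
      fhat n h \<omega> t = smoothing_spline m n h (\<lambda>i. Xs i \<omega>) (\<lambda>i. Ys i \<omega>) t"
    \<comment> \<open>Ef is the conditional expectation of fhat given the design, in the version whose paths are
      continuous in (h, t).  Such a version is unique up to a null set; arbitrary versions for
      uncountably many (h, t) would not determine the suprema in the conclusion.\<close>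
    and Ef: "\<And>n h t. n \<ge> m \<Longrightarrow> 0 < h \<Longrightarrow> h \<le> 1 \<Longrightarrow> t \<in> {0..1} \<Longrightarrow>
      AE \<omega> in M. Ef n h \<omega> t = real_cond_exp M (design_algebra M Xs n) (\<lambda>\<omega>. fhat n h \<omega> t) \<omega>"
    and Ef_cont: "AE \<omega> in M. \<forall>n\<ge>m. continuous_on ({0<..1} \<times> {0..1}) (\<lambda>(h, t). Ef n h \<omega> t)"
    and \<epsilon>: "\<And>n h \<omega> t. n \<ge> m \<Longrightarrow> 0 < h \<Longrightarrow> h \<le> 1 \<Longrightarrow> \<omega> \<in> space M \<Longrightarrow> t \<in> {0..1} \<Longrightarrow>
      fhat n h \<omega> t - Ef n h \<omega> t =
        (1 / real n) * (\<Sum>i=1..n. (Ys i \<omega> - f\<^sub>o (Xs i \<omega>)) * R h (Xs i \<omega>) t) + \<epsilon> n h \<omega> t"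
    and \<gamma>: "\<gamma> > 0"
  shows "AE \<omega> in M.
    limsup (\<lambda>n. SUP h\<in>bandwidths \<kappa> \<gamma> n.
      Linf_norm01 (\<epsilon> n h \<omega>) /
        ereal (h powr (-1/2) * (1 / (real n * h)) * max (ln (1 / h)) (ln (ln (real n))))) < \<infinity>"
proof -
 interpret regression_sample M X Y Xs Ys f\<^sub>o v w w1 w2 \<kappa>
  by (intro regression_sample.intro regression_sample_axioms.intro)
   (use M X Y indep ident f\<^sub>o density w_pos w_bounds \<kappa> moment in auto)
 obtain C c where C: "C > 0" and c: "c > 0" and main: "!!n h l x d R \<eta> t. n > 0 ==> (!!i. i \<in> {1..n} ==> x i \<in> {0<..<1}) ==> unisolvent m n x ==>
   0 < h ==> h <= 1 ==> h < 2 * (1/2) ^ l ==> reproducing_kernel_wmh w m h R ==>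
   cell_discrepancy n x (%_. 1 / real n) w l (h * \<eta>) ==> cell_discrepancy n x (%i. d i / real n) (%_. 0) l (h * \<eta>) ==> \<eta> <= c ==> t \<in> {0..1} ==>
   \<bar>(SUM i=1..n. smoother_weight m n h x i t * d i) - 1 / real n * (SUM i=1..n. d i * R (x i) t)\<bar> <= C * \<eta>^2 / sqrt h"
  using spline_error_bound[OF m measurable_w w_bounds w_pos(1)] by blast
 obtain A where A: "A > 0" and cells: "AE e in M. \<forall>\<^sub>F n in sequentially. \<forall>h\<in>bandwidths \<kappa> \<gamma> n. \<forall>l.
  (1/2) ^ l <= h --> h < 2 * (1/2) ^ l -->
  (let B = h * (A * sqrt (max (ln (1 / h)) (ln (ln (real n))) / (real n * h))) in
   cell_discrepancy n (%i. Xs i e) (%_. 1 / real n) w l B &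
   cell_discrepancy n (%i. Xs i e) (%i. noise_at i e / real n) (%_. 0) l B)"
  using cell_discrepancies[OF \<gamma>] by blast
 \<comment> \<open>The bound (c / A)^2 ensures that \<eta>, which will be A times the square root of
   the ratio, does not exceed \<open>c\<close>.\<close>
 have rate: "\<forall>\<^sub>F n in sequentially. \<forall>h\<in>bandwidths \<kappa> \<gamma> n. 0 < h & max (ln (1 / h)) (ln (ln (real n))) / (real n * h) <= (c / A)^2"
  by (rule eventually_bandwidth_rate[OF \<kappa> \<gamma>]) (use c A in simp)
 have mean: "AE e in M. \<forall>n h t. m <= n --> 0 < h --> h <= 1 --> t \<in> {0..1} -->
  Ef n h e t = (SUM i=1..n. smoother_weight m n h (%i. Xs i e) i t * f\<^sub>o (Xs i e))"
  by (rule cond_mean_spline_continuous_version[OF m Ef[unfolded fhat] Ef_cont])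
 from cells AE_design smoothing_spline_AE mean AE_space show ?thesis
 proof eventually_elim
  case (elim e)
  note cell = elim(1) and des = elim(2) and spl = elim(3) and mean = elim(4) and e = elim(5)
  have "\<forall>\<^sub>F n in sequentially. (SUP h\<in>bandwidths \<kappa> \<gamma> n. Linf_norm01 (\<epsilon> n h e) /
    ereal (h powr (-1/2) * (1 / (real n * h)) * max (ln (1 / h)) (ln (ln (real n))))) <= ereal (C * A^2)"
   using cell rate eventually_ge_at_top[of m]
  proof eventually_elim
   case (elim n)
   have nm: "m <= n" "n > 0" using elim(3) m by auto
   have u: "unisolvent m n (%i. Xs i e)" using des nm by (intro unisolvent_if_distinct) (auto simp: less_imp_le)
   have x: "Xs i e \<in> {0<..<1}" if "i \<in> {1..n}" for i using des that by auto
   show ?case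
   proof (rule SUP_least)
    fix h assume hb: "h \<in> bandwidths \<kappa> \<gamma> n"
    define L where "L = max (ln (1 / h)) (ln (ln (real n)))"
    define q where "q = L / (real n * h)"
    have h: "0 < h" "h <= 1/2" and qc: "q <= (c / A)^2"
     using elim(2) hb unfolding q_def L_def by (auto simp: bandwidths_def)
    have "ln 1 < ln (1 / h)" using h by (subst ln_less_cancel_iff) auto
    then have L0: "0 < L" by (simp add: L_def)
    have q0: "0 < q" using L0 h nm by (simp add: q_def)
    obtain l where l: "(1/2) ^ l <= h" "h < 2 * (1/2) ^ l" using dyadic_scale[of h] h by auto
    define \<eta> where "\<eta> = A * sqrt q"
    have cd: "cell_discrepancy n (%i. Xs i e) (%_. 1 / real n) w l (h * \<eta>)"
     "cell_discrepancy n (%i. Xs i e) (%i. noise_at i e / real n) (%_. 0) l (h * \<eta>)"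
     using elim(1)[rule_format, OF hb l] unfolding Let_def \<eta>_def q_def L_def by blast+
    have "sqrt q <= c / A" using qc c A by (simp add: real_le_lsqrt)
    then have \<eta>c: "\<eta> <= c" using A by (simp add: \<eta>_def field_simps)
    have h1: "h <= 1" using h by simp
    have ker: "reproducing_kernel_wmh w m h (R h)" by (rule kernel[OF h(1) h1])
    have eps: "\<epsilon> n h e t = (SUM i=1..n. smoother_weight m n h (%i. Xs i e) i t * noise_at i e)
      - 1 / real n * (SUM i=1..n. noise_at i e * R h (Xs i e) t)" if t: "t \<in> {0..1}" for t
    proof -
     have "fhat n h e t = (SUM i=1..n. smoother_weight m n h (%i. Xs i e) i t * Ys i e)" unfolding fhat using spl m nm h t by blast
     moreover have "Ef n h e t = (SUM i=1..n. smoother_weight m n h (%i. Xs i e) i t * f\<^sub>o (Xs i e))" using mean nm h h1 t by blast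
     moreover have "(SUM i=1..n. smoother_weight m n h (%i. Xs i e) i t * noise_at i e) =
      (SUM i=1..n. smoother_weight m n h (%i. Xs i e) i t * Ys i e) - (SUM i=1..n. smoother_weight m n h (%i. Xs i e) i t * f\<^sub>o (Xs i e))"
      by (simp add: noise_def right_diff_distrib sum_subtractf)
     ultimately show ?thesis using \<epsilon>[OF nm(1) h(1) h1 e t] by (simp add: noise_def)
    qed
    have bound: "\<bar>\<epsilon> n h e t\<bar> <= C * A^2 * q / sqrt h" if t: "t \<in> {0..1}" for t
    proof -
     have "\<bar>\<epsilon> n h e t\<bar> <= C * \<eta>^2 / sqrt h" unfolding eps[OF t] by (rule main[OF nm(2) x u h(1) h1 l(2) ker cd \<eta>c t])
     then show ?thesis using q0 by (simp add: \<eta>_def power_mult_distrib)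
    qed
    \<comment> \<open>Continuity in t makes \<epsilon> measurable, which is required to pass from
      the pointwise bound to the essential supremum.\<close>
    have cont: "continuous_on {0..1} (\<epsilon> n h e)"
    proof -
     have "continuous_on {0..1} (R h (Xs i e))" if "i \<in> {1..n}" for i
     proof -
      have "Xs i e \<in> {0..1}" using x[OF that] by auto
      then have "R h (Xs i e) \<in> sobolev2 m" using ker by (simp add: reproducing_kernel_wmh_def)
      from sobolev2_continuous[OF this, of 0] m show ?thesis by simp
     qed
     moreover have "continuous_on {0..1} (smoother_weight m n h (%i. Xs i e) i)" for i
      using sobolev2_continuous[OF natspline_sobolev2[OF m], of 0 n "%i. Xs i e"] m unfolding smoother_weight_def[abs_def] by simp
     ultimately have "continuous_on {0..1} (%t. (SUM i=1..n. smoother_weight m n h (%i. Xs i e) i t * noise_at i e)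
      - 1 / real n * (SUM i=1..n. noise_at i e * R h (Xs i e) t))"
      by (intro continuous_on_diff continuous_on_sum continuous_on_mult continuous_on_const) auto
     then show ?thesis by (subst continuous_on_cong[OF refl eps]) auto
    qed
    have "\<epsilon> n h e \<in> borel_measurable leb01"
     by (rule continuous_imp_measurable_on_sets_lebesgue[OF cont]) simp
    then have meas: "(%t. ereal \<bar>\<epsilon> n h e t\<bar>) \<in> borel_measurable leb01" by simp
    have norm: "Linf_norm01 (\<epsilon> n h e) <= ereal (C * A^2 * q / sqrt h)"
     unfolding Linf_norm01_def by (rule esssup_I[OF meas AE_I2]) (use bound in auto)
    \<comment> \<open>The denominator of the theorem is q / sqrt h, so \<open>bound\<close> is C A^2
      times it.\<close>
    have den: "h powr (-1/2) * (1 / (real n * h)) * L = q / sqrt h"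
    proof -
     have "h powr (-1/2) = 1 / sqrt h" using h(1) by (simp add: powr_minus_divide powr_half_sqrt)
     then show ?thesis by (simp add: q_def)
    qed
    have dpos: "0 < q / sqrt h" using q0 h by simp
    have "Linf_norm01 (\<epsilon> n h e) / ereal (q / sqrt h) <= ereal (C * A^2)"
     using norm dpos by (subst ereal_divide_le_pos) (auto simp: mult_ac)
    then show "Linf_norm01 (\<epsilon> n h e) /
     ereal (h powr (-1/2) * (1 / (real n * h)) * max (ln (1 / h)) (ln (ln (real n)))) <= ereal (C * A^2)"
     unfolding L_def[symmetric] den .
   qed
  qed
  from Limsup_bounded[OF this] show ?case by (rule order.strict_trans1) simp
 qed
qed

end
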